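(* Let $N\ge 3$ and $1\le p<n-2$. Let $U\subset\mathcal{F}_p[N]$ be a domain and let $V$ be a bounded subdomain of $U$ with strongly Lipschitz boundary $S$ lying in $U$. Then for each $y'\in V'$ and every left monogenic section $f':U'\to F_1$, $$f'(y')=\int_{S'}\tilde{C}'_{p,N}(x',y')\,n'(x')\,f'(x')\,d\sigma'(x').$$
   Context: Clifford algebra: $Cl_n$ is the real $2^n$-dimensional associative algebra generated by the standard basis $e_1,\dots,e_n$ of $\mathbb{R}^n$ with $e_ie_j+e_je_i=-2\delta_{ij}$; $\mathbb{R}^n\subset Cl_n$ via $x=\sum x_je_j$. $\|a\|$ is the Euclidean norm of the coefficients of $a\in Cl_n$ in the basis of products $e_{j_1}\cdots e_{j_r}$, $j_1<\dots<j_r$. $\tilde a$ is the image of $a$ under the reversion anti-automorphism $e_{j_1}\cdots e_{j_r}\mapsto e_{j_r}\cdots e_{j_1}$. $H^+(\mathbb{R}^n)=\{x\in\mathbb{R}^n:x_n>0\}$. Groups: for $1\le p\le n-1$, $\Gamma_p$ is the group generated by $\begin{pmatrix}0&-1\\1&0\end{pmatrix}$ and $\begin{pmatrix}1&e_j\\0&1\end{pmatrix}$, $j=1,\dots,p$. $\mathcal{O}_p=\sum_{A\subseteq\{1,\dots,p\}}\mathbb{Z}e_A$ with $e_A=e_{j_1}\cdots e_{j_r}$ for $A=\{j_1<\dots<j_r\}$, $e_\emptyset=1$. $\Gamma_p[N]$ is the set of $\begin{pmatrix}a&b\\c&d\end{pmatrix}\in\Gamma_p$ with $a-1,b,c,d-1\in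 N\mathcal{O}_p$. $\mathcal{T}_p[N]$ is the subgroup of translation matrices $T_{\underline m}=\begin{pmatrix}1&\underline m\\0&1\end{pmatrix}$, $\underline m\in N\mathbb{Z}e_1+\dots+N\mathbb{Z}e_p$. A matrix $M=\begin{pmatrix}a&b\\c&d\end{pmatrix}$ acts on $H^+(\mathbb{R}^n)$ by $M\langle x\rangle=(ax+b)(cx+d)^{-1}$. The notation $M:\Gamma_p[N]\backslash\mathcal{T}_p[N]$ means that $M$ runs over a system of representatives of the cosets $\mathcal{T}_p[N]M$ in $\Gamma_p[N]$. Put $J(M,x)=\frac{\widetilde{cx+d}}{\|cx+d\|^n}$. Fundamental domain: a fundamental domain of $\Gamma_p[N]$ is a relatively closed domain $\mathcal{F}\subset H^+(\mathbb{R}^n)$ with $H^+(\mathbb{R}^n)=\bigcup_{M\in\Gamma_p[N]}M\langle\mathcal{F}\rangle$ and such that $\mathrm{int}\,\mathcal{F}\cap M\langle\mathrm{int}\,\mathcal{F}\rangle\neq\emptyset$ implies $M=\pm I$. $\mathcal{F}_p[N]$ is a fixed one contained in $U(p,N)=\{x\in H^+(\mathbb{R}^n):-N/2\le x_i\le N/2,\ i=1,\dots,p\}$ and unbounded in $x_{p+1},\dots,x_n$. The coset representatives $M$ are chosen so that $M\langle\mathcal{F}_p[N]\rangle\subset U(p,N)$. Kernel: with $\omega_n$ the surface area of the unit sphere of $\mathbb{R}^n$ and $G(x)=\frac1{\omega_n}\frac{x}{\|x\|^n}$, for $y\notin\bigcup_{M\in\Gamma_p[N]}\{M\langle x\rangle\}$,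 $$C_{p,N}(x,y)=\sum_{T\in\mathcal{T}_p[N]}\ \sum_{M:\Gamma_p[N]\backslash\mathcal{T}_p[N]}J(TM,x)\,G(y-TM\langle x\rangle).$$ Manifold and sections: $\mathcal{M}_p[N]=H^+(\mathbb{R}^n)/\Gamma_p[N]$, and primes denote images under the projection $H^+(\mathbb{R}^n)\to\mathcal{M}_p[N]$, $x\mapsto x'$ (so $U',V',S'$ are images of $U,V,S$). $F_1$ is the bundle over $\mathcal{M}_p[N]$ obtained by identifying $(x,X)$ with $(M\langle x\rangle,J(M,x)X)$ for $M\in\Gamma_p[N]$, $x\in H^+(\mathbb{R}^n)$, $X\in Cl_n$. A section $f'$ of $F_1$ over $U'$ is left monogenic if its lift $f$ satisfies $Df=0$ locally, where $D=\sum_je_j\partial_{x_j}$. $C'_{p,N}(x',y')$ is the projection of $C_{p,N}(x,y)$; $n'$ and $d\sigma'$ are the projections of the (outward) unit normal $n$ and the surface measure $d\sigma$ of $S$; the integral over $S'$ is evaluated through the lifts to $\mathcal{F}_p[N]$. A hypersurface is strongly Lipschitz if it is locally the graph of a real-valued Lipschitz function, with the Lipschitz constants of these local graphs bounded.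
   Formalization: The double series defining C_{p,N}(x,y) is assumed to converge (inner and outer sums unconditionally) for all x and all y off the orbit of x; this does not follow from p<n-2: for p=2, n=5 it diverges and the kernel is undefined. *)

theory Defs
  imports "HOL-Analysis.Analysis"
begin

text \<open>
  The index type \<^typ>\<open>'n\<close> is a finite linear order, so that it is \<open>{1,\<dots>,n}\<close> with
  \<open>n = CARD('n)\<close>. An element is given by its coefficients with respect to the blades
  \<open>e\<^sub>A = e\<^bsub>j\<^sub>1\<^esub> \<cdots> e\<^bsub>j\<^sub>r\<^esub>\<close>, \<open>A = {j\<^sub>1 < \<dots> < j\<^sub>r}\<close>.
\<close>

typedef 'n clifford = "UNIV :: (real ^ ('n set)) set"
  morphisms cl_coeffs Clifford ..

setup_lifting type_definition_clifford

definition cl_coeff :: "'n::finite clifford \<Rightarrow> 'n set \<Rightarrow> real"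
  where "cl_coeff a A = cl_coeffs a $ A"

lemma clifford_eq_iff: "a = b \<longleftrightarrow> (\<forall>A. cl_coeff a A = cl_coeff b A)"
  by (simp add: cl_coeff_def vec_eq_iff cl_coeffs_inject [symmetric])

instantiation clifford :: (finite) real_vector
begin

lift_definition zero_clifford :: "'a clifford" is 0 .
lift_definition plus_clifford :: "'a clifford \<Rightarrow> 'a clifford \<Rightarrow> 'a clifford" is "(+)" .
lift_definition minus_clifford :: "'a clifford \<Rightarrow> 'a clifford \<Rightarrow> 'a clifford" is "(-)" .
lift_definition uminus_clifford :: "'a clifford \<Rightarrow> 'a clifford" is uminus .
lift_definition scaleR_clifford :: "real \<Rightarrow> 'a clifford \<Rightarrow> 'a clifford" is scaleR .

instance
  by standard (transfer; simp add: scaleR_add_right scaleR_add_left)+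

end

lemma coeff_simps [simp]:
  "cl_coeff 0 A = 0" "cl_coeff (a + b) A = cl_coeff a A + cl_coeff b A"
  "cl_coeff (a - b) A = cl_coeff a A - cl_coeff b A" "cl_coeff (- a) A = - cl_coeff a A"
  "cl_coeff (r *\<^sub>R a) A = r * cl_coeff a A"
  unfolding cl_coeff_def by (transfer; simp)+

lemma coeff_sum: "cl_coeff (sum f I) A = (\<Sum>i\<in>I. cl_coeff (f i) A)"
  by (induction I rule: infinite_finite_induct) auto

instantiation clifford :: (finite) real_inner
begin

lift_definition inner_clifford :: "'a clifford \<Rightarrow> 'a clifford \<Rightarrow> real" is inner .
lift_definition norm_clifford :: "'a clifford \<Rightarrow> real" is norm .
lift_definition dist_clifford :: "'a clifford \<Rightarrow> 'a clifford \<Rightarrow> real" is dist .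
definition sgn_clifford :: "'a clifford \<Rightarrow> 'a clifford"
  where "sgn_clifford a = inverse (norm a) *\<^sub>R a"
definition uniformity_clifford :: "('a clifford \<times> 'a clifford) filter"
  where "uniformity_clifford = (INF e\<in>{0 <..}. principal {(x, y). dist x y < e})"
definition open_clifford :: "'a clifford set \<Rightarrow> bool"
  where "open_clifford U \<longleftrightarrow>
    (\<forall>x\<in>U. eventually (\<lambda>(x', y). x' = x \<longrightarrow> y \<in> U) uniformity)"

instance
proof
  fix a b c :: "'a clifford" and r :: real and U :: "'a clifford set"
  show "dist a b = norm (a - b)" by transfer (simp add: dist_norm)
  show "sgn a = a /\<^sub>R norm a" by (simp add: sgn_clifford_def)
  show "uniformity = (INF e\<in>{0 <..}. principal {(x, y :: 'a clifford). dist x y < e})"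
    by (rule uniformity_clifford_def)
  show "open U \<longleftrightarrow> (\<forall>x\<in>U. \<forall>\<^sub>F (x', y) in uniformity. x' = x \<longrightarrow> y \<in> U)"
    by (rule open_clifford_def)
  show "inner a b = inner b a" by transfer (rule inner_commute)
  show "inner (a + b) c = inner a c + inner b c" by transfer (rule inner_add_left)
  show "inner (r *\<^sub>R a) b = r * inner a b" by transfer (rule inner_scaleR_left)
  show "0 \<le> inner a a" by transfer (rule inner_ge_zero)
  show "inner a a = 0 \<longleftrightarrow> a = 0" by transfer (rule inner_eq_zero_iff)
  show "norm a = sqrt (inner a a)" by transfer (rule norm_eq_sqrt_inner)
qed

end

lemma inner_clifford_coeff: "inner a b = (\<Sum>A\<in>UNIV. cl_coeff a A * cl_coeff b A)"
  unfolding cl_coeff_def by transfer (simp add: inner_vec_def)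

lemma norm_clifford_coeff: "norm a = sqrt (\<Sum>A\<in>UNIV. (cl_coeff a A)\<^sup>2)"
  by (simp add: norm_eq_sqrt_inner inner_clifford_coeff power2_eq_square)

definition blade :: "'n set \<Rightarrow> 'n::finite clifford"
  where "blade A = Clifford (axis A 1)"

lemma coeff_blade: "cl_coeff (blade A) B = (if A = B then 1 else 0)"
  by (simp add: cl_coeff_def blade_def Clifford_inverse axis_def)

lemma blade_expansion: "a = (\<Sum>A\<in>UNIV. cl_coeff a A *\<^sub>R blade A)"
  by (simp add: clifford_eq_iff coeff_sum coeff_blade mult_delta_right)

instantiation clifford :: (finite) euclidean_space
begin

definition Basis_clifford :: "'a clifford set"
  where "Basis_clifford = range blade"

instance
proof
  have inner_blade: "inner a (blade A) = cl_coeff a A" for a :: "'a clifford" and A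
    by (simp add: inner_clifford_coeff coeff_blade mult_delta_right)
  show "(Basis :: 'a clifford set) \<noteq> {}" "finite (Basis :: 'a clifford set)"
    by (simp_all add: Basis_clifford_def)
  show "inner u v = (if u = v then 1 else 0)" if uv: "u \<in> Basis" "v \<in> Basis"
    for u v :: "'a clifford"
  proof -
    obtain A B where "u = blade A" "v = blade B"
      using uv by (auto simp: Basis_clifford_def)
    moreover have "blade A = blade B \<longleftrightarrow> A = B"
      by (metis coeff_blade zero_neq_one)
    ultimately show ?thesis
      by (simp add: inner_blade) (simp add: coeff_blade)
  qed
  show "(\<forall>u\<in>Basis. inner x u = 0) \<longleftrightarrow> x = 0" for x :: "'a clifford"
    by (simp add: Basis_clifford_def inner_blade clifford_eq_iff)
qed

end

text \<open>
  \<open>e\<^sub>A e\<^sub>B\<close> is \<open>e\<close> of the symmetric difference of \<open>A\<close> and \<open>B\<close>, with one sign for every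
  transposition of two generators needed to sort the factors and one for every
  \<open>e\<^sub>j\<^sup>2 = -1\<close>, \<open>j \<in> A \<inter> B\<close>.
\<close>

definition blade_sign :: "'n::{finite,linorder} set \<Rightarrow> 'n set \<Rightarrow> real"
  where "blade_sign A B = (-1) ^ card {(a, b) \<in> A \<times> B. b \<le> a}"

definition symdiff :: "'a set \<Rightarrow> 'a set \<Rightarrow> 'a set"
  where "symdiff A B = (A - B) \<union> (B - A)"

lemma blade_sign_prod:
  "blade_sign A B = (\<Prod>a\<in>A. \<Prod>b\<in>B. if b \<le> a then -1 else 1)"
proof -
  have "(\<Prod>a\<in>A. \<Prod>b\<in>B. if b \<le> a then -1 else 1 :: real)
      = (\<Prod>(a, b)\<in>A \<times> B. if b \<le> a then -1 else 1)"
    by (rule prod.cartesian_product)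
  also have "\<dots> = (\<Prod>z\<in>A \<times> B. if z \<in> {(a, b). b \<le> a} then -1 else 1)"
    by (rule prod.cong) auto
  also have "\<dots> = (\<Prod>z\<in>(A \<times> B) \<inter> {(a, b). b \<le> a}. -1)"
    by (subst prod.inter_restrict [symmetric]) auto
  also have "(A \<times> B) \<inter> {(a, b). b \<le> a} = {(a, b) \<in> A \<times> B. b \<le> a}" by auto
  finally show ?thesis by (simp add: blade_sign_def)
qed

lemma prod_symdiff:
  fixes f :: "'a::finite \<Rightarrow> real"
  assumes "\<And>x. f x * f x = 1"
  shows "prod f (symdiff A B) = prod f A * prod f B"
proof -
  have "prod f A = prod f (A - B) * prod f (A \<inter> B)"
    by (subst prod.union_disjoint [symmetric]) (auto intro: arg_cong [where f = "prod f"])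
  moreover have "prod f B = prod f (B - A) * prod f (A \<inter> B)"
    by (subst prod.union_disjoint [symmetric]) (auto intro: arg_cong [where f = "prod f"])
  moreover have "prod f (symdiff A B) = prod f (A - B) * prod f (B - A)"
    unfolding symdiff_def by (rule prod.union_disjoint) auto
  moreover have "prod f (A \<inter> B) * prod f (A \<inter> B) = 1"
    by (simp add: prod.distrib [symmetric] assms)
  ultimately show ?thesis by (simp add: algebra_simps)
qed

lemma blade_sign_symdiff_left:
  "blade_sign (symdiff A B) C = blade_sign A C * blade_sign B C"
  unfolding blade_sign_prod
  by (rule prod_symdiff) (simp add: prod.distrib [symmetric], auto intro: prod.neutral)

lemma blade_sign_symdiff_right:
  "blade_sign A (symdiff B C) = blade_sign A B * blade_sign A C"
  unfolding blade_sign_prod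
  by (subst prod_symdiff) (auto simp: prod.distrib)

lemma symdiff_simps [simp]:
  "symdiff {} A = A" "symdiff A {} = A" "symdiff A (symdiff A B) = B"
  by (auto simp: symdiff_def)

lemma symdiff_assoc: "symdiff (symdiff A B) C = symdiff A (symdiff B C)"
  by (auto simp: symdiff_def)

lemma symdiff_commute: "symdiff A B = symdiff B A"
  by (auto simp: symdiff_def)

lemma bij_symdiff: "bij (symdiff A)"
  by (rule o_bij [where g = "symdiff A"]) auto

lemma blade_sign_empty [simp]: "blade_sign {} A = 1" "blade_sign A {} = 1"
  by (simp_all add: blade_sign_def)

instantiation clifford :: ("{finite, linorder}") real_algebra_1
begin

definition one_clifford :: "'a clifford"
  where "1 = blade {}"

definition times_clifford :: "'a clifford \<Rightarrow> 'a clifford \<Rightarrow> 'a clifford"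
  where "a * b = (\<Sum>A\<in>UNIV. \<Sum>B\<in>UNIV.
    (cl_coeff a A * cl_coeff b B * blade_sign A B) *\<^sub>R blade (symdiff A B))"

lemma coeff_times:
  fixes a b :: "'a clifford"
  shows "cl_coeff (a * b) C = (\<Sum>A\<in>UNIV. cl_coeff a A * cl_coeff b (symdiff A C) * blade_sign A (symdiff A C))"
proof -
  have eq: "symdiff A B = C \<longleftrightarrow> B = symdiff A C" for A B :: "'a set" by auto
  show ?thesis
    by (simp add: times_clifford_def coeff_sum coeff_blade eq mult_delta_right)
qed

instance
proof
  fix a b c :: "'a clifford" and r :: real
  have "cl_coeff (a * b * c) D = cl_coeff (a * (b * c)) D" for D
  proof -
    have "cl_coeff (a * b * c) D = (\<Sum>E\<in>UNIV. \<Sum>A\<in>UNIV. cl_coeff a A * cl_coeff b (symdiff A E)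
        * cl_coeff c (symdiff E D) * (blade_sign A (symdiff A E) * blade_sign E (symdiff E D)))"
      by (simp only: coeff_times sum_distrib_right) (simp only: mult_ac)
    also have "\<dots> = (\<Sum>A\<in>UNIV. \<Sum>E\<in>UNIV. cl_coeff a A * cl_coeff b (symdiff A E)
        * cl_coeff c (symdiff E D) * (blade_sign A (symdiff A E) * blade_sign E (symdiff E D)))"
      by (rule sum.swap)
    also have "\<dots> = (\<Sum>A\<in>UNIV. \<Sum>B\<in>UNIV. cl_coeff a A * cl_coeff b B
        * cl_coeff c (symdiff B (symdiff A D))
        * (blade_sign A (symdiff A D) * blade_sign B (symdiff B (symdiff A D))))"
    proof (rule sum.cong [OF refl])
      fix A :: "'a set"
      have "(\<Sum>E\<in>UNIV. cl_coeff a A * cl_coeff b (symdiff A E) * cl_coeff c (symdiff E D)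
          * (blade_sign A (symdiff A E) * blade_sign E (symdiff E D)))
        = (\<Sum>B\<in>UNIV. cl_coeff a A * cl_coeff b B * cl_coeff c (symdiff (symdiff A B) D)
          * (blade_sign A B * blade_sign (symdiff A B) (symdiff (symdiff A B) D)))"
        using sum.reindex_bij_betw [OF bij_symdiff [of A], of "\<lambda>E. cl_coeff a A
          * cl_coeff b (symdiff A E) * cl_coeff c (symdiff E D)
          * (blade_sign A (symdiff A E) * blade_sign E (symdiff E D))"]
        by (simp only: symdiff_simps)
      also have "\<dots> = (\<Sum>B\<in>UNIV. cl_coeff a A * cl_coeff b B * cl_coeff c (symdiff B (symdiff A D))
          * (blade_sign A (symdiff A D) * blade_sign B (symdiff B (symdiff A D))))"
      proof (rule sum.cong [OF refl])
        fix B :: "'a set"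
        have 1: "symdiff (symdiff A B) D = symdiff B (symdiff A D)"
          by (metis symdiff_assoc symdiff_commute)
        let ?Z = "symdiff B (symdiff A D)"
        have "blade_sign A (symdiff A D) = blade_sign A (symdiff B ?Z)" by simp
        also have "\<dots> = blade_sign A B * blade_sign A ?Z"
          by (rule blade_sign_symdiff_right)
        finally have "blade_sign A B * blade_sign (symdiff A B) ?Z
            = blade_sign A (symdiff A D) * blade_sign B ?Z"
          by (simp only: blade_sign_symdiff_left mult.assoc)
        then show "cl_coeff a A * cl_coeff b B * cl_coeff c (symdiff (symdiff A B) D)
          * (blade_sign A B * blade_sign (symdiff A B) (symdiff (symdiff A B) D))
          = cl_coeff a A * cl_coeff b B * cl_coeff c ?Z
          * (blade_sign A (symdiff A D) * blade_sign B ?Z)"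
          by (simp only: 1)
      qed
      finally show "(\<Sum>E\<in>UNIV. cl_coeff a A * cl_coeff b (symdiff A E) * cl_coeff c (symdiff E D)
          * (blade_sign A (symdiff A E) * blade_sign E (symdiff E D)))
        = (\<Sum>B\<in>UNIV. cl_coeff a A * cl_coeff b B * cl_coeff c (symdiff B (symdiff A D))
          * (blade_sign A (symdiff A D) * blade_sign B (symdiff B (symdiff A D))))" .
    qed
    also have "\<dots> = cl_coeff (a * (b * c)) D"
      by (simp only: coeff_times sum_distrib_left sum_distrib_right) (simp only: mult_ac)
    finally show ?thesis .
  qed
  then show "a * b * c = a * (b * c)" by (simp add: clifford_eq_iff)
  show "1 * a = a"
    by (simp add: clifford_eq_iff coeff_times one_clifford_def coeff_blade mult_delta_left)
  have eq: "{} = symdiff A C \<longleftrightarrow> A = C" for A C :: "'a set"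
    by (auto simp: symdiff_def)
  have eq': "symdiff C C = {}" for C :: "'a set"
    by (auto simp: symdiff_def)
  show "a * 1 = a"
    by (simp add: clifford_eq_iff coeff_times one_clifford_def coeff_blade mult_delta_right
        mult_delta_left eq eq')
  show "(a + b) * c = a * c + b * c" "a * (b + c) = a * b + a * c"
    by (simp_all add: clifford_eq_iff coeff_times algebra_simps sum.distrib)
  show "r *\<^sub>R a * b = r *\<^sub>R (a * b)" "a * r *\<^sub>R b = r *\<^sub>R (a * b)"
    by (simp_all add: clifford_eq_iff coeff_times sum_distrib_left mult_ac)
  have "cl_coeff 0 {} \<noteq> cl_coeff (1 :: 'a clifford) {}"
    by (simp add: one_clifford_def coeff_blade)
  then show "(0 :: 'a clifford) \<noteq> 1" by metis
qed

end

definition gen :: "'n \<Rightarrow> 'n::{finite,linorder} clifford"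
  where "gen j = blade {j}"

lemma blade_mult: "blade A * blade B = blade_sign A B *\<^sub>R blade (symdiff A B)"
proof -
  have "B = symdiff A C \<longleftrightarrow> symdiff A B = C" for C by auto
  then show ?thesis
    by (auto simp: clifford_eq_iff coeff_times coeff_blade mult_delta_left)
qed

lemma gen_relation:
  fixes i j :: "'n::{finite,linorder}"
  shows "gen i * gen j + gen j * gen i = (if i = j then -2 else 0)"
proof -
  have 1: "{(a, b). a = i \<and> b = j \<and> b \<le> a} = (if j \<le> i then {(i, j)} else {})"
    for i j :: 'n
    by auto
  have two: "(-2 :: 'n clifford) = (-2) *\<^sub>R 1"
    by (simp add: scaleR_conv_of_real)
  show ?thesis
    unfolding two
    by (auto simp: gen_def blade_mult blade_sign_def 1 symdiff_def one_clifford_def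
        clifford_eq_iff coeff_blade insert_commute)
qed

lemma blade_eq_prod: "blade A = prod_list (map gen (sorted_list_of_set A))"
proof -
  have "blade (set xs) = prod_list (map gen xs)" if "sorted_wrt (<) xs" for xs :: "'a list"
    using that
  proof (induction xs)
    case Nil
    then show ?case by (simp add: one_clifford_def)
  next
    case (Cons x xs)
    have "blade {x} * blade (set xs) = blade (insert x (set xs))"
    proof -
      have "{(a, b) \<in> {x} \<times> set xs. b \<le> a} = {}"
        using Cons.prems by auto
      then have "blade_sign {x} (set xs) = 1"
        by (simp only: blade_sign_def card.empty power_0)
      moreover have "symdiff {x} (set xs) = insert x (set xs)"
        using Cons.prems by (auto simp: symdiff_def)
      ultimately show ?thesis by (simp add: blade_mult)
    qed
    with Cons show ?case by (simp add: gen_def)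
  qed
  from this [of "sorted_list_of_set A"] show ?thesis
    by (simp add: strict_sorted_list_of_set)
qed

definition reversion :: "'n::{finite,linorder} clifford \<Rightarrow> 'n clifford"
  where "reversion a =
    (\<Sum>A\<in>UNIV. cl_coeff a A *\<^sub>R prod_list (map gen (rev (sorted_list_of_set A))))"

type_synonym 'n Rn = "(real, 'n) vec"

definition vec_cl :: "'n Rn \<Rightarrow> 'n::{finite,linorder} clifford"
  where "vec_cl x = (\<Sum>j\<in>UNIV. x $ j *\<^sub>R gen j)"

definition vec_part :: "'n::{finite,linorder} clifford \<Rightarrow> 'n Rn"
  where "vec_part a = (\<chi> j. cl_coeff a {j})"

lemma vec_part_vec_cl [simp]: "vec_part (vec_cl x) = x"
  by (simp add: vec_part_def vec_cl_def vec_eq_iff coeff_sum gen_def coeff_blade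
      mult_delta_right)

text \<open>Meaningful for invertible \<open>a\<close> only.\<close>

definition cl_inverse :: "'n::{finite,linorder} clifford \<Rightarrow> 'n clifford"
  where "cl_inverse a = (THE b. a * b = 1 \<and> b * a = 1)"

text \<open>\<open>idx j\<close> is the position of \<open>j\<close>, counted from 1, in the linear order.\<close>

definition idx :: "'n::{finite,linorder} \<Rightarrow> nat"
  where "idx j = card {i. i \<le> j}"

definition upper_half :: "'n::{finite,linorder} Rn set"
  where "upper_half = {x. 0 < x $ Max UNIV}"

type_synonym 'n cl_mat = "'n clifford ^ 2 ^ 2"

definition mat2 :: "'a \<Rightarrow> 'a \<Rightarrow> 'a \<Rightarrow> 'a \<Rightarrow> 'a::zero ^ 2 ^ 2"
  where "mat2 a b c d = vector [vector [a, b], vector [c, d]]"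

inductive_set Gamma :: "nat \<Rightarrow> 'n::{finite,linorder} cl_mat set" for p :: nat
  where
    inversion: "mat2 0 (-1) 1 0 \<in> Gamma p"
  | translation: "idx j \<le> p \<Longrightarrow> mat2 1 (gen j) 0 1 \<in> Gamma p"
  | one: "mat 1 \<in> Gamma p"
  | mult: "A \<in> Gamma p \<Longrightarrow> B \<in> Gamma p \<Longrightarrow> A ** B \<in> Gamma p"
  | inverse: "A \<in> Gamma p \<Longrightarrow> A ** B = mat 1 \<Longrightarrow> B ** A = mat 1 \<Longrightarrow> B \<in> Gamma p"

definition int_ring :: "nat \<Rightarrow> 'n::{finite,linorder} clifford set"
  where "int_ring p =
    {a. \<forall>A. cl_coeff a A \<in> \<int> \<and> (cl_coeff a A \<noteq> 0 \<longrightarrow> A \<subseteq> {j. idx j \<le> p})}"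

definition GammaN :: "nat \<Rightarrow> nat \<Rightarrow> 'n::{finite,linorder} cl_mat set"
  where "GammaN p N = {M \<in> Gamma p.
    {M $ 1 $ 1 - 1, M $ 1 $ 2, M $ 2 $ 1, M $ 2 $ 2 - 1} \<subseteq> (\<lambda>a. real N *\<^sub>R a) ` int_ring p}"

definition translation_group :: "nat \<Rightarrow> nat \<Rightarrow> 'n::{finite,linorder} cl_mat set"
  where "translation_group p N = {mat2 1 (vec_cl m) 0 1 | m.
    (\<forall>j. \<exists>k::int. m $ j = real N * of_int k) \<and> (\<forall>j. p < idx j \<longrightarrow> m $ j = 0)}"

definition denom :: "'n::{finite,linorder} cl_mat \<Rightarrow> 'n Rn \<Rightarrow> 'n clifford"
  where "denom M x = M $ 2 $ 1 * vec_cl x + M $ 2 $ 2"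

text \<open>
  For \<open>M \<in> Gamma p\<close> and \<open>x\<close> in the upper half space the Clifford number
  \<open>(ax + b)(cx + d)\<^sup>-\<^sup>1\<close> is itself a vector.
\<close>

definition mob_act :: "'n::{finite,linorder} cl_mat \<Rightarrow> 'n Rn \<Rightarrow> 'n Rn"
  where "mob_act M x = vec_part ((M $ 1 $ 1 * vec_cl x + M $ 1 $ 2) * cl_inverse (denom M x))"

definition factor_J :: "'n::{finite,linorder} cl_mat \<Rightarrow> 'n Rn \<Rightarrow> 'n clifford"
  where "factor_J M x = (1 / norm (denom M x) ^ CARD('n)) *\<^sub>R reversion (denom M x)"

definition slab :: "nat \<Rightarrow> nat \<Rightarrow> 'n::{finite,linorder} Rn set"
  where "slab p N = {x \<in> upper_half. \<forall>j. idx j \<le> p \<longrightarrow> - real N / 2 \<le> x $ j \<and> x $ j \<le> real N / 2}"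

definition is_domain :: "'a::topological_space set \<Rightarrow> bool"
  where "is_domain U \<longleftrightarrow> open U \<and> connected U \<and> U \<noteq> {}"

definition fundamental_domain :: "nat \<Rightarrow> nat \<Rightarrow> 'n::{finite,linorder} Rn set \<Rightarrow> bool"
  where "fundamental_domain p N F \<longleftrightarrow>
    (\<exists>W. is_domain W \<and> W \<subseteq> upper_half \<and> F = closure W \<inter> upper_half) \<and>
    upper_half = (\<Union>M\<in>GammaN p N. mob_act M ` F) \<and>
    (\<forall>M\<in>GammaN p N. interior F \<inter> mob_act M ` interior F \<noteq> {} \<longrightarrow> M = mat 1 \<or> M = - mat 1)"

definition coset_representatives :: "nat \<Rightarrow> nat \<Rightarrow> 'n::{finite,linorder} cl_mat set \<Rightarrow> bool"
  where "coset_representatives p N R \<longleftrightarrow> R \<subseteq> GammaN p N \<and>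
    (\<forall>M\<in>GammaN p N. \<exists>!L. L \<in> R \<and> (\<exists>T\<in>translation_group p N. L = T ** M))"

definition orbitN :: "nat \<Rightarrow> nat \<Rightarrow> 'n Rn \<Rightarrow> 'n::{finite,linorder} Rn set"
  where "orbitN p N x = (\<lambda>M. mob_act M x) ` GammaN p N"

text \<open>\<open>n\<close> times the volume of the unit ball is the surface area of the unit sphere.\<close>

definition kernel_G :: "'n Rn \<Rightarrow> 'n::{finite,linorder} clifford"
  where "kernel_G x = (1 / (real CARD('n) * unit_ball_vol (real CARD('n)) * norm x ^ CARD('n))) *\<^sub>R vec_cl x"

text \<open>
  \<open>C\<close> is the sum of the kernel series. Stated with \<^const>\<open>HAS_SUM\<close> because
  \<^const>\<open>infsum\<close> would assign the value 0 to a divergent series.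
\<close>

definition is_cauchy_kernel :: "nat \<Rightarrow> nat \<Rightarrow> 'n::{finite,linorder} cl_mat set \<Rightarrow>
    ('n Rn \<Rightarrow> 'n Rn \<Rightarrow> 'n clifford) \<Rightarrow> bool"
  where "is_cauchy_kernel p N R C \<longleftrightarrow>
    (\<forall>x\<in>upper_half. \<forall>y\<in>upper_half - orbitN p N x.
      \<exists>h. (\<forall>T\<in>translation_group p N.
             ((\<lambda>M. factor_J (T ** M) x * kernel_G (y - mob_act (T ** M) x)) has_sum h T) R) \<and>
          (h has_sum C x y) (translation_group p N))"

text \<open>
  Points of the quotient manifold are orbits, the projection being \<open>x \<mapsto> orbitN p N x\<close>.
  Points of the bundle are the classes of pairs \<open>(x, X)\<close> under the equivalence relation
  generated by \<open>(x, X) \<sim> (M\<langle>x\<rangle>, J(M, x) X)\<close>; the base point of a class \<open>q\<close> is the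
  orbit \<open>fst ` q\<close>.
\<close>

definition bundle_ident :: "nat \<Rightarrow> nat \<Rightarrow> 'n Rn \<times> 'n clifford \<Rightarrow>
    'n Rn \<times> 'n::{finite,linorder} clifford \<Rightarrow> bool"
  where "bundle_ident p N z w \<longleftrightarrow> fst z \<in> upper_half \<and>
    (\<exists>M\<in>GammaN p N. w = (mob_act M (fst z), factor_J M (fst z) * snd z))"

definition bundle_point :: "nat \<Rightarrow> nat \<Rightarrow> 'n Rn \<times> 'n clifford \<Rightarrow>
    ('n Rn \<times> 'n::{finite,linorder} clifford) set"
  where "bundle_point p N z = {w. equivclp (bundle_ident p N) z w}"

definition F1 :: "nat \<Rightarrow> nat \<Rightarrow> ('n Rn \<times> 'n::{finite,linorder} clifford) set set"
  where "F1 p N = bundle_point p N ` (upper_half \<times> UNIV)"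

definition bundle_section :: "nat \<Rightarrow> nat \<Rightarrow> 'n Rn set set \<Rightarrow>
    ('n Rn set \<Rightarrow> ('n Rn \<times> 'n::{finite,linorder} clifford) set) \<Rightarrow> bool"
  where "bundle_section p N U' s \<longleftrightarrow> (\<forall>\<xi>\<in>U'. s \<xi> \<in> F1 p N \<and> fst ` s \<xi> = \<xi>)"

definition lift_of_section :: "nat \<Rightarrow> nat \<Rightarrow> 'n Rn set \<Rightarrow>
    ('n Rn set \<Rightarrow> ('n Rn \<times> 'n::{finite,linorder} clifford) set) \<Rightarrow>
    ('n Rn \<Rightarrow> 'n clifford) \<Rightarrow> bool"
  where "lift_of_section p N U s f \<longleftrightarrow>
    (\<forall>x\<in>U. s (orbitN p N x) = bundle_point p N (x, f x))"

definition partial_deriv :: "('n Rn \<Rightarrow> 'b::real_normed_vector) \<Rightarrow> 'n::finite \<Rightarrow> 'n Rn \<Rightarrow> 'b"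
  where "partial_deriv f j x = frechet_derivative f (at x) (axis j 1)"

definition dirac :: "('n Rn \<Rightarrow> 'n clifford) \<Rightarrow> 'n Rn \<Rightarrow> 'n::{finite,linorder} clifford"
  where "dirac f x = (\<Sum>j\<in>UNIV. gen j * partial_deriv f j x)"

definition left_monogenic_on :: "('n Rn \<Rightarrow> 'n::{finite,linorder} clifford) \<Rightarrow> 'n Rn set \<Rightarrow> bool"
  where "left_monogenic_on f U \<longleftrightarrow>
    (\<forall>x\<in>U. f differentiable at x) \<and> (\<forall>j. continuous_on U (partial_deriv f j)) \<and>
    (\<forall>x\<in>U. dirac f x = 0)"

text \<open>
  A chart \<open>(\<nu>, \<phi>, W)\<close> presents \<open>S\<close> inside the open set \<open>W\<close> as the graph, in the direction of
  the unit vector \<open>\<nu>\<close>, of a Lipschitz function on the hyperplane orthogonal to \<open>\<nu>\<close>. That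
  function is represented by its extension \<open>\<phi>\<close> to the whole space which is constant along \<open>\<nu>\<close>.
\<close>

definition lipschitz_graph_chart :: "real \<Rightarrow> 'a::euclidean_space set \<Rightarrow> 'a \<Rightarrow> ('a \<Rightarrow> real) \<Rightarrow> 'a set \<Rightarrow> bool"
  where "lipschitz_graph_chart L S \<nu> \<phi> W \<longleftrightarrow>
    norm \<nu> = 1 \<and> L-lipschitz_on UNIV \<phi> \<and> (\<forall>z t. \<phi> (z + t *\<^sub>R \<nu>) = \<phi> z) \<and>
    open W \<and> S \<inter> W = {z \<in> W. z \<bullet> \<nu> = \<phi> z}"

definition strongly_lipschitz :: "'a::euclidean_space set \<Rightarrow> bool"
  where "strongly_lipschitz S \<longleftrightarrow>
    (\<exists>L. \<forall>x\<in>S. \<exists>\<nu> \<phi> W. x \<in> W \<and> lipschitz_graph_chart L S \<nu> \<phi> W)"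

definition gradient :: "('a::euclidean_space \<Rightarrow> real) \<Rightarrow> 'a \<Rightarrow> 'a"
  where "gradient \<phi> z = (if \<exists>g. GDERIV \<phi> z :> g then THE g. GDERIV \<phi> z :> g else 0)"

text \<open>
  The graph measure \<open>\<surd>(1 + \<parallel>\<nabla>\<phi>\<parallel>\<^sup>2) dz'\<close>, restricted to \<open>W\<close>. Lebesgue measure \<open>dz'\<close> on the
  hyperplane orthogonal to \<open>\<nu>\<close> is obtained as the image, under projection along \<open>\<nu>\<close>, of
  Lebesgue measure on the slab \<open>0 \<le> z \<bullet> \<nu> < 1\<close> of height 1; the map
  \<open>z \<mapsto> z + (\<phi> z - z \<bullet> \<nu>) \<nu>\<close> is this projection followed by the passage to the graph.
\<close>

definition chart_measure :: "'a::euclidean_space \<Rightarrow> ('a \<Rightarrow> real) \<Rightarrow> 'a set \<Rightarrow> 'a measure"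
  where "chart_measure \<nu> \<phi> W =
    (let \<gamma> = (\<lambda>z. z + (\<phi> z - z \<bullet> \<nu>) *\<^sub>R \<nu>) in
     distr (density lebesgue (\<lambda>z. indicator {z. 0 \<le> z \<bullet> \<nu> \<and> z \<bullet> \<nu> < 1 \<and> \<gamma> z \<in> W} z *
              ennreal (sqrt (1 + (norm (gradient \<phi> z))\<^sup>2))))
       borel \<gamma>)"

text \<open>
  Chart measures agree where their charts overlap, so that their supremum in the lattice
  of Borel measures is the measure on \<open>S\<close> obtained by gluing them.
\<close>

definition surface_measure :: "'a::euclidean_space set \<Rightarrow> 'a measure"
  where "surface_measure S =
    (SUP (\<nu>, \<phi>, W) \<in> {(\<nu>, \<phi>, W). \<exists>L. lipschitz_graph_chart L S \<nu> \<phi> W}. chart_measure \<nu> \<phi> W)"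

text \<open>
  The outward unit normal exists at almost every point of a Lipschitz boundary; elsewhere
  \<open>outward_normal\<close> is 0.
\<close>

definition is_outward_normal :: "'a::euclidean_space set \<Rightarrow> 'a \<Rightarrow> 'a \<Rightarrow> bool"
  where "is_outward_normal V x \<nu> \<longleftrightarrow> norm \<nu> = 1 \<and>
    ((\<lambda>z. (z - x) \<bullet> \<nu> / norm (z - x)) \<longlongrightarrow> 0) (at x within frontier V) \<and>
    (\<forall>\<^sub>F t in at_right 0. x - t *\<^sub>R \<nu> \<in> V \<and> x + t *\<^sub>R \<nu> \<notin> V)"

definition outward_normal :: "'a::euclidean_space set \<Rightarrow> 'a \<Rightarrow> 'a"
  where "outward_normal V x =
    (if \<exists>!\<nu>. is_outward_normal V x \<nu> then THE \<nu>. is_outward_normal V x \<nu> else 0)"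

text \<open>
  The integral over the projection of the boundary of \<open>V\<close>, evaluated through lifts: \<open>C\<close> and
  \<open>f\<close> are the lifts of the kernel and of the section.
\<close>

definition cauchy_integral :: "('n Rn \<Rightarrow> 'n Rn \<Rightarrow> 'n clifford) \<Rightarrow> 'n Rn set \<Rightarrow>
    ('n Rn \<Rightarrow> 'n clifford) \<Rightarrow> 'n Rn \<Rightarrow> 'n::{finite,linorder} clifford"
  where "cauchy_integral C V f y =
    (LINT x:frontier V|surface_measure (frontier V).
       reversion (C x y) * vec_cl (outward_normal V x) * f x)"

end

theory Submission imports Defs begin

text \<open>
  Rademacher's theorem shows that a Lipschitz graph has a tangent plane at almost every point. The
  divergence theorem for a bounded open set with strongly Lipschitz boundary follows by letting
  \<open>h \<rightarrow> 0\<close> in the translation identity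
  \<open>\<integral> 1\<^sub>V (x) (g (x + h e) - g x) / h dx = \<integral> (1\<^sub>V (x - h e) - 1\<^sub>V (x)) / h \<cdot> g x dx\<close>,
  and it yields Cauchy's formula over \<open>S\<close> for the kernel \<open>G\<close> and a left monogenic \<open>f\<close>.

  Let \<open>L \<in> \<Gamma>\<^sub>p[N]\<close> and let \<open>w\<close> be the point with \<open>L\<langle>w\<rangle> = y\<close>. The reversion of the summand of the
  kernel series belonging to \<open>L\<close> is \<open>K G(w - x)\<close> with a factor \<open>K\<close> that does not depend on \<open>x\<close>, so
  that its integral over \<open>S\<close> is \<open>K f(w)\<close> if \<open>w \<in> V\<close>, and 0 if \<open>w\<close> is outside the closure of \<open>V\<close>.
  This closure is contained in the interior of the fundamental domain, and \<open>-I \<notin> \<Gamma>\<^sub>p[N]\<close> because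
  \<open>N \<ge> 3\<close>; hence only \<open>L = I\<close> contributes, and it contributes \<open>f(y)\<close>.

  To exchange sum and integral, let \<open>x\<^sub>0 \<in> S\<close>. On \<open>S\<close> the summand belonging to \<open>L = T\<^sub>m M\<close> is at
  most a constant times \<open>\<parallel>c x\<^sub>0 + d\<parallel>\<^bsup>1-n\<^esup> (1 + \<parallel>m\<parallel>)\<^bsup>1-n\<^esup>\<close>, where \<open>(c, d)\<close> is the lower row of \<open>M\<close>. The
  sum over \<open>m\<close> converges since \<open>p < n - 1\<close>, and the sum over \<open>M\<close> converges because the kernel
  series converges at \<open>x\<^sub>0\<close>.
\<close>

section \<open>Rademacher's theorem\<close>

text \<open>\<open>surface_measure\<close> is a supremum over all charts, so a piece of
  \<open>S\<close> must get the same mass in each of them. Charts are not compared directly: up to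
  the factor 2 their measures are limits of tube volume divided by tube radius, and the tube around
  \<open>S\<close> knows no chart. The normal is defined by tangency and crossing, without charts.
  It exists exactly where the graph function is differentiable and \<open>V\<close> lies on one side
  only. \<open>V\<close> may lie on both sides of a piece of its frontier; there the normal is 0 and
  the flux cancels. The pole of \<open>kernel_G\<close> is removed by freezing its denominator
  inside a small ball. The result is Lipschitz, unchanged on \<open>S\<close>, and its Dirac
  derivative is constant in the ball, so the boundary integral is a mean value of \<open>f\<close>.
  The action enters through one identity, \<open>(cw + d)~ (M<w> - M<x>) (cx + d) = w - x\<close>.
  It transforms the kernel and compares denominators at different points; integrality of
  \<open>c\<close> and \<open>d\<close> bounds them below. The kernel series is given as an iterated
  sum. As the algebra has finite dimension, its inner sum converges absolutely, and this makes the
  joint sum over pairs absolutely convergent, uniformly on \<open>S\<close>.\<close>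

lemma cball_midpoint: "cball ((u + v) / 2) ((v - u) / 2) = {u..v::real}"
  by (auto simp: dist_real_def abs_le_iff field_simps)

text \<open>Closed balls of the line are intervals \<open>{u..v}\<close> with centre
  \<open>(u + v) / 2\<close>; the covering theorem for balls is used with the pairs
  \<open>(u, v)\<close> themselves as indices.\<close>

lemma Vitali_covering_intervals:
  fixes S :: "real set"
  assumes K: "\<And>u v. (u, v) \<in> K \<Longrightarrow> u < v"
    and S: "\<And>x d. x \<in> S \<Longrightarrow> 0 < d \<Longrightarrow> \<exists>u v. (u, v) \<in> K \<and> u \<le> x \<and> x \<le> v \<and> v - u < d"
  obtains C where "countable C" "C \<subseteq> K" "disjoint_family_on (\<lambda>(u, v). {u..v}) C"
    "negligible (S - (\<Union>(u, v)\<in>C. {u..v}))"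
proof -
  let ?a = "\<lambda>i :: real \<times> real. (fst i + snd i) / 2" and ?r = "\<lambda>i :: real \<times> real. (snd i - fst i) / 2"
  have cb: "cball (?a i) (?r i) = (case i of (u, v) \<Rightarrow> {u..v})" for i
    by (cases i) (simp add: cball_midpoint)
  have 1: "0 < ?r i" if "i \<in> K" for i using K[of "fst i" "snd i"] that by simp
  have 2: "\<exists>i. i \<in> K \<and> x \<in> cball (?a i) (?r i) \<and> ?r i < d" if xd: "x \<in> S" "0 < d" for x d
  proof -
    obtain u v where "(u, v) \<in> K" "u \<le> x" "x \<le> v" "v - u < d" using S[OF xd] by blast
    then show ?thesis unfolding cb by (intro exI[of _ "(u, v)"]) (use K[of u v] in auto)
  qed
  obtain C where C: "countable C" "C \<subseteq> K"
     "pairwise (\<lambda>i j. disjnt (cball (?a i) (?r i)) (cball (?a j) (?r j))) C"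
     "negligible (S - (\<Union>i \<in> C. cball (?a i) (?r i)))"
    by (rule Vitali_covering_theorem_cballs[of K ?r S ?a, OF 1 2])
  show ?thesis
    by (rule that[OF C(1,2)]) (use C(3,4) in \<open>simp_all add: cb disjoint_family_on_def pairwise_def disjnt_def\<close>)
qed

text \<open>With \<open>d\<close> replaced by \<open>1 / Suc m\<close> the set is a countable
  intersection of unions of open intervals. As arbitrary unions of open sets are open, nothing has
  to be known about \<open>P\<close>.\<close>

lemma slope_oscillation_measurable:
  "{x. \<forall>d>0. \<exists>u v. u < x \<and> x < v \<and> v - u < d \<and> P u v} \<in> sets borel" for P :: "real \<Rightarrow> real \<Rightarrow> bool"
proof -
  have "{x. \<forall>d>0. \<exists>u v. u < x \<and> x < v \<and> v - u < d \<and> P u v}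
      = (\<Inter>m. \<Union>(u, v) \<in> {(u, v). v - u < 1 / real (Suc m) \<and> P u v}. {u<..<v})" (is "?L = ?R")
  proof
    show "?L \<subseteq> ?R"
    proof (intro subsetI INT_I)
      fix x :: real and m assume "x \<in> ?L"
      moreover have "1 / real (Suc m) > 0" by simp
      ultimately obtain u v where "u < x" "x < v" "v - u < 1 / real (Suc m)" "P u v" by blast
      then show "x \<in> (\<Union>(u, v) \<in> {(u, v). v - u < 1 / real (Suc m) \<and> P u v}. {u<..<v})" by auto
    qed
    show "?R \<subseteq> ?L"
    proof (intro subsetI CollectI allI impI)
      fix x and d :: real assume x: "x \<in> ?R" and "0 < d"
      obtain m where m: "1 / real (Suc m) < d" using \<open>0 < d\<close> nat_approx_posE by blast
      have "x \<in> (\<Union>(u, v) \<in> {(u, v). v - u < 1 / real (Suc m) \<and> P u v}. {u<..<v})" using x by blast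
      then obtain u v where "v - u < 1 / real (Suc m)" "P u v" "u < x" "x < v" by auto
      then show "\<exists>u v. u < x \<and> x < v \<and> v - u < d \<and> P u v"
        by (intro exI[of _ u] exI[of _ v]) (use m in linarith)
    qed
  qed
  moreover have "open (\<Union>(u, v) \<in> {(u, v). v - u < 1 / real (Suc m) \<and> P u v}. {u<..<v})" for m
    by (intro open_UN) auto
  ultimately show ?thesis by auto
qed

text \<open>Lebesgue's argument with two Vitali coverings and the Stieltjes measure of
  \<open>f\<close>. Inside an open \<open>U\<close> around \<open>E\<close> choose disjoint
  intervals of slope below \<open>a\<close>, and inside these disjoint intervals of slope above
  \<open>b\<close>, both covering almost all of \<open>E\<close>. Comparing masses gives
  \<open>b |E| \<le> a |U|\<close>, and outer regularity turns \<open>|U|\<close> into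
  \<open>|E|\<close>. The bound \<open>c\<close> makes \<open>|E|\<close> finite, so that it can be
  cancelled.\<close>

lemma slope_gap_negligible:
  fixes f :: "real \<Rightarrow> real" and c :: real
  assumes mono: "mono f" and cont: "continuous_on UNIV f" and ab: "0 < a" "a < b"
  defines "E \<equiv> {x. \<bar>x\<bar> < c \<and> (\<forall>d>0. \<exists>u v. u < x \<and> x < v \<and> v - u < d \<and> f v - f u < a * (v - u))
      \<and> (\<forall>d>0. \<exists>u v. u < x \<and> x < v \<and> v - u < d \<and> f v - f u > b * (v - u))}"
  shows "emeasure lborel E = 0"
proof -
  let ?\<mu> = "interval_measure f"
  let ?I = "\<lambda>(u, v). {u..v::real}"
  have E: "E \<in> sets borel"
  proof -
    have "E = {x. \<bar>x\<bar> < c} \<inter> {x. \<forall>d>0. \<exists>u v. u < x \<and> x < v \<and> v - u < d \<and> f v - f u < a * (v - u)}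
       \<inter> {x. \<forall>d>0. \<exists>u v. u < x \<and> x < v \<and> v - u < d \<and> f v - f u > b * (v - u)}"
      unfolding E_def by auto
    moreover have "{x :: real. \<bar>x\<bar> < c} \<in> sets borel" by measurable
    ultimately show ?thesis by (simp only:) (intro sets.Int slope_oscillation_measurable)
  qed
  have \<mu>: "emeasure ?\<mu> {u..v} = ennreal (f v - f u)" if "u \<le> v" for u v
    by (rule emeasure_interval_measure_Icc) (use that mono cont in \<open>auto dest: monoD\<close>)
  have fin: "emeasure lborel E < \<infinity>"
  proof -
    have "E \<subseteq> {-c..c}" unfolding E_def by auto
    then have "emeasure lborel E \<le> emeasure lborel {-c..c}" by (intro emeasure_mono) auto
    also have "\<dots> < \<infinity>" by (cases "-c \<le> c") auto
    finally show ?thesis .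
  qed
  have key: "ennreal b * emeasure lborel E \<le> ennreal a * emeasure lborel U"
    if U: "open U" "E \<subseteq> U" for U
  proof -
    define K1 where "K1 = {(u, v). u < v \<and> {u..v} \<subseteq> U \<and> f v - f u < a * (v - u)}"
    have 1: "\<exists>u v. (u, v) \<in> K1 \<and> u \<le> x \<and> x \<le> v \<and> v - u < d"
      if x: "x \<in> E" and "0 < d" for x d :: real
    proof -
      obtain r where r: "r > 0" "ball x r \<subseteq> U" using U x open_contains_ball by blast
      have "min d r > 0" using \<open>0 < d\<close> r by auto
      then obtain u v where uv: "u < x" "x < v" "v - u < min d r" "f v - f u < a * (v - u)"
        using x unfolding E_def by blast
      have "{u..v} \<subseteq> ball x r" using uv by (auto simp: dist_real_def)
      then show ?thesis using uv r unfolding K1_def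
        by (intro exI[of _ u] exI[of _ v]) auto
    qed
    obtain C1 where C1: "countable C1" "C1 \<subseteq> K1" "disjoint_family_on ?I C1"
      "negligible (E - (\<Union>i\<in>C1. ?I i))"
      by (rule Vitali_covering_intervals[OF _ 1]) (auto simp: K1_def)
    \<comment> \<open>Only points in the open intervals are covered again, since short intervals
      around them stay inside; the endpoints that are lost are countably many.\<close>
    define E1 where "E1 = E \<inter> (\<Union>(u,v)\<in>C1. {u<..<v})"
    define K2 where "K2 = {(u, v). u < v \<and> (\<exists>i\<in>C1. {u..v} \<subseteq> ?I i) \<and> f v - f u > b * (v - u)}"
    have 2: "\<exists>u v. (u, v) \<in> K2 \<and> u \<le> x \<and> x \<le> v \<and> v - u < d"
      if x: "x \<in> E1" and "0 < d" for x d :: real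
    proof -
      obtain p q where pq: "(p, q) \<in> C1" "p < x" "x < q" using x unfolding E1_def by auto
      have "min d (min (x - p) (q - x)) > 0" using \<open>0 < d\<close> pq by auto
      moreover have "x \<in> E" using x E1_def by auto
      ultimately obtain u v where uv: "u < x" "x < v" "v - u < min d (min (x - p) (q - x))" "f v - f u > b * (v - u)"
        unfolding E_def by blast
      have "{u..v} \<subseteq> {p..q}" using uv by auto
      then show ?thesis using uv pq unfolding K2_def
        by (intro exI[of _ u] exI[of _ v]) (auto intro!: bexI[of _ "(p,q)"])
    qed
    obtain C2 where C2: "countable C2" "C2 \<subseteq> K2" "disjoint_family_on ?I C2"
      "negligible (E1 - (\<Union>i\<in>C2. ?I i))"
      by (rule Vitali_covering_intervals[OF _ 2]) (auto simp: K2_def)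
    have sets: "?I i \<in> sets borel" for i by (cases i) auto
    have nneg: "negligible (E - (\<Union>i\<in>C2. ?I i))"
    proof (rule negligible_subset)
      have "negligible (fst ` C1)" "negligible (snd ` C1)"
        using C1 by (auto simp: negligible_iff_null_sets intro: countable_imp_null_set_lborel null_sets_completionI)
      then show "negligible ((E - (\<Union>i\<in>C1. ?I i)) \<union> (fst ` C1 \<union> snd ` C1) \<union> (E1 - (\<Union>i\<in>C2. ?I i)))"
        using C1(4) C2(4) by (intro negligible_Un)
      show "E - (\<Union>i\<in>C2. ?I i) \<subseteq> (E - (\<Union>i\<in>C1. ?I i)) \<union> (fst ` C1 \<union> snd ` C1) \<union> (E1 - (\<Union>i\<in>C2. ?I i))"
      proof
        fix x assume x: "x \<in> E - (\<Union>i\<in>C2. ?I i)"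
        show "x \<in> (E - (\<Union>i\<in>C1. ?I i)) \<union> (fst ` C1 \<union> snd ` C1) \<union> (E1 - (\<Union>i\<in>C2. ?I i))"
        proof (cases "\<exists>i\<in>C1. x \<in> ?I i")
          case True
          then obtain p q where pq: "(p, q) \<in> C1" "p \<le> x" "x \<le> q" by auto
          consider "x = p" | "x = q" | "p < x" "x < q" using pq by linarith
          then show ?thesis
          proof cases
            case 1 then show ?thesis using pq by force
          next
            case 2 then show ?thesis using pq by force
          next
            case 3
            then have "x \<in> E1" unfolding E1_def using pq x by (intro IntI UN_I[of "(p, q)"]) auto
            then show ?thesis using x by simp
          qed
        qed (use x in auto)
      qed
    qed
    have meas: "(\<Union>i\<in>C. ?I i) \<in> sets borel" if "countable C" for C
      using that sets by (intro sets.countable_UN') auto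
    have "E - (\<Union>i\<in>C2. ?I i) \<in> null_sets lborel"
      using nneg E meas[OF C2(1)] by (auto simp: negligible_iff_null_sets null_sets_completion_iff)
    then have "emeasure lborel E \<le> emeasure lborel (\<Union>i\<in>C2. ?I i)"
      using emeasure_mono[of E "(\<Union>i\<in>C2. ?I i) \<union> (E - (\<Union>i\<in>C2. ?I i))" lborel] E meas[OF C2(1)]
        emeasure_Un_null_set[of "\<Union>i\<in>C2. ?I i" lborel "E - (\<Union>i\<in>C2. ?I i)"]
      by (metis (no_types, lifting) Un_Diff_cancel Un_upper2 sets.Un sets_lborel)
    also have "\<dots> = (\<integral>\<^sup>+i. emeasure lborel (?I i) \<partial>count_space C2)"
      using C2 sets by (intro emeasure_UN_countable) auto
    finally have "ennreal b * emeasure lborel E \<le> ennreal b * (\<integral>\<^sup>+i. emeasure lborel (?I i) \<partial>count_space C2)"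
      by (rule mult_left_mono) auto
    also have "\<dots> = (\<integral>\<^sup>+i. ennreal b * emeasure lborel (?I i) \<partial>count_space C2)"
      by (rule nn_integral_cmult[symmetric]) auto
    also have "\<dots> \<le> (\<integral>\<^sup>+i. emeasure ?\<mu> (?I i) \<partial>count_space C2)"
    proof (rule nn_integral_mono)
      fix i assume "i \<in> space (count_space C2)"
      then have i: "i \<in> K2" using C2 by auto
      then show "ennreal b * emeasure lborel (?I i) \<le> emeasure ?\<mu> (?I i)"
        using ab by (auto simp: K2_def \<mu> ennreal_mult[symmetric] intro!: ennreal_leI)
    qed
    also have "\<dots> = emeasure ?\<mu> (\<Union>i\<in>C2. ?I i)"
      using C2 sets by (intro emeasure_UN_countable[symmetric]) auto
    also have "\<dots> \<le> emeasure ?\<mu> (\<Union>i\<in>C1. ?I i)"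
    proof (rule emeasure_mono)
      show "(\<Union>i\<in>C2. ?I i) \<subseteq> (\<Union>i\<in>C1. ?I i)" using C2(2) unfolding K2_def by fastforce
    qed (use meas[OF C1(1)] in auto)
    also have "\<dots> = (\<integral>\<^sup>+i. emeasure ?\<mu> (?I i) \<partial>count_space C1)"
      using C1 sets by (intro emeasure_UN_countable) auto
    also have "\<dots> \<le> (\<integral>\<^sup>+i. ennreal a * emeasure lborel (?I i) \<partial>count_space C1)"
    proof (rule nn_integral_mono)
      fix i assume "i \<in> space (count_space C1)"
      then have i: "i \<in> K1" using C1 by auto
      then show "emeasure ?\<mu> (?I i) \<le> ennreal a * emeasure lborel (?I i)"
        using ab by (auto simp: K1_def \<mu> ennreal_mult[symmetric] intro!: ennreal_leI)
    qed
    also have "\<dots> = ennreal a * (\<integral>\<^sup>+i. emeasure lborel (?I i) \<partial>count_space C1)"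
      by (rule nn_integral_cmult) auto
    also have "\<dots> = ennreal a * emeasure lborel (\<Union>i\<in>C1. ?I i)"
      using C1 sets by (subst emeasure_UN_countable) auto
    also have "\<dots> \<le> ennreal a * emeasure lborel U"
    proof (intro mult_left_mono emeasure_mono)
      show "(\<Union>i\<in>C1. ?I i) \<subseteq> U" using C1(2) unfolding K1_def by fastforce
    qed (use U in auto)
    finally show ?thesis .
  qed
  obtain m where m: "emeasure lborel E = ennreal m" "m \<ge> 0"
    using fin by (cases "emeasure lborel E") auto
  have "b * m \<le> a * (m + e)" if "e > 0" for e
  proof -
    obtain U where U: "open U" "E \<subseteq> U" "emeasure lborel (U - E) < ennreal e"
      using outer_regular_lborel[OF E \<open>e > 0\<close>] by blast
    have "emeasure lborel U = emeasure lborel E + emeasure lborel (U - E)"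
      using U E by (subst plus_emeasure) (auto simp: Un_absorb1)
    also have "\<dots> \<le> ennreal m + ennreal e" using U m by (intro add_mono) auto
    finally have "emeasure lborel U \<le> ennreal (m + e)" using m that by simp
    with key[OF U(1,2)] have "ennreal b * ennreal m \<le> ennreal a * ennreal (m + e)"
      unfolding m(1) using mult_left_mono[of "emeasure lborel U" "ennreal (m+e)" "ennreal a"] by (meson order_trans zero_le)
    then show ?thesis using ab m(2) that by (simp add: ennreal_mult[symmetric] del: ennreal_plus)
  qed
  then have "b * m \<le> a * m + e" if "e > 0" for e
    using ab that by (auto simp: algebra_simps dest!: meta_spec[of _ "e / a"])
  then have "b * m \<le> a * m" by (rule field_le_epsilon)
  then have "m = 0" using ab m(2) by (simp add: mult_le_cancel_right)
  then show ?thesis using m by simp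
qed


text \<open>\<open>lo x a\<close> and \<open>hi x b\<close> say that \<open>a\<close> and
  \<open>b\<close> bound the slopes over all short intervals around \<open>x\<close> from below and
  above. Off countably many null sets, with rational \<open>a < b\<close>, one of the two holds, so
  lower and upper bounds meet in one number.\<close>

lemma AE_lipschitz_mono_differentiable:
  fixes g :: "real \<Rightarrow> real"
  assumes mono: "mono g" and lip: "L-lipschitz_on UNIV g"
  shows "AE x in lborel. \<exists>D. (g has_real_derivative D) (at x)"
proof -
  define hi where "hi x b \<longleftrightarrow> (\<exists>d>0. \<forall>u v. u < x \<and> x < v \<and> v - u < d \<longrightarrow> g v - g u \<le> b * (v - u))" for x b
  define lo where "lo x a \<longleftrightarrow> (\<exists>d>0. \<forall>u v. u < x \<and> x < v \<and> v - u < d \<longrightarrow> g v - g u \<ge> a * (v - u))" for x a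
  have cont: "continuous_on UNIV g" using lip by (rule lipschitz_on_continuous_on)
  have L: "g v - g u \<le> L * (v - u)" if "u \<le> v" for u v
    using lipschitz_onD[OF lip, of v u] that by (auto simp: dist_real_def)
  let ?E = "\<lambda>a b c. {x. \<bar>x\<bar> < c \<and> (\<forall>d>0. \<exists>u v. u < x \<and> x < v \<and> v - u < d \<and> g v - g u < a * (v - u))
      \<and> (\<forall>d>0. \<exists>u v. u < x \<and> x < v \<and> v - u < d \<and> g v - g u > b * (v - u))}"
  have Eeq: "?E a b c = {x. \<bar>x\<bar> < c \<and> \<not> lo x a \<and> \<not> hi x b}" for a b c :: real
    unfolding lo_def hi_def by (auto simp: not_le) 
  have meas: "?E a b c \<in> sets borel" for a b c :: real
  proof -
    have "?E a b c = {x. \<bar>x\<bar> < c} \<inter> {x. \<forall>d>0. \<exists>u v. u < x \<and> x < v \<and> v - u < d \<and> g v - g u < a * (v - u)}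
       \<inter> {x. \<forall>d>0. \<exists>u v. u < x \<and> x < v \<and> v - u < d \<and> g v - g u > b * (v - u)}"
      by auto
    moreover have "{x :: real. \<bar>x\<bar> < c} \<in> sets borel" by measurable
    ultimately show ?thesis by (simp only:) (intro sets.Int slope_oscillation_measurable)
  qed
  have "AE x in lborel. x \<notin> ?E a b c" if "0 < a" "a < b" for a b c :: real
  proof (rule AE_not_in)
    show "?E a b c \<in> null_sets lborel"
      using slope_gap_negligible[OF mono cont that, of c] meas[of c a b] by (simp add: null_sets_def)
  qed
  then have "AE x in lborel. \<forall>c\<in>\<nat>. \<forall>a\<in>\<rat>. \<forall>b\<in>\<rat>. 0 < a \<longrightarrow> a < b \<longrightarrow> x \<notin> ?E a b c"
    by (intro AE_ball_countable[THEN iffD2] ballI countable_rat)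
       (auto simp: Nats_def simp del: mem_Collect_eq intro: AE_impI)
  then show ?thesis
  proof (rule AE_mp[OF _ AE_I2], intro impI)
    fix x assume x: "\<forall>c\<in>\<nat>. \<forall>a\<in>\<rat>. \<forall>b\<in>\<rat>. 0 < a \<longrightarrow> a < b \<longrightarrow> x \<notin> ?E a b c"
    obtain c :: nat where c: "\<bar>x\<bar> < c" using reals_Archimedean2 by blast
    have dich: "lo x a \<or> hi x b" if "a \<in> \<rat>" "b \<in> \<rat>" "0 < a" "a < b" for a b
      using x[rule_format, of "real c" a b] that c unfolding Eeq by auto
    have loup: "a \<le> L" if a: "lo x a" for a
    proof -
      obtain d where d: "d > 0" "\<And>u v. u < x \<Longrightarrow> x < v \<Longrightarrow> v - u < d \<Longrightarrow> g v - g u \<ge> a * (v - u)"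
        using a unfolding lo_def by blast
      have "a * (2 * (d/4)) \<le> g (x + d/4) - g (x - d/4)" using d(2)[of "x - d/4" "x + d/4"] d(1) by auto
      also have "\<dots> \<le> L * (2 * (d/4))" using L[of "x - d/4" "x + d/4"] d(1) by auto
      finally show ?thesis using d(1) by simp
    qed
    have lo0: "lo x 0" unfolding lo_def
    proof (intro exI[of _ 1] conjI allI impI)
      fix u v assume "u < x \<and> x < v \<and> v - u < 1"
      then show "0 * (v - u) \<le> g v - g u" using monoD[OF mono, of u v] by simp
    qed simp
    \<comment> \<open>The Lipschitz constant bounds these lower slopes. A rational above
      \<open>D\<close> is no lower slope bound, so by \<open>dich\<close> every larger rational is
      an upper one.\<close>
    define D where "D = Sup {a. lo x a}"
    have bdd: "bdd_above {a. lo x a}" using loup by (auto simp: bdd_above_def)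
    have D0: "D \<ge> 0" unfolding D_def by (rule cSup_upper) (use lo0 bdd in auto)
    have loD: "lo x (D - e)" if "e > 0" for e
    proof -
      obtain a where a: "lo x a" "D - e < a"
        using less_cSup_iff[OF _ bdd, of "D - e"] lo0 \<open>e > 0\<close> unfolding D_def by auto
      obtain d where d: "d > 0" "\<And>u v. u < x \<Longrightarrow> x < v \<Longrightarrow> v - u < d \<Longrightarrow> g v - g u \<ge> a * (v - u)"
        using a unfolding lo_def by blast
      show ?thesis unfolding lo_def
      proof (intro exI[of _ d] conjI allI impI d(1))
        fix u v assume uv: "u < x \<and> x < v \<and> v - u < d"
        then have "(D - e) * (v - u) \<le> a * (v - u)" using a by (intro mult_right_mono) auto
        then show "(D - e) * (v - u) \<le> g v - g u" using d(2)[of u v] uv by linarith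
      qed
    qed
    have hiD: "hi x (D + e)" if "e > 0" for e
    proof -
      obtain a where a: "a \<in> \<rat>" "D < a" "a < D + e" using Rats_dense_in_real[of D "D + e"] \<open>e > 0\<close> by auto
      obtain b where b: "b \<in> \<rat>" "a < b" "b < D + e" using Rats_dense_in_real[of a "D + e"] a by auto
      have "\<not> lo x a" using cSup_upper[OF _ bdd, of a] a unfolding D_def[symmetric] by auto
      then have "hi x b" using dich[OF a(1) b(1)] a b D0 by auto
      then obtain d where d: "d > 0" "\<And>u v. u < x \<Longrightarrow> x < v \<Longrightarrow> v - u < d \<Longrightarrow> g v - g u \<le> b * (v - u)"
        unfolding hi_def by blast
      show ?thesis unfolding hi_def
      proof (intro exI[of _ d] conjI allI impI d(1))
        fix u v assume uv: "u < x \<and> x < v \<and> v - u < d"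
        then have "b * (v - u) \<le> (D + e) * (v - u)" using b by (intro mult_right_mono) auto
        then show "g v - g u \<le> (D + e) * (v - u)" using d(2)[of u v] uv by linarith
      qed
    qed
    have contat: "isCont g z" for z using cont by (simp add: continuous_on_eq_continuous_at)
    have "\<exists>d>0. \<forall>h. h \<noteq> 0 \<and> \<bar>h\<bar> < d \<longrightarrow> \<bar>(g (x + h) - g x) / h - D\<bar> \<le> e" if e: "e > 0" for e
    proof -
      obtain d1 where d1: "d1 > 0" "\<And>u v. u < x \<Longrightarrow> x < v \<Longrightarrow> v - u < d1 \<Longrightarrow> g v - g u \<le> (D + e) * (v - u)"
        using hiD[OF e] unfolding hi_def by blast
      obtain d2 where d2: "d2 > 0" "\<And>u v. u < x \<Longrightarrow> x < v \<Longrightarrow> v - u < d2 \<Longrightarrow> g v - g u \<ge> (D - e) * (v - u)"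
        using loD[OF e] unfolding lo_def by blast
      define d where "d = min d1 d2"
      have d: "d > 0" using d1 d2 by (simp add: d_def)
      \<comment> \<open>\<open>lo\<close> and \<open>hi\<close> only see intervals with
        \<open>x\<close> in their interior; the left endpoint \<open>x - s\<close> is moved to
        \<open>x\<close> by continuity, at the price of weak inequalities.\<close>
      have R: "g (x + h) - g x \<le> (D + e) * h \<and> (D - e) * h \<le> g (x + h) - g x" if h: "0 < h" "h < d" for h
      proof -
        have ev: "\<forall>\<^sub>F s in at_right 0. 0 < s \<and> s < d - h"
          using h by (auto simp: eventually_at_right intro!: exI[of _ "d - h"])
        have lim1: "((\<lambda>s. g (x + h) - g (x - s)) \<longlongrightarrow> g (x + h) - g (x - 0)) (at_right 0)"
          by (intro tendsto_intros isCont_tendsto_compose[OF contat])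
        have lim2: "((\<lambda>s. b * (x + h - (x - s))) \<longlongrightarrow> b * (x + h - (x - 0))) (at_right 0)" for b
          by (intro tendsto_intros)
        have "g (x + h) - g (x - 0) \<le> (D + e) * (x + h - (x - 0))"
          by (rule tendsto_le[OF _ lim2 lim1], simp, rule eventually_mono[OF ev], rule d1(2)) (use h d_def in auto)
        moreover have "(D - e) * (x + h - (x - 0)) \<le> g (x + h) - g (x - 0)"
          by (rule tendsto_le[OF _ lim1 lim2], simp, rule eventually_mono[OF ev], rule d2(2)) (use h d_def in auto)
        ultimately show ?thesis by simp
      qed
      have Lf: "g x - g (x - h) \<le> (D + e) * h \<and> (D - e) * h \<le> g x - g (x - h)" if h: "0 < h" "h < d" for h
      proof -
        have ev: "\<forall>\<^sub>F s in at_right 0. 0 < s \<and> s < d - h"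
          using h by (auto simp: eventually_at_right intro!: exI[of _ "d - h"])
        have lim1: "((\<lambda>s. g (x + s) - g (x - h)) \<longlongrightarrow> g (x + 0) - g (x - h)) (at_right 0)"
          by (intro tendsto_intros isCont_tendsto_compose[OF contat])
        have lim2: "((\<lambda>s. b * (x + s - (x - h))) \<longlongrightarrow> b * (x + 0 - (x - h))) (at_right 0)" for b
          by (intro tendsto_intros)
        have "g (x + 0) - g (x - h) \<le> (D + e) * (x + 0 - (x - h))"
          by (rule tendsto_le[OF _ lim2 lim1], simp, rule eventually_mono[OF ev], rule d1(2)) (use h d_def in auto)
        moreover have "(D - e) * (x + 0 - (x - h)) \<le> g (x + 0) - g (x - h)"
          by (rule tendsto_le[OF _ lim1 lim2], simp, rule eventually_mono[OF ev], rule d2(2)) (use h d_def in auto)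
        ultimately show ?thesis by simp
      qed
      show ?thesis
      proof (intro exI[of _ d] conjI d allI impI)
        fix h assume h: "h \<noteq> 0 \<and> \<bar>h\<bar> < d"
        show "\<bar>(g (x + h) - g x) / h - D\<bar> \<le> e"
        proof (cases "h > 0")
          case True
          then show ?thesis using R[of h] h by (auto simp: abs_le_iff field_simps)
        next
          case False
          then show ?thesis using Lf[of "-h"] h by (auto simp: abs_le_iff field_simps)
        qed
      qed
    qed
    then have "((\<lambda>h. (g (x + h) - g x) / h) \<longlongrightarrow> D) (at 0)"
      unfolding LIM_eq by (metis (no_types, lifting) diff_zero field_lbound_gt_zero half_gt_zero le_less_trans less_add_same_cancel1 field_sum_of_halves real_norm_def)
    then show "\<exists>D. (g has_real_derivative D) (at x)" by (auto simp: DERIV_def)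
  qed
qed

text \<open>Adding \<open>L * x\<close> makes an \<open>L\<close>-Lipschitz function monotone
  without affecting differentiability.\<close>

lemma AE_lipschitz_real_differentiable:
  fixes f :: "real \<Rightarrow> real"
  assumes lip: "L-lipschitz_on UNIV f"
  shows "AE x in lborel. \<exists>D. (f has_real_derivative D) (at x)"
proof -
  define g where "g = (\<lambda>x. f x + L * x)"
  have L: "\<bar>f x - f y\<bar> \<le> L * \<bar>x - y\<bar>" for x y
    using lipschitz_onD[OF lip, of x y] by (auto simp: dist_real_def)
  have "g x \<le> g y" if "x \<le> y" for x y
    unfolding g_def using L[of x y] that by (simp add: algebra_simps)
  then have "mono g" by (rule monoI)
  moreover have "(L + \<bar>L\<bar>)-lipschitz_on UNIV g"
    unfolding g_def by (intro lipschitz_on_add lip lipschitz_on_cmult_real lipschitz_on_id[THEN lipschitz_on_le]) (auto intro!: lipschitz_onI simp: dist_real_def abs_mult right_diff_distrib[symmetric])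
  ultimately have "AE x in lborel. \<exists>D. (g has_real_derivative D) (at x)"
    by (rule AE_lipschitz_mono_differentiable)
  then show ?thesis
  proof (rule AE_mp[OF _ AE_I2], intro impI)
    fix x assume "\<exists>D. (g has_real_derivative D) (at x)"
    then obtain D where "(g has_real_derivative D) (at x)" by blast
    then have "((\<lambda>x. g x - L * x) has_real_derivative D - L) (at x)"
      by (auto intro!: derivative_eq_intros)
    then show "\<exists>D. (f has_real_derivative D) (at x)" by (auto simp: g_def)
  qed
qed

section \<open>Integration along lines\<close>

lemma nn_integral_lborel_translate:
  fixes c :: "'a::euclidean_space"
  assumes [measurable]: "g \<in> borel_measurable borel"
  shows "(\<integral>\<^sup>+x. g (x + c) \<partial>lborel) = (\<integral>\<^sup>+x. g x \<partial>lborel)"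
proof -
  have "(\<integral>\<^sup>+x. g x \<partial>lborel) = (\<integral>\<^sup>+x. g x \<partial>distr lborel borel ((+) c))"
    by (simp add: lborel_distr_plus)
  also have "\<dots> = (\<integral>\<^sup>+x. g (x + c) \<partial>lborel)"
    by (subst nn_integral_distr) (auto simp: add.commute)
  finally show ?thesis by simp
qed

lemma integral_lborel_translate:
  fixes c :: "'a::euclidean_space" and g :: "'a \<Rightarrow> 'b::{banach, second_countable_topology}"
  assumes [measurable]: "g \<in> borel_measurable borel"
  shows "(LINT x|lborel. g (x + c)) = (LINT x|lborel. g x)"
proof -
  have "(LINT x|lborel. g x) = (LINT x|distr lborel borel ((+) c). g x)"
    by (simp add: lborel_distr_plus)
  also have "\<dots> = (LINT x|lborel. g (x + c))"
    by (subst integral_distr) (auto simp: add.commute)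
  finally show ?thesis by simp
qed

definition unit_slab :: "'a::euclidean_space \<Rightarrow> 'a set" where
  "unit_slab e = {z. 0 \<le> z \<bullet> e \<and> z \<bullet> e < 1}"

lemma unit_slab_measurable [measurable]: "unit_slab e \<in> sets borel"
  unfolding unit_slab_def by measurable

text \<open>Fubini's theorem for the direction \<open>e\<close> without choosing coordinates: after
  exchanging the integrals and translating by \<open>t e\<close>, the \<open>t\<close> for which
  \<open>w - t e\<close> is in the slab form an interval of length 1 for every
  \<open>w\<close>.\<close>

lemma nn_integral_unit_slab:
  fixes e :: "'a::euclidean_space"
  assumes [measurable]: "g \<in> borel_measurable borel" and e: "norm e = 1"
  shows "(\<integral>\<^sup>+z. g z \<partial>lborel) = (\<integral>\<^sup>+z. indicator (unit_slab e) z * (\<integral>\<^sup>+t. g (z + t *\<^sub>R e) \<partial>lborel) \<partial>lborel)"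
proof -
  have ee: "e \<bullet> e = 1" using e by (simp add: dot_square_norm)
  have "(\<integral>\<^sup>+z. indicator (unit_slab e) z * (\<integral>\<^sup>+t. g (z + t *\<^sub>R e) \<partial>lborel) \<partial>lborel)
    = (\<integral>\<^sup>+z. (\<integral>\<^sup>+(t::real). indicator (unit_slab e) z * g (z + t *\<^sub>R e) \<partial>lborel) \<partial>lborel)"
    by (intro nn_integral_cong nn_integral_cmult[symmetric]) auto
  also have "\<dots> = (\<integral>\<^sup>+(t::real). (\<integral>\<^sup>+z. indicator (unit_slab e) z * g (z + t *\<^sub>R e) \<partial>lborel) \<partial>lborel)"
    by (rule lborel_pair.Fubini'[symmetric]) measurable
  also have "\<dots> = (\<integral>\<^sup>+(t::real). (\<integral>\<^sup>+w. indicator (unit_slab e) (w - t *\<^sub>R e) * g w \<partial>lborel) \<partial>lborel)"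
  proof (rule nn_integral_cong)
    fix t :: real
    show "(\<integral>\<^sup>+z. indicator (unit_slab e) z * g (z + t *\<^sub>R e) \<partial>lborel)
        = (\<integral>\<^sup>+w. indicator (unit_slab e) (w - t *\<^sub>R e) * g w \<partial>lborel)"
      using nn_integral_lborel_translate[of "\<lambda>w. indicator (unit_slab e) (w - t *\<^sub>R e) * g w" "t *\<^sub>R e"] by simp
  qed
  also have "\<dots> = (\<integral>\<^sup>+w. (\<integral>\<^sup>+(t::real). indicator (unit_slab e) (w - t *\<^sub>R e) * g w \<partial>lborel) \<partial>lborel)"
    by (rule lborel_pair.Fubini') measurable
  also have "\<dots> = (\<integral>\<^sup>+w. g w \<partial>lborel)"
  proof (rule nn_integral_cong)
    fix w
    have "(\<integral>\<^sup>+(t::real). indicator (unit_slab e) (w - t *\<^sub>R e) * g w \<partial>lborel)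
        = (\<integral>\<^sup>+(t::real). indicator {w \<bullet> e - 1<..w \<bullet> e} t * g w \<partial>lborel)"
      by (intro nn_integral_cong) (auto simp: unit_slab_def indicator_def inner_diff_left ee)
    also have "\<dots> = (\<integral>\<^sup>+(t::real). indicator {w \<bullet> e - 1<..w \<bullet> e} t \<partial>lborel) * g w"
      by (rule nn_integral_multc) auto
    also have "(\<integral>\<^sup>+(t::real). indicator {w \<bullet> e - 1<..w \<bullet> e} t \<partial>lborel) = 1"
      by (subst nn_integral_indicator) auto
    finally show "(\<integral>\<^sup>+(t::real). indicator (unit_slab e) (w - t *\<^sub>R e) * g w \<partial>lborel) = g w" by simp
  qed
  finally show ?thesis by simp
qed

text \<open>Lebesgue measure with density \<open>1 + F / B'\<close>, where \<open>B'\<close> is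
  large enough to keep the density nonnegative, agrees with Lebesgue measure on boxes. The two
  measures are then equal, and so are their densities almost everywhere.\<close>

lemma AE_zero_if_box_integrals_zero:
  fixes F :: "'a::euclidean_space \<Rightarrow> real"
  assumes [measurable]: "F \<in> borel_measurable borel" and B: "\<And>x. \<bar>F x\<bar> \<le> B"
    and int0: "\<And>a b. (LINT x|lborel. indicator (box a b) x * F x) = 0"
  shows "AE x in lborel. F x = 0"
proof -
  define B' where "B' = \<bar>B\<bar> + 1"
  have B': "B' > 0" "\<bar>F x\<bar> \<le> B'" for x using B[of x] unfolding B'_def by linarith+
  have nn: "0 \<le> 1 + F x / B'" for x using B'(2)[of x] B'(1) by (auto simp: field_simps abs_le_iff)
  let ?M = "density lborel (\<lambda>x. ennreal (1 + F x / B'))"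
  have "lborel = ?M"
  proof (rule lborel_eqI)
    fix l u :: 'a assume lu: "\<And>b. b \<in> Basis \<Longrightarrow> l \<bullet> b \<le> u \<bullet> b"
    have i1: "integrable lborel (indicator (box l u) :: 'a \<Rightarrow> real)"
      by (subst integrable_indicator_iff) (auto simp: emeasure_lborel_box_eq)
    have i2: "integrable lborel (\<lambda>x. indicator (box l u) x * F x)"
    proof (rule Bochner_Integration.integrable_bound[OF integrable_mult_right[OF i1, of B']])
      show "AE x in lborel. norm (indicator (box l u) x * F x) \<le> norm (B' * indicator (box l u) x)"
        using B' by (auto intro!: AE_I2 simp: indicator_def)
    qed measurable
    have "emeasure ?M (box l u) = (\<integral>\<^sup>+x. ennreal (indicator (box l u) x * (1 + F x / B')) \<partial>lborel)"
      by (subst emeasure_density) (auto intro!: nn_integral_cong simp: indicator_def)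
    also have "\<dots> = (\<integral>\<^sup>+x. ennreal (indicator (box l u) x + indicator (box l u) x * F x / B') \<partial>lborel)"
      by (simp add: algebra_simps)
    also have "\<dots> = ennreal (LINT x|lborel. (indicator (box l u) x + indicator (box l u) x * F x / B'))"
    proof (rule nn_integral_eq_integral)
      show "integrable lborel (\<lambda>x. indicator (box l u) x + indicator (box l u) x * F x / B')"
        using i1 i2 by (intro Bochner_Integration.integrable_add Bochner_Integration.integrable_divide)
      show "AE x in lborel. 0 \<le> indicator (box l u) x + indicator (box l u) x * F x / B'"
        using nn by (auto intro!: AE_I2 simp: indicator_def)
    qed
    also have "(LINT x|lborel. (indicator (box l u) x + indicator (box l u) x * F x / B')) = measure lborel (box l u)"
      using i1 i2 int0[of l u] by (subst Bochner_Integration.integral_add) auto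
    also have "\<dots> = (\<Prod>b\<in>Basis. (u - l) \<bullet> b)"
      using lu by (simp add: measure_lborel_box)
    finally show "emeasure ?M (box l u) = (\<Prod>b\<in>Basis. (u - l) \<bullet> b)" .
  qed auto
  then have "density lborel (\<lambda>_. 1) = ?M" by (simp add: density_1)
  then have "AE x in lborel. 1 = ennreal (1 + F x / B')"
    by (subst (asm) sigma_finite_measure.density_unique_iff[OF sigma_finite_lborel]) auto
  then show ?thesis
    using nn B'(1) by (elim AE_mp) (auto intro!: AE_I2 simp: ennreal_eq_1)
qed


section \<open>Directional derivatives of Lipschitz functions\<close>

definition has_dir_deriv :: "('a::euclidean_space \<Rightarrow> real) \<Rightarrow> 'a \<Rightarrow> 'a \<Rightarrow> real \<Rightarrow> bool" where
  "has_dir_deriv \<phi> z e D \<longleftrightarrow> ((\<lambda>h. (\<phi> (z + h *\<^sub>R e) - \<phi> z) / h) \<longlongrightarrow> D) (at 0)"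

lemma has_dir_deriv_unique: "has_dir_deriv \<phi> z e D \<Longrightarrow> has_dir_deriv \<phi> z e D' \<Longrightarrow> D = D'"
  unfolding has_dir_deriv_def by (rule LIM_unique)

lemma has_dir_deriv_0: "has_dir_deriv \<phi> z 0 0"
  unfolding has_dir_deriv_def by simp

lemma has_dir_deriv_scaleR:
  assumes "has_dir_deriv \<phi> z e D"
  shows "has_dir_deriv \<phi> z (c *\<^sub>R e) (c * D)"
proof (cases "c = 0")
  case True then show ?thesis by (simp add: has_dir_deriv_0)
next
  case False
  have "((\<lambda>h. c * ((\<phi> (z + (c * h) *\<^sub>R e) - \<phi> z) / (c * h))) \<longlongrightarrow> c * D) (at 0)"
  proof (intro tendsto_mult tendsto_const)
    have "filterlim (\<lambda>h. c * h) (at 0) (at 0)"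
      using False by (intro filterlim_atI eventually_mono[OF eventually_neq_at_within[of 0]] tendsto_mult_right_zero)
        (auto intro: tendsto_ident_at)
    with assms show "((\<lambda>h. (\<phi> (z + (c * h) *\<^sub>R e) - \<phi> z) / (c * h)) \<longlongrightarrow> D) (at 0)"
      unfolding has_dir_deriv_def by (rule filterlim_compose)
  qed
  then show ?thesis using False by (simp add: has_dir_deriv_def mult.commute)
qed

text \<open>Existence of the limit is the Cauchy condition on the difference quotients. For fixed
  bounds it is an intersection, over all real \<open>s\<close> and \<open>t\<close>, of sets that
  are closed in \<open>z\<close>, hence closed; only countably many bounds are needed.\<close>

lemma dir_deriv_set_measurable:
  fixes \<phi> :: "'a::euclidean_space \<Rightarrow> real"
  assumes cont: "continuous_on UNIV \<phi>"
  shows "{z. \<exists>D. has_dir_deriv \<phi> z e D} \<in> sets borel"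
proof -
  define q where "q z h = (\<phi> (z + h *\<^sub>R e) - \<phi> z) / h" for z h
  define A where "A k m = (\<Inter>(s, t) \<in> {(s, t). s \<noteq> 0 \<and> t \<noteq> 0 \<and> \<bar>s\<bar> < 1 / real (Suc m) \<and> \<bar>t\<bar> < 1 / real (Suc m)}.
      {z. \<bar>q z s - q z t\<bar> \<le> 1 / real (Suc k)})" for k m
  have contq: "continuous_on UNIV (\<lambda>z. q z h)" for h
    unfolding q_def divide_inverse by (intro continuous_intros continuous_on_compose2[OF cont]) auto
  have closed: "closed (A k m)" for k m
    unfolding A_def by (intro closed_INT ballI) (auto intro!: closed_Collect_le continuous_intros contq)
  have "(\<exists>D. has_dir_deriv \<phi> z e D) \<longleftrightarrow> z \<in> (\<Inter>k. \<Union>m. A k m)" for z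
  proof
    assume "\<exists>D. has_dir_deriv \<phi> z e D"
    then obtain D where D: "((\<lambda>h. q z h) \<longlongrightarrow> D) (at 0)" unfolding has_dir_deriv_def q_def by auto
    show "z \<in> (\<Inter>k. \<Union>m. A k m)"
    proof
      fix k
      have "1 / real (Suc k) / 2 > 0" by simp
      with D obtain d where d: "d > 0" "\<And>h. h \<noteq> 0 \<Longrightarrow> \<bar>h\<bar> < d \<Longrightarrow> \<bar>q z h - D\<bar> < 1 / real (Suc k) / 2"
        unfolding LIM_eq by (metis diff_zero real_norm_def)
      obtain m where m: "1 / real (Suc m) < d" using d(1) nat_approx_posE by blast
      have "\<bar>q z s - q z t\<bar> \<le> 1 / real (Suc k)"
        if "s \<noteq> 0" "t \<noteq> 0" "\<bar>s\<bar> < 1 / real (Suc m)" "\<bar>t\<bar> < 1 / real (Suc m)" for s t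
      proof -
        have "\<bar>q z s - D\<bar> < 1 / real (Suc k) / 2" "\<bar>q z t - D\<bar> < 1 / real (Suc k) / 2"
          using d(2)[of s] d(2)[of t] that m by auto
        moreover have "\<bar>a - D\<bar> < y / 2 \<Longrightarrow> \<bar>b - D\<bar> < y / 2 \<Longrightarrow> \<bar>a - b\<bar> \<le> y" for a b y :: real by linarith
        ultimately show ?thesis by blast
      qed
      then show "z \<in> (\<Union>m. A k m)" unfolding A_def by (intro UN_I[of m]) auto
    qed
  next
    assume z: "z \<in> (\<Inter>k. \<Union>m. A k m)"
    have *: "\<exists>m. \<forall>s t. s \<noteq> 0 \<and> t \<noteq> 0 \<and> \<bar>s\<bar> < 1 / real (Suc m) \<and> \<bar>t\<bar> < 1 / real (Suc m) \<longrightarrow> \<bar>q z s - q z t\<bar> \<le> 1 / real (Suc k)" for k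
    proof -
      have "z \<in> (\<Union>m. A k m)" using z by blast
      then obtain m where "z \<in> A k m" by blast
      then show ?thesis unfolding A_def by (intro exI[of _ m]) auto
    qed
    have inv: "1 / real (Suc i) < 1 / real (Suc m) " if "i > m" for i m :: nat
      using that by (simp add: frac_less2)
    have "Cauchy (\<lambda>i. q z (1 / real (Suc i)))"
    proof (rule metric_CauchyI)
      fix \<epsilon> :: real assume "\<epsilon> > 0"
      then obtain k where k: "1 / real (Suc k) < \<epsilon>" using nat_approx_posE by blast
      obtain m where m: "\<And>s t. s \<noteq> 0 \<Longrightarrow> t \<noteq> 0 \<Longrightarrow> \<bar>s\<bar> < 1 / real (Suc m) \<Longrightarrow> \<bar>t\<bar> < 1 / real (Suc m) \<Longrightarrow> \<bar>q z s - q z t\<bar> \<le> 1 / real (Suc k)"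
        using *[of k] by blast
      show "\<exists>M. \<forall>i\<ge>M. \<forall>j\<ge>M. dist (q z (1 / real (Suc i))) (q z (1 / real (Suc j))) < \<epsilon>"
      proof (intro exI[of _ "Suc m"] allI impI)
        fix i j assume "Suc m \<le> i" "Suc m \<le> j"
        then show "dist (q z (1 / real (Suc i))) (q z (1 / real (Suc j))) < \<epsilon>"
          using m[of "1 / real (Suc i)" "1 / real (Suc j)"] inv[of m i] inv[of m j] k by (auto simp: dist_real_def)
      qed
    qed
    then obtain D where D: "(\<lambda>i. q z (1 / real (Suc i))) \<longlonglongrightarrow> D" using Cauchy_convergent_iff convergent_def by blast
    have "((\<lambda>h. q z h) \<longlongrightarrow> D) (at 0)"
      unfolding LIM_eq
    proof (intro allI impI)
      fix \<epsilon> :: real assume "\<epsilon> > 0"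
      then obtain k where k: "1 / real (Suc k) < \<epsilon>" using nat_approx_posE by blast
      obtain m where m: "\<And>s t. s \<noteq> 0 \<Longrightarrow> t \<noteq> 0 \<Longrightarrow> \<bar>s\<bar> < 1 / real (Suc m) \<Longrightarrow> \<bar>t\<bar> < 1 / real (Suc m) \<Longrightarrow> \<bar>q z s - q z t\<bar> \<le> 1 / real (Suc k)"
        using *[of k] by blast
      show "\<exists>s>0. \<forall>x. x \<noteq> 0 \<and> norm (x - 0) < s \<longrightarrow> norm (q z x - D) < \<epsilon>"
      proof (intro exI[of _ "1 / real (Suc m)"] conjI allI impI)
        fix h :: real assume h: "h \<noteq> 0 \<and> norm (h - 0) < 1 / real (Suc m)"
        have "\<bar>q z h - D\<bar> \<le> 1 / real (Suc k)"
        proof (rule Lim_bounded)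
          show "(\<lambda>i. \<bar>q z h - q z (1 / real (Suc i))\<bar>) \<longlonglongrightarrow> \<bar>q z h - D\<bar>"
            by (intro tendsto_intros D)
          show "\<forall>i\<ge>Suc m. \<bar>q z h - q z (1 / real (Suc i))\<bar> \<le> 1 / real (Suc k)"
          proof (intro allI impI)
            fix i assume "Suc m \<le> i"
            then show "\<bar>q z h - q z (1 / real (Suc i))\<bar> \<le> 1 / real (Suc k)"
              using m[of h "1 / real (Suc i)"] h inv[of m i] by auto
          qed
        qed
        then show "norm (q z h - D) < \<epsilon>" using k by simp
      qed simp
    qed
    then show "\<exists>D. has_dir_deriv \<phi> z e D" unfolding has_dir_deriv_def q_def by auto
  qed
  then have "{z. \<exists>D. has_dir_deriv \<phi> z e D} = (\<Inter>k. \<Union>m. A k m)" by blast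
  moreover have "(\<Inter>k. \<Union>m. A k m) \<in> sets borel"
    using closed by (intro sets.countable_INT'' sets.countable_UN') auto
  ultimately show ?thesis by simp
qed

text \<open>Restricted to a line in direction \<open>u\<close>, \<open>\<phi>\<close> is a Lipschitz
  function of one variable, so the bad set meets every such line in a null set;
  \<open>nn_integral_unit_slab\<close> adds these up.\<close>

lemma AE_dir_deriv:
  fixes \<phi> :: "'a::euclidean_space \<Rightarrow> real"
  assumes lip: "L-lipschitz_on UNIV \<phi>"
  shows "AE z in lborel. \<exists>D. has_dir_deriv \<phi> z e D"
proof (cases "e = 0")
  case True then show ?thesis using has_dir_deriv_0 by auto
next
  case False
  define u where "u = (1 / norm e) *\<^sub>R e"
  have u: "norm u = 1" "e = norm e *\<^sub>R u" using False by (auto simp: u_def)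
  define B where "B = {z. \<not> (\<exists>D. has_dir_deriv \<phi> z u D)}"
  have cont: "continuous_on UNIV \<phi>" using lip by (rule lipschitz_on_continuous_on)
  have [measurable]: "B \<in> sets borel"
  proof -
    have "B = space borel - {z. \<exists>D. has_dir_deriv \<phi> z u D}" by (auto simp: B_def)
    then show ?thesis using dir_deriv_set_measurable[OF cont, of u] by (simp only: sets.compl_sets)
  qed
  have inner0: "(\<integral>\<^sup>+t. indicator B (z + t *\<^sub>R u) \<partial>lborel) = 0" for z
  proof -
    have "L-lipschitz_on UNIV (\<lambda>t. \<phi> (z + t *\<^sub>R u))"
    proof (rule lipschitz_onI)
      fix s t :: real
      have "dist (\<phi> (z + s *\<^sub>R u)) (\<phi> (z + t *\<^sub>R u)) \<le> L * dist (z + s *\<^sub>R u) (z + t *\<^sub>R u)"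
        by (rule lipschitz_onD[OF lip]) auto
      also have "dist (z + s *\<^sub>R u) (z + t *\<^sub>R u) = dist s t"
        using u by (simp add: dist_norm scaleR_diff_left[symmetric])
      finally show "dist (\<phi> (z + s *\<^sub>R u)) (\<phi> (z + t *\<^sub>R u)) \<le> L * dist s t" .
    qed (rule lipschitz_on_nonneg[OF lip])
    then have "AE t in lborel. \<exists>D. ((\<lambda>t. \<phi> (z + t *\<^sub>R u)) has_real_derivative D) (at t)"
      by (rule AE_lipschitz_real_differentiable)
    then have "AE t in lborel. indicator B (z + t *\<^sub>R u) = (0::ennreal)"
      by (elim AE_mp) (auto intro!: AE_I2 simp: B_def DERIV_def has_dir_deriv_def algebra_simps)
    then show ?thesis by (subst nn_integral_0_iff_AE) auto
  qed
  have "emeasure lborel B = 0"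
    using nn_integral_unit_slab[of "indicator B" u] u inner0 by simp
  then have "AE z in lborel. z \<notin> B" by (intro AE_not_in) (auto simp: null_sets_def)
  then show ?thesis
  proof (rule AE_mp[OF _ AE_I2], intro impI)
    fix z assume "z \<notin> B"
    then obtain D where "has_dir_deriv \<phi> z u D" unfolding B_def by auto
    then show "\<exists>D. has_dir_deriv \<phi> z e D" using has_dir_deriv_scaleR[of \<phi> z u D "norm e"] u by auto
  qed
qed


text \<open>A limit along one fixed sequence, which makes this a Borel function on the whole space.
  Where the directional derivative exists it has this value; elsewhere the value means
  nothing.\<close>

definition dir_deriv :: "('a::euclidean_space \<Rightarrow> real) \<Rightarrow> 'a \<Rightarrow> 'a \<Rightarrow> real" where
  "dir_deriv \<phi> e z = lim (\<lambda>k. real (Suc k) * (\<phi> (z + (1 / real (Suc k)) *\<^sub>R e) - \<phi> z))"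

lemma has_dir_deriv_LIMSEQ:
  assumes "has_dir_deriv \<phi> z e D"
  shows "(\<lambda>k. real (Suc k) * (\<phi> (z + (1 / real (Suc k)) *\<^sub>R e) - \<phi> z)) \<longlonglongrightarrow> D"
proof -
  have "filterlim (\<lambda>k. 1 / real (Suc k)) (at 0) sequentially"
    by (intro filterlim_atI LIMSEQ_Suc[OF lim_1_over_n]) (auto intro!: always_eventually)
  from filterlim_compose[OF assms[unfolded has_dir_deriv_def] this] show ?thesis
    by (simp add: mult.commute)
qed

lemma has_dir_deriv_imp_dir_deriv: "has_dir_deriv \<phi> z e D \<Longrightarrow> dir_deriv \<phi> e z = D"
  unfolding dir_deriv_def by (rule limI[OF has_dir_deriv_LIMSEQ])

lemma dir_deriv_measurable:
  assumes "continuous_on UNIV \<phi>"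
  shows "dir_deriv \<phi> e \<in> borel_measurable borel"
proof -
  have [measurable]: "\<phi> \<in> borel_measurable borel" using assms by (rule borel_measurable_continuous_onI)
  show ?thesis unfolding dir_deriv_def[abs_def] by measurable
qed

lemma lipschitz_diff_quotient_bound:
  fixes \<phi> :: "'a::euclidean_space \<Rightarrow> real"
  assumes "L-lipschitz_on UNIV \<phi>" "h > 0"
  shows "\<bar>(1 / h) * (\<phi> (z + h *\<^sub>R e) - \<phi> z)\<bar> \<le> L * norm e"
  using lipschitz_onD[OF assms(1), of "z + h *\<^sub>R e" z] assms(2)
  by (simp add: dist_norm abs_mult field_simps)

lemma has_dir_deriv_bound:
  fixes \<phi> :: "'a::euclidean_space \<Rightarrow> real"
  assumes lip: "L-lipschitz_on UNIV \<phi>" and "has_dir_deriv \<phi> z e D"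
  shows "\<bar>D\<bar> \<le> L * norm e"
proof (rule Lim_bounded)
  show "(\<lambda>k. \<bar>real (Suc k) * (\<phi> (z + (1 / real (Suc k)) *\<^sub>R e) - \<phi> z)\<bar>) \<longlonglongrightarrow> \<bar>D\<bar>"
    by (intro tendsto_rabs has_dir_deriv_LIMSEQ assms)
  show "\<forall>k\<ge>0. \<bar>real (Suc k) * (\<phi> (z + (1 / real (Suc k)) *\<^sub>R e) - \<phi> z)\<bar> \<le> L * norm e"
    using lipschitz_diff_quotient_bound[OF lip, of "1 / real (Suc k)" z e for k] by simp
qed

text \<open>Dominated convergence; off the boundary of the box, a null set, the indicator of the
  moving box is eventually constant. The shift \<open>c k\<close> is there for the translation made
  in \<open>AE_dir_deriv_add\<close>.\<close>

lemma box_shifted_quotient_integral_tendsto: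
  fixes \<phi> :: "'a::euclidean_space \<Rightarrow> real"
  assumes lip: "L-lipschitz_on UNIV \<phi>" and c: "c \<longlonglongrightarrow> 0"
  shows "(\<lambda>k. LINT w|lborel. indicator (box a b) (w - c k) * (real (Suc k) * (\<phi> (w + (1 / real (Suc k)) *\<^sub>R e) - \<phi> w)))
    \<longlonglongrightarrow> (LINT w|lborel. indicator (box a b) w * dir_deriv \<phi> e w)"
proof -
  have cont: "continuous_on UNIV \<phi>" using lip by (rule lipschitz_on_continuous_on)
  have [measurable]: "\<phi> \<in> borel_measurable borel" using cont by (rule borel_measurable_continuous_onI)
  have [measurable]: "dir_deriv \<phi> e \<in> borel_measurable borel" by (rule dir_deriv_measurable[OF cont])
  obtain r where r: "\<And>k. norm (c k) \<le> r"
    using convergent_imp_Bseq[OF convergentI[OF c]] by (auto simp: Bseq_def)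
  obtain R where R: "\<And>x. x \<in> box a b \<Longrightarrow> norm x \<le> R" using bounded_box by (metis bounded_iff)
  have L0: "L \<ge> 0" by (rule lipschitz_on_nonneg[OF lip])
  show ?thesis
  proof (rule integral_dominated_convergence[where w="\<lambda>w. indicator (cball 0 (R + r)) w * (L * norm e)"])
    show "integrable lborel (\<lambda>w::'a. indicator (cball 0 (R + r)) w * (L * norm e))"
      using emeasure_lborel_cball_finite[of "0::'a" "R + r"]
      by (intro Bochner_Integration.integrable_mult_left) (auto simp: integrable_indicator_iff)
    have bd: "norm (indicator (box a b) (w - c k) * (real (Suc k) * (\<phi> (w + (1 / real (Suc k)) *\<^sub>R e) - \<phi> w)))
        \<le> indicator (cball 0 (R + r)) w * (L * norm e)" for k w
    proof (cases "w - c k \<in> box a b")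
      case True
      have "norm w \<le> norm (w - c k) + norm (c k)" by (metis diff_add_cancel norm_triangle_ineq)
      then have "norm w \<le> R + r" using R[OF True] r[of k] by linarith
      then show ?thesis using True lipschitz_diff_quotient_bound[OF lip, of "1 / real (Suc k)" w e] by simp
    next
      case False then show ?thesis using L0 by simp
    qed
    show "AE w in lborel. norm (indicator (box a b) (w - c k) * (real (Suc k) * (\<phi> (w + (1 / real (Suc k)) *\<^sub>R e) - \<phi> w)))
        \<le> indicator (cball 0 (R + r)) w * (L * norm e)" for k
      using bd by (intro AE_I2)
    have "cbox a b - box a b \<in> null_sets lborel"
      using negligible_frontier_interval[of a b] by (auto simp: negligible_iff_null_sets null_sets_completion_iff)
    then have 1: "AE w in lborel. w \<notin> cbox a b - box a b" by (rule AE_not_in)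
    show "AE w in lborel. (\<lambda>k. indicator (box a b) (w - c k) * (real (Suc k) * (\<phi> (w + (1 / real (Suc k)) *\<^sub>R e) - \<phi> w)))
       \<longlonglongrightarrow> indicator (box a b) w * dir_deriv \<phi> e w"
      using 1 AE_dir_deriv[OF lip, of e]
    proof eventually_elim
      fix w assume w: "w \<notin> cbox a b - box a b" "\<exists>D. has_dir_deriv \<phi> w e D"
      then obtain D where D: "has_dir_deriv \<phi> w e D" by blast
      have wc: "(\<lambda>k. w - c k) \<longlonglongrightarrow> w" using tendsto_diff[OF tendsto_const c, of w] by simp
      have "(\<lambda>k. indicator (box a b) (w - c k)) \<longlonglongrightarrow> (indicator (box a b) w :: real)"
      proof (rule tendsto_eventually)
        show "\<forall>\<^sub>F k in sequentially. indicator (box a b) (w - c k) = (indicator (box a b) w :: real)"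
        proof (cases "w \<in> box a b")
          case True
          then have "\<forall>\<^sub>F k in sequentially. w - c k \<in> box a b"
            using topological_tendstoD[OF wc open_box] by blast
          then show ?thesis by eventually_elim (use True in auto)
        next
          case False
          then have "\<forall>\<^sub>F k in sequentially. w - c k \<in> - cbox a b"
            using topological_tendstoD[OF wc, of "- cbox a b"] w(1) by (auto simp: open_Compl closed_cbox)
          then show ?thesis by eventually_elim (use False box_subset_cbox[of a b] in \<open>auto simp: indicator_def\<close>)
        qed
      qed
      then show "(\<lambda>k. indicator (box a b) (w - c k) * (real (Suc k) * (\<phi> (w + (1 / real (Suc k)) *\<^sub>R e) - \<phi> w)))
       \<longlonglongrightarrow> indicator (box a b) w * dir_deriv \<phi> e w"
        unfolding has_dir_deriv_imp_dir_deriv[OF D] by (intro tendsto_mult has_dir_deriv_LIMSEQ[OF D])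
    qed
  qed measurable
qed

text \<open>Pointwise additivity cannot be read off from the difference quotients, because the
  second one is taken at a moving point. Integrated over a box, this displacement can be moved to
  the box, where it disappears in the limit; equality of the integrals over all boxes gives equality
  almost everywhere.\<close>

lemma AE_dir_deriv_add:
  fixes \<phi> :: "'a::euclidean_space \<Rightarrow> real"
  assumes lip: "L-lipschitz_on UNIV \<phi>"
  shows "AE z in lborel. dir_deriv \<phi> (e + e') z = dir_deriv \<phi> e z + dir_deriv \<phi> e' z"
proof -
  have cont: "continuous_on UNIV \<phi>" using lip by (rule lipschitz_on_continuous_on)
  have [measurable]: "\<phi> \<in> borel_measurable borel" using cont by (rule borel_measurable_continuous_onI)
  have [measurable]: "dir_deriv \<phi> u \<in> borel_measurable borel" for u by (rule dir_deriv_measurable[OF cont])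
  define G where "G u = {z. \<exists>D. has_dir_deriv \<phi> z u D}" for u
  have [measurable]: "G u \<in> sets borel" for u unfolding G_def by (rule dir_deriv_set_measurable[OF cont])
  have AEG: "AE z in lborel. z \<in> G u" for u unfolding G_def using AE_dir_deriv[OF lip, of u] by simp
  \<comment> \<open>Outside \<open>G u\<close> the value of \<open>dir_deriv\<close> is arbitrary.
    Cutting it off there makes the bound by \<open>L * norm u\<close> hold at every point.\<close>
  define d where "d u z = indicator (G u) z * dir_deriv \<phi> u z" for u z
  have [measurable]: "d u \<in> borel_measurable borel" for u unfolding d_def by measurable
  have dAE: "AE z in lborel. d u z = dir_deriv \<phi> u z" for u
    using AEG[of u] by eventually_elim (simp add: d_def)
  have dbd: "\<bar>d u z\<bar> \<le> L * norm u" for u z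
  proof (cases "z \<in> G u")
    case True then show ?thesis
      using has_dir_deriv_bound[OF lip] has_dir_deriv_imp_dir_deriv by (fastforce simp: d_def G_def)
  next
    case False then show ?thesis using lipschitz_on_nonneg[OF lip] by (simp add: d_def)
  qed
  define F where "F z = d (e + e') z - d e z - d e' z" for z
  have [measurable]: "F \<in> borel_measurable borel" unfolding F_def by measurable
  have dint: "integrable lborel (\<lambda>w. indicator (box a b) w * d u w)" for a b u
  proof (rule Bochner_Integration.integrable_bound)
    show "integrable lborel (\<lambda>w. indicator (box a b) w * (L * norm u))"
      by (intro Bochner_Integration.integrable_mult_left) (auto simp: integrable_indicator_iff emeasure_lborel_box_eq)
    show "AE w in lborel. norm (indicator (box a b) w * d u w) \<le> norm (indicator (box a b) w * (L * norm u))"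
      using dbd[of u] lipschitz_on_nonneg[OF lip] by (auto intro!: AE_I2 simp: indicator_def)
  qed measurable
  define q where "q u k w = real (Suc k) * (\<phi> (w + (1 / real (Suc k)) *\<^sub>R u) - \<phi> w)" for u k w
  have [measurable]: "q u k \<in> borel_measurable borel" for u k unfolding q_def by measurable
  have qint: "integrable lborel (\<lambda>w. indicator (box a b) w * q u k (w + c))" for a b u k c
  proof (rule Bochner_Integration.integrable_bound)
    show "integrable lborel (\<lambda>w. indicator (box a b) w * (L * norm u))"
      by (intro Bochner_Integration.integrable_mult_left) (auto simp: integrable_indicator_iff emeasure_lborel_box_eq)
    have "\<bar>q u k (w + c)\<bar> \<le> L * norm u" for w
      using lipschitz_diff_quotient_bound[OF lip, of "1 / real (Suc k)" "w + c" u] by (simp add: q_def)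
    then show "AE w in lborel. norm (indicator (box a b) w * q u k (w + c)) \<le> norm (indicator (box a b) w * (L * norm u))"
      using lipschitz_on_nonneg[OF lip] by (auto intro!: AE_I2 simp: indicator_def)
  qed measurable
  have lim: "(\<lambda>k. LINT w|lborel. indicator (box a b) (w - c k) * q u k w) \<longlonglongrightarrow> (LINT w|lborel. indicator (box a b) w * d u w)"
    if "c \<longlonglongrightarrow> 0" for a b u c
  proof -
    have "(LINT w|lborel. indicator (box a b) w * d u w) = (LINT w|lborel. indicator (box a b) w * dir_deriv \<phi> u w)"
    proof (rule integral_cong_AE)
      show "AE w in lborel. indicator (box a b) w * d u w = indicator (box a b) w * dir_deriv \<phi> u w"
        using dAE[of u] by eventually_elim simp
    qed measurable
    then show ?thesis using box_shifted_quotient_integral_tendsto[OF lip that, of a b u] by (simp add: q_def)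
  qed
  have "(LINT w|lborel. indicator (box a b) w * d (e + e') w)
      = (LINT w|lborel. indicator (box a b) w * d e w) + (LINT w|lborel. indicator (box a b) w * d e' w)" for a b
  proof (rule LIMSEQ_unique)
    show "(\<lambda>k. LINT w|lborel. indicator (box a b) (w - 0) * q (e + e') k w) \<longlonglongrightarrow> (LINT w|lborel. indicator (box a b) w * d (e + e') w)"
      by (rule lim) simp
    have c: "(\<lambda>k. (1 / real (Suc k)) *\<^sub>R e) \<longlonglongrightarrow> 0"
      using tendsto_scaleR[OF LIMSEQ_Suc[OF lim_1_over_n] tendsto_const[of e]] by simp
    \<comment> \<open>The quotient for \<open>e + e'\<close> at \<open>w\<close> is the quotient for
      \<open>e\<close> at \<open>w\<close> plus the quotient for \<open>e'\<close> at
      \<open>w + (1 / Suc k) e\<close>.\<close>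
    have eq: "(LINT w|lborel. indicator (box a b) (w - 0) * q (e + e') k w)
       = (LINT w|lborel. indicator (box a b) (w - 0) * q e k w)
       + (LINT w|lborel. indicator (box a b) (w - (1 / real (Suc k)) *\<^sub>R e) * q e' k w)" for k
    proof -
      have "(LINT w|lborel. indicator (box a b) (w - 0) * q (e + e') k w)
        = (LINT w|lborel. indicator (box a b) w * q e k w + indicator (box a b) w * q e' k (w + (1 / real (Suc k)) *\<^sub>R e))"
        by (intro Bochner_Integration.integral_cong) (auto simp: q_def algebra_simps)
      also have "\<dots> = (LINT w|lborel. indicator (box a b) w * q e k w)
          + (LINT w|lborel. indicator (box a b) w * q e' k (w + (1 / real (Suc k)) *\<^sub>R e))"
        using qint[of a b e k 0] qint[of a b e' k "(1 / real (Suc k)) *\<^sub>R e"] by (intro Bochner_Integration.integral_add) auto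
      also have "(LINT w|lborel. indicator (box a b) w * q e' k (w + (1 / real (Suc k)) *\<^sub>R e))
        = (LINT w|lborel. indicator (box a b) (w - (1 / real (Suc k)) *\<^sub>R e) * q e' k w)"
        using integral_lborel_translate[of "\<lambda>w. indicator (box a b) (w - (1 / real (Suc k)) *\<^sub>R e) * q e' k w" "(1 / real (Suc k)) *\<^sub>R e"]
        by simp
      finally show ?thesis by simp
    qed
    show "(\<lambda>k. LINT w|lborel. indicator (box a b) (w - 0) * q (e + e') k w)
      \<longlonglongrightarrow> (LINT w|lborel. indicator (box a b) w * d e w) + (LINT w|lborel. indicator (box a b) w * d e' w)"
      unfolding eq by (intro tendsto_add lim c) simp
  qed
  then have "(LINT w|lborel. indicator (box a b) w * F w) = 0" for a b
    unfolding F_def right_diff_distrib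
    by (subst Bochner_Integration.integral_diff | intro Bochner_Integration.integrable_diff dint)+ simp
  moreover have "\<bar>F z\<bar> \<le> L * norm (e + e') + L * norm e + L * norm e'" for z
    using dbd[of "e + e'" z] dbd[of e z] dbd[of e' z] unfolding F_def by linarith
  ultimately have "AE z in lborel. F z = 0"
    by (intro AE_zero_if_box_integrals_zero) auto
  then show ?thesis using dAE[of e] dAE[of e'] dAE[of "e + e'"]
    by eventually_elim (simp add: F_def)
qed

section \<open>Total differentiability\<close>

lemma countable_rational_coordinates: "countable {x :: 'a::euclidean_space. \<forall>b\<in>Basis. x \<bullet> b \<in> \<rat>}"
proof -
  have "{x :: 'a. \<forall>b\<in>Basis. x \<bullet> b \<in> \<rat>} \<subseteq> (\<lambda>f. \<Sum>b\<in>Basis. f b *\<^sub>R b) ` (Basis \<rightarrow>\<^sub>E \<rat>)"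
  proof
    fix x :: 'a assume "x \<in> {x. \<forall>b\<in>Basis. x \<bullet> b \<in> \<rat>}"
    then have "restrict (\<lambda>b. x \<bullet> b) Basis \<in> Basis \<rightarrow>\<^sub>E \<rat>" by auto
    moreover have "x = (\<Sum>b\<in>Basis. restrict (\<lambda>b. x \<bullet> b) Basis b *\<^sub>R b)"
      by (simp add: euclidean_representation)
    ultimately show "x \<in> (\<lambda>f. \<Sum>b\<in>Basis. f b *\<^sub>R b) ` (Basis \<rightarrow>\<^sub>E \<rat>)" by blast
  qed
  then show ?thesis
    by (rule countable_subset) (intro countable_image countable_PiE finite_Basis countable_rat)
qed

lemma dense_rational_coordinates:
  assumes "\<epsilon> > 0"
  obtains q :: "'a::euclidean_space" where "\<forall>b\<in>Basis. q \<bullet> b \<in> \<rat>" "dist q x < \<epsilon>"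
proof -
  have "x \<in> closure (\<Union>f \<in> Basis \<rightarrow> \<rat>. { \<Sum>i :: 'a \<in> Basis. f i *\<^sub>R i })"
    unfolding closure_rational_coordinates by simp
  then obtain q where q: "q \<in> (\<Union>f \<in> Basis \<rightarrow> \<rat>. { \<Sum>i :: 'a \<in> Basis. f i *\<^sub>R i })" "dist q x < \<epsilon>"
    using assms unfolding closure_approachable by blast
  then have "\<forall>b\<in>Basis. q \<bullet> b \<in> \<rat>" by (auto simp: inner_sum_left inner_Basis if_distrib sum.delta' cong: if_cong)
  then show ?thesis using that q by blast
qed

text \<open>Almost everywhere the derivatives in all rational directions exist and are additive, as
  these are countably many conditions. Finitely many rational directions form a net of the unit
  sphere, and the Lipschitz condition carries the estimate, uniformly, from the net to all
  directions.\<close>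

theorem rademacher:
  fixes \<phi> :: "'a::euclidean_space \<Rightarrow> real"
  assumes lip: "L-lipschitz_on UNIV \<phi>"
  shows "AE z in lborel. \<exists>g. GDERIV \<phi> z :> g"
proof -
  define Q where "Q = {x :: 'a. \<forall>b\<in>Basis. x \<bullet> b \<in> \<rat>}"
  have L0: "L \<ge> 0" by (rule lipschitz_on_nonneg[OF lip])
  have cQ: "countable Q" unfolding Q_def by (rule countable_rational_coordinates)
  have 1: "AE z in lborel. \<forall>e\<in>Q. \<exists>D. has_dir_deriv \<phi> z e D"
    using cQ AE_dir_deriv[OF lip] by (subst AE_ball_countable) auto
  have 2: "AE z in lborel. \<forall>e\<in>Q. \<forall>e'\<in>Q. dir_deriv \<phi> (e + e') z = dir_deriv \<phi> e z + dir_deriv \<phi> e' z"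
    using cQ AE_dir_deriv_add[OF lip] by (subst AE_ball_countable, simp)+ auto
  from 1 2 show ?thesis
  proof eventually_elim
    fix z
    assume ex: "\<forall>e\<in>Q. \<exists>D. has_dir_deriv \<phi> z e D"
      and add: "\<forall>e\<in>Q. \<forall>e'\<in>Q. dir_deriv \<phi> (e + e') z = dir_deriv \<phi> e z + dir_deriv \<phi> e' z"
    define g where "g = (\<Sum>b\<in>Basis. dir_deriv \<phi> b z *\<^sub>R b)"
    have BQ: "b \<in> Q" if "b \<in> Basis" for b using that by (auto simp: Q_def inner_Basis)
    have dd: "has_dir_deriv \<phi> z e (dir_deriv \<phi> e z)" if "e \<in> Q" for e
      using ex that has_dir_deriv_imp_dir_deriv by blast
    \<comment> \<open>Additivity is available for rational directions only; all partial sums of the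
      expansion of \<open>e\<close> stay in \<open>Q\<close>.\<close>
    have part: "dir_deriv \<phi> (\<Sum>b\<in>B. (e \<bullet> b) *\<^sub>R b) z = (\<Sum>b\<in>B. (e \<bullet> b) * dir_deriv \<phi> b z)"
      if e: "e \<in> Q" and B: "finite B" "B \<subseteq> Basis" for e B
      using B
    proof (induction B)
      case empty
      then show ?case using has_dir_deriv_imp_dir_deriv[OF has_dir_deriv_0] by simp
    next
      case (insert b B)
      have q1: "(e \<bullet> b) *\<^sub>R b \<in> Q" using insert e by (auto simp: Q_def inner_Basis)
      have q2: "(\<Sum>b\<in>B. (e \<bullet> b) *\<^sub>R b) \<in> Q"
        using insert e by (auto simp: Q_def inner_sum_left inner_Basis intro!: Rats_sum)
      have "dir_deriv \<phi> ((e \<bullet> b) *\<^sub>R b) z = (e \<bullet> b) * dir_deriv \<phi> b z"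
        by (rule has_dir_deriv_imp_dir_deriv[OF has_dir_deriv_scaleR[OF dd[OF BQ]]]) (use insert in auto)
      then show ?case using insert add q1 q2 by auto
    qed
    have lin: "dir_deriv \<phi> e z = e \<bullet> g" if "e \<in> Q" for e
      using part[OF that finite_Basis subset_refl]
      by (simp add: euclidean_representation g_def inner_sum_right mult.commute)
    have "\<exists>d>0. \<forall>y. norm (y - z) < d \<longrightarrow> norm (\<phi> y - \<phi> z - (y - z) \<bullet> g) \<le> \<epsilon> * norm (y - z)" if "\<epsilon> > 0" for \<epsilon>
    proof -
      \<comment> \<open>Replacing a unit vector by a net point at distance below
        \<open>\<eta>\<close> changes the increment of \<open>\<phi>\<close> by at most
        \<open>t * \<eta> * L\<close> and the linear part by at most
        \<open>t * \<eta> * norm g\<close>; together this stays below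
        \<open>t * \<epsilon> / 2\<close>.\<close>
      define \<eta> where "\<eta> = \<epsilon> / (2 * (L + norm g + 1))"
      have pos: "L + norm g + 1 > 0" using L0 by (simp add: add_nonneg_pos)
      have \<eta>: "\<eta> > 0" using that pos by (simp add: \<eta>_def)
      have "sphere 0 1 \<subseteq> (\<Union>q\<in>Q. ball q \<eta>)"
      proof
        fix x :: 'a
        obtain q where "\<forall>b\<in>Basis. q \<bullet> b \<in> \<rat>" "dist q x < \<eta>" using dense_rational_coordinates[OF \<eta>] by blast
        then show "x \<in> (\<Union>q\<in>Q. ball q \<eta>)" by (auto simp: Q_def)
      qed
      then obtain C where C: "C \<subseteq> Q" "finite C" "sphere 0 1 \<subseteq> (\<Union>q\<in>C. ball q \<eta>)"
        using compactE_image[OF compact_sphere, of Q "\<lambda>q. ball q \<eta>"] by (metis open_ball)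
      have "\<exists>d>0. \<forall>h. h \<noteq> 0 \<and> \<bar>h\<bar> < d \<longrightarrow> \<bar>(\<phi> (z + h *\<^sub>R q) - \<phi> z) / h - q \<bullet> g\<bar> < \<epsilon> / 2" if "q \<in> C" for q
      proof -
        have "q \<in> Q" using that C by auto
        from dd[OF this] lin[OF this] have "((\<lambda>h. (\<phi> (z + h *\<^sub>R q) - \<phi> z) / h) \<longlongrightarrow> q \<bullet> g) (at 0)"
          unfolding has_dir_deriv_def by simp
        moreover have "\<epsilon> / 2 > 0" using \<open>\<epsilon> > 0\<close> by simp
        ultimately show ?thesis unfolding LIM_eq by (metis diff_zero real_norm_def)
      qed
      then obtain d where d: "\<And>q. q \<in> C \<Longrightarrow> d q > 0"
        "\<And>q h. q \<in> C \<Longrightarrow> h \<noteq> 0 \<Longrightarrow> \<bar>h\<bar> < d q \<Longrightarrow> \<bar>(\<phi> (z + h *\<^sub>R q) - \<phi> z) / h - q \<bullet> g\<bar> < \<epsilon> / 2"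
        by metis
      define \<delta> where "\<delta> = Min (insert 1 (d ` C))"
      have \<delta>: "\<delta> > 0" "\<And>q. q \<in> C \<Longrightarrow> \<delta> \<le> d q" using C d by (auto simp: \<delta>_def)
      show ?thesis
      proof (intro exI[of _ \<delta>] conjI allI impI \<delta>)
        fix y assume y: "norm (y - z) < \<delta>"
        show "norm (\<phi> y - \<phi> z - (y - z) \<bullet> g) \<le> \<epsilon> * norm (y - z)"
        proof (cases "y = z")
          case False
          define t where "t = norm (y - z)"
          define v where "v = (1 / t) *\<^sub>R (y - z)"
          have t: "t > 0" "y = z + t *\<^sub>R v" "norm v = 1" using False by (auto simp: t_def v_def)
          then have "v \<in> sphere 0 1" by simp
          then obtain q where q: "q \<in> C" "dist q v < \<eta>" using C by auto
          have "\<bar>(\<phi> (z + t *\<^sub>R q) - \<phi> z) / t - q \<bullet> g\<bar> < \<epsilon> / 2"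
          proof (rule d(2)[OF q(1)])
            show "t \<noteq> 0" using t(1) by simp
            show "\<bar>t\<bar> < d q" using t(1) y \<delta>(2)[OF q(1)] unfolding t_def by linarith
          qed
          then have "\<bar>\<phi> (z + t *\<^sub>R q) - \<phi> z - t * (q \<bullet> g)\<bar> \<le> t * (\<epsilon> / 2)"
            using t(1) by (simp add: abs_le_iff abs_less_iff field_simps)
          moreover have "\<bar>\<phi> y - \<phi> (z + t *\<^sub>R q)\<bar> \<le> L * (t * \<eta>)"
          proof -
            have "\<bar>\<phi> y - \<phi> (z + t *\<^sub>R q)\<bar> \<le> L * dist y (z + t *\<^sub>R q)"
              using lipschitz_onD[OF lip, of y "z + t *\<^sub>R q"] by (simp add: dist_real_def)
            also have "dist y (z + t *\<^sub>R q) = t * dist q v"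
              unfolding t(2) using t(1) by (simp add: dist_norm scaleR_diff_right[symmetric] norm_minus_commute)
            finally show ?thesis using q L0 t(1) by (smt (verit) mult_left_mono)
          qed
          moreover have "\<bar>t * (q \<bullet> g) - (y - z) \<bullet> g\<bar> \<le> t * \<eta> * norm g"
          proof -
            have "t * (q \<bullet> g) - (y - z) \<bullet> g = t * ((q - v) \<bullet> g)"
              unfolding t(2) by (simp add: inner_diff_left right_diff_distrib)
            moreover have "\<bar>(q - v) \<bullet> g\<bar> \<le> norm (q - v) * norm g" by (rule Cauchy_Schwarz_ineq2)
            moreover have "norm (q - v) * norm g \<le> \<eta> * norm g"
              using q(2) by (intro mult_right_mono) (auto simp: dist_norm)
            ultimately show ?thesis using t(1) by (simp add: abs_mult mult.assoc)
          qed
          ultimately have "\<bar>\<phi> y - \<phi> z - (y - z) \<bullet> g\<bar> \<le> L * (t * \<eta>) + t * (\<epsilon> / 2) + t * \<eta> * norm g"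
            by linarith
          also have "\<dots> = t * (\<epsilon> / 2) + t * (\<eta> * (L + norm g))" by (simp add: algebra_simps)
          also have "\<eta> * (L + norm g) \<le> \<epsilon> / 2"
            using pos \<open>\<epsilon> > 0\<close> L0 by (simp add: \<eta>_def field_simps)
          finally have "\<bar>\<phi> y - \<phi> z - (y - z) \<bullet> g\<bar> \<le> t * (\<epsilon> / 2) + t * (\<epsilon> / 2)"
            using t(1) by (smt (verit) mult_left_mono)
          then show ?thesis by (simp add: t_def mult.commute)
        qed simp
      qed
    qed
    then have "(\<phi> has_derivative (\<lambda>h. h \<bullet> g)) (at z)"
      unfolding has_derivative_at_alt by (auto intro: bounded_linear_inner_left)
    then show "\<exists>g. GDERIV \<phi> z :> g" unfolding gderiv_def by blast
  qed
qed

section \<open>The gradient and its measurability\<close>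

lemma GDERIV_imp_has_dir_deriv:
  assumes "GDERIV \<phi> z :> g"
  shows "has_dir_deriv \<phi> z e (e \<bullet> g)"
proof -
  have "((\<lambda>h. \<phi> (z + h *\<^sub>R e)) has_derivative (\<lambda>h. (h *\<^sub>R e) \<bullet> g)) (at 0)"
    by (rule has_derivative_compose[of "\<lambda>h. z + h *\<^sub>R e" "\<lambda>h. h *\<^sub>R e" 0 UNIV \<phi> "\<lambda>h. h \<bullet> g"])
       (use assms in \<open>auto simp: gderiv_def intro!: derivative_eq_intros\<close>)
  then have "((\<lambda>h. \<phi> (z + h *\<^sub>R e)) has_real_derivative e \<bullet> g) (at 0)"
    by (simp add: has_field_derivative_def mult_commute_abs)
  then show ?thesis by (simp add: DERIV_def has_dir_deriv_def)
qed

text \<open>Besides uniqueness, this expresses the gradient by Borel functions that are defined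
  everywhere, which removes the quantifier over \<open>g\<close> in
  \<open>differentiable_set_measurable\<close>.\<close>

lemma GDERIV_dir_deriv:
  assumes "GDERIV \<phi> z :> g"
  shows "g = (\<Sum>b\<in>Basis. dir_deriv \<phi> b z *\<^sub>R b)"
proof -
  have "dir_deriv \<phi> b z = g \<bullet> b" for b
    using has_dir_deriv_imp_dir_deriv[OF GDERIV_imp_has_dir_deriv[OF assms, of b]] by (simp add: inner_commute)
  then show ?thesis by (simp add: euclidean_representation)
qed

lemma gradient_eq: "GDERIV \<phi> z :> g \<Longrightarrow> gradient \<phi> z = g"
proof -
  assume g: "GDERIV \<phi> z :> g"
  have "(THE g. GDERIV \<phi> z :> g) = g"
  proof (rule the_equality)
    show "GDERIV \<phi> z :> g" by (rule g)
    fix g' assume "GDERIV \<phi> z :> g'"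
    then show "g' = g" by (rule trans[OF GDERIV_dir_deriv GDERIV_dir_deriv[OF g, symmetric]])
  qed
  then show ?thesis using g unfolding gradient_def by auto
qed

lemma GDERIV_alt:
  "GDERIV \<phi> z :> g \<longleftrightarrow> (\<forall>e>0. \<exists>d>0. \<forall>v. norm v < d \<longrightarrow> \<bar>\<phi> (z + v) - \<phi> z - v \<bullet> g\<bar> \<le> e * norm v)"
proof -
  have "(\<forall>y. norm (y - z) < d \<longrightarrow> norm (\<phi> y - \<phi> z - (y - z) \<bullet> g) \<le> e * norm (y - z))
      \<longleftrightarrow> (\<forall>v. norm v < d \<longrightarrow> \<bar>\<phi> (z + v) - \<phi> z - v \<bullet> g\<bar> \<le> e * norm v)" (is "?A \<longleftrightarrow> ?B") for d e
  proof
    assume A: ?A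
    show ?B
    proof (intro allI impI)
      fix v show "norm v < d \<Longrightarrow> \<bar>\<phi> (z + v) - \<phi> z - v \<bullet> g\<bar> \<le> e * norm v"
        using A[rule_format, of "z + v"] by simp
    qed
  next
    assume B: ?B
    show ?A
    proof (intro allI impI)
      fix y show "norm (y - z) < d \<Longrightarrow> norm (\<phi> y - \<phi> z - (y - z) \<bullet> g) \<le> e * norm (y - z)"
        using B[rule_format, of "y - z"] by simp
    qed
  qed
  then show ?thesis unfolding gderiv_def has_derivative_at_alt by (simp only: bounded_linear_inner_left simp_thms)
qed

text \<open>For a given precision the inequality is closed in \<open>v\<close>, so it may be tested
  on a dense set. With a countable one, differentiability becomes a countable combination of Borel
  conditions.\<close>

lemma GDERIV_dense:
  fixes \<phi> :: "'a::euclidean_space \<Rightarrow> real"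
  assumes cont: "continuous_on UNIV \<phi>" and Q: "closure Q = UNIV"
  shows "GDERIV \<phi> z :> g \<longleftrightarrow> (\<forall>k::nat. \<exists>m::nat. \<forall>v\<in>Q. norm v < 1 / real (Suc m) \<longrightarrow> \<bar>\<phi> (z + v) - \<phi> z - v \<bullet> g\<bar> \<le> 1 / real (Suc k) * norm v)"
    (is "_ \<longleftrightarrow> ?R")
proof
  assume G: "GDERIV \<phi> z :> g"
  show ?R
  proof
    fix k
    have "1 / real (Suc k) > 0" by simp
    then obtain d where d: "d > 0" "\<And>v. norm v < d \<Longrightarrow> \<bar>\<phi> (z + v) - \<phi> z - v \<bullet> g\<bar> \<le> 1 / real (Suc k) * norm v"
      using G unfolding GDERIV_alt by blast
    obtain m where "1 / real (Suc m) < d" using d(1) nat_approx_posE by blast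
    then show "\<exists>m. \<forall>v\<in>Q. norm v < 1 / real (Suc m) \<longrightarrow> \<bar>\<phi> (z + v) - \<phi> z - v \<bullet> g\<bar> \<le> 1 / real (Suc k) * norm v"
      by (intro exI[of _ m] ballI impI d(2)) linarith
  qed
next
  assume R: ?R
  show "GDERIV \<phi> z :> g" unfolding GDERIV_alt
  proof (intro allI impI)
    fix e :: real assume "e > 0"
    then obtain k where k: "1 / real (Suc k) < e" using nat_approx_posE by blast
    obtain m where m: "\<And>v. v \<in> Q \<Longrightarrow> norm v < 1 / real (Suc m) \<Longrightarrow> \<bar>\<phi> (z + v) - \<phi> z - v \<bullet> g\<bar> \<le> 1 / real (Suc k) * norm v"
      using R by meson
    show "\<exists>d>0. \<forall>v. norm v < d \<longrightarrow> \<bar>\<phi> (z + v) - \<phi> z - v \<bullet> g\<bar> \<le> e * norm v"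
    proof (intro exI[of _ "1 / real (Suc m)"] conjI allI impI)
      fix v :: 'a assume v: "norm v < 1 / real (Suc m)"
      let ?C = "{v. \<bar>\<phi> (z + v) - \<phi> z - v \<bullet> g\<bar> \<le> 1 / real (Suc k) * norm v}"
      have "closed ?C"
        by (intro closed_Collect_le continuous_intros continuous_on_compose2[OF cont]) auto
      moreover have "ball 0 (1 / real (Suc m)) \<inter> Q \<subseteq> ?C" using m by auto
      ultimately have "closure (ball 0 (1 / real (Suc m)) \<inter> Q) \<subseteq> ?C" by (intro closure_minimal)
      moreover have "v \<in> closure (ball 0 (1 / real (Suc m)) \<inter> Q)"
        using open_Int_closure_subset[of "ball 0 (1 / real (Suc m))" Q] v Q by auto
      ultimately have "\<bar>\<phi> (z + v) - \<phi> z - v \<bullet> g\<bar> \<le> 1 / real (Suc k) * norm v" by auto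
      also have "\<dots> \<le> e * norm v" using k by (intro mult_right_mono) auto
      finally show "\<bar>\<phi> (z + v) - \<phi> z - v \<bullet> g\<bar> \<le> e * norm v" .
    qed simp
  qed
qed

lemma differentiable_set_measurable:
  fixes \<phi> :: "'a::euclidean_space \<Rightarrow> real"
  assumes cont: "continuous_on UNIV \<phi>"
  shows "{z. \<exists>g. GDERIV \<phi> z :> g} \<in> sets borel"
proof -
  have [measurable]: "\<phi> \<in> borel_measurable borel" using cont by (rule borel_measurable_continuous_onI)
  have [measurable]: "dir_deriv \<phi> u \<in> borel_measurable borel" for u by (rule dir_deriv_measurable[OF cont])
  obtain Q :: "'a set" where Q: "countable Q" "closure Q = UNIV"
  proof (rule that)
    show "countable {x :: 'a. \<forall>b\<in>Basis. x \<bullet> b \<in> \<rat>}" by (rule countable_rational_coordinates)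
    show "closure {x :: 'a. \<forall>b\<in>Basis. x \<bullet> b \<in> \<rat>} = UNIV"
    proof (rule UNIV_eq_I[symmetric])
      show "x \<in> closure {x :: 'a. \<forall>b\<in>Basis. x \<bullet> b \<in> \<rat>}" for x
        unfolding closure_approachable by (auto intro: dense_rational_coordinates[of _ x])
    qed
  qed
  define G where "G z = (\<Sum>b\<in>Basis. dir_deriv \<phi> b z *\<^sub>R b)" for z
  have [measurable]: "G \<in> borel_measurable borel" unfolding G_def by measurable
  define B where "B k m = (\<Inter>v\<in>Q \<inter> ball 0 (1 / real (Suc m)). {z. \<bar>\<phi> (z + v) - \<phi> z - v \<bullet> G z\<bar> \<le> 1 / real (Suc k) * norm v})" for k m :: nat
  have [measurable]: "B k m \<in> sets borel" for k m
  proof -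
    have "{z. \<bar>\<phi> (z + v) - \<phi> z - v \<bullet> G z\<bar> \<le> 1 / real (Suc k) * norm v} \<in> sets borel" for v
      by measurable
    moreover have "countable (Q \<inter> ball 0 (1 / real (Suc m)))" using Q(1) by blast
    ultimately show ?thesis unfolding B_def by (intro sets.countable_INT'') auto
  qed
  have "{z. \<exists>g. GDERIV \<phi> z :> g} = {z. GDERIV \<phi> z :> G z}"
    unfolding G_def using GDERIV_dir_deriv by blast
  also have "\<dots> = (\<Inter>k::nat. \<Union>m::nat. B k m)"
    unfolding GDERIV_dense[OF cont Q(2)] B_def by (rule set_eqI, unfold INT_iff UN_iff mem_Collect_eq, simp only: Ball_def Bex_def UNIV_I Int_iff mem_ball_0 imp_conjL simp_thms)
  also have "\<dots> \<in> sets borel"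
    by (intro sets.countable_INT'' sets.countable_UN') auto
  finally show ?thesis .
qed

lemma gradient_measurable:
  fixes \<phi> :: "'a::euclidean_space \<Rightarrow> real"
  assumes cont: "continuous_on UNIV \<phi>"
  shows "gradient \<phi> \<in> borel_measurable borel"
proof -
  have [measurable]: "dir_deriv \<phi> u \<in> borel_measurable borel" for u by (rule dir_deriv_measurable[OF cont])
  have [measurable]: "{z. \<exists>g. GDERIV \<phi> z :> g} \<in> sets borel" by (rule differentiable_set_measurable[OF cont])
  have "gradient \<phi> = (\<lambda>z. indicator {z. \<exists>g. GDERIV \<phi> z :> g} z *\<^sub>R (\<Sum>b\<in>Basis. dir_deriv \<phi> b z *\<^sub>R b))"
  proof
    fix z
    show "gradient \<phi> z = indicator {z. \<exists>g. GDERIV \<phi> z :> g} z *\<^sub>R (\<Sum>b\<in>Basis. dir_deriv \<phi> b z *\<^sub>R b)"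
    proof (cases "\<exists>g. GDERIV \<phi> z :> g")
      case True
      then obtain g where g: "GDERIV \<phi> z :> g" by blast
      then have "indicator {z. \<exists>g. GDERIV \<phi> z :> g} z = (1::real)" by (auto simp: indicator_def)
      then show ?thesis using gradient_eq[OF g] GDERIV_dir_deriv[OF g] by simp
    qed (auto simp: gradient_def)
  qed
  also have "\<dots> \<in> borel_measurable borel" by measurable
  finally show ?thesis .
qed

lemma GDERIV_lipschitz_bound:
  fixes \<phi> :: "'a::euclidean_space \<Rightarrow> real"
  assumes "L-lipschitz_on UNIV \<phi>" "GDERIV \<phi> z :> g"
  shows "norm g \<le> L"
proof -
  have "norm g * norm g \<le> L * norm g"
    using has_dir_deriv_bound[OF assms(1) GDERIV_imp_has_dir_deriv[OF assms(2), of g]]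
    by (simp add: dot_square_norm power2_eq_square)
  then show ?thesis using lipschitz_on_nonneg[OF assms(1)] by (cases "norm g = 0") auto
qed

lemma norm_gradient_le:
  fixes \<phi> :: "'a::euclidean_space \<Rightarrow> real"
  assumes "L-lipschitz_on UNIV \<phi>"
  shows "norm (gradient \<phi> z) \<le> L"
  using GDERIV_lipschitz_bound[OF assms] gradient_eq[of \<phi> z] lipschitz_on_nonneg[OF assms]
  by (cases "\<exists>g. GDERIV \<phi> z :> g") (auto simp: gradient_def)

section \<open>Graphs of Lipschitz functions\<close>

definition graph_function :: "real \<Rightarrow> 'a::euclidean_space \<Rightarrow> ('a \<Rightarrow> real) \<Rightarrow> bool" where
  "graph_function L \<nu> \<phi> \<longleftrightarrow> norm \<nu> = 1 \<and> L-lipschitz_on UNIV \<phi> \<and> (\<forall>z t. \<phi> (z + t *\<^sub>R \<nu>) = \<phi> z)"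

definition graph_point :: "'a::euclidean_space \<Rightarrow> ('a \<Rightarrow> real) \<Rightarrow> 'a \<Rightarrow> 'a" where
  "graph_point \<nu> \<phi> z = z + (\<phi> z - z \<bullet> \<nu>) *\<^sub>R \<nu>"

context
  fixes L :: real and \<nu> :: "'a::euclidean_space" and \<phi> :: "'a \<Rightarrow> real"
  assumes gf: "graph_function L \<nu> \<phi>"
begin

lemma graph_direction_unit: "norm \<nu> = 1" "\<nu> \<bullet> \<nu> = 1"
  using gf by (auto simp: graph_function_def dot_square_norm)

lemma graph_function_lipschitz: "L-lipschitz_on UNIV \<phi>" using gf by (simp add: graph_function_def)

lemma graph_function_bound_nonneg: "L \<ge> 0" by (rule lipschitz_on_nonneg[OF graph_function_lipschitz])

lemma graph_function_vertical [simp]: "\<phi> (z + t *\<^sub>R \<nu>) = \<phi> z" using gf by (simp add: graph_function_def)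

lemma graph_function_vertical_diff [simp]: "\<phi> (z - t *\<^sub>R \<nu>) = \<phi> z" using graph_function_vertical[of z "-t"] by simp

lemma cont_graph_function: "continuous_on UNIV \<phi>" by (rule lipschitz_on_continuous_on[OF graph_function_lipschitz])

lemma graph_function_measurable [measurable]: "\<phi> \<in> borel_measurable borel"
  by (rule borel_measurable_continuous_onI[OF cont_graph_function])

lemma graph_point_continuous: "continuous_on UNIV (graph_point \<nu> \<phi>)"
  unfolding graph_point_def[abs_def] by (intro continuous_intros cont_graph_function)

lemma graph_point_measurable [measurable]: "graph_point \<nu> \<phi> \<in> borel_measurable borel"
  by (rule borel_measurable_continuous_onI[OF graph_point_continuous])

lemma gradient_measurable' [measurable]: "gradient \<phi> \<in> borel_measurable borel"
  by (rule gradient_measurable[OF cont_graph_function])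

lemma phi_graph_point [simp]: "\<phi> (graph_point \<nu> \<phi> z) = \<phi> z"
  by (simp add: graph_point_def)

lemma height_graph_point [simp]: "graph_point \<nu> \<phi> z \<bullet> \<nu> = \<phi> z"
  by (simp add: graph_point_def inner_add_left graph_direction_unit)

lemma GDERIV_vertical: "GDERIV \<phi> (z + t *\<^sub>R \<nu>) :> g \<longleftrightarrow> GDERIV \<phi> z :> g"
proof -
  have "\<phi> (z + t *\<^sub>R \<nu> + v) = \<phi> (z + v)" for v
    using graph_function_vertical[of "z + v" t] by (simp add: algebra_simps)
  then show ?thesis unfolding GDERIV_alt by simp
qed

lemma gradient_vertical: "gradient \<phi> (z + t *\<^sub>R \<nu>) = gradient \<phi> z"
  proof -
  have "gderiv \<phi> (z + t *\<^sub>R \<nu>) = gderiv \<phi> z" by (rule ext) (rule GDERIV_vertical)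
  then show ?thesis by (simp add: gradient_def)
qed

lemma GDERIV_graph_point: "GDERIV \<phi> (graph_point \<nu> \<phi> z) :> g \<longleftrightarrow> GDERIV \<phi> z :> g"
  by (simp add: graph_point_def GDERIV_vertical)

lemma gradient_graph_point: "gradient \<phi> (graph_point \<nu> \<phi> z) = gradient \<phi> z"
  by (simp add: graph_point_def gradient_vertical)

lemma GDERIV_orthogonal:
  assumes "GDERIV \<phi> z :> g" shows "\<nu> \<bullet> g = 0"
proof -
  have "has_dir_deriv \<phi> z \<nu> 0" unfolding has_dir_deriv_def by simp
  then show ?thesis using has_dir_deriv_unique[OF GDERIV_imp_has_dir_deriv[OF assms]] by blast
qed

text \<open>Both heights are controlled: that of \<open>z\<close> by the slab, that of the graph
  point by its norm. Hence only a bounded part of the slab lies over a bounded part of the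
  graph.\<close>

lemma slab_norm_bound:
  assumes "z \<in> unit_slab \<nu>" shows "norm z \<le> 2 * norm (graph_point \<nu> \<phi> z) + 1"
proof -
  have "\<bar>\<phi> z\<bar> \<le> norm (graph_point \<nu> \<phi> z)"
    using Cauchy_Schwarz_ineq2[of "graph_point \<nu> \<phi> z" \<nu>] graph_direction_unit by simp
  moreover have "norm z \<le> norm (graph_point \<nu> \<phi> z) + \<bar>\<phi> z - z \<bullet> \<nu>\<bar>"
    using norm_triangle_ineq4[of "graph_point \<nu> \<phi> z" "(\<phi> z - z \<bullet> \<nu>) *\<^sub>R \<nu>"] graph_direction_unit by (simp add: graph_point_def)
  moreover have "0 \<le> z \<bullet> \<nu>" "z \<bullet> \<nu> < 1" using assms by (auto simp: unit_slab_def)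
  ultimately show ?thesis by linarith
qed

text \<open>For fixed \<open>z\<close> the parameter runs through the line
  \<open>z + t \<nu>\<close>, with its origin moved from \<open>z\<close> to the graph. This is a
  translation in \<open>t\<close>, so it preserves length.\<close>

lemma distr_slab_coordinates:
  "distr (density lborel (indicator (unit_slab \<nu>)) \<Otimes>\<^sub>M (lborel :: real measure)) borel (\<lambda>(z, t). graph_point \<nu> \<phi> z + t *\<^sub>R \<nu>) = lborel"
proof (rule measure_eqI)
  let ?P = "density lborel (indicator (unit_slab \<nu>)) :: 'a measure"
  fix A assume "A \<in> sets (distr (?P \<Otimes>\<^sub>M lborel) borel (\<lambda>(z, t::real). graph_point \<nu> \<phi> z + t *\<^sub>R \<nu>))"
  then have [measurable]: "A \<in> sets borel" by simp
  have "emeasure (distr (?P \<Otimes>\<^sub>M lborel) borel (\<lambda>(z, t). graph_point \<nu> \<phi> z + t *\<^sub>R \<nu>)) A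
    = (\<integral>\<^sup>+x. indicator A ((\<lambda>(z, t). graph_point \<nu> \<phi> z + t *\<^sub>R \<nu>) x) \<partial>(?P \<Otimes>\<^sub>M lborel))"
    by (subst nn_integral_indicator[symmetric], simp, subst nn_integral_distr) simp_all
  also have "\<dots> = (\<integral>\<^sup>+z. \<integral>\<^sup>+t. indicator A (graph_point \<nu> \<phi> z + t *\<^sub>R \<nu>) \<partial>lborel \<partial>?P)"
    by (subst sigma_finite_measure.nn_integral_fst[OF sigma_finite_lborel, symmetric]) simp_all
  also have "\<dots> = (\<integral>\<^sup>+z. indicator (unit_slab \<nu>) z * (\<integral>\<^sup>+t. indicator A (graph_point \<nu> \<phi> z + t *\<^sub>R \<nu>) \<partial>lborel) \<partial>lborel)"
    by (subst nn_integral_density) simp_all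
  also have "\<dots> = (\<integral>\<^sup>+z. indicator (unit_slab \<nu>) z * (\<integral>\<^sup>+t. indicator A (z + t *\<^sub>R \<nu>) \<partial>lborel) \<partial>lborel)"
  proof (rule nn_integral_cong)
    fix z :: 'a
    have "(\<integral>\<^sup>+t. indicator A (graph_point \<nu> \<phi> z + t *\<^sub>R \<nu>) \<partial>lborel) = (\<integral>\<^sup>+t. indicator A (z + t *\<^sub>R \<nu>) \<partial>lborel)"
      using nn_integral_lborel_translate[of "\<lambda>t. indicator A (z + t *\<^sub>R \<nu>)" "\<phi> z - z \<bullet> \<nu>"]
      by (simp add: graph_point_def algebra_simps)
    then show "indicator (unit_slab \<nu>) z * (\<integral>\<^sup>+t. indicator A (graph_point \<nu> \<phi> z + t *\<^sub>R \<nu>) \<partial>lborel)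
      = indicator (unit_slab \<nu>) z * (\<integral>\<^sup>+t. indicator A (z + t *\<^sub>R \<nu>) \<partial>lborel)" by simp
  qed
  also have "\<dots> = (\<integral>\<^sup>+z. indicator A z \<partial>lborel)"
    by (rule nn_integral_unit_slab[symmetric]) (auto simp: graph_direction_unit)
  finally show "emeasure (distr (?P \<Otimes>\<^sub>M lborel) borel (\<lambda>(z, t). graph_point \<nu> \<phi> z + t *\<^sub>R \<nu>)) A = emeasure lborel A"
    by simp
qed simp

lemma integral_slab_coordinates:
  fixes g :: "'a \<Rightarrow> real"
  assumes g: "integrable lborel g"
  shows "(LINT x|lborel. g x) = (LINT z|lborel. indicator (unit_slab \<nu>) z * (LINT t|lborel. g (graph_point \<nu> \<phi> z + t *\<^sub>R \<nu>)))"
    "integrable lborel (\<lambda>z. indicator (unit_slab \<nu>) z * (LINT t|lborel. g (graph_point \<nu> \<phi> z + t *\<^sub>R \<nu>)))"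
proof -
  let ?P = "density lborel (indicator (unit_slab \<nu>)) :: 'a measure"
  have Peq: "?P = density lborel (\<lambda>x. ennreal (indicator (unit_slab \<nu>) x))"
    by (simp add: ennreal_indicator)
  have sfP: "sigma_finite_measure ?P"
    unfolding Peq by (subst sigma_finite_measure.sigma_finite_iff_density_finite[OF sigma_finite_lborel]) auto
  interpret P: sigma_finite_measure ?P by (rule sfP)
  interpret PL: pair_sigma_finite ?P "lborel :: real measure" ..
  have [measurable]: "g \<in> borel_measurable borel" using g by auto
  have i: "integrable (?P \<Otimes>\<^sub>M lborel) (\<lambda>x. g ((\<lambda>(z, t). graph_point \<nu> \<phi> z + t *\<^sub>R \<nu>) x))"
    using g by (subst integrable_distr_eq[symmetric, where N=borel]) (auto simp: distr_slab_coordinates)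
  have "(LINT x|lborel. g x) = (LINT x|(?P \<Otimes>\<^sub>M lborel). g ((\<lambda>(z, t). graph_point \<nu> \<phi> z + t *\<^sub>R \<nu>) x))"
    by (subst distr_slab_coordinates[symmetric], subst integral_distr) auto
  also have "\<dots> = (LINT z|?P. LINT t|lborel. g (graph_point \<nu> \<phi> z + t *\<^sub>R \<nu>))"
    using PL.integral_fst'[OF i] by simp
  also have "\<dots> = (LINT z|lborel. indicator (unit_slab \<nu>) z * (LINT t|lborel. g (graph_point \<nu> \<phi> z + t *\<^sub>R \<nu>)))"
    unfolding Peq by (subst integral_density) auto
  finally show "(LINT x|lborel. g x) = (LINT z|lborel. indicator (unit_slab \<nu>) z * (LINT t|lborel. g (graph_point \<nu> \<phi> z + t *\<^sub>R \<nu>)))" .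
  have "integrable ?P (\<lambda>z. LINT t|lborel. g (graph_point \<nu> \<phi> z + t *\<^sub>R \<nu>))"
    using PL.integrable_fst'[OF i] by simp
  then show "integrable lborel (\<lambda>z. indicator (unit_slab \<nu>) z * (LINT t|lborel. g (graph_point \<nu> \<phi> z + t *\<^sub>R \<nu>)))"
    unfolding Peq by (subst (asm) integrable_density) auto
qed


section \<open>Integrals over thin layers around a graph\<close>

text \<open>The common limit argument for the flux and for the tube volume. \<open>k n\<close> lives
  within vertical distance of order \<open>h n\<close> of the graph, so in the integral along a
  vertical line \<open>G\<close> can be replaced by its value at the graph point; what remains is
  the limit \<open>\<rho>\<close> in one variable.\<close>

lemma slab_limit:
  fixes G :: "'a \<Rightarrow> real" and k :: "nat \<Rightarrow> 'a \<Rightarrow> real" and h :: "nat \<Rightarrow> real"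
  assumes G: "continuous_on UNIV G" "\<And>x. R < norm x \<Longrightarrow> G x = 0"
    and k [measurable]: "\<And>n. k n \<in> borel_measurable borel"
    and k1: "\<And>n x. \<bar>k n x\<bar> \<le> 1"
    and supp: "\<And>n z t. k n (graph_point \<nu> \<phi> z + t *\<^sub>R \<nu>) \<noteq> 0 \<Longrightarrow> \<bar>t\<bar> \<le> C * h n"
    and h: "\<And>n. h n > 0" "h \<longlonglongrightarrow> 0"
    and \<rho> [measurable]: "\<rho> \<in> borel_measurable borel"
    and lim: "AE z in lborel. (\<lambda>n. (1 / h n) * (LINT t|lborel. k n (graph_point \<nu> \<phi> z + t *\<^sub>R \<nu>))) \<longlonglongrightarrow> \<rho> z"
  shows "(\<lambda>n. (1 / h n) * (LINT x|lborel. k n x * G x))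
     \<longlonglongrightarrow> (LINT z|lborel. indicator (unit_slab \<nu>) z * (G (graph_point \<nu> \<phi> z) * \<rho> z))"
proof -
  define C' where "C' = \<bar>C\<bar>"
  have C': "C' \<ge> 0" "\<And>n z t. k n (graph_point \<nu> \<phi> z + t *\<^sub>R \<nu>) \<noteq> 0 \<Longrightarrow> \<bar>t\<bar> \<le> C' * h n"
  proof -
    show "C' \<ge> 0" by (simp add: C'_def)
    fix n z t assume "k n (graph_point \<nu> \<phi> z + t *\<^sub>R \<nu>) \<noteq> 0"
    then have "\<bar>t\<bar> \<le> C * h n" by (rule supp)
    also have "\<dots> \<le> C' * h n" unfolding C'_def using h(1)[of n] by (intro mult_right_mono) auto
    finally show "\<bar>t\<bar> \<le> C' * h n" .
  qed
  have [measurable]: "G \<in> borel_measurable borel" by (rule borel_measurable_continuous_onI[OF G(1)])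
  obtain M where M: "M \<ge> 0" "\<And>x. \<bar>G x\<bar> \<le> M"
  proof -
    have "compact (G ` cball 0 R)"
      by (intro compact_continuous_image continuous_on_subset[OF G(1)] compact_cball) auto
    then obtain B where B: "\<And>x. x \<in> cball 0 R \<Longrightarrow> \<bar>G x\<bar> \<le> B"
      using compact_imp_bounded bounded_iff by (metis imageI real_norm_def)
    have "\<bar>G x\<bar> \<le> \<bar>B\<bar>" for x
    proof (cases "norm x \<le> R")
      case True then show ?thesis using B[of x] by auto
    next
      case False then show ?thesis using G(2)[of x] by auto
    qed
    then show thesis using that[of "\<bar>B\<bar>"] by auto
  qed
  obtain H where H: "\<And>n. h n \<le> H"
    using convergent_imp_Bseq[OF convergentI[OF h(2)]] h(1) by (metis BseqE abs_of_pos real_norm_def)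
  have kint: "integrable lborel (\<lambda>t. k n (graph_point \<nu> \<phi> z + t *\<^sub>R \<nu>) * u t)"
    and kbd: "\<bar>LINT t|lborel. k n (graph_point \<nu> \<phi> z + t *\<^sub>R \<nu>) * u t\<bar> \<le> 2 * C' * h n * B"
    if [measurable]: "u \<in> borel_measurable borel" and u: "\<And>t. \<bar>t\<bar> \<le> C' * h n \<Longrightarrow> \<bar>u t\<bar> \<le> B" and B: "B \<ge> 0" for n z u B
  proof -
    let ?I = "{-(C' * h n)..C' * h n}"
    have i: "integrable lborel (\<lambda>t. indicator ?I t * B)"
      using emeasure_bounded_finite[of ?I]
      by (intro Bochner_Integration.integrable_mult_left) (auto simp: integrable_indicator_iff)
    have le: "\<bar>k n (graph_point \<nu> \<phi> z + t *\<^sub>R \<nu>) * u t\<bar> \<le> indicator ?I t * B" for t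
    proof (cases "k n (graph_point \<nu> \<phi> z + t *\<^sub>R \<nu>) = 0")
      case False
      then have t: "\<bar>t\<bar> \<le> C' * h n" by (rule C'(2))
      have "\<bar>k n (graph_point \<nu> \<phi> z + t *\<^sub>R \<nu>)\<bar> * \<bar>u t\<bar> \<le> 1 * B"
        by (rule mult_mono[OF k1 u[OF t]]) auto
      then show ?thesis using t by (auto simp: abs_mult abs_le_iff indicator_def)
    qed (use B in auto)
    show kint: "integrable lborel (\<lambda>t. k n (graph_point \<nu> \<phi> z + t *\<^sub>R \<nu>) * u t)"
      by (rule Bochner_Integration.integrable_bound[OF i]) (use le B in \<open>auto intro!: AE_I2 simp: abs_mult\<close>)
    have "\<bar>LINT t|lborel. k n (graph_point \<nu> \<phi> z + t *\<^sub>R \<nu>) * u t\<bar> \<le> (LINT t|lborel. \<bar>k n (graph_point \<nu> \<phi> z + t *\<^sub>R \<nu>) * u t\<bar>)"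
      by (rule integral_abs_bound)
    also have "\<dots> \<le> (LINT t|lborel. indicator ?I t * B)"
      using kint le by (intro integral_mono i) auto
    also have "\<dots> = 2 * C' * h n * B"
      using C'(1) h(1)[of n] by (simp add: less_imp_le)
    finally show "\<bar>LINT t|lborel. k n (graph_point \<nu> \<phi> z + t *\<^sub>R \<nu>) * u t\<bar> \<le> 2 * C' * h n * B" .
  qed
  let ?s = "\<lambda>n z. (1 / h n) * (LINT t|lborel. k n (graph_point \<nu> \<phi> z + t *\<^sub>R \<nu>) * G (graph_point \<nu> \<phi> z + t *\<^sub>R \<nu>))"
  \<comment> \<open>The bound of \<open>slab_norm_bound\<close> for graph points of norm at most
    \<open>R + C' * H\<close>; over all other points of the slab the integrand vanishes for every
    \<open>n\<close>.\<close>
  define B0 where "B0 = 2 * (R + C' * H) + 1"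
  have eq: "(1 / h n) * (LINT x|lborel. k n x * G x) = (LINT z|lborel. indicator (unit_slab \<nu>) z * ?s n z)" for n
  proof -
    have "integrable lborel (\<lambda>x. k n x * G x)"
    proof (rule Bochner_Integration.integrable_bound)
      show "integrable lborel (\<lambda>x::'a. indicator (cball 0 R) x * M)"
        using emeasure_lborel_cball_finite[of "0::'a" R]
        by (intro Bochner_Integration.integrable_mult_left) (auto simp: integrable_indicator_iff)
      have "\<bar>k n x * G x\<bar> \<le> indicator (cball 0 R) x * M" for x
      proof (cases "norm x \<le> R")
        case True
        have "\<bar>k n x\<bar> * \<bar>G x\<bar> \<le> 1 * M" by (rule mult_mono[OF k1 M(2)]) auto
        then show ?thesis using True by (auto simp: abs_mult)
      next
        case False then show ?thesis using G(2)[of x] M by auto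
      qed
      then show "AE x in lborel. norm (k n x * G x) \<le> norm (indicator (cball 0 R) x * M)"
        using M(1) by (intro AE_I2) auto
    qed measurable
    from integral_slab_coordinates(1)[OF this] show ?thesis
      by (simp add: mult.left_commute)
  qed
  show ?thesis unfolding eq
  proof (rule integral_dominated_convergence[where w="\<lambda>z. indicator (cball 0 B0) z * (2 * C' * M)"])
    show "integrable lborel (\<lambda>z::'a. indicator (cball 0 B0) z * (2 * C' * M))"
      using emeasure_lborel_cball_finite[of "0::'a" B0]
      by (intro Bochner_Integration.integrable_mult_left) (auto simp: integrable_indicator_iff)
    have bd: "\<bar>?s n z\<bar> \<le> 2 * C' * M" for n z
    proof -
      have "\<bar>?s n z\<bar> \<le> (1 / h n) * (2 * C' * h n * M)"
        unfolding abs_mult using h(1)[of n] M C'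
        by (intro mult_mono kbd) auto
      then show ?thesis using h(1)[of n] by simp
    qed
    have zero: "?s n z = 0" if "z \<in> unit_slab \<nu>" "z \<notin> cball 0 B0" for n z
    proof -
      have "k n (graph_point \<nu> \<phi> z + t *\<^sub>R \<nu>) * G (graph_point \<nu> \<phi> z + t *\<^sub>R \<nu>) = 0" for t
      proof (cases "k n (graph_point \<nu> \<phi> z + t *\<^sub>R \<nu>) = 0")
        case False
        have "\<bar>t\<bar> \<le> C' * h n" by (rule C'(2)[OF False])
        also have "\<dots> \<le> C' * H" using H C' by (intro mult_left_mono) auto
        finally have t: "\<bar>t\<bar> \<le> C' * H" .
        have "R + C' * H < norm (graph_point \<nu> \<phi> z)"
          using slab_norm_bound[OF that(1)] that(2) by (simp add: B0_def)
        then have "R < norm (graph_point \<nu> \<phi> z + t *\<^sub>R \<nu>)"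
          using norm_diff_ineq[of "graph_point \<nu> \<phi> z" "t *\<^sub>R \<nu>"] t by (simp add: graph_direction_unit)
        then show ?thesis using G(2) by simp
      qed simp
      then show ?thesis by (simp only: integral_zero mult_zero_right)
    qed
    show "AE z in lborel. norm (indicator (unit_slab \<nu>) z * ?s n z) \<le> indicator (cball 0 B0) z * (2 * C' * M)" for n
    proof (rule AE_I2)
      fix z
      show "norm (indicator (unit_slab \<nu>) z * ?s n z) \<le> indicator (cball 0 B0) z * (2 * C' * M)"
        using bd[of n z] zero[of z n] by (cases "z \<in> unit_slab \<nu>"; cases "z \<in> cball 0 B0") (simp_all add: C' M)
    qed
    show "AE z in lborel. (\<lambda>n. indicator (unit_slab \<nu>) z * ?s n z) \<longlonglongrightarrow> indicator (unit_slab \<nu>) z * (G (graph_point \<nu> \<phi> z) * \<rho> z)"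
      using lim
    proof eventually_elim
      fix z
      let ?x = "graph_point \<nu> \<phi> z"
      assume lz: "(\<lambda>n. (1 / h n) * (LINT t|lborel. k n (?x + t *\<^sub>R \<nu>))) \<longlonglongrightarrow> \<rho> z"
      \<comment> \<open>The first summand carries the oscillation of \<open>G\<close> over a segment
        of length of order \<open>h n\<close> and tends to 0; the second is the assumed limit times
        \<open>G ?x\<close>.\<close>
      have split: "?s n z = (1 / h n) * (LINT t|lborel. k n (?x + t *\<^sub>R \<nu>) * (G (?x + t *\<^sub>R \<nu>) - G ?x))
         + ((1 / h n) * (LINT t|lborel. k n (?x + t *\<^sub>R \<nu>))) * G ?x" for n
      proof -
        have "(LINT t|lborel. k n (?x + t *\<^sub>R \<nu>) * G (?x + t *\<^sub>R \<nu>))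
          = (LINT t|lborel. k n (?x + t *\<^sub>R \<nu>) * (G (?x + t *\<^sub>R \<nu>) - G ?x) + k n (?x + t *\<^sub>R \<nu>) * G ?x)"
          by (simp add: algebra_simps)
        also have "\<dots> = (LINT t|lborel. k n (?x + t *\<^sub>R \<nu>) * (G (?x + t *\<^sub>R \<nu>) - G ?x)) + (LINT t|lborel. k n (?x + t *\<^sub>R \<nu>) * G ?x)"
        proof (rule Bochner_Integration.integral_add)
          show "integrable lborel (\<lambda>t. k n (?x + t *\<^sub>R \<nu>) * (G (?x + t *\<^sub>R \<nu>) - G ?x))"
            by (rule kint[where B="2 * M"], measurable) (use M(1) M(2)[of ?x] in \<open>auto intro: order_trans[OF abs_triangle_ineq4 order_trans[OF add_mono[OF M(2) M(2)]]]\<close>)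
          show "integrable lborel (\<lambda>t. k n (?x + t *\<^sub>R \<nu>) * G ?x)"
            by (rule kint[where B="M"]) (use M in auto)
        qed
        finally show ?thesis by (simp add: algebra_simps)
      qed
      have "(\<lambda>n. (1 / h n) * (LINT t|lborel. k n (?x + t *\<^sub>R \<nu>) * (G (?x + t *\<^sub>R \<nu>) - G ?x))) \<longlonglongrightarrow> 0"
      proof (rule LIMSEQ_I)
        fix r :: real assume r: "r > 0"
        define \<epsilon> where "\<epsilon> = r / (2 * C' + 1) / 2"
        have \<epsilon>: "\<epsilon> > 0" using r C'(1) by (simp add: \<epsilon>_def)
        have \<epsilon>2: "2 * C' * \<epsilon> < r"
        proof -
          have "2 * C' * \<epsilon> \<le> (2 * C' + 1) * \<epsilon>" using \<epsilon> by (simp add: algebra_simps)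
          also have "\<dots> = r / 2" using C'(1) by (simp add: \<epsilon>_def divide_simps)
          finally show ?thesis using r by simp
        qed
        have "isCont G ?x" using G(1) by (simp add: continuous_on_eq_continuous_at)
        then obtain d where d: "d > 0" "\<And>y. dist y ?x < d \<Longrightarrow> dist (G y) (G ?x) < \<epsilon>"
          using \<epsilon> unfolding continuous_at_eps_delta by blast
        have "(\<lambda>n. C' * h n) \<longlonglongrightarrow> C' * 0" by (intro tendsto_intros h)
        then have "\<forall>\<^sub>F n in sequentially. C' * h n < d" using d(1) by (intro order_tendstoD) auto
        then obtain N where N: "\<And>n. n \<ge> N \<Longrightarrow> C' * h n < d" by (auto simp: eventually_sequentially)
        show "\<exists>no. \<forall>n\<ge>no. norm ((1 / h n) * (LINT t|lborel. k n (?x + t *\<^sub>R \<nu>) * (G (?x + t *\<^sub>R \<nu>) - G ?x)) - 0) < r"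
        proof (intro exI[of _ N] allI impI)
          fix n assume "n \<ge> N"
          have "\<bar>LINT t|lborel. k n (?x + t *\<^sub>R \<nu>) * (G (?x + t *\<^sub>R \<nu>) - G ?x)\<bar> \<le> 2 * C' * h n * \<epsilon>"
          proof (rule kbd)
            fix t assume "\<bar>t\<bar> \<le> C' * h n"
            then have "dist (?x + t *\<^sub>R \<nu>) ?x < d" using N[OF \<open>n \<ge> N\<close>] by (simp add: dist_norm graph_direction_unit)
            from d(2)[OF this] show "\<bar>G (?x + t *\<^sub>R \<nu>) - G ?x\<bar> \<le> \<epsilon>" by (simp add: dist_real_def)
          qed (use \<epsilon> in auto)
          then have "(1 / h n) * \<bar>LINT t|lborel. k n (?x + t *\<^sub>R \<nu>) * (G (?x + t *\<^sub>R \<nu>) - G ?x)\<bar> \<le> (1 / h n) * (2 * C' * h n * \<epsilon>)"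
            using h(1)[of n] by (intro mult_left_mono) auto
          also have "\<dots> = 2 * C' * \<epsilon>" using h(1)[of n] by simp
          finally show "norm ((1 / h n) * (LINT t|lborel. k n (?x + t *\<^sub>R \<nu>) * (G (?x + t *\<^sub>R \<nu>) - G ?x)) - 0) < r"
            using \<epsilon>2 h(1)[of n] by (simp add: abs_mult)
        qed
      qed
      then have "(\<lambda>n. ?s n z) \<longlonglongrightarrow> 0 + \<rho> z * G ?x" unfolding split
        by (intro tendsto_add tendsto_mult lz tendsto_const)
      then have "(\<lambda>n. ?s n z) \<longlonglongrightarrow> G ?x * \<rho> z" by (simp only: add_0 mult.commute[of "\<rho> z"])
      then show "(\<lambda>n. indicator (unit_slab \<nu>) z * ?s n z) \<longlonglongrightarrow> indicator (unit_slab \<nu>) z * (G ?x * \<rho> z)"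
        by (rule tendsto_mult_left)
    qed
  qed measurable
qed

text \<open>On a vertical line the difference of the indicators is the signed indicator of the
  interval between 0 and \<open>\<tau> n z\<close>, so its integral is exactly
  \<open>\<tau> n z\<close>. Division by \<open>h n\<close> produces a difference quotient of
  \<open>\<phi>\<close>, which converges where \<open>\<phi>\<close> is differentiable.\<close>

lemma subgraph_flux:
  fixes G :: "'a \<Rightarrow> real" and h :: "nat \<Rightarrow> real"
  defines "A \<equiv> {z. z \<bullet> \<nu> < \<phi> z}"
  assumes G: "continuous_on UNIV G" "\<And>x. R < norm x \<Longrightarrow> G x = 0"
    and h: "\<And>n. h n > 0" "h \<longlonglongrightarrow> 0"
  shows "(\<lambda>n. (1 / h n) * (LINT x|lborel. (indicator A (x - h n *\<^sub>R e) - indicator A x) * G x))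
     \<longlonglongrightarrow> (LINT z|lborel. indicator (unit_slab \<nu>) z * (G (graph_point \<nu> \<phi> z) * (e \<bullet> (\<nu> - gradient \<phi> z))))"
proof -
  define \<tau> where "\<tau> n z = \<phi> (z - h n *\<^sub>R e) - \<phi> z + h n * (e \<bullet> \<nu>)" for n z
  have [measurable]: "A \<in> sets borel" unfolding A_def by measurable
  have A1: "graph_point \<nu> \<phi> z + t *\<^sub>R \<nu> \<in> A \<longleftrightarrow> t < 0" for z t
    by (simp add: A_def inner_add_left graph_direction_unit)
  have A2: "graph_point \<nu> \<phi> z + t *\<^sub>R \<nu> - h n *\<^sub>R e \<in> A \<longleftrightarrow> t < \<tau> n z" for z t n
  proof -
    have "\<phi> (graph_point \<nu> \<phi> z + t *\<^sub>R \<nu> - h n *\<^sub>R e) = \<phi> (z - h n *\<^sub>R e)"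
      using graph_function_vertical[of "z - h n *\<^sub>R e" "\<phi> z - z \<bullet> \<nu> + t"] by (simp add: graph_point_def algebra_simps)
    then show ?thesis
      by (auto simp: A_def \<tau>_def inner_diff_left inner_add_left graph_direction_unit)
  qed
  have \<tau>bd: "\<bar>\<tau> n z\<bar> \<le> ((L + 1) * norm e) * h n" for n z
  proof -
    have "\<bar>\<phi> (z - h n *\<^sub>R e) - \<phi> z\<bar> \<le> L * (h n * norm e)"
      using lipschitz_onD[OF graph_function_lipschitz, of "z - h n *\<^sub>R e" z] h(1)[of n] by (simp add: dist_norm)
    moreover have "\<bar>e \<bullet> \<nu>\<bar> \<le> norm e" using Cauchy_Schwarz_ineq2[of e \<nu>] graph_direction_unit by simp
    then have "\<bar>h n * (e \<bullet> \<nu>)\<bar> \<le> h n * norm e" using h(1)[of n] by (simp add: abs_mult)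
    ultimately show ?thesis unfolding \<tau>_def by (simp add: algebra_simps)
  qed
  have lint: "(LINT t|lborel. (indicator A (graph_point \<nu> \<phi> z + t *\<^sub>R \<nu> - h n *\<^sub>R e) - indicator A (graph_point \<nu> \<phi> z + t *\<^sub>R \<nu>))) = \<tau> n z" for n z
  proof -
    have "(\<lambda>t. indicator A (graph_point \<nu> \<phi> z + t *\<^sub>R \<nu> - h n *\<^sub>R e) - indicator A (graph_point \<nu> \<phi> z + t *\<^sub>R \<nu>) :: real)
       = (\<lambda>t. indicator {0..<\<tau> n z} t - indicator {\<tau> n z..<0} t)"
      by (rule ext) (auto simp: indicator_def A1 A2)
    then show ?thesis by (cases "0 \<le> \<tau> n z") simp_all
  qed
  show ?thesis
  proof (rule slab_limit[where C="(L + 1) * norm e"])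
    show "\<bar>t\<bar> \<le> (L + 1) * norm e * h n"
      if "indicator A (graph_point \<nu> \<phi> z + t *\<^sub>R \<nu> - h n *\<^sub>R e) - indicator A (graph_point \<nu> \<phi> z + t *\<^sub>R \<nu>) \<noteq> (0::real)" for n z t
    proof -
      have "(t < \<tau> n z) \<noteq> (t < 0)" using that by (auto simp: indicator_def A1 A2 split: if_splits)
      then have "\<bar>t\<bar> \<le> \<bar>\<tau> n z\<bar>" by auto
      then show ?thesis using \<tau>bd[of n z] by linarith
    qed
    show "AE z in lborel. (\<lambda>n. (1 / h n) * (LINT t|lborel. (indicator A (graph_point \<nu> \<phi> z + t *\<^sub>R \<nu> - h n *\<^sub>R e) - indicator A (graph_point \<nu> \<phi> z + t *\<^sub>R \<nu>))))
        \<longlonglongrightarrow> e \<bullet> (\<nu> - gradient \<phi> z)"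
      using rademacher[OF graph_function_lipschitz]
    proof eventually_elim
      fix z assume "\<exists>g. GDERIV \<phi> z :> g"
      then obtain g where g: "GDERIV \<phi> z :> g" by blast
      have fl: "filterlim (\<lambda>n. - h n) (at 0) sequentially"
        using h tendsto_minus[OF h(2)] by (intro filterlim_atI) (auto intro!: always_eventually simp: less_imp_neq[symmetric])
      have "(\<lambda>n. (\<phi> (z + (- h n) *\<^sub>R e) - \<phi> z) / (- h n)) \<longlonglongrightarrow> e \<bullet> g"
        using filterlim_compose[OF GDERIV_imp_has_dir_deriv[OF g, of e, unfolded has_dir_deriv_def] fl] .
      then have "(\<lambda>n. - ((\<phi> (z + (- h n) *\<^sub>R e) - \<phi> z) / (- h n)) + e \<bullet> \<nu>) \<longlonglongrightarrow> - (e \<bullet> g) + e \<bullet> \<nu>"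
        by (intro tendsto_intros)
      moreover have "- ((\<phi> (z + (- h n) *\<^sub>R e) - \<phi> z) / (- h n)) + e \<bullet> \<nu> = 1 / h n * \<tau> n z" for n
        using h(1)[of n] by (simp add: \<tau>_def field_simps)
      ultimately show "(\<lambda>n. (1 / h n) * (LINT t|lborel. (indicator A (graph_point \<nu> \<phi> z + t *\<^sub>R \<nu> - h n *\<^sub>R e) - indicator A (graph_point \<nu> \<phi> z + t *\<^sub>R \<nu>))))
        \<longlonglongrightarrow> e \<bullet> (\<nu> - gradient \<phi> z)"
        unfolding lint gradient_eq[OF g] by (simp add: inner_diff_right)
    qed
  qed (use G h in \<open>auto simp: indicator_def\<close>)
qed

text \<open>The tangent plane has the normal \<open>\<nu> - p\<close>, whose component along
  \<open>\<nu>\<close> is 1 and whose length is \<open>s = sqrt (1 + |p|^2)\<close>. A vertical line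
  therefore stays within distance \<open>h\<close> of that plane for a length of
  \<open>2 s h\<close>. Differentiability traps the section of the true tube between sections with
  factors \<open>1 - \<eta>\<close> and \<open>1 + \<eta>\<close>.\<close>

lemma graph_neighbourhood_limit:
  fixes G :: "'a \<Rightarrow> real" and h :: "nat \<Rightarrow> real"
  defines "N \<equiv> \<lambda>r. (\<Union>w\<in>{w. w \<bullet> \<nu> = \<phi> w}. ball w r)"
  assumes G: "continuous_on UNIV G" "\<And>x. R < norm x \<Longrightarrow> G x = 0"
    and h: "\<And>n. h n > 0" "h \<longlonglongrightarrow> 0"
  shows "(\<lambda>n. (1 / h n) * (LINT x|lborel. indicator (N (h n)) x * G x))
     \<longlonglongrightarrow> (LINT z|lborel. indicator (unit_slab \<nu>) z * (G (graph_point \<nu> \<phi> z) * (2 * sqrt (1 + (norm (gradient \<phi> z))\<^sup>2))))"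
proof -
  have oN: "open (N r)" for r unfolding N_def by auto
  have [measurable]: "N r \<in> sets borel" for r using oN by simp
  define T where "T n z = {t. graph_point \<nu> \<phi> z + t *\<^sub>R \<nu> \<in> N (h n)}" for n z
  have Tsub: "\<bar>t\<bar> \<le> (1 + L) * h n" if mem: "graph_point \<nu> \<phi> z + t *\<^sub>R \<nu> \<in> N (h n)" for n z t
  proof -
    let ?q = "graph_point \<nu> \<phi> z + t *\<^sub>R \<nu>"
    obtain w where w: "w \<bullet> \<nu> = \<phi> w" "dist w ?q < h n" using mem by (auto simp: N_def)
    have "t = (?q - w) \<bullet> \<nu> - (\<phi> ?q - \<phi> w)"
      using w(1) by (simp add: inner_diff_left inner_add_left graph_direction_unit)
    moreover have "\<bar>(?q - w) \<bullet> \<nu>\<bar> \<le> norm (?q - w)" using Cauchy_Schwarz_ineq2[of "?q - w" \<nu>] graph_direction_unit by simp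
    moreover have "\<bar>\<phi> ?q - \<phi> w\<bar> \<le> L * norm (?q - w)" using lipschitz_onD[OF graph_function_lipschitz, of ?q w] by (simp add: dist_norm)
    moreover have "norm (?q - w) \<le> h n" using w(2) by (simp add: dist_norm norm_minus_commute)
    then have "L * norm (?q - w) \<le> L * h n" using graph_function_bound_nonneg by (rule mult_left_mono)
    ultimately have "\<bar>t\<bar> \<le> h n + L * h n" using \<open>norm (?q - w) \<le> h n\<close> by linarith
    then show ?thesis by (simp add: algebra_simps)
  qed
  have Tm: "T n z \<in> sets borel" for n z
  proof -
    have "open ((\<lambda>t. graph_point \<nu> \<phi> z + t *\<^sub>R \<nu>) -` N (h n))"
      by (intro open_vimage oN continuous_intros)
    then show ?thesis unfolding T_def vimage_def by simp
  qed
  have Tint: "(LINT t|lborel. indicator (N (h n)) (graph_point \<nu> \<phi> z + t *\<^sub>R \<nu>)) = measure lborel (T n z)" for n z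
  proof -
    have "(\<lambda>t. indicator (N (h n)) (graph_point \<nu> \<phi> z + t *\<^sub>R \<nu>) :: real) = indicator (T n z)"
      by (rule ext) (auto simp: T_def indicator_def)
    then show ?thesis by simp
  qed
  show ?thesis
  proof (rule slab_limit[where C="1 + L"])
    show "\<bar>t\<bar> \<le> (1 + L) * h n" if "indicator (N (h n)) (graph_point \<nu> \<phi> z + t *\<^sub>R \<nu>) \<noteq> (0::real)" for n z t
      using that by (intro Tsub[of z]) (auto simp: indicator_def split: if_splits)
    show "AE z in lborel. (\<lambda>n. (1 / h n) * (LINT t|lborel. indicator (N (h n)) (graph_point \<nu> \<phi> z + t *\<^sub>R \<nu>)))
       \<longlonglongrightarrow> 2 * sqrt (1 + (norm (gradient \<phi> z))\<^sup>2)"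
      using rademacher[OF graph_function_lipschitz]
    proof eventually_elim
      fix z assume "\<exists>g. GDERIV \<phi> z :> g"
      then obtain p where "GDERIV \<phi> z :> p" by blast
      then have pz: "gradient \<phi> z = p" and p\<nu>: "\<nu> \<bullet> p = 0" and px: "GDERIV \<phi> (graph_point \<nu> \<phi> z) :> p"
        using gradient_eq GDERIV_orthogonal by (auto simp: GDERIV_graph_point)
      define x where "x = graph_point \<nu> \<phi> z"
      define s where "s = sqrt (1 + (norm p)\<^sup>2)"
      have s: "s \<ge> 1" "s * s = 1 + (norm p)\<^sup>2" by (auto simp: s_def)
      have nn: "norm (\<nu> - p) = s" "(\<nu> - p) \<bullet> (\<nu> - p) = s * s"
      proof -
        have "p \<bullet> \<nu> = 0" using p\<nu> by (simp add: inner_commute)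
        then show "(\<nu> - p) \<bullet> (\<nu> - p) = s * s" unfolding s(2) inner_diff_left inner_diff_right
          using p\<nu> graph_direction_unit by (simp add: dot_square_norm)
        then show "norm (\<nu> - p) = s" using s(1) by (simp add: norm_eq_sqrt_inner)
      qed
      have xx: "x \<bullet> \<nu> = \<phi> x" by (simp add: x_def)
      show "(\<lambda>n. (1 / h n) * (LINT t|lborel. indicator (N (h n)) (graph_point \<nu> \<phi> z + t *\<^sub>R \<nu>)))
       \<longlonglongrightarrow> 2 * sqrt (1 + (norm (gradient \<phi> z))\<^sup>2)"
        unfolding Tint pz s_def[symmetric]
      proof (rule LIMSEQ_I)
        fix r :: real assume r: "r > 0"
        define \<eta> where "\<eta> = min (1/2) (r / (4 * s))"
        have \<eta>: "\<eta> > 0" "\<eta> < 1" "2 * \<eta> * s < r"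
          using r s(1) by (auto simp: \<eta>_def min_def field_simps)
        \<comment> \<open>Linearisation is used at distance at most \<open>(2 + L) * h n\<close>
          from \<open>x\<close> for the upper inclusion and at most \<open>2 * s * h n\<close> for
          the lower one. \<open>\<epsilon>1\<close> and \<open>\<epsilon>2\<close> make both errors
          small compared with \<open>\<eta>\<close>.\<close>
        define \<epsilon> where "\<epsilon> = \<eta> / (4 * s) / (2 + L)"
        have LL: "2 + L > 0" using graph_function_bound_nonneg by simp
        have \<epsilon>: "\<epsilon> > 0" using \<eta>(1) s(1) LL by (simp add: \<epsilon>_def)
        have \<epsilon>1: "\<epsilon> * (2 + L) \<le> \<eta> * s"
        proof -
          have "\<epsilon> * (2 + L) = \<eta> / (4 * s)" using LL by (simp add: \<epsilon>_def)
          also have "\<dots> \<le> \<eta> / 1" using \<eta>(1) s(1) by (intro divide_left_mono) auto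
          also have "\<dots> \<le> \<eta> * s" using \<eta>(1) s(1) by simp
          finally show ?thesis .
        qed
        have \<epsilon>2: "\<epsilon> * (2 * s) < \<eta>"
        proof -
          have "\<epsilon> * (2 * s) = \<eta> / (2 * (2 + L))" using s(1) graph_function_bound_nonneg by (simp add: \<epsilon>_def divide_simps)
          also have "\<dots> < \<eta> / 1" using \<eta>(1) graph_function_bound_nonneg by (intro divide_strict_left_mono) auto
          finally show ?thesis by simp
        qed
        obtain d where d: "d > 0" "\<And>v. norm v < d \<Longrightarrow> \<bar>\<phi> (x + v) - \<phi> x - v \<bullet> p\<bar> \<le> \<epsilon> * norm v"
          using px \<epsilon> unfolding GDERIV_alt x_def by blast
        have "(\<lambda>n. (2 + L + 2 * s) * h n) \<longlonglongrightarrow> (2 + L + 2 * s) * 0" by (intro tendsto_intros h)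
        then have "\<forall>\<^sub>F n in sequentially. (2 + L + 2 * s) * h n < d" using d(1) by (intro order_tendstoD) auto
        then obtain M where M: "\<And>n. n \<ge> M \<Longrightarrow> (2 + L + 2 * s) * h n < d" by (auto simp: eventually_sequentially)
        show "\<exists>no. \<forall>n\<ge>no. norm (1 / h n * measure lborel (T n z) - 2 * s) < r"
        proof (intro exI[of _ M] allI impI)
          fix n assume n: "n \<ge> M"
          have hn: "h n > 0" by (rule h)
          have small: "(2 + L) * h n < d" "2 * s * h n < d"
          proof -
            have "2 * s * h n > 0" "(2 + L) * h n > 0" using s(1) graph_function_bound_nonneg hn by simp_all
            moreover have "(2 + L + 2 * s) * h n = (2 + L) * h n + 2 * s * h n" by (simp add: algebra_simps)
            ultimately show "(2 + L) * h n < d" "2 * s * h n < d" using M[OF n] by linarith+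
          qed
          have up: "T n z \<subseteq> {-((1 + \<eta>) * s * h n)..(1 + \<eta>) * s * h n}"
          proof
            fix t assume t: "t \<in> T n z"
            then have tN: "x + t *\<^sub>R \<nu> \<in> N (h n)" by (simp add: T_def x_def)
            then have tb: "\<bar>t\<bar> \<le> (1 + L) * h n" unfolding x_def by (rule Tsub)
            obtain w where w: "w \<bullet> \<nu> = \<phi> w" "dist w (x + t *\<^sub>R \<nu>) < h n" using tN by (auto simp: N_def)
            have wx: "norm (w - x) \<le> (2 + L) * h n"
            proof -
              have "norm (w - x) \<le> norm (w - (x + t *\<^sub>R \<nu>)) + norm (t *\<^sub>R \<nu>)"
                using norm_triangle_ineq[of "w - (x + t *\<^sub>R \<nu>)" "t *\<^sub>R \<nu>"] by (simp add: algebra_simps)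
              also have "\<dots> \<le> h n + (1 + L) * h n" using w(2) tb graph_direction_unit by (simp add: dist_norm)
              finally show ?thesis by (simp add: algebra_simps)
            qed
            have rr: "\<bar>\<phi> w - \<phi> x - (w - x) \<bullet> p\<bar> \<le> \<epsilon> * norm (w - x)"
              using d(2)[of "w - x"] wx small by simp
            \<comment> \<open>Since \<open>\<nu> \<bullet> (\<nu> - p) = 1\<close>, the point
              \<open>x + t \<nu>\<close> has height \<open>t\<close> over the tangent plane in
              direction \<open>\<nu> - p\<close>. The height of \<open>w\<close> is the
              linearisation error.\<close>
            have "t = (x + t *\<^sub>R \<nu> - w) \<bullet> (\<nu> - p) + (\<phi> w - \<phi> x - (w - x) \<bullet> p)"
              using w(1) xx p\<nu> graph_direction_unit by (simp add: inner_diff_left inner_diff_right inner_add_left)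
            moreover have "\<bar>(x + t *\<^sub>R \<nu> - w) \<bullet> (\<nu> - p)\<bar> \<le> h n * s"
            proof -
              have "\<bar>(x + t *\<^sub>R \<nu> - w) \<bullet> (\<nu> - p)\<bar> \<le> norm (x + t *\<^sub>R \<nu> - w) * norm (\<nu> - p)" by (rule Cauchy_Schwarz_ineq2)
              also have "\<dots> \<le> h n * s" unfolding nn using w(2) s(1) by (intro mult_right_mono) (auto simp: dist_norm norm_minus_commute)
              finally show ?thesis .
            qed
            moreover have "\<epsilon> * norm (w - x) \<le> \<eta> * s * h n"
            proof -
              have "\<epsilon> * norm (w - x) \<le> \<epsilon> * ((2 + L) * h n)" using wx \<epsilon> by (intro mult_left_mono) auto
              also have "\<dots> \<le> \<eta> * s * h n" using \<epsilon>1 hn by (simp add: mult.assoc[symmetric])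
              finally show ?thesis .
            qed
            ultimately have "\<bar>t\<bar> \<le> h n * s + \<eta> * s * h n" using rr by linarith
            then show "t \<in> {-((1 + \<eta>) * s * h n)..(1 + \<eta>) * s * h n}"
              by (simp add: algebra_simps abs_le_iff)
          qed
          have low: "{-((1 - \<eta>) * s * h n)..(1 - \<eta>) * s * h n} \<subseteq> T n z"
          proof
            fix t assume t: "t \<in> {-((1 - \<eta>) * s * h n)..(1 - \<eta>) * s * h n}"
            then have tb: "\<bar>t\<bar> \<le> (1 - \<eta>) * s * h n" by (simp add: abs_le_iff)
            \<comment> \<open>\<open>x + v\<close> is the foot of the perpendicular from
              \<open>x + t \<nu>\<close> to the tangent plane, at distance \<open>|t| / s\<close>;
              \<open>w\<close> is the graph point over this foot.\<close>
            define v where "v = t *\<^sub>R \<nu> - (t / (s * s)) *\<^sub>R (\<nu> - p)"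
            define w where "w = graph_point \<nu> \<phi> (x + v)"
            have ts: "\<bar>t\<bar> \<le> s * h n"
            proof -
              have "(1 - \<eta>) * (s * h n) \<le> 1 * (s * h n)" using \<eta> s(1) hn by (intro mult_right_mono) auto
              then show ?thesis using tb by (simp add: mult.assoc)
            qed
            have n2: "norm ((t / (s * s)) *\<^sub>R (\<nu> - p)) = \<bar>t\<bar> / s" using s(1) by (simp add: nn abs_mult)
            have vb: "norm v \<le> 2 * s * h n"
            proof -
              have "norm v \<le> norm (t *\<^sub>R \<nu>) + \<bar>t\<bar> / s" unfolding v_def n2[symmetric] by (rule norm_triangle_ineq4)
              also have "\<dots> \<le> \<bar>t\<bar> + \<bar>t\<bar>" using s(1) graph_direction_unit by (simp add: divide_le_eq mult_le_cancel_left1)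
              finally show ?thesis using ts by simp
            qed
            have v0: "v \<bullet> (\<nu> - p) = 0"
              using s(1) p\<nu> by (simp add: v_def inner_diff_left[of "t *\<^sub>R \<nu>"] nn) (simp add: inner_diff_right graph_direction_unit)
            have rr: "\<bar>\<phi> (x + v) - \<phi> x - v \<bullet> p\<bar> \<le> \<epsilon> * norm v"
              using d(2)[of v] vb small by simp
            have "w = x + v + (\<phi> (x + v) - \<phi> x - v \<bullet> p) *\<^sub>R \<nu>"
              using v0 xx by (simp add: w_def graph_point_def inner_add_left inner_diff_right)
            then have "w - (x + t *\<^sub>R \<nu>) = - ((t / (s * s)) *\<^sub>R (\<nu> - p)) + (\<phi> (x + v) - \<phi> x - v \<bullet> p) *\<^sub>R \<nu>"
              by (simp add: v_def)
            then have "norm (w - (x + t *\<^sub>R \<nu>)) \<le> \<bar>t\<bar> / s + \<bar>\<phi> (x + v) - \<phi> x - v \<bullet> p\<bar>"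
              using norm_triangle_ineq[of "- ((t / (s * s)) *\<^sub>R (\<nu> - p))" "(\<phi> (x + v) - \<phi> x - v \<bullet> p) *\<^sub>R \<nu>"] n2 graph_direction_unit by simp
            also have "\<dots> \<le> (1 - \<eta>) * h n + \<epsilon> * (2 * s * h n)"
            proof (rule add_mono)
              show "\<bar>t\<bar> / s \<le> (1 - \<eta>) * h n" using tb s(1) by (simp add: divide_le_eq mult_ac)
              show "\<bar>\<phi> (x + v) - \<phi> x - v \<bullet> p\<bar> \<le> \<epsilon> * (2 * s * h n)"
                using rr vb \<epsilon> by (smt (verit) mult_left_mono)
            qed
            also have "\<dots> < (1 - \<eta>) * h n + \<eta> * h n"
              using \<epsilon>2 hn by (simp add: mult.assoc[symmetric])
            also have "\<dots> = h n" by (simp add: algebra_simps)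
            finally have "x + t *\<^sub>R \<nu> \<in> ball w (h n)" by (simp add: dist_norm)
            then show "t \<in> T n z" unfolding T_def N_def x_def[symmetric]
              by (intro CollectI UN_I[of w]) (auto simp: w_def)
          qed
          have fin: "{-((1 + \<eta>) * s * h n)..(1 + \<eta>) * s * h n} \<in> fmeasurable lborel"
            unfolding fmeasurable_def using emeasure_bounded_finite[OF bounded_closed_interval] by auto
          have "measure lborel (T n z) \<le> measure lborel {-((1 + \<eta>) * s * h n)..(1 + \<eta>) * s * h n}"
            by (rule measure_mono_fmeasurable[OF up]) (use Tm fin in auto)
          also have "\<dots> = 2 * (1 + \<eta>) * s * h n"
            using \<eta> s(1) hn by simp
          finally have 1: "measure lborel (T n z) \<le> 2 * (1 + \<eta>) * s * h n" .
          have "2 * (1 - \<eta>) * s * h n = measure lborel {-((1 - \<eta>) * s * h n)..(1 - \<eta>) * s * h n}"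
            using \<eta> s(1) hn by simp
          also have "\<dots> \<le> measure lborel (T n z)"
            by (rule measure_mono_fmeasurable[OF low]) (use Tm fmeasurableI2[OF fin up] in auto)
          finally have 2: "2 * (1 - \<eta>) * s * h n \<le> measure lborel (T n z)" .
          have "\<bar>1 / h n * measure lborel (T n z) - 2 * s\<bar> \<le> 2 * \<eta> * s"
            using 1 2 hn by (simp add: abs_le_iff field_simps)
          then show "norm (1 / h n * measure lborel (T n z) - 2 * s) < r" using \<eta>(3) by simp
        qed
      qed
    qed
  qed (use G h in \<open>auto simp: indicator_def\<close>)
qed

end

section \<open>The surface measure\<close>

lemma chart_graph_function: "lipschitz_graph_chart L S \<nu> \<phi> W \<Longrightarrow> graph_function L \<nu> \<phi>"
  by (simp add: lipschitz_graph_chart_def graph_function_def)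

definition chart_density :: "'a::euclidean_space \<Rightarrow> ('a \<Rightarrow> real) \<Rightarrow> 'a set \<Rightarrow> 'a \<Rightarrow> real" where
  "chart_density \<nu> \<phi> W z = indicator (unit_slab \<nu>) z * indicator W (graph_point \<nu> \<phi> z) * sqrt (1 + (norm (gradient \<phi> z))\<^sup>2)"

lemma chart_density_nonneg: "chart_density \<nu> \<phi> W z \<ge> 0"
  by (simp add: chart_density_def)

context
  fixes L :: real and S W :: "'a::euclidean_space set" and \<nu> \<phi>
  assumes chart: "lipschitz_graph_chart L S \<nu> \<phi> W"
begin

lemma chart_graph: "graph_function L \<nu> \<phi>" by (rule chart_graph_function[OF chart])

lemma chart_open: "open W" using chart by (simp add: lipschitz_graph_chart_def)

lemma chart_iff: "z \<in> W \<Longrightarrow> z \<in> S \<longleftrightarrow> z \<bullet> \<nu> = \<phi> z"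
  using chart by (auto simp: lipschitz_graph_chart_def)

lemma graph_point_in_S: "graph_point \<nu> \<phi> z \<in> W \<Longrightarrow> graph_point \<nu> \<phi> z \<in> S"
  using chart_iff height_graph_point[OF chart_graph] phi_graph_point[OF chart_graph] by simp

lemma chart_domain_measurable [measurable]: "W \<in> sets borel" using chart_open by simp

lemmas [measurable] = graph_function_measurable[OF chart_graph] graph_point_measurable[OF chart_graph] gradient_measurable'[OF chart_graph]

lemma chart_density_measurable [measurable]: "chart_density \<nu> \<phi> W \<in> borel_measurable borel"
  unfolding chart_density_def[abs_def] by measurable

text \<open>Graph map and density are Borel functions, by the measurability of the gradient, so
  completed Lebesgue measure can be replaced by \<open>lborel\<close>, on which the Fubini arguments
  take place.\<close>

lemma chart_measure_eq:
  "chart_measure \<nu> \<phi> W = distr (density lborel (\<lambda>z. ennreal (chart_density \<nu> \<phi> W z))) borel (graph_point \<nu> \<phi>)"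
proof (rule measure_eqI)
  let ?d = "\<lambda>z. indicator {z. 0 \<le> z \<bullet> \<nu> \<and> z \<bullet> \<nu> < 1 \<and> graph_point \<nu> \<phi> z \<in> W} z * ennreal (sqrt (1 + (norm (gradient \<phi> z))\<^sup>2))"
  have cm: "chart_measure \<nu> \<phi> W = distr (density lebesgue ?d) borel (graph_point \<nu> \<phi>)"
    by (simp add: chart_measure_def graph_point_def[abs_def] Let_def)
  have d: "?d = (\<lambda>z. ennreal (chart_density \<nu> \<phi> W z))"
    by (rule ext) (auto simp: chart_density_def unit_slab_def indicator_def)
  show "sets (chart_measure \<nu> \<phi> W) = sets (distr (density lborel (\<lambda>z. ennreal (chart_density \<nu> \<phi> W z))) borel (graph_point \<nu> \<phi>))"
    by (simp add: cm)
  fix A assume "A \<in> sets (chart_measure \<nu> \<phi> W)"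
  then have A [measurable]: "A \<in> sets borel" by (simp add: cm)
  have m: "graph_point \<nu> \<phi> \<in> lebesgue \<rightarrow>\<^sub>M borel" by (rule measurable_completion) simp
  have P: "graph_point \<nu> \<phi> -` A \<in> sets borel" using measurable_sets[OF graph_point_measurable[OF chart_graph] A] by simp
  then have PL: "graph_point \<nu> \<phi> -` A \<in> sets lebesgue" by simp
  have "emeasure (chart_measure \<nu> \<phi> W) A = emeasure (density lebesgue (\<lambda>z. ennreal (chart_density \<nu> \<phi> W z))) (graph_point \<nu> \<phi> -` A)"
    unfolding cm d using m A by (subst emeasure_distr) auto
  also have "\<dots> = (\<integral>\<^sup>+z. ennreal (chart_density \<nu> \<phi> W z) * indicator (graph_point \<nu> \<phi> -` A) z \<partial>lborel)"
  proof (subst emeasure_density)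
    show "(\<lambda>z. ennreal (chart_density \<nu> \<phi> W z)) \<in> borel_measurable lebesgue"
      by (rule measurable_completion) simp
  qed (use PL nn_integral_completion in auto)
  also have "\<dots> = emeasure (distr (density lborel (\<lambda>z. ennreal (chart_density \<nu> \<phi> W z))) borel (graph_point \<nu> \<phi>)) A"
    using P by (subst emeasure_distr) (auto simp: emeasure_density)
  finally show "emeasure (chart_measure \<nu> \<phi> W) A = emeasure (distr (density lborel (\<lambda>z. ennreal (chart_density \<nu> \<phi> W z))) borel (graph_point \<nu> \<phi>)) A" .
qed

lemma sets_chart_measure [simp]: "sets (chart_measure \<nu> \<phi> W) = sets borel"
  by (simp add: chart_measure_eq)

lemma space_chart_measure [simp]: "space (chart_measure \<nu> \<phi> W) = UNIV"
  by (simp add: chart_measure_eq)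

lemma emeasure_chart_measure:
  assumes [measurable]: "A \<in> sets borel"
  shows "emeasure (chart_measure \<nu> \<phi> W) A = (\<integral>\<^sup>+z. ennreal (chart_density \<nu> \<phi> W z) * indicator A (graph_point \<nu> \<phi> z) \<partial>lborel)"
proof -
  have [measurable]: "graph_point \<nu> \<phi> -` A \<in> sets borel"
    using measurable_sets[OF graph_point_measurable[OF chart_graph] assms] by simp
  show ?thesis unfolding chart_measure_eq
    by (subst emeasure_distr) (auto simp: emeasure_density indicator_vimage intro!: nn_integral_cong split: split_indicator)
qed

lemma integral_chart_measure:
  fixes g :: "'a \<Rightarrow> 'b::{banach, second_countable_topology}"
  assumes [measurable]: "g \<in> borel_measurable borel"
  shows "(LINT x|chart_measure \<nu> \<phi> W. g x) = (LINT z|lborel. chart_density \<nu> \<phi> W z *\<^sub>R g (graph_point \<nu> \<phi> z))"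
  unfolding chart_measure_eq
  by (subst integral_distr, simp, simp, subst integral_density) (auto simp: chart_density_nonneg)

lemma chart_measure_outside:
  assumes "A \<in> sets borel" "A \<inter> S \<inter> W = {}"
  shows "emeasure (chart_measure \<nu> \<phi> W) A = 0"
proof -
  have "ennreal (chart_density \<nu> \<phi> W z) * indicator A (graph_point \<nu> \<phi> z) = 0" for z
    using graph_point_in_S[of z] assms(2) by (auto simp: chart_density_def indicator_def)
  then show ?thesis by (simp only: emeasure_chart_measure[OF assms(1)] nn_integral_const mult_zero_left)
qed

text \<open>The density is at most \<open>sqrt (1 + L^2)\<close>, and by
  \<open>slab_norm_bound\<close> it lives on a bounded part of the slab.\<close>

lemma finite_chart_measure:
  assumes "bounded S"
  shows "emeasure (chart_measure \<nu> \<phi> W) A < \<infinity>"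
proof -
  obtain r where r: "\<And>x. x \<in> S \<Longrightarrow> norm x \<le> r" using assms by (auto simp: bounded_iff)
  have le: "chart_density \<nu> \<phi> W z \<le> sqrt (1 + L\<^sup>2) * indicator (cball 0 (2 * r + 1)) z" for z
  proof (cases "z \<in> unit_slab \<nu> \<and> graph_point \<nu> \<phi> z \<in> W")
    case True
    then have "norm (graph_point \<nu> \<phi> z) \<le> r" using r graph_point_in_S by blast
    then have "norm z \<le> 2 * r + 1" using slab_norm_bound[OF chart_graph, of z] True by linarith
    moreover have "(norm (gradient \<phi> z))\<^sup>2 \<le> L\<^sup>2"
      by (intro power_mono norm_gradient_le[OF graph_function_lipschitz[OF chart_graph]]) simp
    ultimately show ?thesis using True by (simp add: chart_density_def)
  qed (auto simp: chart_density_def)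
  have "emeasure (chart_measure \<nu> \<phi> W) A \<le> emeasure (chart_measure \<nu> \<phi> W) UNIV"
    by (metis emeasure_space space_chart_measure)
  also have "\<dots> \<le> (\<integral>\<^sup>+z. ennreal (sqrt (1 + L\<^sup>2)) * indicator (cball (0::'a) (2 * r + 1)) z \<partial>lborel)"
  proof (subst emeasure_chart_measure, simp, intro nn_integral_mono)
    fix z
    show "ennreal (chart_density \<nu> \<phi> W z) * indicator UNIV (graph_point \<nu> \<phi> z) \<le> ennreal (sqrt (1 + L\<^sup>2)) * indicator (cball 0 (2 * r + 1)) z"
      using le[of z] by (auto simp: indicator_def ennreal_neg intro: ennreal_leI split: if_splits)
  qed
  also have "\<dots> = ennreal (sqrt (1 + L\<^sup>2)) * emeasure lborel (cball (0::'a) (2 * r + 1))"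
    by (rule nn_integral_cmult_indicator) simp
  also have "\<dots> < \<infinity>"
    using emeasure_lborel_cball_finite[of "0::'a" "2 * r + 1"] by (simp add: ennreal_mult_less_top)
  finally show ?thesis .
qed

text \<open>Inside \<open>W\<close> the set \<open>S\<close> is the graph. Once the radius is below
  the distance from \<open>K\<close> to the complement of \<open>W\<close>, the tubes around
  \<open>S\<close> and around the whole graph agree on \<open>K\<close>, and the limit for graphs
  applies.\<close>

lemma chart_neighbourhood_limit:
  fixes G :: "'a \<Rightarrow> real" and h :: "nat \<Rightarrow> real"
  assumes G: "continuous_on UNIV G" and K: "compact K" "K \<subseteq> W" "\<And>x. x \<notin> K \<Longrightarrow> G x = 0"
    and h: "\<And>n. h n > 0" "h \<longlonglongrightarrow> 0"
  shows "(\<lambda>n. (1 / h n) * (LINT x|lborel. indicator (\<Union>w\<in>S. ball w (h n)) x * G x))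
      \<longlonglongrightarrow> 2 * (LINT x|chart_measure \<nu> \<phi> W. G x)"
proof -
  have [measurable]: "G \<in> borel_measurable borel" by (rule borel_measurable_continuous_onI[OF G])
  obtain R where R: "\<And>x. x \<in> K \<Longrightarrow> norm x \<le> R" using compact_imp_bounded[OF K(1)] by (auto simp: bounded_iff)
  have G0: "G x = 0" if "R < norm x" for x using R[of x] K(3)[of x] that by force
  have lim: "(\<lambda>n. (1 / h n) * (LINT x|lborel. indicator (\<Union>w\<in>{w. w \<bullet> \<nu> = \<phi> w}. ball w (h n)) x * G x))
     \<longlonglongrightarrow> (LINT z|lborel. indicator (unit_slab \<nu>) z * (G (graph_point \<nu> \<phi> z) * (2 * sqrt (1 + (norm (gradient \<phi> z))\<^sup>2))))"
    by (rule graph_neighbourhood_limit[OF chart_graph G G0 h])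
  have "(LINT z|lborel. indicator (unit_slab \<nu>) z * (G (graph_point \<nu> \<phi> z) * (2 * sqrt (1 + (norm (gradient \<phi> z))\<^sup>2))))
      = (LINT z|lborel. 2 * (chart_density \<nu> \<phi> W z *\<^sub>R G (graph_point \<nu> \<phi> z)))"
    by (rule Bochner_Integration.integral_cong) (use K in \<open>auto simp: chart_density_def indicator_def\<close>)
  also have "\<dots> = 2 * (LINT x|chart_measure \<nu> \<phi> W. G x)" by (simp add: integral_chart_measure)
  finally have eq: "(LINT z|lborel. indicator (unit_slab \<nu>) z * (G (graph_point \<nu> \<phi> z) * (2 * sqrt (1 + (norm (gradient \<phi> z))\<^sup>2))))
      = 2 * (LINT x|chart_measure \<nu> \<phi> W. G x)" .
  obtain \<delta> where \<delta>: "\<delta> > 0" "\<And>x. x \<in> K \<Longrightarrow> ball x \<delta> \<subseteq> W"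
    using compact_subset_open_imp_ball_epsilon_subset[OF K(1) chart_open K(2)] by (metis UN_subset_iff)
  have "\<forall>\<^sub>F n in sequentially. h n < \<delta>" using h(2) \<delta>(1) by (rule order_tendstoD)
  then have "\<forall>\<^sub>F n in sequentially. (1 / h n) * (LINT x|lborel. indicator (\<Union>w\<in>{w. w \<bullet> \<nu> = \<phi> w}. ball w (h n)) x * G x)
     = (1 / h n) * (LINT x|lborel. indicator (\<Union>w\<in>S. ball w (h n)) x * G x)"
  proof eventually_elim
    case (elim n)
    have "indicator (\<Union>w\<in>{w. w \<bullet> \<nu> = \<phi> w}. ball w (h n)) x * G x = indicator (\<Union>w\<in>S. ball w (h n)) x * G x" for x
    proof (cases "x \<in> K")
      case True
      have "w \<in> W" if "dist w x < h n" for w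
        using \<delta>(2)[OF True] that elim by (auto simp: subset_iff dist_commute)
      then have "x \<in> (\<Union>w\<in>{w. w \<bullet> \<nu> = \<phi> w}. ball w (h n)) \<longleftrightarrow> x \<in> (\<Union>w\<in>S. ball w (h n))"
        using chart_iff by auto
      then show ?thesis by (simp add: indicator_def)
    qed (use K in auto)
    then show ?case by presburger
  qed
  from Lim_transform_eventually[OF lim this] show ?thesis unfolding eq .
qed

end

section \<open>Independence of the chart\<close>

lemma open_cutoff_sequence:
  fixes U :: "'a::euclidean_space set"
  assumes U: "open U" "bounded U"
  obtains g :: "nat \<Rightarrow> 'a \<Rightarrow> real" and K where
    "\<And>n. continuous_on UNIV (g n)" "\<And>n. compact (K n)" "\<And>n. K n \<subseteq> U" "\<And>n x. x \<notin> K n \<Longrightarrow> g n x = 0"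
    "\<And>n x. 0 \<le> g n x \<and> g n x \<le> 1" "\<And>x. (\<lambda>n. g n x) \<longlonglongrightarrow> indicator U x"
proof -
  let ?d = "\<lambda>x. infdist x (- U)"
  \<comment> \<open>The distance to the empty set is 0 by convention, so \<open>?d\<close> detects
    \<open>U\<close> only if its complement is nonempty.\<close>
  have ne: "- U \<noteq> {}" using U(2) not_bounded_UNIV by (metis Compl_empty_eq double_complement)
  have zero: "?d x = 0" if "x \<notin> U" for x using that by simp
  have pos: "?d x > 0" if "x \<in> U" for x
    using in_closed_iff_infdist_zero[of "- U" x] U(1) ne that infdist_nonneg[of x "- U"] by (auto simp: less_le)
  define g where "g n x = max 0 (min 1 (real n * ?d x - 1))" for n :: nat and x
  define K where "K n = {x. 1 \<le> real n * ?d x}" for n :: nat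
  show thesis
  proof
    show "continuous_on UNIV (g n)" for n
      unfolding g_def by (intro continuous_intros)
    show KU: "K n \<subseteq> U" for n
    proof (rule subsetI, rule ccontr)
      fix x assume "x \<in> K n" "x \<notin> U"
      then show False using zero[of x] by (simp add: K_def)
    qed
    then have "bounded (K n)" for n using U(2) bounded_subset by blast
    moreover have "closed (K n)" for n
      unfolding K_def by (intro closed_Collect_le continuous_intros)
    ultimately show "compact (K n)" for n by (simp add: compact_eq_bounded_closed)
    show "g n x = 0" if "x \<notin> K n" for n x using that by (simp add: K_def g_def)
    show "0 \<le> g n x \<and> g n x \<le> 1" for n x by (auto simp: g_def)
    show "(\<lambda>n. g n x) \<longlonglongrightarrow> indicator U x" for x
    proof (cases "x \<in> U")
      case True
      obtain N :: nat where N: "2 / ?d x < N" using reals_Archimedean2 by blast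
      have "g n x = 1" if "n \<ge> N" for n
      proof -
        have "2 < real N * ?d x" using N pos[OF True] by (simp add: divide_less_eq)
        also have "\<dots> \<le> real n * ?d x" using that pos[OF True] by (intro mult_right_mono) auto
        finally show ?thesis by (simp add: g_def)
      qed
      then show ?thesis using True by (intro tendsto_eventually) (auto simp: eventually_sequentially)
    next
      case False
      then show ?thesis using zero[OF False] by (simp add: g_def)
    qed
  qed
qed

text \<open>
  By \<open>chart_neighbourhood_limit\<close> both measures are limits of the normalized volume of the tubular
  neighbourhoods of \<open>S\<close>, and these do not depend on the chart.
\<close>

lemma chart_measures_agree:
  assumes c1: "lipschitz_graph_chart L1 S \<nu>1 \<phi>1 W1" and c2: "lipschitz_graph_chart L2 S \<nu>2 \<phi>2 W2"
    and S: "bounded S" and A: "A \<in> sets borel" "A \<subseteq> W1 \<inter> W2"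
  shows "emeasure (chart_measure \<nu>1 \<phi>1 W1) A = emeasure (chart_measure \<nu>2 \<phi>2 W2) A"
proof -
  let ?m1 = "chart_measure \<nu>1 \<phi>1 W1" and ?m2 = "chart_measure \<nu>2 \<phi>2 W2"
  note [simp] = sets_chart_measure[OF c1] sets_chart_measure[OF c2] space_chart_measure[OF c1] space_chart_measure[OF c2]
  have fm1: "finite_measure ?m1" using finite_chart_measure[OF c1 S] by (intro finite_measureI) (simp add: less_top)
  have fm2: "finite_measure ?m2" using finite_chart_measure[OF c2 S] by (intro finite_measureI) (simp add: less_top)
  have opn: "emeasure ?m1 U = emeasure ?m2 U" if U: "open U" "bounded U" "U \<subseteq> W1 \<inter> W2" for U
  proof -
    obtain g :: "nat \<Rightarrow> 'a \<Rightarrow> real" and K where g: "\<And>n. continuous_on UNIV (g n)" "\<And>n. compact (K n)" "\<And>n. K n \<subseteq> U" "\<And>n x. x \<notin> K n \<Longrightarrow> g n x = 0"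
      "\<And>n x. 0 \<le> g n x \<and> g n x \<le> 1" "\<And>x. (\<lambda>n. g n x) \<longlonglongrightarrow> indicator U x"
      using open_cutoff_sequence[OF U(1,2)] by metis
    have gm: "g n \<in> borel_measurable borel" for n by (rule borel_measurable_continuous_onI[OF g(1)])
    have eq: "(LINT x|?m1. g n x) = (LINT x|?m2. g n x)" for n
    proof -
      define h where "h = (\<lambda>n. 1 / real (Suc n))"
      have h: "\<And>n. h n > 0" "h \<longlonglongrightarrow> 0" unfolding h_def using LIMSEQ_Suc[OF lim_1_over_n] by auto
      have "K n \<subseteq> W1" "K n \<subseteq> W2" using g(3)[of n] U(3) by auto
      then have "2 * (LINT x|?m1. g n x) = 2 * (LINT x|?m2. g n x)"
        using LIMSEQ_unique[OF chart_neighbourhood_limit[OF c1 g(1)[of n] g(2)[of n] _ g(4)[of _ n] h]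
          chart_neighbourhood_limit[OF c2 g(1)[of n] g(2)[of n] _ g(4)[of _ n] h]] by blast
      then show ?thesis by simp
    qed
    have lim: "(\<lambda>n. LINT x|m. g n x) \<longlonglongrightarrow> measure m U" if m: "finite_measure m" "sets m = sets borel" for m
    proof -
      interpret finite_measure m by (rule m)
      have sp: "space m = UNIV" using sets_eq_imp_space_eq[OF m(2)] by simp
      have "(\<lambda>n. LINT x|m. g n x) \<longlonglongrightarrow> (LINT x|m. indicator U x)"
      proof (rule integral_dominated_convergence[where w="\<lambda>_. 1"])
        show "g n \<in> borel_measurable m" for n using gm[of n] m(2) by (simp cong: measurable_cong_sets)
        show "(indicator U :: 'a \<Rightarrow> real) \<in> borel_measurable m" using U(1) m(2) by (intro borel_measurable_indicator) auto
      qed (use g in auto)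
      then show ?thesis using U(1) m(2) sp by simp
    qed
    have "measure ?m1 U = measure ?m2 U"
      using LIMSEQ_unique[OF lim[OF fm1] lim[OF fm2, folded eq]] by simp
    then show ?thesis
      using finite_measure.emeasure_eq_measure[OF fm1] finite_measure.emeasure_eq_measure[OF fm2] by simp
  qed
  obtain r where r: "S \<subseteq> ball 0 r" using S bounded_subset_ballD by blast
  \<comment> \<open>The equality \<open>opn\<close> is for bounded open sets. Cutting with a ball
    around \<open>S\<close> loses no mass, because both measures live on \<open>S\<close>.\<close>
  define Z where "Z = W1 \<inter> W2 \<inter> ball 0 r"
  have oZ: "open Z" "bounded Z" unfolding Z_def using chart_open[OF c1] chart_open[OF c2] by auto
  have "density ?m1 (indicator Z) = density ?m2 (indicator Z)"
  proof (rule measure_eqI_generator_eq[where E="{S. open S}" and \<Omega>=UNIV and A="\<lambda>_. UNIV"])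
    show "Int_stable {S :: 'a set. open S}" by (auto simp: Int_stable_def)
    fix X :: "'a set" assume "X \<in> {S. open S}"
    then have X: "open X" by simp
    have "emeasure (density m (indicator Z)) X = emeasure m (Z \<inter> X)" if "sets m = sets borel" for m
      using X oZ that by (intro emeasure_restricted) auto
    then show "emeasure (density ?m1 (indicator Z)) X = emeasure (density ?m2 (indicator Z)) X"
      using opn[of "Z \<inter> X"] X oZ by (simp add: open_Int bounded_Int) (auto simp: Z_def)
  next
    show "emeasure (density ?m1 (indicator Z)) UNIV \<noteq> \<infinity>"
      using finite_chart_measure[OF c1 S, of Z] oZ emeasure_restricted[of Z ?m1 UNIV] by simp
  qed (auto simp: borel_def)
  then have "emeasure (density ?m1 (indicator Z)) A = emeasure (density ?m2 (indicator Z)) A" by simp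
  moreover have "emeasure (density m (indicator Z)) A = emeasure m (A \<inter> Z)" if "sets m = sets borel" for m
    unfolding Int_commute[of A] using A oZ that by (intro emeasure_restricted) auto
  ultimately have "emeasure ?m1 (A \<inter> Z) = emeasure ?m2 (A \<inter> Z)" by simp
  moreover have "emeasure m A = emeasure m (A \<inter> Z)"
    if m: "sets m = sets borel" "\<And>B. B \<in> sets borel \<Longrightarrow> B \<inter> S = {} \<Longrightarrow> emeasure m B = 0" for m
  proof -
    have s: "A \<inter> Z \<in> sets borel" "A - Z \<in> sets borel" using A oZ by auto
    have "emeasure m A = emeasure m (A \<inter> Z) + emeasure m (A - Z)"
      using s m(1) by (subst plus_emeasure) (auto simp: Int_Diff_Un)
    moreover have "emeasure m (A - Z) = 0" using s A(2) r by (intro m(2)) (auto simp: Z_def)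
    ultimately show ?thesis by simp
  qed
  ultimately show ?thesis
    using chart_measure_outside[OF c1] chart_measure_outside[OF c2] by (metis Int_empty_left sets_chart_measure[OF c1] sets_chart_measure[OF c2])
qed


section \<open>Gluing the chart measures\<close>

lemma countably_additive_finite_sum:
  assumes "finite I" "\<And>i. i \<in> I \<Longrightarrow> countably_additive M (f i)"
  shows "countably_additive M (\<lambda>A. \<Sum>i\<in>I. f i A :: ennreal)"
proof (rule countably_additiveI)
  fix A :: "nat \<Rightarrow> _" assume A: "range A \<subseteq> M" "disjoint_family A" "\<Union> (range A) \<in> M"
  have "(\<Sum>n. \<Sum>i\<in>I. f i (A n)) = (\<Sum>i\<in>I. \<Sum>n. f i (A n))"
    by (rule suminf_sum) simp
  also have "\<dots> = (\<Sum>i\<in>I. f i (\<Union> (range A)))"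
    using assms(2) A by (intro sum.cong refl) (auto simp: countably_additive_def)
  finally show "(\<Sum>n. \<Sum>i\<in>I. f i (A n)) = (\<Sum>i\<in>I. f i (\<Union> (range A)))" .
qed

text \<open>By itself the supremum of the chart measures says nothing about its size; an upper bound
  is needed that does not exceed the chart measure inside the given chart. Compactness gives
  finitely many charts, listed after the given one, which has index 0. They are made disjoint by
  removing the earlier ones, and their measures are added. Agreement on overlaps shows that the sum
  has the required values in every chart.\<close>

lemma glued_chart_measure:
  fixes S :: "'a::euclidean_space set"
  assumes S: "compact S" "strongly_lipschitz S" and c: "lipschitz_graph_chart L S \<nu> \<phi> W"
  obtains \<mu> where "sets \<mu> = sets borel" "emeasure \<mu> UNIV < \<infinity>" "emeasure \<mu> (- S) = 0"
    "\<And>A. A \<in> sets borel \<Longrightarrow> A \<subseteq> W \<Longrightarrow> emeasure \<mu> A = emeasure (chart_measure \<nu> \<phi> W) A"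
    "\<And>L' \<nu>' \<phi>' W'. lipschitz_graph_chart L' S \<nu>' \<phi>' W' \<Longrightarrow> chart_measure \<nu>' \<phi>' W' \<le> \<mu>"
proof -
  have bS: "bounded S" using S(1) by (rule compact_imp_bounded)
  obtain L0 where "\<forall>x\<in>S. \<exists>\<nu> \<phi> W. x \<in> W \<and> lipschitz_graph_chart L0 S \<nu> \<phi> W"
    using S(2) unfolding strongly_lipschitz_def by blast
  then obtain n f w where ch: "\<And>x. x \<in> S \<Longrightarrow> x \<in> w x \<and> lipschitz_graph_chart L0 S (n x) (f x) (w x)" by metis
  have "S \<subseteq> (\<Union>x\<in>S. w x)" using ch by blast
  then obtain X where X: "X \<subseteq> S" "finite X" "S \<subseteq> (\<Union>x\<in>X. w x)"
    using compactE_image[OF S(1), of S w] ch chart_open by metis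
  obtain xs where xs: "set xs = X" using finite_list[OF X(2)] by blast
  define m where "m = length xs"
  define Wf where "Wf i = (if i = 0 then W else w (xs ! (i - 1)))" for i
  define cf where "cf i = (if i = 0 then chart_measure \<nu> \<phi> W else chart_measure (n (xs ! (i - 1))) (f (xs ! (i - 1))) (w (xs ! (i - 1))))" for i
  have chi: "\<exists>L' \<nu>' \<phi>'. lipschitz_graph_chart L' S \<nu>' \<phi>' (Wf i) \<and> cf i = chart_measure \<nu>' \<phi>' (Wf i)" if "i \<le> m" for i
  proof (cases "i = 0")
    case True then show ?thesis using c by (auto simp: Wf_def cf_def)
  next
    case False
    then have "xs ! (i - 1) \<in> S" using that X xs m_def nth_mem[of "i - 1" xs] by auto
    then show ?thesis using ch False by (auto simp: Wf_def cf_def)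
  qed
  have cover: "S \<subseteq> (\<Union>i\<in>{..m}. Wf i)"
  proof
    fix x assume "x \<in> S"
    then obtain y where "y \<in> X" "x \<in> w y" using X by blast
    moreover then obtain j where "j < m" "xs ! j = y" using xs m_def by (metis in_set_conv_nth)
    ultimately have "x \<in> Wf (Suc j)" "Suc j \<le> m" by (auto simp: Wf_def)
    then show "x \<in> (\<Union>i\<in>{..m}. Wf i)" by blast
  qed
  define D where "D i = Wf i - (\<Union>j<i. Wf j)" for i
  have Wopen: "open (Wf i)" if "i \<le> m" for i using chi[OF that] chart_open by blast
  have Dm: "D i \<in> sets borel" if "i \<le> m" for i
    unfolding D_def using Wopen that by (intro sets.Diff sets.finite_UN) auto
  have csets: "sets (cf i) = sets borel" if "i \<le> m" for i using chi[OF that] sets_chart_measure by metis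
  have Dcover: "S \<subseteq> (\<Union>i\<in>{..m}. D i)"
  proof
    fix x assume "x \<in> S"
    then have ex: "\<exists>i. i \<le> m \<and> x \<in> Wf i" using cover by blast
    define i where "i = (LEAST i. i \<le> m \<and> x \<in> Wf i)"
    have i: "i \<le> m" "x \<in> Wf i" using LeastI_ex[OF ex] by (auto simp: i_def)
    moreover have "x \<notin> Wf j" if "j < i" for j 
    proof -
      have "\<not> (j \<le> m \<and> x \<in> Wf j)" using that unfolding i_def by (rule not_less_Least)
      then show ?thesis using that i(1) by auto
    qed
    ultimately show "x \<in> (\<Union>i\<in>{..m}. D i)" by (auto simp: D_def)
  qed
  have Ddisj: "disjoint_family_on D {..m}"
  proof -
    have "D i \<inter> D j = {}" if "i < j" for i j using that by (auto simp: D_def)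
    then show ?thesis unfolding disjoint_family_on_def by (metis linorder_neqE_nat inf_commute)
  qed
  define \<mu>f where "\<mu>f A = (\<Sum>i\<le>m. emeasure (cf i) (A \<inter> D i))" for A
  define \<mu> where "\<mu> = measure_of UNIV (sets borel) \<mu>f"
  have \<mu>s: "sets \<mu> = sets borel" unfolding \<mu>_def by (metis sets.sigma_sets_eq sets_measure_of space_borel subset_UNIV Pow_UNIV)
  have em: "emeasure \<mu> A = \<mu>f A" if "A \<in> sets borel" for A
    unfolding \<mu>_def
  proof (rule emeasure_measure_of_sigma)
    show "sigma_algebra UNIV (sets borel)" by (metis sets.sigma_algebra_axioms space_borel)
    show "positive (sets borel) \<mu>f" by (simp add: positive_def \<mu>f_def)
    show "countably_additive (sets borel) \<mu>f"
      unfolding \<mu>f_def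
    proof (rule countably_additive_finite_sum)
      fix i assume "i \<in> {..m}"
      then have i: "i \<le> m" by simp
      show "countably_additive (sets borel) (\<lambda>A. emeasure (cf i) (A \<inter> D i))"
      proof (rule countably_additiveI)
        fix A :: "nat \<Rightarrow> 'a set" assume A: "range A \<subseteq> sets borel" "disjoint_family A"
        have "(\<Sum>k. emeasure (cf i) (A k \<inter> D i)) = emeasure (cf i) (\<Union>k. A k \<inter> D i)"
          using A Dm[OF i] csets[OF i] by (intro suminf_emeasure) (auto simp: disjoint_family_on_def)
        then show "(\<Sum>k. emeasure (cf i) (A k \<inter> D i)) = emeasure (cf i) (\<Union> (range A) \<inter> D i)" by simp
      qed
    qed simp
  qed (use that in auto)
  have loc: "emeasure M A = (\<Sum>i\<le>m. emeasure M (A \<inter> D i))"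
    if M: "sets M = sets borel" "\<And>B. B \<in> sets borel \<Longrightarrow> B \<inter> S = {} \<Longrightarrow> emeasure M B = 0" and A: "A \<in> sets borel" for M A
  proof -
    have s: "(\<Union>i\<le>m. A \<inter> D i) \<in> sets borel" "A - (\<Union>i\<le>m. A \<inter> D i) \<in> sets borel" using A Dm by auto
    have "emeasure M A = emeasure M (\<Union>i\<le>m. A \<inter> D i) + emeasure M (A - (\<Union>i\<le>m. A \<inter> D i))"
      using s M(1) by (subst plus_emeasure) (auto intro!: arg_cong[where f="emeasure M"])
    also have "emeasure M (A - (\<Union>i\<le>m. A \<inter> D i)) = 0" using s Dcover by (intro M(2)) auto
    also have "emeasure M (\<Union>i\<le>m. A \<inter> D i) = (\<Sum>i\<le>m. emeasure M (A \<inter> D i))"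
      using A Dm M(1) Ddisj by (intro sum_emeasure[symmetric]) (auto simp: disjoint_family_on_def, blast)
    finally show ?thesis by simp
  qed
  have le: "emeasure (chart_measure \<nu>' \<phi>' W') A \<le> emeasure \<mu> A"
      and eq: "A \<subseteq> W' \<Longrightarrow> emeasure (chart_measure \<nu>' \<phi>' W') A = emeasure \<mu> A"
    if c': "lipschitz_graph_chart L' S \<nu>' \<phi>' W'" and A: "A \<in> sets borel" for L' \<nu>' \<phi>' W' A
  proof -
    let ?m = "chart_measure \<nu>' \<phi>' W'"
    have s: "sets ?m = sets borel" by (rule sets_chart_measure[OF c'])
    have oW': "open W'" by (rule chart_open[OF c'])
    have sum: "emeasure ?m A = (\<Sum>i\<le>m. emeasure ?m (A \<inter> D i))"
      by (rule loc[OF s _ A]) (rule chart_measure_outside[OF c'], auto)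
    \<comment> \<open>Outside \<open>W'\<close> this chart measure has no mass, and on
      \<open>D i \<inter> W'\<close> it agrees with that of the chart \<open>Wf i\<close>.\<close>
    have tm: "emeasure ?m (A \<inter> D i) = emeasure (cf i) (A \<inter> D i \<inter> W')" if i: "i \<le> m" for i
    proof -
      have b: "A \<inter> D i \<inter> W' \<in> sets borel" "A \<inter> D i - W' \<in> sets borel" using A Dm[OF i] oW' by auto
      have "emeasure ?m (A \<inter> D i) = emeasure ?m (A \<inter> D i \<inter> W') + emeasure ?m (A \<inter> D i - W')"
        using b s by (subst plus_emeasure) (auto simp: Int_Diff_Un)
      also have "emeasure ?m (A \<inter> D i - W') = 0" by (rule chart_measure_outside[OF c' b(2)]) auto
      also have "emeasure ?m (A \<inter> D i \<inter> W') = emeasure (cf i) (A \<inter> D i \<inter> W')"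
      proof -
        obtain L'' \<nu>'' \<phi>'' where "lipschitz_graph_chart L'' S \<nu>'' \<phi>'' (Wf i)" "cf i = chart_measure \<nu>'' \<phi>'' (Wf i)"
          using chi[OF i] by blast
        then show ?thesis using chart_measures_agree[OF c' _ bS b(1)] by (auto simp: D_def)
      qed
      finally show ?thesis by simp
    qed
    show "emeasure ?m A \<le> emeasure \<mu> A"
      unfolding em[OF A] \<mu>f_def sum
      by (intro sum_mono, simp only: atMost_iff tm, rule emeasure_mono) (use A Dm csets in auto)
    show "emeasure ?m A = emeasure \<mu> A" if "A \<subseteq> W'"
      unfolding em[OF A] \<mu>f_def sum
      by (intro sum.cong refl, simp only: atMost_iff tm) (use that in \<open>metis Int_absorb2 inf.coboundedI1 \<close>)
  qed
  show thesis
  proof (rule that[OF \<mu>s])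
    show "emeasure \<mu> UNIV < \<infinity>"
    proof -
      have "emeasure (cf i) (D i) < \<infinity>" if "i \<le> m" for i
        using chi[OF that] finite_chart_measure[OF _ bS] by metis
      then show ?thesis by (subst em, simp) (auto simp: \<mu>f_def)
    qed
    have "emeasure (cf i) (- S \<inter> D i) = 0" if "i \<le> m" for i
      using chi[OF that] chart_measure_outside[of _ S _ _ "Wf i" "- S \<inter> D i"] Dm[OF that] compact_imp_closed[OF S(1)] by auto
    then show "emeasure \<mu> (- S) = 0" using compact_imp_closed[OF S(1)] by (subst em) (auto simp: \<mu>f_def)
    show "emeasure \<mu> A = emeasure (chart_measure \<nu> \<phi> W) A" if "A \<in> sets borel" "A \<subseteq> W" for A
      using eq[OF c that] by simp
    show "chart_measure \<nu>' \<phi>' W' \<le> \<mu>" if c': "lipschitz_graph_chart L' S \<nu>' \<phi>' W'" for L' \<nu>' \<phi>' W'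
    proof -
      have "emeasure (chart_measure \<nu>' \<phi>' W') A \<le> emeasure \<mu> A" for A
      proof (cases "A \<in> sets borel")
        case True then show ?thesis by (rule le[OF c'])
      next
        case False then show ?thesis using sets_chart_measure[OF c'] by (simp add: emeasure_notin_sets)
      qed
      then show ?thesis
        using sets_chart_measure[OF c'] \<mu>s sets_eq_imp_space_eq[OF \<mu>s] space_chart_measure[OF c'] by (simp add: le_measure_iff le_fun_def)
    qed
  qed
qed

text \<open>The supremum lies between the chart measure and the glued measure, which agree on
  \<open>W\<close>. The order on measures compares spaces and sigma-algebras before values, so these
  two are settled first.\<close>

lemma surface_measure_chart:
  fixes S :: "'a::euclidean_space set"
  assumes S: "compact S" "strongly_lipschitz S" and c: "lipschitz_graph_chart L S \<nu> \<phi> W"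
  shows "sets (surface_measure S) = sets borel" "emeasure (surface_measure S) UNIV < \<infinity>" "emeasure (surface_measure S) (- S) = 0"
    "\<And>A. A \<in> sets borel \<Longrightarrow> A \<subseteq> W \<Longrightarrow> emeasure (surface_measure S) A = emeasure (chart_measure \<nu> \<phi> W) A"
proof -
  obtain \<mu> where \<mu>: "sets \<mu> = sets borel" "emeasure \<mu> UNIV < \<infinity>" "emeasure \<mu> (- S) = 0"
    "\<And>A. A \<in> sets borel \<Longrightarrow> A \<subseteq> W \<Longrightarrow> emeasure \<mu> A = emeasure (chart_measure \<nu> \<phi> W) A"
    "\<And>L' \<nu>' \<phi>' W'. lipschitz_graph_chart L' S \<nu>' \<phi>' W' \<Longrightarrow> chart_measure \<nu>' \<phi>' W' \<le> \<mu>"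
    by (rule glued_chart_measure[OF S c]) blast
  have up: "surface_measure S \<le> \<mu>" unfolding surface_measure_def using \<mu>(5) by (intro SUP_least) auto
  have low: "chart_measure \<nu> \<phi> W \<le> surface_measure S"
    unfolding surface_measure_def using c by (intro SUP_upper2[of "(\<nu>, \<phi>, W)"]) auto
  have sp: "space (surface_measure S) = UNIV"
    using le_measureD1[OF low] space_chart_measure[OF c] by auto
  have sp\<mu>: "space \<mu> = UNIV" using sets_eq_imp_space_eq[OF \<mu>(1)] by simp
  show ss: "sets (surface_measure S) = sets borel"
    using le_measureD2[OF low] le_measureD2[OF up] sp sp\<mu> \<mu>(1) sets_chart_measure[OF c] space_chart_measure[OF c] by auto
  have le1: "emeasure (surface_measure S) A \<le> emeasure \<mu> A" for A
    by (rule le_measureD3[OF up]) (simp add: ss \<mu>)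
  have le2: "emeasure (chart_measure \<nu> \<phi> W) A \<le> emeasure (surface_measure S) A" for A
    by (rule le_measureD3[OF low]) (simp add: ss sets_chart_measure[OF c])
  show "emeasure (surface_measure S) UNIV < \<infinity>" using le1[of UNIV] \<mu>(2) by (rule le_less_trans)
  show "emeasure (surface_measure S) (- S) = 0" using le1[of "- S"] \<mu>(3) by simp
  show "emeasure (surface_measure S) A = emeasure (chart_measure \<nu> \<phi> W) A" if "A \<in> sets borel" "A \<subseteq> W" for A
    using le1[of A] le2[of A] \<mu>(4)[OF that] by simp
qed

lemma integral_surface_measure_chart:
  fixes S :: "'a::euclidean_space set" and g :: "'a \<Rightarrow> 'b::{banach, second_countable_topology}"
  assumes S: "compact S" "strongly_lipschitz S" and c: "lipschitz_graph_chart L S \<nu> \<phi> W"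
    and g [measurable]: "g \<in> borel_measurable borel" and g0: "\<And>x. x \<notin> W \<Longrightarrow> g x = 0"
  shows "(LINT x|surface_measure S. g x) = (LINT x|chart_measure \<nu> \<phi> W. g x)"
proof -
  note sm = surface_measure_chart[OF S c]
  have W: "W \<in> sets borel" by (rule chart_domain_measurable[OF c])
  have eq: "density (surface_measure S) (\<lambda>x. ennreal (indicator W x)) = density (chart_measure \<nu> \<phi> W) (\<lambda>x. ennreal (indicator W x))"
  proof (rule measure_eqI)
    fix A assume "A \<in> sets (density (surface_measure S) (\<lambda>x. ennreal (indicator W x)))"
    then have A: "A \<in> sets borel" by (simp add: sm(1))
    have "emeasure (density m (\<lambda>x. ennreal (indicator W x))) A = emeasure m (W \<inter> A)" if "sets m = sets borel" for m
      unfolding ennreal_indicator using A W that by (intro emeasure_restricted) auto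
    then show "emeasure (density (surface_measure S) (\<lambda>x. ennreal (indicator W x))) A = emeasure (density (chart_measure \<nu> \<phi> W) (\<lambda>x. ennreal (indicator W x))) A"
      using sm(1) sm(4)[of "W \<inter> A"] sets_chart_measure[OF c] A W by simp
  qed (simp add: sm(1) sets_chart_measure[OF c])
  have "(LINT x|m. g x) = (LINT x|density m (\<lambda>x. ennreal (indicator W x)). g x)" if m: "sets m = sets borel" for m
  proof -
    have [measurable]: "g \<in> borel_measurable m" "W \<in> sets m" using g W m by (auto cong: measurable_cong_sets)
    have "(LINT x|density m (\<lambda>x. ennreal (indicator W x)). g x) = (LINT x|m. indicator W x *\<^sub>R g x)"
      by (rule integral_density) auto
    also have "\<dots> = (LINT x|m. g x)"
      by (rule Bochner_Integration.integral_cong) (auto simp: indicator_def g0)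
    finally show ?thesis by simp
  qed
  then show ?thesis using eq sm(1) sets_chart_measure[OF c] by metis
qed

section \<open>The divergence theorem for Lipschitz boundaries\<close>

text \<open>\<open>Q\<close> is a cylinder sheared along the graph. Each of its halves is the image
  of a convex set under \<open>z + \<phi> z \<nu>\<close>, hence connected, and avoids the frontier;
  so it lies in \<open>V\<close> or misses \<open>V\<close>.\<close>

lemma chart_sides:
  assumes chart: "lipschitz_graph_chart L (frontier V) \<nu> \<phi> W" and x: "x \<in> W" "x \<in> frontier V"
  obtains Q where "open Q" "x \<in> Q" "Q \<subseteq> W"
    "Q \<inter> {z. z \<bullet> \<nu> < \<phi> z} \<subseteq> V \<or> Q \<inter> {z. z \<bullet> \<nu> < \<phi> z} \<inter> V = {}"
    "Q \<inter> {z. z \<bullet> \<nu> > \<phi> z} \<subseteq> V \<or> Q \<inter> {z. z \<bullet> \<nu> > \<phi> z} \<inter> V = {}"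
proof -
  note gf = chart_graph[OF chart]
  have L0: "L \<ge> 0" by (rule graph_function_bound_nonneg[OF gf])
  obtain r where r: "r > 0" "ball x r \<subseteq> W" using chart_open[OF chart] x(1) open_contains_ball by blast
  \<comment> \<open>A point of \<open>Q\<close> deviates from \<open>x\<close> by less than
    \<open>\<rho>\<close> horizontally and less than \<open>\<rho>\<close> from the graph, while the
    graph itself moves by at most \<open>L * \<rho>\<close>; so \<open>Q\<close> fits into the ball
    of radius \<open>r\<close> if \<open>(L + 2) * \<rho> < r\<close>.\<close>
  define \<rho> where "\<rho> = r / 2 / (L + 2)"
  have half: "a * (b / a) = b" if "a > 0" for a b :: real using that by simp
  have "L + 2 > 0" using L0 by simp
  then have \<rho>: "\<rho> > 0" "(L + 2) * \<rho> < r" using r half[of "L + 2" "r / 2"] unfolding \<rho>_def by simp_all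
  have xx: "x \<bullet> \<nu> = \<phi> x" using chart_iff[OF chart x(1)] x(2) by simp
  define hor where "hor z = (z - x) - ((z - x) \<bullet> \<nu>) *\<^sub>R \<nu>" for z
  have hor_lin: "hor ((1 - u) *\<^sub>R a + u *\<^sub>R b) = (1 - u) *\<^sub>R hor a + u *\<^sub>R hor b" for u a b
    by (simp add: hor_def inner_diff_left inner_add_left algebra_simps)
  have hor_cont: "continuous_on UNIV hor" unfolding hor_def[abs_def] by (intro continuous_intros)
  have hor_vert: "hor (z + t *\<^sub>R \<nu>) = hor z" for z t
    by (simp add: hor_def inner_diff_left inner_add_left graph_direction_unit[OF gf] algebra_simps)
  define Q where "Q = {z. norm (hor z) < \<rho> \<and> \<bar>z \<bullet> \<nu> - \<phi> z\<bar> < \<rho>}"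
  have cphi: "continuous_on UNIV \<phi>" by (rule cont_graph_function[OF gf])
  have oQ: "open Q" unfolding Q_def
    by (intro open_Collect_conj open_Collect_less continuous_intros cphi hor_cont)
  have xQ: "x \<in> Q" using \<rho> xx by (simp add: Q_def hor_def)
  have QW: "Q \<subseteq> W"
  proof
    fix z assume z: "z \<in> Q"
    have "\<phi> z = \<phi> (x + hor z)"
      using graph_function_vertical[OF gf, of "x + hor z" "(z - x) \<bullet> \<nu>"] by (simp add: hor_def)
    then have "\<bar>\<phi> z - \<phi> x\<bar> \<le> L * norm (hor z)"
      using lipschitz_onD[OF graph_function_lipschitz[OF gf], of "x + hor z" x] by (simp add: dist_norm)
    also have "\<dots> \<le> L * \<rho>" using z L0 by (intro mult_left_mono) (auto simp: Q_def)
    finally have 1: "\<bar>\<phi> z - \<phi> x\<bar> \<le> L * \<rho>" .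
    have "norm (z - x) \<le> norm (hor z) + norm (((z - x) \<bullet> \<nu>) *\<^sub>R \<nu>)"
      using norm_triangle_ineq[of "hor z" "((z - x) \<bullet> \<nu>) *\<^sub>R \<nu>"] by (simp add: hor_def)
    also have "norm (((z - x) \<bullet> \<nu>) *\<^sub>R \<nu>) = \<bar>(z \<bullet> \<nu> - \<phi> z) + (\<phi> z - \<phi> x)\<bar>"
      using xx by (simp add: graph_direction_unit[OF gf] inner_diff_left)
    finally have "norm (z - x) < (L + 2) * \<rho>"
    proof -
      assume "norm (z - x) \<le> norm (hor z) + \<bar>(z \<bullet> \<nu> - \<phi> z) + (\<phi> z - \<phi> x)\<bar>"
      moreover have "norm (hor z) < \<rho>" "\<bar>z \<bullet> \<nu> - \<phi> z\<bar> < \<rho>" using z by (auto simp: Q_def)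
      moreover have "(L + 2) * \<rho> = L * \<rho> + \<rho> + \<rho>" by (simp add: algebra_simps)
      ultimately show ?thesis using 1 by linarith
    qed
    then show "z \<in> W" using r \<rho> by (auto simp: dist_norm norm_minus_commute)
  qed
  have side: "Q \<inter> P \<subseteq> V \<or> Q \<inter> P \<inter> V = {}"
    if P: "P = {z. z \<bullet> \<nu> < \<phi> z} \<and> I = {-\<rho><..<0} \<or> P = {z. z \<bullet> \<nu> > \<phi> z} \<and> I = {0<..<\<rho>}" for P and I :: "real set"
  proof -
    have I: "convex I" using P by auto
    define B where "B = {z. norm (hor z) < \<rho> \<and> z \<bullet> \<nu> \<in> I}"
    have "convex B" unfolding convex_alt
    proof (intro ballI allI impI)
      fix a b u assume a: "a \<in> B" and b: "b \<in> B" and u: "0 \<le> u \<and> u \<le> (1::real)"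
      have "norm ((1 - u) *\<^sub>R hor a + u *\<^sub>R hor b) < \<rho>"
        using convexD_alt[OF convex_ball, of "hor a" 0 \<rho> "hor b" u] a b u by (simp add: B_def)
      moreover have "(1 - u) *\<^sub>R (a \<bullet> \<nu>) + u *\<^sub>R (b \<bullet> \<nu>) \<in> I"
        using convexD_alt[OF I, of "a \<bullet> \<nu>" "b \<bullet> \<nu>" u] a b u by (simp add: B_def)
      ultimately show "(1 - u) *\<^sub>R a + u *\<^sub>R b \<in> B" by (simp add: B_def hor_lin inner_add_left)
    qed
    moreover have "Q \<inter> P = (\<lambda>z. z + \<phi> z *\<^sub>R \<nu>) ` B"
    proof
      show "Q \<inter> P \<subseteq> (\<lambda>z. z + \<phi> z *\<^sub>R \<nu>) ` B"
      proof
        fix z assume z: "z \<in> Q \<inter> P"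
        have "z - \<phi> z *\<^sub>R \<nu> \<in> B" using z P hor_vert[of z "- \<phi> z"]
          by (auto simp: B_def Q_def inner_diff_left graph_direction_unit[OF gf] abs_less_iff)
        moreover have "z = (z - \<phi> z *\<^sub>R \<nu>) + \<phi> (z - \<phi> z *\<^sub>R \<nu>) *\<^sub>R \<nu>" by (simp add: graph_function_vertical_diff[OF gf])
        ultimately show "z \<in> (\<lambda>z. z + \<phi> z *\<^sub>R \<nu>) ` B" by blast
      qed
      show "(\<lambda>z. z + \<phi> z *\<^sub>R \<nu>) ` B \<subseteq> Q \<inter> P"
        using P by (auto simp: B_def Q_def hor_vert graph_function_vertical[OF gf] inner_add_left graph_direction_unit[OF gf])
    qed
    ultimately have "connected (Q \<inter> P)"
      by (simp only:) (intro connected_continuous_image convex_connected continuous_intros continuous_on_subset[OF cphi] subset_UNIV)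
    moreover have "Q \<inter> P \<inter> frontier V = {}" using P QW chart_iff[OF chart] by fastforce
    ultimately show ?thesis using connected_Int_frontier[of "Q \<inter> P" V] by blast
  qed
  have "{z. z \<bullet> \<nu> < \<phi> z} = {z. z \<bullet> \<nu> < \<phi> z} \<and> {-\<rho><..<0} = {-\<rho><..<0}" by simp
  note s1 = side[OF disjI1, OF this]
  have "{z. z \<bullet> \<nu> > \<phi> z} = {z. z \<bullet> \<nu> > \<phi> z} \<and> {0<..<\<rho>} = {0<..<\<rho>}" by simp
  note s2 = side[OF disjI2, OF this]
  show thesis by (rule that[OF oQ xQ QW s1 s2])
qed

lemma graph_null: 
  assumes gf: "graph_function L \<nu> \<phi>"
  shows "{z. z \<bullet> \<nu> = \<phi> z} \<in> null_sets lborel"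
proof -
  have [measurable]: "\<phi> \<in> borel_measurable borel" by (rule graph_function_measurable[OF gf])
  let ?G = "{z. z \<bullet> \<nu> = \<phi> z}"
  have [measurable]: "?G \<in> sets borel" by measurable
  have "(\<integral>\<^sup>+(t::real). indicator ?G (z + t *\<^sub>R \<nu>) \<partial>lborel) = 0" for z
  proof -
    have "(\<integral>\<^sup>+(t::real). indicator ?G (z + t *\<^sub>R \<nu>) \<partial>lborel) = (\<integral>\<^sup>+t. indicator {\<phi> z - z \<bullet> \<nu>} t \<partial>lborel)"
      by (rule nn_integral_cong) (auto simp: indicator_def inner_add_left graph_direction_unit[OF gf] graph_function_vertical[OF gf])
    then show ?thesis by simp
  qed
  then have "emeasure lborel ?G = 0"
    using nn_integral_unit_slab[of "indicator ?G" \<nu>] graph_direction_unit[OF gf] by simp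
  then show ?thesis by (simp add: null_sets_def)
qed

lemma GDERIV_cong_small:
  assumes "\<And>e. e > 0 \<Longrightarrow> \<exists>d>0. \<forall>v. norm v < d \<longrightarrow> \<bar>\<phi> (z + v) - \<phi> z - v \<bullet> g\<bar> \<le> C * e * norm v" "C > 0"
  shows "GDERIV \<phi> z :> g"
  unfolding GDERIV_alt
proof (intro allI impI)
  fix e :: real assume "e > 0"
  then have "e / C > 0" using assms(2) by simp
  from assms(1)[OF this] show "\<exists>d>0. \<forall>v. norm v < d \<longrightarrow> \<bar>\<phi> (z + v) - \<phi> z - v \<bullet> g\<bar> \<le> e * norm v"
    using assms(2) by simp
qed

text \<open>In \<open>V\<close>, and likewise outside its closure, the points \<open>x - t n\<close>
  and \<open>x + t n\<close> are on the same side for small \<open>t\<close>, so no vector crosses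
  the boundary and the default 0 is taken. Integrands containing the normal thus vanish off the
  frontier.\<close>

lemma nonfrontier_normal:
  fixes V :: "'a::euclidean_space set"
  assumes V: "open V" and x: "x \<notin> frontier V" shows "outward_normal V x = 0"
proof -
  have nb: "at_right (0::real) \<noteq> bot" by (simp add: trivial_limit_at_right_real)
  have lim: "((\<lambda>t. x + t *\<^sub>R n) \<longlongrightarrow> x + 0 *\<^sub>R n) (at_right 0)" "((\<lambda>t. x - t *\<^sub>R n) \<longlongrightarrow> x - 0 *\<^sub>R n) (at_right 0)" for n
    by (intro tendsto_intros)+
  have "\<not> is_outward_normal V x n" for n
  proof
    assume n: "is_outward_normal V x n"
    then have ev: "\<forall>\<^sub>F t in at_right 0. x - t *\<^sub>R n \<in> V \<and> x + t *\<^sub>R n \<notin> V" by (simp add: is_outward_normal_def)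
    show False
    proof (cases "x \<in> V")
      case True
      then have "\<forall>\<^sub>F t in at_right 0. x + t *\<^sub>R n \<in> V" using topological_tendstoD[OF lim(1)[of n] V] by simp
      with ev have "\<forall>\<^sub>F t in at_right (0::real). False" by eventually_elim auto
      then show False using nb by simp
    next
      case False
      then have "x \<in> - closure V" using x by (simp add: frontier_def interior_open[OF V])
      then have "\<forall>\<^sub>F t in at_right 0. x - t *\<^sub>R n \<in> - closure V"
        using topological_tendstoD[OF lim(2)[of n], of "- closure V"] by (simp add: open_Compl)
      with ev have "\<forall>\<^sub>F t in at_right (0::real). False" by eventually_elim (use closure_subset in auto)
      then show False using nb by simp
    qed
  qed
  then show ?thesis by (auto simp: outward_normal_def)
qed

lemma norm_outward_normal_le: "norm (outward_normal V x) \<le> 1"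
proof (cases "\<exists>!n. is_outward_normal V x n")
  case True
  then have "is_outward_normal V x (THE n. is_outward_normal V x n)" by (rule theI')
  then have "norm (THE n. is_outward_normal V x n) = 1"
    unfolding is_outward_normal_def[of V x "THE n. is_outward_normal V x n"] by blast
  then show ?thesis using True by (simp add: outward_normal_def)
qed (simp add: outward_normal_def)

text \<open>\<open>\<sigma>\<close> records where \<open>V\<close> lies: 1 below the graph, -1 above
  it, 0 on both sides. The last case, a slit, is compatible with a strongly Lipschitz frontier; it
  has no outward normal and contributes no flux, so the factor \<open>\<sigma>\<close> treats all
  cases alike.\<close>

locale boundary_chart =
  fixes L :: real and V :: "'a::euclidean_space set" and \<nu> \<phi> W Q and \<sigma> :: real
  assumes chart: "lipschitz_graph_chart L (frontier V) \<nu> \<phi> W"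
    and Q: "open Q" "Q \<subseteq> W" and V: "open V"
    and side: "\<sigma> = 1 \<and> Q \<inter> {z. z \<bullet> \<nu> < \<phi> z} \<subseteq> V \<and> Q \<inter> {z. z \<bullet> \<nu> > \<phi> z} \<inter> V = {}
      \<or> \<sigma> = -1 \<and> Q \<inter> {z. z \<bullet> \<nu> < \<phi> z} \<inter> V = {} \<and> Q \<inter> {z. z \<bullet> \<nu> > \<phi> z} \<subseteq> V
      \<or> \<sigma> = 0 \<and> Q \<inter> {z. z \<bullet> \<nu> < \<phi> z} \<subseteq> V \<and> Q \<inter> {z. z \<bullet> \<nu> > \<phi> z} \<subseteq> V"
begin

lemmas gf = chart_graph[OF chart]
lemmas graph_direction_unit = graph_direction_unit[OF gf] and graph_function_vertical = graph_function_vertical[OF gf] and graph_function_lipschitz = graph_function_lipschitz[OF gf] and graph_function_bound_nonneg = graph_function_bound_nonneg[OF gf]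

lemma frontier_iff: "z \<in> Q \<Longrightarrow> z \<in> frontier V \<longleftrightarrow> z \<bullet> \<nu> = \<phi> z"
  using chart_iff[OF chart] Q(2) by blast

lemma in_V_iff:
  assumes "z \<in> Q" "z \<bullet> \<nu> \<noteq> \<phi> z"
  shows "z \<in> V \<longleftrightarrow> (\<sigma> = 0 \<or> \<sigma> = 1 \<and> z \<bullet> \<nu> < \<phi> z \<or> \<sigma> = -1 \<and> z \<bullet> \<nu> > \<phi> z)"
  using side assms by (elim disjE) (force)+

text \<open>Along \<open>\<kappa> (\<nu> - g)\<close> the height over the graph has derivative
  \<open>\<kappa> * (1 + g \<bullet> g)\<close>, whose sign is that of
  \<open>\<kappa>\<close>.\<close>

lemma normal_crossing:
  assumes w: "w \<in> Q" "w \<in> frontier V" and g: "GDERIV \<phi> w :> g" and \<kappa>: "\<kappa> \<noteq> 0"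
  shows "\<forall>\<^sub>F t in at_right 0. w + t *\<^sub>R (\<kappa> *\<^sub>R (\<nu> - g)) \<in> Q \<and>
     (if \<kappa> > 0 then \<phi> (w + t *\<^sub>R (\<kappa> *\<^sub>R (\<nu> - g))) < (w + t *\<^sub>R (\<kappa> *\<^sub>R (\<nu> - g))) \<bullet> \<nu>
      else (w + t *\<^sub>R (\<kappa> *\<^sub>R (\<nu> - g))) \<bullet> \<nu> < \<phi> (w + t *\<^sub>R (\<kappa> *\<^sub>R (\<nu> - g))))"
proof -
  define n where "n = \<kappa> *\<^sub>R (\<nu> - g)"
  have ww: "w \<bullet> \<nu> = \<phi> w" using w frontier_iff by blast
  have \<nu>g: "\<nu> \<bullet> g = 0" by (rule GDERIV_orthogonal[OF gf g])
  have c: "\<kappa> * (1 + g \<bullet> g) = n \<bullet> \<nu> - n \<bullet> g"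
    using \<nu>g by (simp add: n_def inner_diff_left inner_commute[of g \<nu>] graph_direction_unit algebra_simps)
  have pos: "1 + g \<bullet> g > 0" by (simp add: add_pos_nonneg)
  have lim: "((\<lambda>t. ((w + t *\<^sub>R n) \<bullet> \<nu> - \<phi> (w + t *\<^sub>R n)) / t) \<longlongrightarrow> \<kappa> * (1 + g \<bullet> g)) (at_right 0)"
  proof -
    have "((\<lambda>t. n \<bullet> \<nu> - (\<phi> (w + t *\<^sub>R n) - \<phi> w) / t) \<longlongrightarrow> n \<bullet> \<nu> - n \<bullet> g) (at_right 0)"
      by (intro tendsto_diff tendsto_const tendsto_within_subset[OF GDERIV_imp_has_dir_deriv[OF g, of n, unfolded has_dir_deriv_def]]) simp
    moreover have "\<forall>\<^sub>F t in at_right 0. n \<bullet> \<nu> - (\<phi> (w + t *\<^sub>R n) - \<phi> w) / t = ((w + t *\<^sub>R n) \<bullet> \<nu> - \<phi> (w + t *\<^sub>R n)) / t"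
      unfolding eventually_at_right_field using ww
      by (intro exI[of _ 1]) (auto simp: inner_add_left field_simps)
    ultimately show ?thesis unfolding c by (rule Lim_transform_eventually)
  qed
  have "((\<lambda>t. w + t *\<^sub>R n) \<longlongrightarrow> w + 0 *\<^sub>R n) (at_right 0)" by (intro tendsto_intros)
  then have evQ: "\<forall>\<^sub>F t in at_right 0. w + t *\<^sub>R n \<in> Q" using topological_tendstoD[OF _ Q(1)] w(1) by fastforce
  have evpos: "\<forall>\<^sub>F t in at_right (0::real). t > 0" by (rule eventually_at_right_less)
  show ?thesis
  proof (cases "\<kappa> > 0")
    case True
    then have "0 < \<kappa> * (1 + g \<bullet> g)" using pos by simp
    from order_tendstoD(1)[OF lim this] have "\<forall>\<^sub>F t in at_right 0. 0 < ((w + t *\<^sub>R n) \<bullet> \<nu> - \<phi> (w + t *\<^sub>R n)) / t" .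
    with evQ evpos show ?thesis unfolding n_def[symmetric]
      by eventually_elim (use True in \<open>auto simp: zero_less_divide_iff\<close>)
  next
    case False
    then have "\<kappa> * (1 + g \<bullet> g) < 0" using \<kappa> pos by (simp add: mult_less_0_iff)
    from order_tendstoD(2)[OF lim this] have "\<forall>\<^sub>F t in at_right 0. ((w + t *\<^sub>R n) \<bullet> \<nu> - \<phi> (w + t *\<^sub>R n)) / t < 0" .
    with evQ evpos show ?thesis unfolding n_def[symmetric]
      by eventually_elim (use False in \<open>auto simp: divide_less_0_iff\<close>)
  qed
qed

lemma norm_normal:
  assumes "GDERIV \<phi> w :> g"
  shows "norm (\<nu> - g) = sqrt (1 + (norm g)\<^sup>2)"
proof -
  have "\<nu> \<bullet> g = 0" by (rule GDERIV_orthogonal[OF gf assms])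
  then have "(\<nu> - g) \<bullet> (\<nu> - g) = 1 + (norm g)\<^sup>2"
    unfolding inner_diff_left inner_diff_right inner_commute[of g \<nu>] using graph_direction_unit by (simp add: dot_square_norm)
  then show ?thesis by (simp add: norm_eq_sqrt_inner)
qed

text \<open>A tangent plane to the frontier already forces differentiability. The vector from
  \<open>w\<close> to the graph point over \<open>w + v\<close> is \<open>v\<close> plus a multiple
  of \<open>\<nu>\<close>, its product with \<open>n\<close> is small compared with
  \<open>v\<close>, and since \<open>\<nu> \<bullet> n\<close> is nonzero this can be solved for the
  increment of \<open>\<phi>\<close>.\<close>

lemma outward_normal_imp_derivative:
  assumes w: "w \<in> Q" "w \<in> frontier V" and n: "is_outward_normal V w n"
  obtains g \<kappa> where "GDERIV \<phi> w :> g" "\<kappa> \<noteq> 0" "n = \<kappa> *\<^sub>R (\<nu> - g)"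
proof -
  have n1: "norm n = 1" "n \<bullet> n = 1" and lim: "((\<lambda>z. (z - w) \<bullet> n / norm (z - w)) \<longlongrightarrow> 0) (at w within frontier V)"
    using n by (auto simp: is_outward_normal_def dot_square_norm)
  have ww: "w \<bullet> \<nu> = \<phi> w" using w frontier_iff by blast
  define \<kappa> where "\<kappa> = \<nu> \<bullet> n"
  have LL: "L + 2 > 0" using graph_function_bound_nonneg by simp
  have key: "\<exists>d>0. \<forall>v. norm v < d \<longrightarrow> \<bar>v \<bullet> n + (\<phi> (w + v) - \<phi> w - v \<bullet> \<nu>) * \<kappa>\<bar> \<le> e * ((L + 2) * norm v)" if epos: "e > 0" for e
  proof -
    obtain d1 where d1: "d1 > 0" "\<And>z. z \<in> frontier V \<Longrightarrow> z \<noteq> w \<Longrightarrow> dist z w < d1 \<Longrightarrow> \<bar>(z - w) \<bullet> n / norm (z - w)\<bar> < e"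
      using tendstoD[OF lim epos] by (auto simp: eventually_at dist_real_def)
    obtain d2 where d2: "d2 > 0" "ball w d2 \<subseteq> Q" using Q(1) w(1) open_contains_ball by blast
    show ?thesis
    proof (intro exI[of _ "min d1 d2 / (L + 2)"] conjI allI impI)
      show "min d1 d2 / (L + 2) > 0" using d1 d2 LL by simp
      fix v :: 'a assume v: "norm v < min d1 d2 / (L + 2)"
      define z where "z = graph_point \<nu> \<phi> (w + v)"
      have zw: "z - w = v + (\<phi> (w + v) - \<phi> w - v \<bullet> \<nu>) *\<^sub>R \<nu>"
        using ww by (simp add: z_def graph_point_def inner_add_left)
      have "norm (z - w) \<le> norm v + \<bar>\<phi> (w + v) - \<phi> w - v \<bullet> \<nu>\<bar>"
        unfolding zw using norm_triangle_ineq[of v "(\<phi> (w + v) - \<phi> w - v \<bullet> \<nu>) *\<^sub>R \<nu>"] by (simp add: graph_direction_unit)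
      moreover have "\<bar>\<phi> (w + v) - \<phi> w\<bar> \<le> L * norm v"
        using lipschitz_onD[OF graph_function_lipschitz, of "w + v" w] by (simp add: dist_norm)
      moreover have "\<bar>v \<bullet> \<nu>\<bar> \<le> norm v" using Cauchy_Schwarz_ineq2[of v \<nu>] by (simp add: graph_direction_unit)
      ultimately have nz: "norm (z - w) \<le> (L + 2) * norm v" by (simp add: algebra_simps)
      also have "\<dots> < min d1 d2" using v LL by (simp add: pos_less_divide_eq mult.commute)
      finally have small: "norm (z - w) < d1" "norm (z - w) < d2" by auto
      have "z \<in> Q" using small d2 by (auto simp: dist_norm norm_minus_commute)
      then have zf: "z \<in> frontier V" using frontier_iff by (simp add: z_def height_graph_point[OF gf] phi_graph_point[OF gf])
      have "\<bar>(z - w) \<bullet> n\<bar> \<le> e * norm (z - w)"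
      proof (cases "z = w")
        case False
        then show ?thesis using d1(2)[OF zf False] small by (simp add: dist_norm abs_divide divide_less_eq)
      qed simp
      also have "\<dots> \<le> e * ((L + 2) * norm v)" using nz epos by (intro mult_left_mono) auto
      finally show "\<bar>v \<bullet> n + (\<phi> (w + v) - \<phi> w - v \<bullet> \<nu>) * \<kappa>\<bar> \<le> e * ((L + 2) * norm v)"
        unfolding zw by (simp add: inner_add_left \<kappa>_def)
    qed
  qed
  have \<kappa>: "\<kappa> \<noteq> 0"
  proof
    assume "\<kappa> = 0"
    \<comment> \<open>With this precision \<open>key\<close> gives
      \<open>|v \<bullet> n| \<le> |v| / 2\<close> for small \<open>v\<close>, which fails for
      multiples of the unit vector \<open>n\<close>.\<close>
    have "1 / (2 * (L + 2)) > 0" using LL by simp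
    from key[OF this] obtain d where d: "d > 0" "\<And>v. norm v < d \<Longrightarrow> \<bar>v \<bullet> n\<bar> \<le> 1 / (2 * (L + 2)) * ((L + 2) * norm v)"
      using \<open>\<kappa> = 0\<close> by auto
    have "\<bar>(d / 2) *\<^sub>R n \<bullet> n\<bar> \<le> 1 / (2 * (L + 2)) * ((L + 2) * norm ((d / 2) *\<^sub>R n))"
      using d(1) n1 by (intro d(2)) simp
    also have "\<dots> = d / 4" using LL d(1) n1 by (simp add: divide_simps)
    finally show False using d(1) n1 by simp
  qed
  have "GDERIV \<phi> w :> (\<nu> - (1 / \<kappa>) *\<^sub>R n)"
  proof (rule GDERIV_cong_small)
    show "(L + 2) / \<bar>\<kappa>\<bar> > 0" using LL \<kappa> by simp
    fix e :: real assume "e > 0"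
    then obtain d where d: "d > 0" "\<And>v. norm v < d \<Longrightarrow> \<bar>v \<bullet> n + (\<phi> (w + v) - \<phi> w - v \<bullet> \<nu>) * \<kappa>\<bar> \<le> e * ((L + 2) * norm v)"
      using key by blast
    show "\<exists>d>0. \<forall>v. norm v < d \<longrightarrow> \<bar>\<phi> (w + v) - \<phi> w - v \<bullet> (\<nu> - (1 / \<kappa>) *\<^sub>R n)\<bar> \<le> (L + 2) / \<bar>\<kappa>\<bar> * e * norm v"
    proof (intro exI[of _ d] conjI d(1) allI impI)
      fix v :: 'a assume v: "norm v < d"
      have "\<phi> (w + v) - \<phi> w - v \<bullet> (\<nu> - (1 / \<kappa>) *\<^sub>R n) = (v \<bullet> n + (\<phi> (w + v) - \<phi> w - v \<bullet> \<nu>) * \<kappa>) / \<kappa>"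
        using \<kappa> by (simp add: inner_diff_right field_simps)
      then have "\<bar>\<phi> (w + v) - \<phi> w - v \<bullet> (\<nu> - (1 / \<kappa>) *\<^sub>R n)\<bar> = \<bar>v \<bullet> n + (\<phi> (w + v) - \<phi> w - v \<bullet> \<nu>) * \<kappa>\<bar> / \<bar>\<kappa>\<bar>"
        by (simp add: abs_divide)
      also have "\<dots> \<le> e * ((L + 2) * norm v) / \<bar>\<kappa>\<bar>" using d(2)[OF v] by (rule divide_right_mono) simp
      finally show "\<bar>\<phi> (w + v) - \<phi> w - v \<bullet> (\<nu> - (1 / \<kappa>) *\<^sub>R n)\<bar> \<le> (L + 2) / \<bar>\<kappa>\<bar> * e * norm v"
        by (simp add: mult_ac)
    qed
  qed
  moreover have "n = \<kappa> *\<^sub>R (\<nu> - (\<nu> - (1 / \<kappa>) *\<^sub>R n))" using \<kappa> by simp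
  ultimately show thesis using that \<kappa> by blast
qed

text \<open>Equivalence at every point of the frontier, not just almost everywhere: it shows that
  the normal is unique and takes the default 0 exactly in a slit or where \<open>\<phi>\<close> is
  not differentiable, which is what makes it measurable.\<close>

lemma is_outward_normal_iff:
  assumes w: "w \<in> Q" "w \<in> frontier V"
  shows "is_outward_normal V w n \<longleftrightarrow> \<sigma> \<noteq> 0 \<and> (\<exists>g. GDERIV \<phi> w :> g \<and> n = (\<sigma> / sqrt (1 + (norm g)\<^sup>2)) *\<^sub>R (\<nu> - g))"
proof
  assume n: "is_outward_normal V w n"
  obtain g \<kappa> where g: "GDERIV \<phi> w :> g" "\<kappa> \<noteq> 0" "n = \<kappa> *\<^sub>R (\<nu> - g)"
    by (rule outward_normal_imp_derivative[OF w n])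
  define s where "s = sqrt (1 + (norm g)\<^sup>2)"
  have s: "s > 0" by (simp add: s_def add_pos_nonneg)
  have "norm n = 1" using n by (simp add: is_outward_normal_def)
  moreover have "norm n = \<bar>\<kappa>\<bar> * s" by (simp only: g(3) norm_scaleR norm_normal[OF g(1)] s_def real_norm_def)
  ultimately have ks: "\<bar>\<kappa>\<bar> = 1 / s" using s by (simp add: field_simps)
  have ev: "\<forall>\<^sub>F t in at_right 0. w - t *\<^sub>R n \<in> V \<and> w + t *\<^sub>R n \<notin> V" using n by (simp add: is_outward_normal_def)
  have mk: "- \<kappa> \<noteq> 0" using g(2) by simp
  have sg: "\<sigma> = sgn \<kappa>"
  proof -
    have ev2: "\<forall>\<^sub>F t in at_right 0. (w - t *\<^sub>R n \<in> V \<and> w + t *\<^sub>R n \<notin> V)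
     \<and> (w + t *\<^sub>R (\<kappa> *\<^sub>R (\<nu> - g)) \<in> Q \<and>
     (if \<kappa> > 0 then \<phi> (w + t *\<^sub>R (\<kappa> *\<^sub>R (\<nu> - g))) < (w + t *\<^sub>R (\<kappa> *\<^sub>R (\<nu> - g))) \<bullet> \<nu>
      else (w + t *\<^sub>R (\<kappa> *\<^sub>R (\<nu> - g))) \<bullet> \<nu> < \<phi> (w + t *\<^sub>R (\<kappa> *\<^sub>R (\<nu> - g)))))
     \<and> (w + t *\<^sub>R (- \<kappa> *\<^sub>R (\<nu> - g)) \<in> Q \<and>
     (if - \<kappa> > 0 then \<phi> (w + t *\<^sub>R (- \<kappa> *\<^sub>R (\<nu> - g))) < (w + t *\<^sub>R (- \<kappa> *\<^sub>R (\<nu> - g))) \<bullet> \<nu>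
      else (w + t *\<^sub>R (- \<kappa> *\<^sub>R (\<nu> - g))) \<bullet> \<nu> < \<phi> (w + t *\<^sub>R (- \<kappa> *\<^sub>R (\<nu> - g)))))"
      by (intro eventually_conj ev normal_crossing[OF w g(1,2)] normal_crossing[OF w g(1) mk])
    have nb: "at_right (0::real) \<noteq> bot" by (simp add: trivial_limit_at_right_real)
    obtain t where a: "w - t *\<^sub>R n \<in> V \<and> w + t *\<^sub>R n \<notin> V"
     and b: "w + t *\<^sub>R (\<kappa> *\<^sub>R (\<nu> - g)) \<in> Q \<and>
     (if \<kappa> > 0 then \<phi> (w + t *\<^sub>R (\<kappa> *\<^sub>R (\<nu> - g))) < (w + t *\<^sub>R (\<kappa> *\<^sub>R (\<nu> - g))) \<bullet> \<nu>
      else (w + t *\<^sub>R (\<kappa> *\<^sub>R (\<nu> - g))) \<bullet> \<nu> < \<phi> (w + t *\<^sub>R (\<kappa> *\<^sub>R (\<nu> - g))))"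
     and c: "w + t *\<^sub>R (- \<kappa> *\<^sub>R (\<nu> - g)) \<in> Q \<and>
     (if - \<kappa> > 0 then \<phi> (w + t *\<^sub>R (- \<kappa> *\<^sub>R (\<nu> - g))) < (w + t *\<^sub>R (- \<kappa> *\<^sub>R (\<nu> - g))) \<bullet> \<nu>
      else (w + t *\<^sub>R (- \<kappa> *\<^sub>R (\<nu> - g))) \<bullet> \<nu> < \<phi> (w + t *\<^sub>R (- \<kappa> *\<^sub>R (\<nu> - g))))"
      using eventually_happens'[OF nb ev2] by blast
    have m: "w - t *\<^sub>R n = w + t *\<^sub>R (- \<kappa> *\<^sub>R (\<nu> - g))" by (simp add: g(3))
    have p: "w + t *\<^sub>R n = w + t *\<^sub>R (\<kappa> *\<^sub>R (\<nu> - g))" by (simp add: g(3))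
    show "\<sigma> = sgn \<kappa>"
    proof (cases "\<kappa> > 0")
      case True
      have "w - t *\<^sub>R n \<in> Q" "(w - t *\<^sub>R n) \<bullet> \<nu> < \<phi> (w - t *\<^sub>R n)" using c True unfolding m[symmetric] by auto
      moreover have "w + t *\<^sub>R n \<in> Q" "\<phi> (w + t *\<^sub>R n) < (w + t *\<^sub>R n) \<bullet> \<nu>" using b True unfolding p[symmetric] by auto
      ultimately have "\<sigma> = 1" using a in_V_iff[of "w - t *\<^sub>R n"] in_V_iff[of "w + t *\<^sub>R n"] by auto
      then show ?thesis using True by simp
    next
      case False
      then have F: "\<kappa> < 0" using g(2) by simp
      have "w - t *\<^sub>R n \<in> Q" "(w - t *\<^sub>R n) \<bullet> \<nu> > \<phi> (w - t *\<^sub>R n)" using c F unfolding m[symmetric] by auto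
      moreover have "w + t *\<^sub>R n \<in> Q" "\<phi> (w + t *\<^sub>R n) > (w + t *\<^sub>R n) \<bullet> \<nu>" using b F unfolding p[symmetric] by auto
      ultimately have "\<sigma> = -1" using a in_V_iff[of "w - t *\<^sub>R n"] in_V_iff[of "w + t *\<^sub>R n"] by auto
      then show ?thesis using F by simp
    qed
  qed
  then have "\<kappa> = \<sigma> / s" using ks g(2) s by (auto simp: sgn_if split: if_splits)
  then show "\<sigma> \<noteq> 0 \<and> (\<exists>g. GDERIV \<phi> w :> g \<and> n = (\<sigma> / sqrt (1 + (norm g)\<^sup>2)) *\<^sub>R (\<nu> - g))"
    using g sg by (auto simp: s_def sgn_0_0)
next
  assume R: "\<sigma> \<noteq> 0 \<and> (\<exists>g. GDERIV \<phi> w :> g \<and> n = (\<sigma> / sqrt (1 + (norm g)\<^sup>2)) *\<^sub>R (\<nu> - g))"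
  then obtain g where g: "GDERIV \<phi> w :> g" and n: "n = (\<sigma> / sqrt (1 + (norm g)\<^sup>2)) *\<^sub>R (\<nu> - g)" by blast
  define s where "s = sqrt (1 + (norm g)\<^sup>2)"
  have s: "s \<ge> 1" by (simp add: s_def)
  have \<sigma>: "\<sigma> = 1 \<or> \<sigma> = -1" using side R by auto
  have n': "n = (\<sigma> / s) *\<^sub>R (\<nu> - g)" by (simp add: n s_def)
  have ww: "w \<bullet> \<nu> = \<phi> w" using w frontier_iff by blast
  show "is_outward_normal V w n" unfolding is_outward_normal_def
  proof (intro conjI)
    show "norm n = 1" using \<sigma> s norm_normal[OF g] by (auto simp: n' s_def[symmetric])
    show "((\<lambda>z. (z - w) \<bullet> n / norm (z - w)) \<longlongrightarrow> 0) (at w within frontier V)"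
      unfolding tendsto_iff
    proof (intro allI impI)
      fix e :: real assume e: "e > 0"
      then obtain d where d: "d > 0" "\<And>v. norm v < d \<Longrightarrow> \<bar>\<phi> (w + v) - \<phi> w - v \<bullet> g\<bar> \<le> e / 2 * norm v"
        using g unfolding GDERIV_alt by (metis half_gt_zero)
      obtain d2 where d2: "d2 > 0" "ball w d2 \<subseteq> Q" using Q(1) w(1) open_contains_ball by blast
      show "\<forall>\<^sub>F z in at w within frontier V. dist ((z - w) \<bullet> n / norm (z - w)) 0 < e"
        unfolding eventually_at
      proof (intro exI[of _ "min d d2"] conjI ballI impI)
        show "min d d2 > 0" using d d2 by simp
        fix z assume z: "z \<in> frontier V" "z \<noteq> w \<and> dist z w < min d d2"
        have "z \<in> Q" using z(2) d2 by (auto simp: dist_commute)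
        then have zz: "z \<bullet> \<nu> = \<phi> z" using frontier_iff z(1) by blast
        have "\<bar>(z - w) \<bullet> n\<bar> = \<bar>\<phi> z - \<phi> w - (z - w) \<bullet> g\<bar> / s"
          using \<sigma> s zz ww by (auto simp: n' inner_diff_right inner_diff_left abs_divide abs_minus_commute)
        also have "\<dots> \<le> \<bar>\<phi> z - \<phi> w - (z - w) \<bullet> g\<bar>" using s by (simp add: divide_le_eq mult_le_cancel_left1)
        also have "\<dots> \<le> e / 2 * norm (z - w)" using d(2)[of "z - w"] z(2) by (simp add: dist_norm)
        also have "\<dots> < e * norm (z - w)" using e z(2) by simp
        finally show "dist ((z - w) \<bullet> n / norm (z - w)) 0 < e"
          using z(2) by (simp add: abs_divide divide_less_eq)
      qed
    qed
    have k1: "\<sigma> / s \<noteq> 0" "- (\<sigma> / s) \<noteq> 0" using \<sigma> s by auto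
    show "\<forall>\<^sub>F t in at_right 0. w - t *\<^sub>R n \<in> V \<and> w + t *\<^sub>R n \<notin> V"
      using normal_crossing[OF w g k1(1)] normal_crossing[OF w g k1(2)]
    proof eventually_elim
      fix t
      assume b: "w + t *\<^sub>R ((\<sigma> / s) *\<^sub>R (\<nu> - g)) \<in> Q \<and>
       (if \<sigma> / s > 0 then \<phi> (w + t *\<^sub>R ((\<sigma> / s) *\<^sub>R (\<nu> - g))) < (w + t *\<^sub>R ((\<sigma> / s) *\<^sub>R (\<nu> - g))) \<bullet> \<nu>
        else (w + t *\<^sub>R ((\<sigma> / s) *\<^sub>R (\<nu> - g))) \<bullet> \<nu> < \<phi> (w + t *\<^sub>R ((\<sigma> / s) *\<^sub>R (\<nu> - g))))"
      and c: "w + t *\<^sub>R (- (\<sigma> / s) *\<^sub>R (\<nu> - g)) \<in> Q \<and>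
       (if - (\<sigma> / s) > 0 then \<phi> (w + t *\<^sub>R (- (\<sigma> / s) *\<^sub>R (\<nu> - g))) < (w + t *\<^sub>R (- (\<sigma> / s) *\<^sub>R (\<nu> - g))) \<bullet> \<nu>
        else (w + t *\<^sub>R (- (\<sigma> / s) *\<^sub>R (\<nu> - g))) \<bullet> \<nu> < \<phi> (w + t *\<^sub>R (- (\<sigma> / s) *\<^sub>R (\<nu> - g))))"
      have m: "w + t *\<^sub>R (- (\<sigma> / s) *\<^sub>R (\<nu> - g)) = w - t *\<^sub>R n" by (simp add: n')
      have p: "w + t *\<^sub>R ((\<sigma> / s) *\<^sub>R (\<nu> - g)) = w + t *\<^sub>R n" by (simp add: n')
      show "w - t *\<^sub>R n \<in> V \<and> w + t *\<^sub>R n \<notin> V"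
        using b c \<sigma> s in_V_iff[of "w - t *\<^sub>R n"] in_V_iff[of "w + t *\<^sub>R n"] unfolding m p
        by (auto simp: zero_less_divide_iff split: if_splits)
    qed
  qed
qed

lemma outward_normal_eq:
  assumes w: "w \<in> Q" "w \<in> frontier V"
  shows "outward_normal V w = (\<sigma> / sqrt (1 + (norm (gradient \<phi> w))\<^sup>2)) *\<^sub>R (indicator {z. \<exists>g. GDERIV \<phi> z :> g} w *\<^sub>R (\<nu> - gradient \<phi> w))"
proof (cases "\<exists>g. GDERIV \<phi> w :> g")
  case True
  then obtain g where g: "GDERIV \<phi> w :> g" by blast
  have uniq: "(\<exists>g. GDERIV \<phi> w :> g \<and> n = (\<sigma> / sqrt (1 + (norm g)\<^sup>2)) *\<^sub>R (\<nu> - g)) \<longleftrightarrow> n = (\<sigma> / sqrt (1 + (norm g)\<^sup>2)) *\<^sub>R (\<nu> - g)" for n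
    using g gradient_eq by blast
  have i: "is_outward_normal V w = (\<lambda>n. \<sigma> \<noteq> 0 \<and> n = (\<sigma> / sqrt (1 + (norm g)\<^sup>2)) *\<^sub>R (\<nu> - g))"
    by (rule ext) (simp add: is_outward_normal_iff[OF w] uniq)
  show ?thesis unfolding outward_normal_def i
    using g by (cases "\<sigma> = 0") (auto simp: gradient_eq[OF g] indicator_def)
next
  case False
  have "\<not> is_outward_normal V w n" for n using is_outward_normal_iff[OF w, of n] False by blast
  then show ?thesis using False by (auto simp: outward_normal_def)
qed


section \<open>The flux through one boundary chart\<close>

lemmas [measurable] = graph_function_measurable[OF gf] graph_point_measurable[OF gf] gradient_measurable'[OF gf]

lemma differentiable_points_measurable [measurable]: "{z. \<exists>g. GDERIV \<phi> z :> g} \<in> sets borel"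
  by (rule differentiable_set_measurable[OF cont_graph_function[OF gf]])

text \<open>A function on the whole space, visibly Borel, that agrees with the outward normal on the
  part of the frontier in \<open>Q\<close>.\<close>

definition normal_field :: "'a \<Rightarrow> 'a" where
  "normal_field w = (\<sigma> / sqrt (1 + (norm (gradient \<phi> w))\<^sup>2)) *\<^sub>R (indicator {z. \<exists>g. GDERIV \<phi> z :> g} w *\<^sub>R (\<nu> - gradient \<phi> w))"

lemma normal_field_measurable [measurable]: "normal_field \<in> borel_measurable borel"
  unfolding normal_field_def[abs_def] by measurable

context
  fixes G :: "'a \<Rightarrow> real" and K
  assumes G: "continuous_on UNIV G" and K: "compact K" "K \<subseteq> Q" "\<And>x. x \<notin> K \<Longrightarrow> G x = 0"
    and S: "compact (frontier V)" "strongly_lipschitz (frontier V)"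
begin

lemma G_normal: "G x * (e \<bullet> outward_normal V x) = G x * (e \<bullet> (indicator (frontier V) x *\<^sub>R normal_field x))"
  using K nonfrontier_normal[OF V, of x] outward_normal_eq[of x] by (cases "x \<in> K"; cases "x \<in> frontier V") (auto simp: normal_field_def)

lemma G_measurable [measurable]: "G \<in> borel_measurable borel" by (rule borel_measurable_continuous_onI[OF G])

lemma G_normal_measurable [measurable]: "(\<lambda>x. G x * (e \<bullet> outward_normal V x)) \<in> borel_measurable borel"
proof -
  have [measurable]: "frontier V \<in> sets borel" by simp
  show ?thesis unfolding G_normal by measurable
qed

lemma G_normal_integrable: "integrable (surface_measure (frontier V)) (\<lambda>x. G x * (e \<bullet> outward_normal V x))"
proof -
  note sm = surface_measure_chart[OF S chart]
  have fm: "finite_measure (surface_measure (frontier V))"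
    using sm(2) sets_eq_imp_space_eq[OF sm(1)] by (intro finite_measureI) (simp add: less_top)
  have "compact (G ` K)" by (intro compact_continuous_image continuous_on_subset[OF G] K) auto
  then obtain B where B: "\<And>x. x \<in> K \<Longrightarrow> \<bar>G x\<bar> \<le> B" using compact_imp_bounded bounded_iff by (metis imageI real_norm_def)
  show ?thesis
  proof (rule finite_measure.integrable_const_bound[OF fm, where B="\<bar>B\<bar> * norm e"])
    have "norm (G x * (e \<bullet> outward_normal V x)) \<le> \<bar>B\<bar> * norm e" for x
    proof -
      have "norm e * norm (outward_normal V x) \<le> norm e * 1"
        by (intro mult_left_mono norm_outward_normal_le) simp
      then have "\<bar>e \<bullet> outward_normal V x\<bar> \<le> norm e"
        using Cauchy_Schwarz_ineq2[of e "outward_normal V x"] by linarith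
      moreover have "\<bar>G x\<bar> \<le> \<bar>B\<bar>" using B[of x] K(3)[of x] by (cases "x \<in> K") auto
      ultimately show ?thesis unfolding real_norm_def abs_mult by (intro mult_mono) auto
    qed
    then show "AE x in surface_measure (frontier V). norm (G x * (e \<bullet> outward_normal V x)) \<le> \<bar>B\<bar> * norm e" by simp
    show "(\<lambda>x. G x * (e \<bullet> outward_normal V x)) \<in> borel_measurable (surface_measure (frontier V))"
      using G_normal_measurable by (simp add: measurable_cong_sets[OF sm(1) refl])
  qed
qed

text \<open>Near the support of \<open>G\<close> the set \<open>V\<close> is, up to the null graph,
  the subgraph \<open>A\<close>, its complement or everything, so translation differences of
  \<open>V\<close> are \<open>\<sigma>\<close> times those of \<open>A\<close>. On the other side,
  the length of \<open>\<nu> - gradient \<phi> z\<close> cancels against the chart density.\<close>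

lemma local_flux:
  assumes h: "\<And>n. h n > 0" "h \<longlonglongrightarrow> 0"
  shows "(\<lambda>n. (1 / h n) * (LINT x|lborel. (indicator V (x - h n *\<^sub>R e) - indicator V x) * G x))
     \<longlonglongrightarrow> (LINT x|surface_measure (frontier V). G x * (e \<bullet> outward_normal V x))"
proof -
  define A where "A = {z. z \<bullet> \<nu> < \<phi> z}"
  have [measurable]: "A \<in> sets borel" "V \<in> sets borel" unfolding A_def using V by measurable
  obtain R where R: "\<And>x. x \<in> K \<Longrightarrow> norm x \<le> R" using compact_imp_bounded[OF K(1)] by (auto simp: bounded_iff)
  have G0: "G x = 0" if "R < norm x" for x using R[of x] K(3)[of x] that by force
  have lim: "(\<lambda>n. \<sigma> * ((1 / h n) * (LINT x|lborel. (indicator A (x - h n *\<^sub>R e) - indicator A x) * G x)))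
     \<longlonglongrightarrow> \<sigma> * (LINT z|lborel. indicator (unit_slab \<nu>) z * (G (graph_point \<nu> \<phi> z) * (e \<bullet> (\<nu> - gradient \<phi> z))))"
    unfolding A_def by (intro tendsto_mult_left subgraph_flux[OF gf G G0 h])
  have "(LINT x|surface_measure (frontier V). G x * (e \<bullet> outward_normal V x)) = (LINT x|chart_measure \<nu> \<phi> W. G x * (e \<bullet> outward_normal V x))"
    by (rule integral_surface_measure_chart[OF S chart]) (use K Q in auto)
  also have "\<dots> = (LINT z|lborel. chart_density \<nu> \<phi> W z *\<^sub>R (G (graph_point \<nu> \<phi> z) * (e \<bullet> outward_normal V (graph_point \<nu> \<phi> z))))"
    by (rule integral_chart_measure[OF chart]) measurable
  also have "\<dots> = (LINT z|lborel. \<sigma> * (indicator (unit_slab \<nu>) z * (G (graph_point \<nu> \<phi> z) * (e \<bullet> (\<nu> - gradient \<phi> z)))))"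
  proof (rule integral_cong_AE)
    show "AE z in lborel. chart_density \<nu> \<phi> W z *\<^sub>R (G (graph_point \<nu> \<phi> z) * (e \<bullet> outward_normal V (graph_point \<nu> \<phi> z)))
      = \<sigma> * (indicator (unit_slab \<nu>) z * (G (graph_point \<nu> \<phi> z) * (e \<bullet> (\<nu> - gradient \<phi> z))))"
      using rademacher[OF graph_function_lipschitz]
    proof eventually_elim
      fix z assume z: "\<exists>g. GDERIV \<phi> z :> g"
      let ?x = "graph_point \<nu> \<phi> z"
      show "chart_density \<nu> \<phi> W z *\<^sub>R (G ?x * (e \<bullet> outward_normal V ?x)) = \<sigma> * (indicator (unit_slab \<nu>) z * (G ?x * (e \<bullet> (\<nu> - gradient \<phi> z))))"
      proof (cases "?x \<in> K")
        case True
        then have xQ: "?x \<in> Q" and xW: "?x \<in> W" using K Q by auto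
        then have xf: "?x \<in> frontier V" using graph_point_in_S[OF chart] by blast
        have d: "\<exists>g. GDERIV \<phi> ?x :> g" using z GDERIV_graph_point[OF gf] by blast
        have pos: "sqrt (1 + (norm (gradient \<phi> z))\<^sup>2) \<noteq> 0"
          by (metis add_pos_nonneg less_irrefl real_sqrt_eq_zero_cancel_iff zero_le_power2 zero_less_one)
        have "outward_normal V ?x = (\<sigma> / sqrt (1 + (norm (gradient \<phi> z))\<^sup>2)) *\<^sub>R (\<nu> - gradient \<phi> z)"
          using outward_normal_eq[OF xQ xf] d by (simp add: gradient_graph_point[OF gf] indicator_def)
        then show ?thesis using xW pos by (simp add: chart_density_def)
      qed (use K in simp)
    qed
    have "(\<lambda>z. G (graph_point \<nu> \<phi> z) * (e \<bullet> outward_normal V (graph_point \<nu> \<phi> z))) \<in> borel_measurable borel"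
      by (rule measurable_compose[OF graph_point_measurable[OF gf] G_normal_measurable])
    then show "(\<lambda>z. chart_density \<nu> \<phi> W z *\<^sub>R (G (graph_point \<nu> \<phi> z) * (e \<bullet> outward_normal V (graph_point \<nu> \<phi> z)))) \<in> borel_measurable lborel"
      using chart_density_measurable[OF chart] by simp
  qed measurable
  also have "\<dots> = \<sigma> * (LINT z|lborel. indicator (unit_slab \<nu>) z * (G (graph_point \<nu> \<phi> z) * (e \<bullet> (\<nu> - gradient \<phi> z))))" by simp
  finally have eq: "(LINT x|surface_measure (frontier V). G x * (e \<bullet> outward_normal V x)) = \<dots>" .
  obtain \<delta> where \<delta>: "\<delta> > 0" "\<And>x. x \<in> K \<Longrightarrow> ball x \<delta> \<subseteq> Q"
    using compact_subset_open_imp_ball_epsilon_subset[OF K(1) Q(1) K(2)] by (metis UN_subset_iff)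
  have "(\<lambda>n. h n * norm e) \<longlonglongrightarrow> 0 * norm e" by (intro tendsto_intros h)
  then have "\<forall>\<^sub>F n in sequentially. h n * norm e < \<delta>" using \<delta>(1) by (intro order_tendstoD) auto
  then have "\<forall>\<^sub>F n in sequentially. \<sigma> * ((1 / h n) * (LINT x|lborel. (indicator A (x - h n *\<^sub>R e) - indicator A x) * G x))
      = (1 / h n) * (LINT x|lborel. (indicator V (x - h n *\<^sub>R e) - indicator V x) * G x)"
  proof eventually_elim
    case (elim n)
    have null1: "AE x in lborel. x \<bullet> \<nu> \<noteq> \<phi> x" using AE_not_in[OF graph_null[OF gf]] by simp
    have null2: "AE x in lborel. (x - h n *\<^sub>R e) \<bullet> \<nu> \<noteq> \<phi> (x - h n *\<^sub>R e)"
    proof -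
      let ?G = "{z. z \<bullet> \<nu> = \<phi> z}" and ?H = "{x. (x - h n *\<^sub>R e) \<bullet> \<nu> = \<phi> (x - h n *\<^sub>R e)}"
      have [measurable]: "?G \<in> sets borel" "?H \<in> sets borel" by measurable
      have "emeasure lborel ?H = (\<integral>\<^sup>+x. indicator ?H x \<partial>lborel)" by simp
      also have "\<dots> = (\<integral>\<^sup>+x. indicator ?G (x + (- h n *\<^sub>R e)) \<partial>lborel)"
        by (intro nn_integral_cong) (auto simp: indicator_def)
      also have "\<dots> = (\<integral>\<^sup>+x. indicator ?G x \<partial>lborel)"
        by (rule nn_integral_lborel_translate) measurable
      also have "\<dots> = 0" using graph_null[OF gf] by (simp add: null_sets_def)
      finally have "?H \<in> null_sets lborel" by (simp add: null_sets_def)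
      from AE_not_in[OF this] show ?thesis by simp
    qed
    have "(LINT x|lborel. (indicator V (x - h n *\<^sub>R e) - indicator V x) * G x) = (LINT x|lborel. \<sigma> * ((indicator A (x - h n *\<^sub>R e) - indicator A x) * G x))"
    proof (rule integral_cong_AE)
      show "AE x in lborel. (indicator V (x - h n *\<^sub>R e) - indicator V x) * G x = \<sigma> * ((indicator A (x - h n *\<^sub>R e) - indicator A x) * G x)"
        using null1 null2
      proof eventually_elim
        fix x assume a: "x \<bullet> \<nu> \<noteq> \<phi> x" and b: "(x - h n *\<^sub>R e) \<bullet> \<nu> \<noteq> \<phi> (x - h n *\<^sub>R e)"
        show "(indicator V (x - h n *\<^sub>R e) - indicator V x) * G x = \<sigma> * ((indicator A (x - h n *\<^sub>R e) - indicator A x) * G x)"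
        proof (cases "x \<in> K")
          case True
          have "x - h n *\<^sub>R e \<in> ball x \<delta>" using elim h(1)[of n] by (simp add: dist_norm)
          then have xq: "x \<in> Q" "x - h n *\<^sub>R e \<in> Q" using \<delta>(2)[OF True] K(2) True by auto
          \<comment> \<open>In the difference of the values at the two points the constants drop
            out, and the three cases become the factors 0, 1 and -1.\<close>
          have "indicator V y = (if \<sigma> = 0 then 1 else if \<sigma> = 1 then indicator A y else 1 - indicator A y :: real)"
            if "y \<in> Q" "y \<bullet> \<nu> \<noteq> \<phi> y" for y
            using in_V_iff[OF that] side that by (auto simp: indicator_def A_def)
          from this[OF xq(1) a] this[OF xq(2) b] show ?thesis using side by auto
        qed (use K in simp)
      qed
    qed measurable
    then show ?case by simp
  qed
  from Lim_transform_eventually[OF lim this] show ?thesis unfolding eq .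
qed

end

end

section \<open>The divergence theorem by a partition of unity\<close>

lemma exists_boundary_chart:
  assumes V: "open V" and S: "strongly_lipschitz (frontier V)" and x: "x \<in> frontier V" and U: "open U" "x \<in> U"
  obtains L \<nu> \<phi> W Q \<sigma> where "boundary_chart L V \<nu> \<phi> W Q \<sigma>" "x \<in> Q" "Q \<subseteq> U"
proof -
  obtain L \<nu> \<phi> W where c: "lipschitz_graph_chart L (frontier V) \<nu> \<phi> W" "x \<in> W"
    using S x unfolding strongly_lipschitz_def by blast
  obtain Q where Q: "open Q" "x \<in> Q" "Q \<subseteq> W"
    "Q \<inter> {z. z \<bullet> \<nu> < \<phi> z} \<subseteq> V \<or> Q \<inter> {z. z \<bullet> \<nu> < \<phi> z} \<inter> V = {}"
    "Q \<inter> {z. z \<bullet> \<nu> > \<phi> z} \<subseteq> V \<or> Q \<inter> {z. z \<bullet> \<nu> > \<phi> z} \<inter> V = {}"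
    by (rule chart_sides[OF c x])
  have "x \<in> closure V" using x by (simp add: frontier_def)
  then obtain v where v: "v \<in> V" "v \<in> Q"
    using Q(1,2) by (meson closure_iff_nhds_not_empty subset_refl disjoint_iff)
  have "v \<notin> frontier V" using v V by (simp add: frontier_def interior_open)
  then have "v \<bullet> \<nu> \<noteq> \<phi> v" using chart_iff[OF c(1)] v(2) Q(3) by blast
  then have "v \<in> Q \<inter> {z. z \<bullet> \<nu> < \<phi> z} \<inter> V \<or> v \<in> Q \<inter> {z. z \<bullet> \<nu> > \<phi> z} \<inter> V" using v by auto
  then have ne: "\<not> (Q \<inter> {z. z \<bullet> \<nu> < \<phi> z} \<inter> V = {} \<and> Q \<inter> {z. z \<bullet> \<nu> > \<phi> z} \<inter> V = {})" by blast
  define \<sigma> :: real where "\<sigma> = (if Q \<inter> {z. z \<bullet> \<nu> > \<phi> z} \<inter> V = {} then 1 else if Q \<inter> {z. z \<bullet> \<nu> < \<phi> z} \<inter> V = {} then - 1 else 0)"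
  have "boundary_chart L V \<nu> \<phi> W (Q \<inter> U) \<sigma>"
  proof
    show "lipschitz_graph_chart L (frontier V) \<nu> \<phi> W" by (rule c(1))
    show "open (Q \<inter> U)" "Q \<inter> U \<subseteq> W" "open V" using Q U V by auto
    show "\<sigma> = 1 \<and> (Q \<inter> U) \<inter> {z. z \<bullet> \<nu> < \<phi> z} \<subseteq> V \<and> (Q \<inter> U) \<inter> {z. z \<bullet> \<nu> > \<phi> z} \<inter> V = {}
      \<or> \<sigma> = -1 \<and> (Q \<inter> U) \<inter> {z. z \<bullet> \<nu> < \<phi> z} \<inter> V = {} \<and> (Q \<inter> U) \<inter> {z. z \<bullet> \<nu> > \<phi> z} \<subseteq> V
      \<or> \<sigma> = 0 \<and> (Q \<inter> U) \<inter> {z. z \<bullet> \<nu> < \<phi> z} \<subseteq> V \<and> (Q \<inter> U) \<inter> {z. z \<bullet> \<nu> > \<phi> z} \<subseteq> V"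
      using Q(4,5) ne unfolding \<sigma>_def by (auto; blast)
  qed
  then show thesis using that[of L \<nu> \<phi> W "Q \<inter> U" \<sigma>] Q(2) U(2) by blast
qed

text \<open>Tent functions on finitely many balls split \<open>g\<close> into pieces, each supported
  in one boundary chart. They need to add up to \<open>g\<close> only near the frontier: a small
  translation changes the indicator of \<open>V\<close> nowhere else.\<close>

theorem boundary_flux:
  fixes V U :: "'a::euclidean_space set" and g :: "'a \<Rightarrow> real"
  assumes V: "open V" "bounded V" and S: "strongly_lipschitz (frontier V)"
    and U: "open U" "frontier V \<subseteq> U" and g: "continuous_on U g"
    and h: "\<And>n. h n > 0" "h \<longlonglongrightarrow> 0"
  shows "(\<lambda>n. (1 / h n) * (LINT x|lborel. (indicator V (x - h n *\<^sub>R e) - indicator V x) * g x))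
     \<longlonglongrightarrow> (LINT x|surface_measure (frontier V). g x * (e \<bullet> outward_normal V x))" (is ?lim)
   and "integrable (surface_measure (frontier V)) (\<lambda>x. g x * (e \<bullet> outward_normal V x))" (is ?int)
proof -
  let ?S = "frontier V"
  have cS: "compact ?S" using V(2) compact_frontier_bounded by blast
  have "\<exists>L \<nu> \<phi> W Q \<sigma> r. boundary_chart L V \<nu> \<phi> W Q \<sigma> \<and> Q \<subseteq> U \<and> r > 0 \<and> cball x r \<subseteq> Q" if x: "x \<in> ?S" for x
  proof -
    obtain L \<nu> \<phi> W Q \<sigma> where b: "boundary_chart L V \<nu> \<phi> W Q \<sigma>" "x \<in> Q" "Q \<subseteq> U"
      using exists_boundary_chart[OF V(1) S x U(1)] x U(2) by blast
    have "open Q" using b(1) by (simp add: boundary_chart_def)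
    then obtain r where "r > 0" "cball x r \<subseteq> Q" using b(2) open_contains_cball by blast
    then show ?thesis using b by blast
  qed
  then obtain L \<nu> \<phi> W Q \<sigma> r where b: "\<And>x. x \<in> ?S \<Longrightarrow> boundary_chart (L x) V (\<nu> x) (\<phi> x) (W x) (Q x) (\<sigma> x)"
    "\<And>x. x \<in> ?S \<Longrightarrow> Q x \<subseteq> U" "\<And>x. x \<in> ?S \<Longrightarrow> r x > 0" "\<And>x. x \<in> ?S \<Longrightarrow> cball x (r x) \<subseteq> Q x" by metis
  have "?S \<subseteq> (\<Union>x\<in>?S. ball x (r x))" using b(3) by auto
  then obtain X where X: "X \<subseteq> ?S" "finite X" "?S \<subseteq> (\<Union>x\<in>X. ball x (r x))"
    using compactE_image[OF cS, of ?S "\<lambda>x. ball x (r x)"] by (metis open_ball)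
  define \<beta> where "\<beta> x z = max 0 (r x - dist z x)" for x z
  define B where "B z = (\<Sum>x\<in>X. \<beta> x z)" for z
  have \<beta>0: "\<beta> x z \<ge> 0" for x z by (simp add: \<beta>_def)
  have c\<beta>: "continuous_on UNIV (\<beta> x)" for x unfolding \<beta>_def[abs_def] by (intro continuous_intros)
  have cB: "continuous_on UNIV B" unfolding B_def[abs_def] by (intro continuous_intros c\<beta>)
  have Bpos: "B z > 0" if z: "z \<in> ?S" for z
  proof -
    obtain x where x: "x \<in> X" "z \<in> ball x (r x)" using X z by blast
    have "0 < \<beta> x z" using x by (simp add: \<beta>_def dist_commute)
    also have "\<dots> \<le> B z" unfolding B_def using x X(2) \<beta>0 by (intro member_le_sum) auto
    finally show ?thesis .
  qed
  obtain m where m: "m > 0" "\<And>z. z \<in> ?S \<Longrightarrow> m \<le> B z"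
  proof (cases "?S = {}")
    case False
    obtain z0 where "z0 \<in> ?S" "\<And>z. z \<in> ?S \<Longrightarrow> B z0 \<le> B z"
      using continuous_attains_inf[OF cS False continuous_on_subset[OF cB]] by auto
    then show thesis using that[of "B z0"] Bpos by blast
  qed (use that[of 1] in auto)
  define N where "N = {z. m / 2 < B z}"
  have N: "open N" "?S \<subseteq> N"
    unfolding N_def by (intro open_Collect_less continuous_intros cB) (use m in force)
  obtain \<delta> where \<delta>: "\<delta> > 0" "(\<Union>x\<in>?S. ball x \<delta>) \<subseteq> N"
    using compact_subset_open_imp_ball_epsilon_subset[OF cS N] by blast
  \<comment> \<open>The lower bound \<open>m / 2\<close> keeps the quotient continuous everywhere.
    On \<open>N\<close> it is not attained, so there the quotients add up to 1.\<close>
  define \<zeta> where "\<zeta> x z = \<beta> x z / max (B z) (m / 2)" for x z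
  have \<zeta>sum: "(\<Sum>x\<in>X. \<zeta> x z) = 1" if "z \<in> N" for z
  proof -
    have "max (B z) (m / 2) = B z" "B z > 0" using that m(1) by (auto simp: N_def)
    then show ?thesis by (simp add: \<zeta>_def sum_divide_distrib[symmetric] B_def[symmetric])
  qed
  have \<zeta>0: "\<zeta> x z = 0" if "z \<notin> cball x (r x)" for x z using that by (simp add: \<zeta>_def \<beta>_def dist_commute)
  have c\<zeta>: "continuous_on UNIV (\<zeta> x)" for x
    unfolding \<zeta>_def[abs_def] using m(1) by (intro continuous_intros c\<beta> cB) (auto simp: max_def)
  define G where "G x z = \<zeta> x z * (if z \<in> U then g z else 0)" for x z
  have G0: "G x z = 0" if "z \<notin> cball x (r x)" for x z using \<zeta>0[OF that] by (simp add: G_def)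
  have cG: "continuous_on UNIV (G x)" if x: "x \<in> X" for x
  proof -
    have "continuous_on U (\<lambda>z. \<zeta> x z * g z)" by (intro continuous_intros g continuous_on_subset[OF c\<zeta>]) auto
    then have 1: "continuous_on U (G x)" by (rule continuous_on_eq) (simp add: G_def)
    have 2: "continuous_on (- cball x (r x)) (G x)"
      by (rule continuous_on_eq[of _ "\<lambda>_. 0"]) (auto simp: G0)
    have "cball x (r x) \<subseteq> U" using b(2,4) x X(1) by blast
    then have "U \<union> - cball x (r x) = UNIV" by blast
    then show ?thesis using continuous_on_open_Un[OF U(1) _ 1 2] by (simp add: open_Compl)
  qed
  have Gsum: "(\<Sum>x\<in>X. G x z) = g z" if "z \<in> N" for z
  proof -
    have "z \<in> U"
    proof (rule ccontr)
      assume z: "z \<notin> U"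
      have "\<zeta> x z = 0" if "x \<in> X" for x
        using b(2,4) that X(1) z by (intro \<zeta>0) blast
      then show False using \<zeta>sum[OF \<open>z \<in> N\<close>] by simp
    qed
    then show ?thesis using \<zeta>sum[OF that] by (simp add: G_def sum_distrib_right[symmetric])
  qed
  have flux: "(\<lambda>n. (1 / h n) * (LINT z|lborel. (indicator V (z - h n *\<^sub>R e) - indicator V z) * G x z))
     \<longlonglongrightarrow> (LINT z|surface_measure ?S. G x z * (e \<bullet> outward_normal V z))"
     and Gint: "integrable (surface_measure ?S) (\<lambda>z. G x z * (e \<bullet> outward_normal V z))" if x: "x \<in> X" for x
  proof -
    have xs: "x \<in> ?S" using x X by blast
    show "(\<lambda>n. (1 / h n) * (LINT z|lborel. (indicator V (z - h n *\<^sub>R e) - indicator V z) * G x z))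
     \<longlonglongrightarrow> (LINT z|surface_measure ?S. G x z * (e \<bullet> outward_normal V z))"
      by (rule boundary_chart.local_flux[OF b(1)[OF xs] cG[OF x] compact_cball b(4)[OF xs] G0 cS S h])
    show "integrable (surface_measure ?S) (\<lambda>z. G x z * (e \<bullet> outward_normal V z))"
      by (rule boundary_chart.G_normal_integrable[OF b(1)[OF xs] cG[OF x] compact_cball b(4)[OF xs] G0 cS S])
  qed
  have out0: "outward_normal V z = 0" if "z \<notin> ?S" for z
    by (rule nonfrontier_normal[OF V(1) that])
  have rhs: "(\<Sum>x\<in>X. G x z * (e \<bullet> outward_normal V z)) = g z * (e \<bullet> outward_normal V z)" for z
    using Gsum[of z] N(2) out0[of z] by (cases "z \<in> ?S") (auto simp: sum_distrib_right[symmetric])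
  have "integrable (surface_measure ?S) (\<lambda>z. \<Sum>x\<in>X. G x z * (e \<bullet> outward_normal V z))"
    by (rule Bochner_Integration.integrable_sum[OF Gint])
  then show ?int unfolding rhs .
  have rhs2: "(\<Sum>x\<in>X. (LINT z|surface_measure ?S. G x z * (e \<bullet> outward_normal V z))) = (LINT z|surface_measure ?S. g z * (e \<bullet> outward_normal V z))"
    unfolding rhs[symmetric] by (rule Bochner_Integration.integral_sum[symmetric, OF Gint])
  have lim: "(\<lambda>n. \<Sum>x\<in>X. (1 / h n) * (LINT z|lborel. (indicator V (z - h n *\<^sub>R e) - indicator V z) * G x z))
     \<longlonglongrightarrow> (\<Sum>x\<in>X. (LINT z|surface_measure ?S. G x z * (e \<bullet> outward_normal V z)))"
    by (intro tendsto_sum flux)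
  have [measurable]: "V \<in> sets borel" using V by simp
  have "(\<lambda>n. h n * norm e) \<longlonglongrightarrow> 0 * norm e" by (intro tendsto_intros h)
  then have "\<forall>\<^sub>F n in sequentially. h n * norm e < \<delta>" using \<delta>(1) by (intro order_tendstoD) auto
  then have "\<forall>\<^sub>F n in sequentially. (\<Sum>x\<in>X. (1 / h n) * (LINT z|lborel. (indicator V (z - h n *\<^sub>R e) - indicator V z) * G x z))
     = (1 / h n) * (LINT x|lborel. (indicator V (x - h n *\<^sub>R e) - indicator V x) * g x)"
  proof eventually_elim
    case (elim n)
    have pt: "(\<Sum>x\<in>X. (indicator V (z - h n *\<^sub>R e) - indicator V z) * G x z) = (indicator V (z - h n *\<^sub>R e) - indicator V z) * g z" for z
    proof (cases "z - h n *\<^sub>R e \<in> V \<longleftrightarrow> z \<in> V")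
      case False
      \<comment> \<open>If exactly one endpoint is in \<open>V\<close>, the segment meets the
        frontier, so \<open>z\<close> is within \<open>\<delta>\<close> of it.\<close>
      let ?seg = "closed_segment (z - h n *\<^sub>R e) z"
      have "?seg \<inter> ?S \<noteq> {}"
        by (rule connected_Int_frontier) (use False in auto)
      then obtain s where s: "s \<in> ?seg" "s \<in> ?S" by blast
      have "dist s z \<le> dist (z - h n *\<^sub>R e) z" using segment_bound(2)[OF s(1)] by (simp add: dist_norm norm_minus_commute)
      also have "\<dots> < \<delta>" using elim h(1)[of n] by (simp add: dist_norm)
      finally have "z \<in> ball s \<delta>" by simp
      then have "z \<in> N" using \<delta>(2) s(2) by blast
      then show ?thesis using Gsum[of z] by (simp add: sum_distrib_left[symmetric])
    qed (simp add: indicator_def)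
    have "integrable lborel (\<lambda>z. (indicator V (z - h n *\<^sub>R e) - indicator V z) * G x z)" if x: "x \<in> X" for x
    proof (rule Bochner_Integration.integrable_bound)
      show "integrable lborel (\<lambda>z. indicator (cball x (r x)) z *\<^sub>R G x z)"
        by (rule borel_integrable_compact) (use cG[OF x] continuous_on_subset in auto)
      have [measurable]: "G x \<in> borel_measurable borel" by (rule borel_measurable_continuous_onI[OF cG[OF x]])
      show "(\<lambda>z. (indicator V (z - h n *\<^sub>R e) - indicator V z) * G x z) \<in> borel_measurable lborel" by measurable
      have "norm ((indicator V (z - h n *\<^sub>R e) - indicator V z) * G x z) \<le> norm (indicator (cball x (r x)) z *\<^sub>R G x z)" for z
      proof (cases "z \<in> cball x (r x)")
        case True
        have "\<bar>indicator V (z - h n *\<^sub>R e) - indicator V z\<bar> * \<bar>G x z\<bar> \<le> 1 * \<bar>G x z\<bar>"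
          by (intro mult_right_mono) (auto simp: indicator_def)
        then show ?thesis using True by (simp add: abs_mult)
      qed (use G0 in simp)
      then show "AE z in lborel. norm ((indicator V (z - h n *\<^sub>R e) - indicator V z) * G x z) \<le> norm (indicator (cball x (r x)) z *\<^sub>R G x z)"
        by (rule AE_I2)
    qed
    then have "(LINT z|lborel. (\<Sum>x\<in>X. (indicator V (z - h n *\<^sub>R e) - indicator V z) * G x z)) = (\<Sum>x\<in>X. LINT z|lborel. (indicator V (z - h n *\<^sub>R e) - indicator V z) * G x z)"
      by (rule Bochner_Integration.integral_sum)
    then show ?case unfolding pt by (simp only: sum_distrib_left)
  qed
  from Lim_transform_eventually[OF lim this] show ?lim unfolding rhs2 .
qed

text \<open>Differentiability is assumed almost everywhere, together with a Lipschitz bound for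
  short steps from \<open>V\<close> as the dominating function. This fits the truncated kernel,
  which has a kink on a sphere.\<close>

theorem lipschitz_divergence:
  fixes V U :: "'a::euclidean_space set" and g :: "'a \<Rightarrow> real"
  assumes V: "open V" "bounded V" and S: "strongly_lipschitz (frontier V)"
    and U: "open U" "closure V \<subseteq> U" and g: "continuous_on U g"
    and M: "\<delta> > 0" "\<And>x v. x \<in> V \<Longrightarrow> norm v < \<delta> \<Longrightarrow> \<bar>g (x + v) - g x\<bar> \<le> M * norm v"
    and d: "AE x in lborel. x \<in> V \<longrightarrow> has_dir_deriv g x e (d x)"
    and dm: "(\<lambda>x. indicator V x * d x) \<in> borel_measurable borel"
  shows "(LINT x|lborel. indicator V x * d x) = (LINT x|surface_measure (frontier V). g x * (e \<bullet> outward_normal V x))"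
   and "integrable lborel (\<lambda>x. indicator V x * d x)"
proof -
  define h where "h n = 1 / real (Suc n)" for n
  have h: "\<And>n. h n > 0" "h \<longlonglongrightarrow> 0" unfolding h_def using LIMSEQ_Suc[OF lim_1_over_n] by auto
  have [measurable]: "V \<in> sets borel" using V by simp
  have VU: "V \<subseteq> U" "frontier V \<subseteq> U" using U(2) closure_subset by (auto simp: frontier_def)
  have cc: "compact (closure V)" using V(2) by (simp add: compact_closure)
  obtain \<delta>' where \<delta>': "\<delta>' > 0" "(\<Union>x\<in>closure V. ball x \<delta>') \<subseteq> U"
    using compact_subset_open_imp_ball_epsilon_subset[OF cc U] by blast
  have "bounded (g ` closure V)"
    using compact_continuous_image[OF continuous_on_subset[OF g U(2)] cc] compact_imp_bounded by blast
  then obtain B where B: "\<And>x. x \<in> V \<Longrightarrow> \<bar>g x\<bar> \<le> B"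
    unfolding bounded_iff using closure_subset[of V] by (metis image_eqI real_norm_def subsetD)
  have Vint: "integrable lborel (\<lambda>x. indicator V x * c)" for c :: real
    using emeasure_bounded_finite[OF V(2)] by (intro Bochner_Integration.integrable_mult_left) (auto simp: integrable_indicator_iff)
  have "(\<lambda>n. h n * norm e) \<longlonglongrightarrow> 0 * norm e" by (intro tendsto_intros h)
  then have "\<forall>\<^sub>F n in sequentially. h n * norm e < min \<delta> \<delta>'" using M(1) \<delta>'(1) by (intro order_tendstoD) auto
  then obtain n0 where n0: "\<And>n. n \<ge> n0 \<Longrightarrow> h n * norm e < min \<delta> \<delta>'" by (auto simp: eventually_sequentially)
  have nrm: "norm (h n *\<^sub>R e) = h n * norm e" for n using h(1)[of n] by simp
  have shiftU: "x + h n *\<^sub>R e \<in> U" if x: "x \<in> V" and n: "n \<ge> n0" for x n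
  proof -
    have "x + h n *\<^sub>R e \<in> ball x \<delta>'" using n0[OF n] h(1)[of n] by (simp add: dist_norm)
    then show ?thesis using \<delta>'(2) x closure_subset by blast
  qed
  have shm: "(\<lambda>x. indicator V x * g (x + h n *\<^sub>R e)) \<in> borel_measurable borel" if n: "n \<ge> n0" for n
  proof -
    have "continuous_on V (\<lambda>x. g (x + h n *\<^sub>R e))"
      by (rule continuous_on_compose2[OF g]) (auto intro!: continuous_intros shiftU n)
    from borel_measurable_continuous_on_indicator[OF _ this] show ?thesis by simp
  qed
  have gm: "(\<lambda>x. indicator V x * g x) \<in> borel_measurable borel"
    using borel_measurable_continuous_on_indicator[OF _ continuous_on_subset[OF g VU(1)]] by simp
  have lipn: "\<bar>g (x + h n *\<^sub>R e) - g x\<bar> \<le> M * (h n * norm e)" if "x \<in> V" "n \<ge> n0" for x n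
    using M(2)[OF that(1), of "h n *\<^sub>R e", unfolded nrm] n0[OF that(2)] by simp
  define q where "q n x = indicator V x * ((g (x + h n *\<^sub>R e) - g x) / h n)" for n x
  have qm: "q n \<in> borel_measurable borel" if n: "n \<ge> n0" for n
  proof -
    have "q n = (\<lambda>x. (indicator V x * g (x + h n *\<^sub>R e) - indicator V x * g x) / h n)"
      by (rule ext) (simp add: q_def right_diff_distrib)
    then show ?thesis using shm[OF n] gm by simp
  qed
  \<comment> \<open>Translating by \<open>h n e\<close> moves the shift from the indicator to
    \<open>g\<close>.\<close>
  have eq: "(1 / h n) * (LINT x|lborel. (indicator V (x - h n *\<^sub>R e) - indicator V x) * g x) = (LINT x|lborel. q n x)" if n: "n \<ge> n0" for n
  proof -
    have i1: "integrable lborel (\<lambda>x. indicator V x * g x)"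
      by (rule Bochner_Integration.integrable_bound[OF Vint[of B]]) (use gm B in \<open>auto simp: indicator_def intro: order_trans[OF _ abs_ge_self]\<close>)
    have i2: "integrable lborel (\<lambda>x. indicator V x * g (x + h n *\<^sub>R e))"
    proof (rule Bochner_Integration.integrable_bound[OF Vint[of "B + M * (h n * norm e)"]])
      have "\<bar>g (x + h n *\<^sub>R e)\<bar> \<le> \<bar>B + M * (h n * norm e)\<bar>" if "x \<in> V" for x
        using lipn[OF that n] B[OF that] by linarith
      then show "AE x in lborel. norm (indicator V x * g (x + h n *\<^sub>R e)) \<le> norm (indicator V x * (B + M * (h n * norm e)))"
        by (auto simp: indicator_def)
    qed (use shm[OF n] in simp)
    let ?F = "\<lambda>x. indicator V (x - h n *\<^sub>R e) * g x"
    have Fm: "?F \<in> borel_measurable borel"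
      using measurable_compose[of "\<lambda>x. x - h n *\<^sub>R e" borel borel "\<lambda>x. indicator V x * g (x + h n *\<^sub>R e)" borel] shm[OF n] by simp
    have i3: "integrable lborel ?F"
    proof -
      have "integrable (distr lborel borel ((+) (h n *\<^sub>R e))) ?F"
        using i2 Fm by (subst integrable_distr_eq) (auto simp: add.commute)
      then show ?thesis by (simp add: lborel_distr_plus)
    qed
    have "(LINT x|lborel. (indicator V (x - h n *\<^sub>R e) - indicator V x) * g x) = (LINT x|lborel. ?F x) - (LINT x|lborel. indicator V x * g x)"
      unfolding left_diff_distrib by (rule Bochner_Integration.integral_diff[OF i3 i1])
    also have "(LINT x|lborel. ?F x) = (LINT x|lborel. indicator V x * g (x + h n *\<^sub>R e))"
      using integral_lborel_translate[OF Fm, of "h n *\<^sub>R e"] by simp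
    also have "(LINT x|lborel. indicator V x * g (x + h n *\<^sub>R e)) - (LINT x|lborel. indicator V x * g x)
      = (LINT x|lborel. indicator V x * g (x + h n *\<^sub>R e) - indicator V x * g x)"
      by (rule Bochner_Integration.integral_diff[OF i2 i1, symmetric])
    finally have A: "(LINT x|lborel. (indicator V (x - h n *\<^sub>R e) - indicator V x) * g x)
      = (LINT x|lborel. indicator V x * g (x + h n *\<^sub>R e) - indicator V x * g x)" .
    have "q n = (\<lambda>x. (indicator V x * g (x + h n *\<^sub>R e) - indicator V x * g x) / h n)"
      by (rule ext) (simp add: q_def right_diff_distrib)
    then show ?thesis using A by simp
  qed
  have AElim: "AE x in lborel. (\<lambda>n. q (n + n0) x) \<longlonglongrightarrow> indicator V x * d x"
    using d
  proof eventually_elim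
    fix x assume x: "x \<in> V \<longrightarrow> has_dir_deriv g x e (d x)"
    have "(\<lambda>n. q n x) \<longlonglongrightarrow> indicator V x * d x"
    proof (cases "x \<in> V")
      case True
      then have "(\<lambda>k. real (Suc k) * (g (x + (1 / real (Suc k)) *\<^sub>R e) - g x)) \<longlonglongrightarrow> d x"
        using x has_dir_deriv_LIMSEQ by blast
      then show ?thesis using True by (simp add: q_def h_def mult.commute)
    qed (simp add: q_def)
    then show "(\<lambda>n. q (n + n0) x) \<longlonglongrightarrow> indicator V x * d x" by (rule LIMSEQ_ignore_initial_segment)
  qed
  have bound: "AE x in lborel. norm (q (n + n0) x) \<le> indicator V x * (M * norm e)" for n
  proof (rule AE_I2)
    fix x
    have hp: "h (n + n0) > 0" by (rule h)
    show "norm (q (n + n0) x) \<le> indicator V x * (M * norm e)"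
    proof (cases "x \<in> V")
      case True
      have "\<bar>g (x + h (n + n0) *\<^sub>R e) - g x\<bar> / h (n + n0) \<le> (M * (h (n + n0) * norm e)) / h (n + n0)"
        using lipn[OF True, of "n + n0"] hp by (intro divide_right_mono) auto
      then show ?thesis using True hp by (simp add: q_def abs_divide)
    qed (simp add: q_def)
  qed
  have qm': "q (n + n0) \<in> borel_measurable lborel" for n using qm[of "n + n0"] by simp
  have dm': "(\<lambda>x. indicator V x * d x) \<in> borel_measurable lborel" using dm by simp
  show "integrable lborel (\<lambda>x. indicator V x * d x)"
    by (rule integrable_dominated_convergence[OF dm' qm' Vint AElim bound])
  have lim1: "(\<lambda>n. LINT x|lborel. q (n + n0) x) \<longlonglongrightarrow> (LINT x|lborel. indicator V x * d x)"
    by (rule integral_dominated_convergence[OF dm' qm' Vint AElim bound])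
  have "(\<lambda>n. (1 / h (n + n0)) * (LINT x|lborel. (indicator V (x - h (n + n0) *\<^sub>R e) - indicator V x) * g x))
     \<longlonglongrightarrow> (LINT x|surface_measure (frontier V). g x * (e \<bullet> outward_normal V x))"
    by (rule LIMSEQ_ignore_initial_segment[OF boundary_flux(1)[OF V S U(1) VU(2) g h]])
  then have "(\<lambda>n. LINT x|lborel. q (n + n0) x) \<longlonglongrightarrow> (LINT x|surface_measure (frontier V). g x * (e \<bullet> outward_normal V x))"
    by (simp only: eq[OF le_add2])
  from LIMSEQ_unique[OF lim1 this]
  show "(LINT x|lborel. indicator V x * d x) = (LINT x|surface_measure (frontier V). g x * (e \<bullet> outward_normal V x))" .
qed

section \<open>Clifford numbers\<close>

lemma coeff_gen_mult: "cl_coeff (gen i * a) C = cl_coeff a (symdiff {i} C) * blade_sign {i} (symdiff {i} C)"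
  by (simp add: coeff_times gen_def coeff_blade mult_delta_left)

text \<open>Multiplication by a generator permutes the blades up to sign; going forth and back gives
  the sign of \<open>e_i^2 = -1\<close>, so it is skew.\<close>

lemma inner_gen_mult: "inner (gen i * a) b = - inner a (gen i * b)"
proof -
  have s: "blade_sign {i} (symdiff {i} C) = - blade_sign {i} C" for C
  proof -
    have "blade_sign {i} {i} = -1" by (simp add: blade_sign_prod)
    then show ?thesis by (simp only: blade_sign_symdiff_right mult_minus1)
  qed
  have "inner (gen i * a) b = (\<Sum>C\<in>UNIV. cl_coeff a (symdiff {i} C) * blade_sign {i} (symdiff {i} C) * cl_coeff b C)"
    by (simp add: inner_clifford_coeff coeff_gen_mult)
  also have "\<dots> = (\<Sum>C\<in>UNIV. cl_coeff a C * blade_sign {i} C * cl_coeff b (symdiff {i} C))"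
    using sum.reindex_bij_betw[OF bij_symdiff[of "{i}"], of "\<lambda>C. cl_coeff a C * blade_sign {i} C * cl_coeff b (symdiff {i} C)"]
    by simp
  also have "\<dots> = - inner a (gen i * b)"
    by (simp add: inner_clifford_coeff coeff_gen_mult s sum_negf[symmetric] mult_ac)
  finally show ?thesis .
qed

lemma vec_cl_add: "vec_cl (x + y) = vec_cl x + vec_cl y"
  and vec_cl_diff: "vec_cl (x - y) = vec_cl x - vec_cl y"
  and vec_cl_minus: "vec_cl (- x) = - vec_cl x"
  and vec_cl_scaleR: "vec_cl (r *\<^sub>R x) = r *\<^sub>R vec_cl x"
  and vec_cl_0: "vec_cl 0 = 0"
  by (simp_all add: vec_cl_def scaleR_add_left scaleR_diff_left sum.distrib sum_subtractf sum_negf scaleR_sum_right)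

lemma vec_cl_axis: "vec_cl (axis j 1) = gen j"
  by (simp add: vec_cl_def axis_def if_distrib[of "\<lambda>c. c *\<^sub>R _"] sum.delta cong: if_cong)

lemma inner_vec_cl_mult: "inner (vec_cl x * a) b = - inner a (vec_cl x * b)"
  by (simp add: vec_cl_def sum_distrib_right inner_sum_left inner_sum_right inner_gen_mult sum_negf)

text \<open>Adding the double sum to itself with the factors interchanged leaves only
  anticommutators, and these vanish off the diagonal.\<close>

lemma vec_cl_square: "vec_cl x * vec_cl x = - ((norm x)\<^sup>2 *\<^sub>R 1)"
proof -
  have P: "vec_cl x * vec_cl x = (\<Sum>i\<in>UNIV. \<Sum>j\<in>UNIV. (x $ i * x $ j) *\<^sub>R (gen i * gen j))"
    by (simp add: vec_cl_def sum_product mult_ac)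
  have P': "(\<Sum>i\<in>UNIV. \<Sum>j\<in>UNIV. (x $ i * x $ j) *\<^sub>R (gen i * gen j)) = (\<Sum>i\<in>UNIV. \<Sum>j\<in>UNIV. (x $ i * x $ j) *\<^sub>R (gen j * gen i))"
    by (subst sum.swap) (simp only: mult.commute)
  have "2 *\<^sub>R (vec_cl x * vec_cl x) = (\<Sum>i\<in>UNIV. \<Sum>j\<in>UNIV. (x $ i * x $ j) *\<^sub>R (gen i * gen j)) + (\<Sum>i\<in>UNIV. \<Sum>j\<in>UNIV. (x $ i * x $ j) *\<^sub>R (gen j * gen i))"
    unfolding scaleR_2 using P P' by simp
  also have "\<dots> = (\<Sum>i\<in>UNIV. \<Sum>j\<in>UNIV. (x $ i * x $ j) *\<^sub>R (gen i * gen j + gen j * gen i))"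
    by (simp add: sum.distrib scaleR_add_right)
  also have "\<dots> = (\<Sum>i\<in>UNIV. \<Sum>j\<in>UNIV. if i = j then (x $ i * x $ j) *\<^sub>R (-2) else 0)"
    by (intro sum.cong refl) (simp add: gen_relation)
  also have "\<dots> = (\<Sum>i\<in>UNIV. (x $ i * x $ i) *\<^sub>R (-2))" by simp
  also have "\<dots> = (norm x)\<^sup>2 *\<^sub>R (-2)"
    by (simp only: scaleR_sum_left[symmetric]) (simp add: norm_vec_def L2_set_def power2_eq_square[symmetric] sum_nonneg)
  also have "\<dots> = 2 *\<^sub>R (- ((norm x)\<^sup>2 *\<^sub>R 1))"
  proof -
    have "(-2 :: 'a clifford) = (-2) *\<^sub>R 1" by (simp add: scaleR_conv_of_real)
    then show ?thesis
      by (simp only: scaleR_scaleR scaleR_minus_left scaleR_minus_right mult_minus_right mult.commute)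
  qed
  finally have "2 *\<^sub>R (vec_cl x * vec_cl x) = 2 *\<^sub>R (- ((norm x)\<^sup>2 *\<^sub>R 1))" .
  then show ?thesis by (rule real_vector.scale_left_imp_eq[rotated]) simp
qed

text \<open>Multiplication by a vector is skew with square \<open>-|x|^2\<close>. The coefficient
  norm is not multiplicative on the whole algebra, hence the care taken below about factors that are
  products of vectors.\<close>

lemma norm_vec_cl_mult: "norm (vec_cl x * a) = norm x * norm a"
proof -
  have "inner (vec_cl x * a) (vec_cl x * a) = - inner a ((vec_cl x * vec_cl x) * a)"
    by (simp add: inner_vec_cl_mult mult.assoc)
  also have "\<dots> = (norm x * norm a)\<^sup>2"
    by (simp add: vec_cl_square power_mult_distrib dot_square_norm)
  finally show ?thesis by (simp add: norm_eq_sqrt_inner)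
qed

lemma norm_one_clifford: "norm (1 :: 'n::{finite,linorder} clifford) = 1"
  by (simp add: norm_clifford_coeff one_clifford_def coeff_blade if_distrib[of "\<lambda>c. c\<^sup>2"] sum.delta cong: if_cong)

lemma norm_vec_cl: "norm (vec_cl x) = norm x"
  using norm_vec_cl_mult[of x 1] by (simp add: norm_one_clifford)

lemma abs_coeff_le_norm: "\<bar>cl_coeff a A\<bar> \<le> norm a"
proof -
  have "(cl_coeff a A)\<^sup>2 \<le> (\<Sum>A\<in>UNIV. (cl_coeff a A)\<^sup>2)" by (rule member_le_sum) auto
  then show ?thesis unfolding norm_clifford_coeff by (metis real_sqrt_abs real_sqrt_le_iff)
qed

section \<open>Reversion\<close>

lemma card_le_singleton: "card {(a, b). a \<in> A \<and> b = j \<and> b \<le> a} = card {a \<in> A. j \<le> a}"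
  by (rule bij_betw_same_card[of fst]) (auto simp: bij_betw_def inj_on_def image_iff)

lemma card_singleton_le: "card {(a, b). a = j \<and> b \<in> A \<and> b \<le> a} = card {b \<in> A. b \<le> j}"
  by (rule bij_betw_same_card[of snd]) (auto simp: bij_betw_def inj_on_def image_iff)

lemma blade_sign_singleton:
  "blade_sign A {j} = (-1) ^ card {a \<in> A. j \<le> a}" "blade_sign {j} A = (-1) ^ card {b \<in> A. b \<le> j}"
  by (simp_all add: blade_sign_def card_le_singleton card_singleton_le)

text \<open>Reversing \<open>k\<close> anticommuting factors takes \<open>k choose 2\<close>
  transpositions.\<close>

definition rev_sign :: "'n set \<Rightarrow> real" where
  "rev_sign A = (-1) ^ (card A choose 2)"

lemma prod_list_gen_rev:
  assumes "sorted_wrt (<) xs"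
  shows "prod_list (map gen (rev xs)) = rev_sign (set xs) *\<^sub>R blade (set xs)"
  using assms
proof (induction xs)
  case Nil
  then show ?case by (simp add: rev_sign_def one_clifford_def numeral_2_eq_2)
next
  case (Cons x xs)
  have x: "x \<notin> set xs" using Cons.prems by auto
  have e: "{a \<in> set xs. x \<le> a} = set xs" using Cons.prems by auto
  have "symdiff (set xs) {x} = insert x (set xs)" using x by (auto simp: symdiff_def)
  then have "blade (set xs) * gen x = (-1) ^ card (set xs) *\<^sub>R blade (insert x (set xs))"
    by (simp add: gen_def blade_mult blade_sign_singleton e)
  moreover have "Suc (card (set xs)) choose 2 = card (set xs) + (card (set xs) choose 2)"
    by (simp add: numeral_2_eq_2)
  ultimately show ?case
    using Cons x by (simp add: rev_sign_def power_add mult.commute)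
qed

lemma coeff_reversion: "cl_coeff (reversion a) A = rev_sign A * cl_coeff a A"
proof -
  have "reversion a = (\<Sum>A\<in>UNIV. cl_coeff a A *\<^sub>R (rev_sign A *\<^sub>R blade A))"
    unfolding reversion_def
    by (intro sum.cong refl) (simp add: prod_list_gen_rev strict_sorted_list_of_set)
  then show ?thesis by (simp add: coeff_sum coeff_blade if_distrib sum.delta mult.commute cong: if_cong)
qed

lemma reversion_blade: "reversion (blade A) = rev_sign A *\<^sub>R blade A"
  by (auto simp: clifford_eq_iff coeff_reversion coeff_blade)

lemma reversion_add: "reversion (a + b) = reversion a + reversion b"
  and reversion_scaleR: "reversion (r *\<^sub>R a) = r *\<^sub>R reversion a"
  and reversion_0: "reversion 0 = 0"
  by (simp_all add: clifford_eq_iff coeff_reversion algebra_simps)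

lemma reversion_sum: "reversion (sum f I) = (\<Sum>i\<in>I. reversion (f i))"
  by (induction I rule: infinite_finite_induct) (simp_all add: reversion_add reversion_0)

lemma rev_sign_sq: "rev_sign A * rev_sign A = 1"
  by (simp add: rev_sign_def power_mult_distrib[symmetric])

lemma reversion_reversion [simp]: "reversion (reversion a) = a"
  by (simp add: clifford_eq_iff coeff_reversion mult.assoc[symmetric] rev_sign_sq)

lemma norm_reversion [simp]: "norm (reversion a) = norm a"
  by (simp add: norm_clifford_coeff coeff_reversion power_mult_distrib power2_eq_square[of "rev_sign _"] rev_sign_sq)

lemma reversion_one [simp]: "reversion 1 = 1"
  by (simp add: one_clifford_def reversion_blade rev_sign_def numeral_2_eq_2)

lemma reversion_gen [simp]: "reversion (gen j) = gen j"
  by (simp add: gen_def reversion_blade rev_sign_def numeral_2_eq_2)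

lemma reversion_vec_cl [simp]: "reversion (vec_cl x) = vec_cl x"
  by (simp add: vec_cl_def reversion_sum reversion_scaleR)

text \<open>A parity count. The elements of \<open>A\<close> below \<open>j\<close> and those above
  \<open>j\<close> exhaust \<open>A\<close> and share at most \<open>j\<close>, while the
  cardinality of \<open>symdiff {j} A\<close> differs from that of \<open>A\<close> by one.\<close>

lemma reversion_gen_mult_blade: "reversion (gen j * blade A) = reversion (blade A) * gen j"
proof -
  have split: "card {b \<in> A. b \<le> j} + card {a \<in> A. j \<le> a} = card A + (if j \<in> A then 1 else 0)"
  proof -
    have "card {b \<in> A. b \<le> j} + card {a \<in> A. j \<le> a} = card ({b \<in> A. b \<le> j} \<union> {a \<in> A. j \<le> a}) + card ({b \<in> A. b \<le> j} \<inter> {a \<in> A. j \<le> a})"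
      by (rule card_Un_Int) auto
    moreover have "{b \<in> A. b \<le> j} \<union> {a \<in> A. j \<le> a} = A" by auto
    moreover have "{b \<in> A. b \<le> j} \<inter> {a \<in> A. j \<le> a} = (if j \<in> A then {j} else {})" by auto
    ultimately show ?thesis by simp
  qed
  have "even ((card {b \<in> A. b \<le> j} + (card (symdiff {j} A) choose 2)) + ((card A choose 2) + card {a \<in> A. j \<le> a}))"
  proof (cases "j \<in> A")
    case False
    then have "symdiff {j} A = insert j A" by (auto simp: symdiff_def)
    then have "card (symdiff {j} A) = Suc (card A)" using False by simp
    then have "card (symdiff {j} A) choose 2 = card A + (card A choose 2)" by (simp add: numeral_2_eq_2)
    then show ?thesis using split False by presburger
  next
    case True
    then have "symdiff {j} A = A - {j}" by (auto simp: symdiff_def)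
    moreover obtain k where k: "card A = Suc k" using True by (metis card_Suc_Diff1 finite_code)
    ultimately have "card (symdiff {j} A) = k" using True by simp
    moreover have "card A choose 2 = k + (k choose 2)" using k by (simp add: numeral_2_eq_2)
    ultimately have "(card {b \<in> A. b \<le> j} + (card (symdiff {j} A) choose 2)) + ((card A choose 2) + card {a \<in> A. j \<le> a})
      = 2 * (k + 1 + (k choose 2))" using split True k by simp
    then show ?thesis by simp
  qed
  then have "blade_sign {j} A * rev_sign (symdiff {j} A) = rev_sign A * blade_sign A {j}"
    unfolding blade_sign_singleton rev_sign_def power_add[symmetric]
    by (metis (no_types, lifting) even_add neg_one_even_power neg_one_odd_power)
  then show ?thesis
    by (simp add: gen_def blade_mult reversion_scaleR reversion_blade symdiff_commute[of A])
qed

lemma reversion_gen_mult: "reversion (gen j * a) = reversion a * gen j"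
proof -
  have "reversion (gen j * (\<Sum>A\<in>UNIV. cl_coeff a A *\<^sub>R blade A)) = reversion (\<Sum>A\<in>UNIV. cl_coeff a A *\<^sub>R blade A) * gen j"
    by (simp add: sum_distrib_left sum_distrib_right reversion_sum reversion_scaleR reversion_gen_mult_blade)
  then show ?thesis by (simp only: blade_expansion[symmetric])
qed

lemma reversion_prod_list_mult: "reversion (prod_list (map gen xs) * a) = reversion a * reversion (prod_list (map gen xs))"
  by (induction xs arbitrary: a) (simp_all add: reversion_gen_mult mult.assoc)

text \<open>Moving one generator at a time treats products of generators; blades are such products,
  and both sides are linear.\<close>

lemma reversion_mult: "reversion (a * b) = reversion b * reversion a"
proof -
  have bl: "reversion (blade A * b) = reversion b * reversion (blade A)" for A
    unfolding blade_eq_prod by (rule reversion_prod_list_mult)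
  have "reversion ((\<Sum>A\<in>UNIV. cl_coeff a A *\<^sub>R blade A) * b) = reversion b * reversion (\<Sum>A\<in>UNIV. cl_coeff a A *\<^sub>R blade A)"
    by (simp add: sum_distrib_left sum_distrib_right reversion_sum reversion_scaleR bl)
  then show ?thesis by (simp only: blade_expansion[symmetric])
qed

lemma norm_mult_vec_cl: "norm (a * vec_cl x) = norm a * norm x"
  by (metis norm_reversion reversion_mult reversion_vec_cl norm_vec_cl_mult mult.commute)

section \<open>Products of vectors\<close>

text \<open>The products of nonzero vectors, that is, the Clifford (Lipschitz) group. Denominators
  \<open>cx + d\<close> belong to it; its elements are invertible, and multiplication by them scales
  norms.\<close>

inductive_set versor :: "'n::{finite,linorder} clifford set" where
  one: "1 \<in> versor"
| vec: "a \<in> versor \<Longrightarrow> x \<noteq> 0 \<Longrightarrow> vec_cl x * a \<in> versor"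

lemma versor_mult: "a \<in> versor \<Longrightarrow> b \<in> versor \<Longrightarrow> a * b \<in> versor"
  by (induction rule: versor.induct) (auto simp: mult.assoc intro: versor.intros)

lemma versor_norm_mult: "a \<in> versor \<Longrightarrow> norm (a * b) = norm a * norm b"
  by (induction rule: versor.induct) (simp_all add: norm_one_clifford mult.assoc norm_vec_cl_mult)

lemma versor_norm_pos: "a \<in> versor \<Longrightarrow> norm a > 0"
  by (induction rule: versor.induct) (simp_all add: norm_one_clifford norm_vec_cl_mult)

text \<open>In \<open>a~ a\<close> the innermost vectors meet and contribute \<open>-|x|^2\<close>
  one pair after the other, so \<open>s\<close> is the parity of the number of factors.\<close>

lemma versor_reversion_mult:
  assumes "a \<in> versor"
  obtains s :: real where "s = 1 \<or> s = -1" "reversion a * a = (s * (norm a)\<^sup>2) *\<^sub>R 1" "a * reversion a = (s * (norm a)\<^sup>2) *\<^sub>R 1"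
proof -
  have "\<exists>s::real. (s = 1 \<or> s = -1) \<and> reversion a * a = (s * (norm a)\<^sup>2) *\<^sub>R 1 \<and> a * reversion a = (s * (norm a)\<^sup>2) *\<^sub>R 1"
    using assms
  proof induction
    case one
    then show ?case by (intro exI[of _ 1]) (simp add: norm_one_clifford)
  next
    case (vec a x)
    then obtain s :: real where s: "s = 1 \<or> s = -1" "reversion a * a = (s * (norm a)\<^sup>2) *\<^sub>R 1" "a * reversion a = (s * (norm a)\<^sup>2) *\<^sub>R 1" by blast
    have "reversion (vec_cl x * a) * (vec_cl x * a) = reversion a * (vec_cl x * vec_cl x) * a"
      by (simp add: reversion_mult mult.assoc)
    also have "\<dots> = (- s * (norm (vec_cl x * a))\<^sup>2) *\<^sub>R 1"
      by (simp add: vec_cl_square s(2) norm_vec_cl_mult power_mult_distrib mult_ac)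
    finally have 1: "reversion (vec_cl x * a) * (vec_cl x * a) = (- s * (norm (vec_cl x * a))\<^sup>2) *\<^sub>R 1" .
    have "(vec_cl x * a) * reversion (vec_cl x * a) = vec_cl x * (a * reversion a) * vec_cl x"
      by (simp add: reversion_mult mult.assoc)
    also have "\<dots> = (- s * (norm (vec_cl x * a))\<^sup>2) *\<^sub>R 1"
      by (simp add: vec_cl_square s(3) norm_vec_cl_mult power_mult_distrib mult_ac)
    finally show ?case using 1 s(1) by (intro exI[of _ "- s"]) auto
  qed
  then show thesis using that by blast
qed

lemma versor_inverse:
  assumes "a \<in> versor"
  obtains b where "a * b = 1" "b * a = 1"
proof -
  obtain s :: real where s: "s = 1 \<or> s = -1" "reversion a * a = (s * (norm a)\<^sup>2) *\<^sub>R 1" "a * reversion a = (s * (norm a)\<^sup>2) *\<^sub>R 1"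
    by (rule versor_reversion_mult[OF assms])
  have "s * (norm a)\<^sup>2 \<noteq> 0" using s(1) versor_norm_pos[OF assms] by auto
  then show thesis using that[of "(1 / (s * (norm a)\<^sup>2)) *\<^sub>R reversion a"] s(2,3) by simp
qed

lemma cl_inverse_eq:
  assumes "a * b = 1" "b * a = 1" shows "cl_inverse a = b"
  unfolding cl_inverse_def
proof (rule the_equality)
  fix c assume "a * c = 1 \<and> c * a = 1"
  then show "c = b" using assms by (metis mult.assoc mult_1_left mult_1_right)
qed (use assms in simp)

section \<open>The action on the upper half space\<close>

lemma mat2_entries [simp]:
  "mat2 a b c d $ 1 $ 1 = a" "mat2 a b c d $ 1 $ 2 = b" "mat2 a b c d $ 2 $ 1 = c" "mat2 a b c d $ 2 $ 2 = d"
  by (simp_all add: mat2_def)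

lemma mat2_eq_iff: "M = mat2 a b c d \<longleftrightarrow> M $ 1 $ 1 = a \<and> M $ 1 $ 2 = b \<and> M $ 2 $ 1 = c \<and> M $ 2 $ 2 = d"
  by (auto simp: vec_eq_iff forall_2)

lemma mat2_mult: "mat2 a b c d ** mat2 a' b' c' d' = mat2 (a * a' + b * c') (a * b' + b * d') (c * a' + d * c') (c * b' + d * d')"
  by (simp add: mat2_eq_iff matrix_matrix_mult_def sum_2)

lemma mat_1_mat2: "mat 1 = mat2 1 0 0 1"
  by (simp add: mat2_eq_iff mat_def)

lemma mult_entries:
  "(A ** B) $ i $ j = A $ i $ 1 * B $ 1 $ j + A $ i $ 2 * B $ 2 $ j" for A B :: "'a::semiring_1^2^2"
  by (simp add: matrix_matrix_mult_def sum_2)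

definition numer :: "'n::{finite,linorder} cl_mat \<Rightarrow> 'n Rn \<Rightarrow> 'n clifford" where
  "numer M x = M $ 1 $ 1 * vec_cl x + M $ 1 $ 2"

text \<open>One invariant for everything needed about a matrix, because its parts are inherited by
  products only together. The fourth conjunct is the difference identity for two points. The last
  one says that coordinates beyond \<open>p\<close> are only rescaled, since the translations do not
  touch them.\<close>

definition acts :: "nat \<Rightarrow> 'n::{finite,linorder} cl_mat \<Rightarrow> bool" where
  "acts p M \<longleftrightarrow> (\<forall>x\<in>upper_half. denom M x \<in> versor \<and> mob_act M x \<in> upper_half \<and>
     numer M x = vec_cl (mob_act M x) * denom M x \<and>
     (\<forall>w\<in>upper_half. reversion (denom M w) * vec_cl (mob_act M w - mob_act M x) * denom M x = vec_cl (w - x)) \<and>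
     (\<forall>j. p < idx j \<longrightarrow> mob_act M x $ j = x $ j / (norm (denom M x))\<^sup>2))"

lemma mob_actI:
  assumes "denom M x \<in> versor" "numer M x = vec_cl y * denom M x"
  shows "mob_act M x = y"
proof -
  obtain b where b: "denom M x * b = 1" "b * denom M x = 1" by (rule versor_inverse[OF assms(1)])
  have "mob_act M x = vec_part (numer M x * b)"
    by (simp add: mob_act_def numer_def cl_inverse_eq[OF b])
  also have "numer M x * b = vec_cl y" by (simp add: assms(2) mult.assoc b)
  finally show ?thesis by simp
qed

text \<open>Entries do not commute, but in
  \<open>numer B x = vec_cl (mob_act B x) * denom B x\<close> the denominator stands on the right,
  so it factors out of both rows of the product. All remaining claims follow from the resulting
  cocycle rule.\<close>

lemma acts_mult:
  assumes A: "acts p A" and B: "acts p B"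
  shows "acts p (A ** B)"
    and "\<And>x. x \<in> upper_half \<Longrightarrow> denom (A ** B) x = denom A (mob_act B x) * denom B x"
    and "\<And>x. x \<in> upper_half \<Longrightarrow> mob_act (A ** B) x = mob_act A (mob_act B x)"
proof -
  have Bx: "denom B x \<in> versor" "mob_act B x \<in> upper_half" "numer B x = vec_cl (mob_act B x) * denom B x" if "x \<in> upper_half" for x
    using B that unfolding acts_def by auto
  have Ax: "denom A x \<in> versor" "mob_act A x \<in> upper_half" "numer A x = vec_cl (mob_act A x) * denom A x" if "x \<in> upper_half" for x
    using A that unfolding acts_def by auto
  have num: "numer (A ** B) x = A $ 1 $ 1 * numer B x + A $ 1 $ 2 * denom B x"
    and den: "denom (A ** B) x = A $ 2 $ 1 * numer B x + A $ 2 $ 2 * denom B x" for x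
    by (simp_all add: numer_def denom_def mult_entries algebra_simps)
  show d: "denom (A ** B) x = denom A (mob_act B x) * denom B x" if "x \<in> upper_half" for x
    by (simp add: den Bx(3)[OF that] denom_def[of A] algebra_simps)
  have n: "numer (A ** B) x = vec_cl (mob_act A (mob_act B x)) * denom (A ** B) x" if x: "x \<in> upper_half" for x
  proof -
    have "numer (A ** B) x = numer A (mob_act B x) * denom B x"
      by (simp add: num Bx(3)[OF x] numer_def[of A] algebra_simps)
    then show ?thesis by (simp add: Ax(3)[OF Bx(2)[OF x]] d[OF x] mult.assoc)
  qed
  have v: "denom (A ** B) x \<in> versor" if "x \<in> upper_half" for x
    unfolding d[OF that] using that by (intro versor_mult Ax Bx)
  show m: "mob_act (A ** B) x = mob_act A (mob_act B x)" if "x \<in> upper_half" for x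
    by (rule mob_actI[OF v[OF that] n[OF that]])
  show "acts p (A ** B)" unfolding acts_def
  proof (intro ballI conjI allI impI)
    fix x :: "'a Rn" assume x: "x \<in> upper_half"
    show "denom (A ** B) x \<in> versor" by (rule v[OF x])
    show "mob_act (A ** B) x \<in> upper_half" unfolding m[OF x] by (rule Ax(2)[OF Bx(2)[OF x]])
    show "numer (A ** B) x = vec_cl (mob_act (A ** B) x) * denom (A ** B) x" unfolding m[OF x] by (rule n[OF x])
    show "mob_act (A ** B) x $ j = x $ j / (norm (denom (A ** B) x))\<^sup>2" if j: "p < idx j" for j
    proof -
      have "mob_act A (mob_act B x) $ j = mob_act B x $ j / (norm (denom A (mob_act B x)))\<^sup>2"
        using A Bx(2)[OF x] j unfolding acts_def by blast
      moreover have "mob_act B x $ j = x $ j / (norm (denom B x))\<^sup>2"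
        using B x j unfolding acts_def by blast
      ultimately show ?thesis unfolding m[OF x] d[OF x] versor_norm_mult[OF Ax(1)[OF Bx(2)[OF x]]]
        by (simp add: power_mult_distrib)
    qed
    fix w :: "'a Rn" assume w: "w \<in> upper_half"
    have "reversion (denom (A ** B) w) * vec_cl (mob_act (A ** B) w - mob_act (A ** B) x) * denom (A ** B) x
      = reversion (denom B w) * (reversion (denom A (mob_act B w)) * vec_cl (mob_act A (mob_act B w) - mob_act A (mob_act B x)) * denom A (mob_act B x)) * denom B x"
      by (simp add: d[OF x] d[OF w] m[OF x] m[OF w] reversion_mult mult.assoc)
    also have "reversion (denom A (mob_act B w)) * vec_cl (mob_act A (mob_act B w) - mob_act A (mob_act B x)) * denom A (mob_act B x) = vec_cl (mob_act B w - mob_act B x)"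
      using A Bx(2)[OF x] Bx(2)[OF w] unfolding acts_def by blast
    also have "reversion (denom B w) * vec_cl (mob_act B w - mob_act B x) * denom B x = vec_cl (w - x)"
      using B x w unfolding acts_def by blast
    finally show "reversion (denom (A ** B) w) * vec_cl (mob_act (A ** B) w - mob_act (A ** B) x) * denom (A ** B) x = vec_cl (w - x)" .
  qed
qed

lemma idx_Max: "idx (Max UNIV :: 'n::{finite,linorder}) = CARD('n)"
  by (simp add: idx_def)

lemma upper_half_nonzero: "x \<in> upper_half \<Longrightarrow> x \<noteq> 0"
  by (auto simp: upper_half_def)

text \<open>The sign \<open>s\<close> covers the generator and its inverse at once; both act as
  \<open>x / |x|^2\<close>.\<close>

lemma acts_inversion:
  assumes s: "s = 1 \<or> s = - 1"
  shows "acts p (mat2 0 (- (s *\<^sub>R 1)) (s *\<^sub>R 1) 0)"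
proof -
  let ?M = "mat2 0 (- (s *\<^sub>R 1)) (s *\<^sub>R 1) 0 :: 'a cl_mat"
  have d: "denom ?M x = vec_cl (s *\<^sub>R x)" for x :: "'a Rn" by (simp add: denom_def vec_cl_scaleR)
  have v: "denom ?M x \<in> versor" if "x \<in> upper_half" for x :: "'a Rn"
    unfolding d using versor.vec[OF versor.one, of "s *\<^sub>R x"] upper_half_nonzero[OF that] s by auto
  have ss: "s * s = 1" using s by auto
  have n: "numer ?M x = vec_cl ((1 / (norm x)\<^sup>2) *\<^sub>R x) * denom ?M x" if "x \<in> upper_half" for x :: "'a Rn"
    using upper_half_nonzero[OF that] by (simp add: d numer_def vec_cl_scaleR vec_cl_square)
  have m: "mob_act ?M x = (1 / (norm x)\<^sup>2) *\<^sub>R x" if "x \<in> upper_half" for x :: "'a Rn"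
    by (rule mob_actI[OF v[OF that] n[OF that]])
  show ?thesis unfolding acts_def
  proof (intro ballI conjI allI impI)
    fix x :: "'a Rn" assume x: "x \<in> upper_half"
    show "denom ?M x \<in> versor" by (rule v[OF x])
    show "mob_act ?M x \<in> upper_half" unfolding m[OF x] using x upper_half_nonzero[OF x] by (simp add: upper_half_def)
    show "numer ?M x = vec_cl (mob_act ?M x) * denom ?M x" unfolding m[OF x] by (rule n[OF x])
    show "mob_act ?M x $ j = x $ j / (norm (denom ?M x))\<^sup>2" for j
      unfolding m[OF x] d norm_vec_cl using s by auto
    fix w :: "'a Rn" assume w: "w \<in> upper_half"
    have 1: "vec_cl w * vec_cl ((1 / (norm w)\<^sup>2) *\<^sub>R w) = - 1"
      using upper_half_nonzero[OF w] by (simp add: vec_cl_scaleR vec_cl_square)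
    have 2: "vec_cl ((1 / (norm x)\<^sup>2) *\<^sub>R x) * vec_cl x = - 1"
      using upper_half_nonzero[OF x] by (simp add: vec_cl_scaleR vec_cl_square)
    have "vec_cl w * vec_cl ((1 / (norm w)\<^sup>2) *\<^sub>R w - (1 / (norm x)\<^sup>2) *\<^sub>R x) * vec_cl x
      = (vec_cl w * vec_cl ((1 / (norm w)\<^sup>2) *\<^sub>R w)) * vec_cl x - vec_cl w * (vec_cl ((1 / (norm x)\<^sup>2) *\<^sub>R x) * vec_cl x)"
      by (simp add: vec_cl_diff algebra_simps)
    also have "\<dots> = vec_cl (w - x)" unfolding 1 2 by (simp add: vec_cl_diff)
    finally show "reversion (denom ?M w) * vec_cl (mob_act ?M w - mob_act ?M x) * denom ?M x = vec_cl (w - x)"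
      unfolding m[OF x] m[OF w] d reversion_vec_cl by (simp add: vec_cl_scaleR ss)
  qed
qed

lemma denom_translation: "denom (mat2 1 (vec_cl m) 0 1) x = 1"
  by (simp add: denom_def)

lemma acts_translation:
  assumes m: "\<And>j. p < idx j \<Longrightarrow> m $ j = 0" and p: "p < CARD('n)"
  shows "acts p (mat2 1 (vec_cl m) 0 1 :: 'n::{finite,linorder} cl_mat)"
    and "\<And>x. mob_act (mat2 1 (vec_cl m) 0 1 :: 'n cl_mat) x = x + m"
proof -
  let ?M = "mat2 1 (vec_cl m) 0 1 :: 'n cl_mat"
  show ma: "mob_act ?M x = x + m" for x
    by (rule mob_actI) (simp_all add: denom_translation numer_def vec_cl_add versor.one)
  show "acts p ?M" unfolding acts_def
    using m[of "Max UNIV"] p m by (auto simp: ma denom_translation numer_def vec_cl_add versor.one upper_half_def idx_Max norm_one_clifford vec_cl_diff[symmetric])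
qed

section \<open>The generated group\<close>

text \<open>The monoid generated by the generators and their inverses. Induction over it has no case
  for inverting an arbitrary element, in which neither \<open>acts\<close> nor integrality would be
  at hand.\<close>

inductive_set Gamma_mon :: "nat \<Rightarrow> 'n::{finite,linorder} cl_mat set" for p :: nat where
  inv: "s = 1 \<or> s = - 1 \<Longrightarrow> mat2 0 (- (s *\<^sub>R 1)) (s *\<^sub>R 1) 0 \<in> Gamma_mon p"
| trans: "idx j \<le> p \<Longrightarrow> s = 1 \<or> s = - 1 \<Longrightarrow> mat2 1 (vec_cl (s *\<^sub>R axis j 1)) 0 1 \<in> Gamma_mon p"
| one: "mat 1 \<in> Gamma_mon p"
| mult: "A \<in> Gamma_mon p \<Longrightarrow> B \<in> Gamma_mon p \<Longrightarrow> A ** B \<in> Gamma_mon p"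

text \<open>The inverse is carried along in the monoid, so that the inversion rule of
  \<open>Gamma\<close> only exchanges the two, by uniqueness of inverses.\<close>

lemma Gamma_imp_Gamma_mon:
  assumes "M \<in> Gamma p"
  shows "M \<in> Gamma_mon p \<and> (\<exists>M'\<in>Gamma_mon p. M ** M' = mat 1 \<and> M' ** M = mat 1)"
  using assms
proof induction
  case inversion
  have 1: "mat2 0 (- ((1::real) *\<^sub>R 1)) ((1::real) *\<^sub>R 1) 0 \<in> Gamma_mon p" by (rule Gamma_mon.inv) simp
  have 2: "mat2 0 (- ((-1::real) *\<^sub>R 1)) ((-1::real) *\<^sub>R 1) 0 \<in> Gamma_mon p" by (rule Gamma_mon.inv) simp
  show ?case using 1 2 by (auto simp: mat_1_mat2 mat2_mult intro!: bexI[OF _ 2])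
next
  case (translation j)
  have 1: "mat2 1 (vec_cl ((1::real) *\<^sub>R axis j 1)) 0 1 \<in> Gamma_mon p" by (rule Gamma_mon.trans[OF translation]) simp
  have 2: "mat2 1 (vec_cl ((-1::real) *\<^sub>R axis j 1)) 0 1 \<in> Gamma_mon p" by (rule Gamma_mon.trans[OF translation]) simp
  show ?case using 1 2 by (auto simp: mat_1_mat2 mat2_mult vec_cl_axis vec_cl_minus intro!: bexI[OF _ 2])
next
  case one
  show ?case using Gamma_mon.one by (auto simp: matrix_mul_lid)
next
  case (mult A B)
  then obtain A' B' where A': "A' \<in> Gamma_mon p" "A ** A' = mat 1" "A' ** A = mat 1" and B': "B' \<in> Gamma_mon p" "B ** B' = mat 1" "B' ** B = mat 1" by blast
  have "(A ** B) ** (B' ** A') = A ** (B ** B') ** A'" by (simp add: matrix_mul_assoc)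
  then have 1: "(A ** B) ** (B' ** A') = mat 1" by (simp add: A' B' matrix_mul_rid)
  have "(B' ** A') ** (A ** B) = B' ** (A' ** A) ** B" by (simp add: matrix_mul_assoc)
  then have 2: "(B' ** A') ** (A ** B) = mat 1" by (simp add: A' B' matrix_mul_rid)
  show ?case using 1 2 mult A' B' by (auto intro!: Gamma_mon.mult)
next
  case (inverse A B)
  then obtain A' where A': "A' \<in> Gamma_mon p" "A ** A' = mat 1" "A' ** A = mat 1" and A: "A \<in> Gamma_mon p" by blast
  have "B = B ** (A ** A')" by (simp add: A' matrix_mul_rid)
  also have "\<dots> = A'" by (simp add: matrix_mul_assoc inverse matrix_mul_lid)
  finally show ?case using A A' by auto
qed

lemma Gamma_mon_acts: "M \<in> Gamma_mon p \<Longrightarrow> p < CARD('n) \<Longrightarrow> acts p (M :: 'n::{finite,linorder} cl_mat)"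
proof (induction rule: Gamma_mon.induct)
  case (inv s) then show ?case by (intro acts_inversion)
next
  case (trans j s) then show ?case by (intro acts_translation) (auto simp: axis_def)
next
  case one
  show ?case using acts_translation(1)[of p 0] one by (simp add: mat_1_mat2 vec_cl_0)
next
  case (mult A B) then show ?case by (intro acts_mult)
qed

lemma Gamma_acts: "M \<in> Gamma p \<Longrightarrow> p < CARD('n) \<Longrightarrow> acts p (M :: 'n::{finite,linorder} cl_mat)"
  using Gamma_imp_Gamma_mon Gamma_mon_acts by blast

lemma Gamma_surjective:
  assumes "M \<in> Gamma p" "p < CARD('n)" "y \<in> upper_half"
  obtains w where "w \<in> upper_half" "mob_act (M :: 'n::{finite,linorder} cl_mat) w = y"
proof -
  obtain M' where M': "M' \<in> Gamma_mon p" "M ** M' = mat 1" using Gamma_imp_Gamma_mon[OF assms(1)] by blast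
  have a: "acts p M" "acts p M'" using Gamma_acts[OF assms(1,2)] Gamma_mon_acts[OF M'(1) assms(2)] by auto
  have "mob_act M (mob_act M' y) = mob_act (mat 1) y" using acts_mult(3)[OF a assms(3)] M'(2) by simp
  also have "\<dots> = y" using acts_translation(2)[of p 0 y] assms(2) by (simp add: mat_1_mat2 vec_cl_0)
  finally show thesis using that[of "mob_act M' y"] a(2) assms(3) unfolding acts_def by blast
qed

section \<open>Integrality and the lower bound for denominators\<close>

lemma int_ring_0: "0 \<in> int_ring p" and int_ring_1: "1 \<in> int_ring p"
  and int_ring_minus: "a \<in> int_ring p \<Longrightarrow> - a \<in> int_ring p"
  by (auto simp: int_ring_def one_clifford_def coeff_blade)

lemma int_ring_add:
  assumes "a \<in> int_ring p" "b \<in> int_ring p" shows "a + b \<in> int_ring p"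
  unfolding int_ring_def
proof (intro CollectI allI conjI impI)
  fix A
  show "cl_coeff (a + b) A \<in> \<int>" using assms by (simp add: int_ring_def)
  assume "cl_coeff (a + b) A \<noteq> 0"
  then have "cl_coeff a A \<noteq> 0 \<or> cl_coeff b A \<noteq> 0" by auto
  then show "A \<subseteq> {j. idx j \<le> p}" using assms unfolding int_ring_def by blast
qed

lemma int_ring_mult:
  assumes "a \<in> int_ring p" "b \<in> int_ring p" shows "a * b \<in> int_ring p"
  unfolding int_ring_def
proof (intro CollectI allI conjI impI)
  fix C
  have bs: "blade_sign A B \<in> \<int>" for A B :: "'a set" by (simp add: blade_sign_def)
  show "cl_coeff (a * b) C \<in> \<int>"
    unfolding coeff_times using assms bs by (intro Ints_sum Ints_mult) (auto simp: int_ring_def)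
  assume "cl_coeff (a * b) C \<noteq> 0"
  then obtain A where "cl_coeff a A * cl_coeff b (symdiff A C) * blade_sign A (symdiff A C) \<noteq> 0"
    unfolding coeff_times by (rule sum.not_neutral_contains_not_neutral)
  then have "cl_coeff a A \<noteq> 0" "cl_coeff b (symdiff A C) \<noteq> 0" by simp_all
  then have "A \<subseteq> {j. idx j \<le> p}" "symdiff A C \<subseteq> {j. idx j \<le> p}" using assms unfolding int_ring_def by blast+
  moreover have "C \<subseteq> A \<union> symdiff A C" by (auto simp: symdiff_def)
  ultimately show "C \<subseteq> {j. idx j \<le> p}" by blast
qed

lemma int_ring_gen: "idx j \<le> p \<Longrightarrow> gen j \<in> int_ring p"
  by (auto simp: int_ring_def gen_def coeff_blade)

lemma Gamma_mon_int: "M \<in> Gamma_mon p \<Longrightarrow> M $ i $ k \<in> int_ring p"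
proof (induction arbitrary: i k rule: Gamma_mon.induct)
  case (inv s)
  then show ?case using exhaust_2[of i] exhaust_2[of k] by (auto simp: int_ring_0 int_ring_1 int_ring_minus)
next
  case (trans j s)
  then show ?case using exhaust_2[of i] exhaust_2[of k]
    by (auto simp: vec_cl_minus vec_cl_axis int_ring_0 int_ring_1 int_ring_minus int_ring_gen)
next
  case one
  then show ?case using exhaust_2[of i] exhaust_2[of k] by (auto simp: mat_1_mat2 intro: int_ring_0 int_ring_1)
next
  case (mult A B)
  then show ?case by (auto simp: mult_entries intro!: int_ring_add int_ring_mult)
qed

lemma int_ring_coeff_ge_1: "a \<in> int_ring p \<Longrightarrow> cl_coeff a A \<noteq> 0 \<Longrightarrow> 1 \<le> \<bar>cl_coeff a A\<bar>"
  by (auto simp: int_ring_def intro: Ints_nonzero_abs_ge1)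

text \<open>The entries are integral and do not involve the last generator. If \<open>c\<close> has
  a nonzero coefficient at \<open>A\<close>, the coefficient of \<open>cx + d\<close> at
  \<open>A\<close> with the last index added is, up to sign, that integer times the last coordinate
  of \<open>x\<close>, for no other term produces this blade. If \<open>c = 0\<close>, then
  \<open>d\<close> is a nonzero integral element.\<close>

lemma Gamma_denom_ge:
  fixes M :: "'n::{finite,linorder} cl_mat"
  assumes M: "M \<in> Gamma p" and p: "p < CARD('n)" and x: "x \<in> upper_half"
  shows "norm (denom M x) \<ge> min 1 (x $ Max UNIV)"
proof -
  have int: "M $ i $ k \<in> int_ring p" for i k using Gamma_mon_int Gamma_imp_Gamma_mon[OF M] by blast
  let ?c = "M $ 2 $ 1" and ?d = "M $ 2 $ 2" and ?n = "Max UNIV :: 'n"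
  have xn: "x $ ?n > 0" using x by (simp add: upper_half_def)
  show ?thesis
  proof (cases "?c = 0")
    case True
    then have "denom M x = ?d" by (simp add: denom_def)
    moreover have "denom M x \<in> versor" using Gamma_acts[OF M p] x by (auto simp: acts_def)
    then have "denom M x \<noteq> 0" using versor_norm_pos by fastforce
    ultimately obtain A where "cl_coeff ?d A \<noteq> 0" by (auto simp: clifford_eq_iff)
    then have "1 \<le> norm ?d" using int_ring_coeff_ge_1[OF int] abs_coeff_le_norm order_trans by blast
    then show ?thesis using \<open>denom M x = ?d\<close> by simp
  next
    case False
    then obtain A where A: "cl_coeff ?c A \<noteq> 0" by (auto simp: clifford_eq_iff)
    have out: "cl_coeff (M $ i $ k) B = 0" if "?n \<in> B" for B i k
    proof (rule ccontr)
      assume "cl_coeff (M $ i $ k) B \<noteq> 0"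
      then have "B \<subseteq> {j. idx j \<le> p}" using int[of i k] by (auto simp: int_ring_def)
      then have "idx ?n \<le> p" using that by blast
      then show False using p by (simp add: idx_Max)
    qed
    have nA: "?n \<notin> A" using out A by blast
    let ?C = "insert ?n A"
    have "cl_coeff (?c * gen j) ?C = cl_coeff ?c (symdiff ?C {j}) * blade_sign (symdiff ?C {j}) {j}" for j
    proof -
      have eq: "{j} = symdiff B ?C \<longleftrightarrow> B = symdiff ?C {j}" for B
        by (metis symdiff_commute symdiff_simps(3))
      show ?thesis by (simp add: coeff_times gen_def coeff_blade mult_delta_right mult_delta_left eq)
         (metis symdiff_commute symdiff_simps(3))
    qed
    moreover have "cl_coeff ?c (symdiff ?C {j}) = 0" if "j \<noteq> ?n" for j
      using that by (intro out) (auto simp: symdiff_def)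
    moreover have "symdiff ?C {?n} = A" using nA by (auto simp: symdiff_def)
    ultimately have g: "cl_coeff (?c * gen j) ?C = (if j = ?n then cl_coeff ?c A * blade_sign A {?n} else 0)" for j by auto
    have "cl_coeff (denom M x) ?C = (\<Sum>j\<in>UNIV. x $ j * cl_coeff (?c * gen j) ?C)"
      by (simp add: denom_def out vec_cl_def sum_distrib_left coeff_sum)
    also have "\<dots> = x $ ?n * (cl_coeff ?c A * blade_sign A {?n})" by (simp add: g if_distrib sum.delta cong: if_cong)
    finally have "\<bar>cl_coeff (denom M x) ?C\<bar> = x $ ?n * \<bar>cl_coeff ?c A\<bar>"
      using xn by (simp add: abs_mult blade_sign_def)
    also have "\<dots> \<ge> x $ ?n * 1" using int_ring_coeff_ge_1[OF int A] xn by (intro mult_left_mono) auto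
    finally show ?thesis using abs_coeff_le_norm[of "denom M x" ?C] by simp
  qed
qed

section \<open>Cauchy's integral formula\<close>

lemma has_derivative_imp_has_dir_deriv:
  fixes \<phi> :: "'a::euclidean_space \<Rightarrow> real"
  assumes "(\<phi> has_derivative \<phi>') (at z)"
  shows "has_dir_deriv \<phi> z e (\<phi>' e)"
proof -
  have lin: "bounded_linear \<phi>'" using assms by (rule has_derivative_bounded_linear)
  have "((\<lambda>h. \<phi> (z + h *\<^sub>R e)) has_derivative (\<lambda>h. \<phi>' (h *\<^sub>R e))) (at 0)"
    by (rule has_derivative_compose[of "\<lambda>h. z + h *\<^sub>R e" "\<lambda>h. h *\<^sub>R e" 0 UNIV \<phi> \<phi>'])
       (use assms in \<open>auto intro!: derivative_eq_intros\<close>)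
  then have "((\<lambda>h. \<phi> (z + h *\<^sub>R e)) has_real_derivative \<phi>' e) (at 0)"
    by (simp add: has_field_derivative_def linear_scale[OF bounded_linear.linear[OF lin]] mult_commute_abs)
  then show ?thesis by (simp add: DERIV_def has_dir_deriv_def)
qed

theorem lipschitz_divergence_vector:
  fixes V U :: "'a::euclidean_space set" and g d :: "'a \<Rightarrow> 'b::euclidean_space"
  assumes V: "open V" "bounded V" and S: "strongly_lipschitz (frontier V)"
    and U: "open U" "closure V \<subseteq> U" and g: "continuous_on U g"
    and M: "\<delta> > 0" "\<And>x v. x \<in> V \<Longrightarrow> norm v < \<delta> \<Longrightarrow> norm (g (x + v) - g x) \<le> M * norm v"
    and d: "AE x in lborel. x \<in> V \<longrightarrow> (\<exists>g'. (g has_derivative g') (at x) \<and> g' e = d x)"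
    and dm: "(\<lambda>x. indicator V x *\<^sub>R d x) \<in> borel_measurable borel"
  shows "(LINT x|lborel. indicator V x *\<^sub>R d x) = (LINT x|surface_measure (frontier V). (e \<bullet> outward_normal V x) *\<^sub>R g x)"
   and "integrable lborel (\<lambda>x. indicator V x *\<^sub>R d x)"
   and "integrable (surface_measure (frontier V)) (\<lambda>x. (e \<bullet> outward_normal V x) *\<^sub>R g x)"
proof -
  let ?\<sigma> = "surface_measure (frontier V)"
  have gb: "continuous_on U (\<lambda>x. g x \<bullet> b)" for b by (intro continuous_intros g)
  have Mb: "\<bar>g (x + v) \<bullet> b - g x \<bullet> b\<bar> \<le> M * norm v" if "x \<in> V" "norm v < \<delta>" "b \<in> Basis" for x v b
    using Basis_le_norm[OF that(3), of "g (x + v) - g x"] M(2)[OF that(1,2)] by (simp add: inner_diff_left)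
  have db: "AE x in lborel. x \<in> V \<longrightarrow> has_dir_deriv (\<lambda>x. g x \<bullet> b) x e (d x \<bullet> b)" for b
    using d
  proof eventually_elim
    fix x assume x: "x \<in> V \<longrightarrow> (\<exists>g'. (g has_derivative g') (at x) \<and> g' e = d x)"
    show "x \<in> V \<longrightarrow> has_dir_deriv (\<lambda>x. g x \<bullet> b) x e (d x \<bullet> b)"
    proof
      assume "x \<in> V"
      then obtain g' where g': "(g has_derivative g') (at x)" "g' e = d x" using x by blast
      from has_derivative_imp_has_dir_deriv[OF has_derivative_inner_left[OF g'(1), of b], of e]
      show "has_dir_deriv (\<lambda>x. g x \<bullet> b) x e (d x \<bullet> b)" by (simp add: g'(2))
    qed
  qed
  have dmb: "(\<lambda>x. indicator V x * (d x \<bullet> b)) \<in> borel_measurable borel" for b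
  proof -
    have "(\<lambda>x. (indicator V x *\<^sub>R d x) \<bullet> b) \<in> borel_measurable borel"
      by (rule borel_measurable_inner[OF dm borel_measurable_const])
    then show ?thesis by simp
  qed
  note div = lipschitz_divergence[OF V S U gb M(1) Mb db dmb]
  have fU: "frontier V \<subseteq> U" using U(2) by (auto simp: frontier_def)
  have h: "\<And>n. 0 < 1 / real (Suc n)" "(\<lambda>n. 1 / real (Suc n)) \<longlonglongrightarrow> 0" using LIMSEQ_Suc[OF lim_1_over_n] by auto
  have ib: "integrable ?\<sigma> (\<lambda>x. (g x \<bullet> b) * (e \<bullet> outward_normal V x))" for b
    by (rule boundary_flux(2)[OF V S U(1) fU gb h])
  have rep: "(e \<bullet> outward_normal V x) *\<^sub>R g x = (\<Sum>b\<in>Basis. ((g x \<bullet> b) * (e \<bullet> outward_normal V x)) *\<^sub>R b)" for x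
    by (subst euclidean_representation[of "g x", symmetric]) (simp add: scaleR_sum_right mult.commute)
  show i2: "integrable ?\<sigma> (\<lambda>x. (e \<bullet> outward_normal V x) *\<^sub>R g x)"
    unfolding rep by (intro Bochner_Integration.integrable_sum integrable_scaleR_left ib)
  have rep1: "indicator V x *\<^sub>R d x = (\<Sum>b\<in>Basis. (indicator V x * (d x \<bullet> b)) *\<^sub>R b)" for x
    by (subst euclidean_representation[of "d x", symmetric]) (simp add: scaleR_sum_right)
  show i1: "integrable lborel (\<lambda>x. indicator V x *\<^sub>R d x)"
    unfolding rep1 by (intro Bochner_Integration.integrable_sum integrable_scaleR_left div(2))
  show "(LINT x|lborel. indicator V x *\<^sub>R d x) = (LINT x|?\<sigma>. (e \<bullet> outward_normal V x) *\<^sub>R g x)"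
  proof (rule euclidean_eqI)
    fix b :: 'b assume b: "b \<in> Basis"
    have "(LINT x|lborel. indicator V x *\<^sub>R d x) \<bullet> b = (LINT x|lborel. indicator V x * (d x \<bullet> b))"
      using integral_inner_left[of b lborel "\<lambda>x. indicator V x *\<^sub>R d x"] i1 by simp
    also have "\<dots> = (LINT x|?\<sigma>. (g x \<bullet> b) * (e \<bullet> outward_normal V x))" using b by (intro div(1))
    also have "\<dots> = (LINT x|?\<sigma>. (e \<bullet> outward_normal V x) *\<^sub>R g x) \<bullet> b"
      using integral_inner_left[of b ?\<sigma> "\<lambda>x. (e \<bullet> outward_normal V x) *\<^sub>R g x"] i2 by (simp add: mult.commute)
    finally show "(LINT x|lborel. indicator V x *\<^sub>R d x) \<bullet> b = (LINT x|?\<sigma>. (e \<bullet> outward_normal V x) *\<^sub>R g x) \<bullet> b" .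
  qed
qed

lemma bounded_bilinear_clifford: "bounded_bilinear ((*) :: 'n::{finite,linorder} clifford \<Rightarrow> 'n clifford \<Rightarrow> 'n clifford)"
  unfolding bilinear_conv_bounded_bilinear[symmetric] bilinear_def
  by (auto intro!: linearI simp: algebra_simps)

lemma bounded_linear_vec_cl: "bounded_linear vec_cl"
  unfolding linear_conv_bounded_linear[symmetric] by (rule linearI) (simp_all add: vec_cl_add vec_cl_scaleR)

lemmas clifford_FDERIV = bounded_bilinear.FDERIV[OF bounded_bilinear_clifford]
lemmas clifford_continuous_on = bounded_bilinear.continuous_on[OF bounded_bilinear_clifford]

lemma clifford_mult_measurable [measurable (raw)]:
  fixes a b :: "'x \<Rightarrow> 'n::{finite,linorder} clifford"
  assumes "a \<in> borel_measurable M" "b \<in> borel_measurable M"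
  shows "(\<lambda>x. a x * b x) \<in> borel_measurable M"
  using assms by (rule borel_measurable_continuous_Pair) (intro clifford_continuous_on continuous_intros)

lemma vec_cl_measurable [measurable (raw)]:
  "a \<in> borel_measurable M \<Longrightarrow> (\<lambda>x. vec_cl (a x)) \<in> borel_measurable M"
  by (rule measurable_compose[OF _ borel_measurable_continuous_onI[OF linear_continuous_on[OF bounded_linear_vec_cl]]])

section \<open>The truncated kernel\<close>

lemma power_lipschitz_bounded:
  fixes R :: real
  assumes "R \<ge> 0"
  shows "\<exists>C\<ge>0. \<forall>a\<in>{0..R}. \<forall>b\<in>{0..R}. \<bar>a ^ n - b ^ n\<bar> \<le> C * \<bar>a - b\<bar>"
proof (induction n)
  case (Suc n)
  then obtain C where C: "C \<ge> 0" "\<And>a b. a \<in> {0..R} \<Longrightarrow> b \<in> {0..R} \<Longrightarrow> \<bar>a ^ n - b ^ n\<bar> \<le> C * \<bar>a - b\<bar>" by blast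
  show ?case
  proof (intro exI[of _ "R * C + R ^ n"] conjI ballI)
    show "R * C + R ^ n \<ge> 0" using C assms by simp
    fix a b assume ab: "a \<in> {0..R}" "b \<in> {0..R}"
    have "a ^ Suc n - b ^ Suc n = a * (a ^ n - b ^ n) + (a - b) * b ^ n" by (simp add: algebra_simps)
    then have "\<bar>a ^ Suc n - b ^ Suc n\<bar> \<le> \<bar>a\<bar> * \<bar>a ^ n - b ^ n\<bar> + \<bar>a - b\<bar> * \<bar>b ^ n\<bar>"
      by (metis abs_mult abs_triangle_ineq)
    also have "\<dots> \<le> R * (C * \<bar>a - b\<bar>) + \<bar>a - b\<bar> * R ^ n"
      using ab C assms by (intro add_mono mult_mono) (auto intro: power_mono)
    finally show "\<bar>a ^ Suc n - b ^ Suc n\<bar> \<le> (R * C + R ^ n) * \<bar>a - b\<bar>" by (simp add: algebra_simps)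
  qed
qed (auto intro: exI[of _ 0])

text \<open>\<open>kernel_G\<close> with the norm in the denominator kept at
  \<open>\<epsilon>\<close> inside the ball of radius \<open>\<epsilon>\<close>: linear there,
  unchanged outside, continuous everywhere.\<close>

definition truncated_kernel :: "real \<Rightarrow> 'n Rn \<Rightarrow> 'n::{finite,linorder} clifford" where
  "truncated_kernel \<epsilon> u = (1 / (real CARD('n) * unit_ball_vol (real CARD('n)) * (max (norm u) \<epsilon>) ^ CARD('n))) *\<^sub>R vec_cl u"

lemma truncated_kernel_eq: "\<epsilon> \<le> norm u \<Longrightarrow> truncated_kernel \<epsilon> u = kernel_G u"
  by (simp add: truncated_kernel_def kernel_G_def max_def)

lemma unit_ball_vol_nonzero [simp]: "unit_ball_vol (real n) \<noteq> 0"
  using unit_ball_vol_pos[of "real n"] by (metis less_irrefl of_nat_0_le_iff)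

lemma truncated_kernel_lipschitz:
  assumes \<epsilon>: "\<epsilon> > 0"
  shows "\<exists>C. \<forall>u v. norm u \<le> R \<longrightarrow> norm v \<le> R \<longrightarrow> norm (truncated_kernel \<epsilon> u - truncated_kernel \<epsilon> v :: 'n::{finite,linorder} clifford) \<le> C * norm (u - v)"
proof -
  let ?n = "CARD('n)" and ?m = "\<lambda>u :: 'n Rn. max (norm u) \<epsilon>"
  define c where "c = 1 / (real ?n * unit_ball_vol (real ?n))"
  define R' where "R' = max R \<epsilon>"
  have R': "R' \<ge> 0" using \<epsilon> by (simp add: R'_def)
  obtain C where C: "C \<ge> 0" "\<And>a b. a \<in> {0..R'} \<Longrightarrow> b \<in> {0..R'} \<Longrightarrow> \<bar>a ^ ?n - b ^ ?n\<bar> \<le> C * \<bar>a - b\<bar>"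
    using power_lipschitz_bounded[OF R', of ?n] by blast
  have "norm (truncated_kernel \<epsilon> u - truncated_kernel \<epsilon> v) \<le> (\<bar>c\<bar> * (1 / \<epsilon> ^ ?n + R' * (C / (\<epsilon> ^ ?n * \<epsilon> ^ ?n)))) * norm (u - v)"
    if uv: "norm u \<le> R" "norm v \<le> R" for u v :: "'n Rn"
  proof -
    have pos: "?m u ^ ?n \<ge> \<epsilon> ^ ?n" "?m v ^ ?n \<ge> \<epsilon> ^ ?n" "\<epsilon> ^ ?n > 0" using \<epsilon> by (auto intro!: power_mono)
    have mm: "\<bar>?m v - ?m u\<bar> \<le> norm (u - v)"
      using norm_triangle_ineq3[of u v] by (auto simp: max_def abs_le_iff)
    have eq: "truncated_kernel \<epsilon> u - truncated_kernel \<epsilon> v = c *\<^sub>R ((1 / ?m u ^ ?n) *\<^sub>R vec_cl (u - v) + (1 / ?m u ^ ?n - 1 / ?m v ^ ?n) *\<^sub>R vec_cl v)"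
      by (simp add: truncated_kernel_def c_def vec_cl_diff algebra_simps)
    have "norm (truncated_kernel \<epsilon> u - truncated_kernel \<epsilon> v) \<le> \<bar>c\<bar> * (\<bar>1 / ?m u ^ ?n\<bar> * norm (u - v) + \<bar>1 / ?m u ^ ?n - 1 / ?m v ^ ?n\<bar> * norm v)"
      unfolding eq norm_scaleR by (intro mult_left_mono order_trans[OF norm_triangle_ineq]) (simp_all add: norm_vec_cl)
    also have "\<dots> \<le> \<bar>c\<bar> * ((1 / \<epsilon> ^ ?n) * norm (u - v) + (C * norm (u - v) / (\<epsilon> ^ ?n * \<epsilon> ^ ?n)) * R')"
    proof (intro mult_left_mono add_mono mult_mono)
      show "\<bar>1 / ?m u ^ ?n\<bar> \<le> 1 / \<epsilon> ^ ?n" using pos by (simp add: frac_le)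
      have "\<bar>1 / ?m u ^ ?n - 1 / ?m v ^ ?n\<bar> = \<bar>?m v ^ ?n - ?m u ^ ?n\<bar> / (?m u ^ ?n * ?m v ^ ?n)"
      proof -
        have "1 / a - 1 / b = (b - a) / (a * b)" if "a > 0" "b > 0" for a b :: real using that by (simp add: field_simps)
        moreover have "?m u ^ ?n > 0" "?m v ^ ?n > 0" using pos by linarith+
        ultimately show ?thesis by (simp only: abs_divide) (simp add: abs_mult)
      qed
      also have "\<dots> \<le> (C * norm (u - v)) / (\<epsilon> ^ ?n * \<epsilon> ^ ?n)"
      proof (intro frac_le mult_mono)
        have "\<bar>?m v ^ ?n - ?m u ^ ?n\<bar> \<le> C * \<bar>?m v - ?m u\<bar>"
          using uv \<epsilon> by (intro C(2)) (auto simp: R'_def max_def)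
        also have "\<dots> \<le> C * norm (u - v)" using mm C(1) by (rule mult_left_mono)
        finally show "\<bar>?m v ^ ?n - ?m u ^ ?n\<bar> \<le> C * norm (u - v)" .
      qed (use pos C in auto)
      finally show "\<bar>1 / ?m u ^ ?n - 1 / ?m v ^ ?n\<bar> \<le> C * norm (u - v) / (\<epsilon> ^ ?n * \<epsilon> ^ ?n)" .
      show "norm v \<le> R'" using uv by (simp add: R'_def)
    qed (use pos C R' in auto)
    also have "\<dots> = (\<bar>c\<bar> * (1 / \<epsilon> ^ ?n + R' * (C / (\<epsilon> ^ ?n * \<epsilon> ^ ?n)))) * norm (u - v)"
      by (simp add: algebra_simps)
    finally show ?thesis .
  qed
  then show ?thesis by blast
qed

lemma truncated_kernel_continuous: "\<epsilon> > 0 \<Longrightarrow> continuous_on UNIV (truncated_kernel \<epsilon>)"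
  unfolding truncated_kernel_def[abs_def]
  by (intro continuous_intros continuous_on_compose2[OF linear_continuous_on[OF bounded_linear_vec_cl]]) (auto simp: max_def)

text \<open>The derivative of \<open>truncated_kernel\<close> at \<open>u\<close> in direction
  \<open>h\<close>, away from the sphere of radius \<open>\<epsilon>\<close>.\<close>

definition kernel_deriv :: "real \<Rightarrow> 'n Rn \<Rightarrow> 'n Rn \<Rightarrow> 'n::{finite,linorder} clifford" where
  "kernel_deriv \<epsilon> u h = (1 / (real CARD('n) * unit_ball_vol (real CARD('n)))) *\<^sub>R
     (if norm u < \<epsilon> then (1 / \<epsilon> ^ CARD('n)) *\<^sub>R vec_cl h
      else (1 / norm u ^ CARD('n)) *\<^sub>R vec_cl h - (real CARD('n) * (u \<bullet> h) / norm u ^ (CARD('n) + 2)) *\<^sub>R vec_cl u)"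

text \<open>The Dirac operator acting from the right. Outside the ball \<open>kernel_G\<close> is
  monogenic; inside, the sum of the squares of the generators is \<open>-n\<close>, which cancels
  the factor \<open>n\<close> in the surface area and leaves minus one over the volume of the
  ball.\<close>

lemma kernel_deriv_sum:
  assumes "\<epsilon> > 0"
  shows "(\<Sum>j\<in>UNIV. kernel_deriv \<epsilon> u (axis j 1) * gen j :: 'n::{finite,linorder} clifford)
    = (if norm u < \<epsilon> then - (1 / (unit_ball_vol (real CARD('n)) * \<epsilon> ^ CARD('n))) *\<^sub>R 1 else 0)"
proof -
  let ?n = "real CARD('n)"
  have g: "gen j * gen j = - (1 :: 'n clifford)" for j
    using vec_cl_square[of "axis j 1"] by (simp add: vec_cl_axis norm_axis_1)
  have gg: "(\<Sum>j\<in>UNIV. gen j * gen j) = - (?n *\<^sub>R (1 :: 'n clifford))"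
    by (simp add: g scaleR_conv_of_real)
  have uu: "(\<Sum>j\<in>UNIV. (u \<bullet> axis j 1) *\<^sub>R (vec_cl u * gen j)) = - ((norm u)\<^sup>2 *\<^sub>R 1)"
  proof -
    have "(\<Sum>j\<in>UNIV. (u \<bullet> axis j 1) *\<^sub>R (vec_cl u * gen j)) = vec_cl u * vec_cl u"
      by (subst (3) vec_cl_def) (simp add: sum_distrib_left inner_axis)
    then show ?thesis by (simp add: vec_cl_square)
  qed
  show ?thesis
  proof (cases "norm u < \<epsilon>")
    case True
    have "(\<Sum>j\<in>UNIV. kernel_deriv \<epsilon> u (axis j 1) * gen j) = (1 / (?n * unit_ball_vol ?n)) *\<^sub>R (1 / \<epsilon> ^ CARD('n)) *\<^sub>R (\<Sum>j\<in>UNIV. gen j * gen j)"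
      using True by (simp add: kernel_deriv_def vec_cl_axis scaleR_sum_right)
    then show ?thesis using True by (simp add: gg)
  next
    case False
    then have u0: "norm u > 0" using assms by linarith
    have "(\<Sum>j\<in>UNIV. kernel_deriv \<epsilon> u (axis j 1) * gen j) = (1 / (?n * unit_ball_vol ?n)) *\<^sub>R
       ((1 / norm u ^ CARD('n)) *\<^sub>R (\<Sum>j\<in>UNIV. gen j * gen j) - (?n / norm u ^ (CARD('n) + 2)) *\<^sub>R (\<Sum>j\<in>UNIV. (u \<bullet> axis j 1) *\<^sub>R (vec_cl u * gen j)))"
      using False by (simp add: kernel_deriv_def vec_cl_axis scaleR_sum_right sum_subtractf[symmetric] algebra_simps)
    also have "\<dots> = 0" unfolding gg uu using u0 by (simp add: power_add power2_eq_square)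
    finally show ?thesis using False by simp
  qed
qed

lemma norm_power_has_derivative:
  fixes u :: "'a::real_inner"
  assumes "u \<noteq> 0"
  shows "((\<lambda>u. 1 / norm u ^ n) has_derivative (\<lambda>h. - (real n * (u \<bullet> h) / norm u ^ (n + 2)))) (at u)"
proof -
  have N: "(norm has_derivative (\<lambda>h. u \<bullet> h / norm u)) (at u)"
    using GDERIV_norm[OF assms] by (simp add: gderiv_def sgn_div_norm inner_commute divide_inverse mult.commute)
  have "DERIV (\<lambda>t. 1 / t ^ n) (norm u) :> - (1 * (real n * norm u ^ (n - 1))) / (norm u ^ n * norm u ^ n)"
    using assms by (auto intro!: derivative_eq_intros)
  from DERIV_compose_FDERIV[OF this N]
  have "((\<lambda>u. 1 / norm u ^ n) has_derivative (\<lambda>h. - (1 * (real n * (u \<bullet> h / norm u) * norm u ^ (n - 1))) / (norm u ^ n * norm u ^ n))) (at u)"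
    by (simp add: mult_ac)
  moreover have "- (1 * (real n * (u \<bullet> h / norm u) * norm u ^ (n - 1))) / (norm u ^ n * norm u ^ n) = - (real n * (u \<bullet> h) / norm u ^ (n + 2))" for h
    using assms by (cases n) (simp_all add: field_simps power_add power2_eq_square)
  ultimately show ?thesis by simp
qed

lemma truncated_kernel_derivative:
  fixes u :: "'n::{finite,linorder} Rn"
  assumes \<epsilon>: "\<epsilon> > 0" and u: "norm u \<noteq> \<epsilon>"
  shows "(truncated_kernel \<epsilon> has_derivative kernel_deriv \<epsilon> u) (at u)"
proof -
  let ?n = "CARD('n)"
  define c where "c = 1 / (real ?n * unit_ball_vol (real ?n))"
  show ?thesis
  proof (cases "norm u < \<epsilon>")
    case True
    have "((\<lambda>v. c *\<^sub>R (1 / \<epsilon> ^ ?n) *\<^sub>R vec_cl v) has_derivative (\<lambda>h. c *\<^sub>R (1 / \<epsilon> ^ ?n) *\<^sub>R vec_cl h)) (at u)"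
      by (intro has_derivative_scaleR_right bounded_linear_imp_has_derivative bounded_linear_vec_cl)
    moreover have "open (ball (0::'n Rn) \<epsilon>)" "u \<in> ball 0 \<epsilon>" using True by auto
    ultimately have "(truncated_kernel \<epsilon> has_derivative (\<lambda>h. c *\<^sub>R (1 / \<epsilon> ^ ?n) *\<^sub>R vec_cl h)) (at u)"
      by (rule has_derivative_transform_within_open) (auto simp: truncated_kernel_def c_def max_def)
    moreover have "kernel_deriv \<epsilon> u = (\<lambda>h. c *\<^sub>R (1 / \<epsilon> ^ ?n) *\<^sub>R vec_cl h)"
      using True by (auto simp: kernel_deriv_def c_def fun_eq_iff)
    ultimately show ?thesis by simp
  next
    case False
    then have u': "\<epsilon> < norm u" "u \<noteq> 0" using u \<epsilon> by auto
    have "((\<lambda>v. c *\<^sub>R ((1 / norm v ^ ?n) *\<^sub>R vec_cl v)) has_derivative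
       (\<lambda>h. c *\<^sub>R ((1 / norm u ^ ?n) *\<^sub>R vec_cl h + (- (real ?n * (u \<bullet> h) / norm u ^ (?n + 2))) *\<^sub>R vec_cl u))) (at u)"
      by (intro has_derivative_scaleR_right has_derivative_scaleR[OF norm_power_has_derivative[OF u'(2)]]
          bounded_linear_imp_has_derivative bounded_linear_vec_cl)
    moreover have "open (- cball (0::'n Rn) \<epsilon>)" "u \<in> - cball 0 \<epsilon>" using u' by (auto simp: open_Compl)
    ultimately have "(truncated_kernel \<epsilon> has_derivative (\<lambda>h. c *\<^sub>R ((1 / norm u ^ ?n) *\<^sub>R vec_cl h + (- (real ?n * (u \<bullet> h) / norm u ^ (?n + 2))) *\<^sub>R vec_cl u))) (at u)"
      by (rule has_derivative_transform_within_open) (auto simp: truncated_kernel_def c_def max_def)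
    moreover have "kernel_deriv \<epsilon> u = (\<lambda>h. c *\<^sub>R ((1 / norm u ^ ?n) *\<^sub>R vec_cl h + (- (real ?n * (u \<bullet> h) / norm u ^ (?n + 2))) *\<^sub>R vec_cl u))"
      using False by (auto simp: kernel_deriv_def c_def fun_eq_iff)
    ultimately show ?thesis by simp
  qed
qed

lemma kernel_deriv_measurable [measurable]: "(\<lambda>u. kernel_deriv \<epsilon> u h) \<in> borel_measurable borel"
  unfolding kernel_deriv_def[abs_def] by measurable

text \<open>The partial derivatives are bounded on a compact neighbourhood of the closure of
  \<open>V\<close>. Neither \<open>V\<close> nor that neighbourhood is convex, so the mean value
  theorem is applied in balls around points of \<open>V\<close>, hence only to short steps.\<close>

lemma left_monogenic_lipschitz:
  fixes f :: "'n::{finite,linorder} Rn \<Rightarrow> 'n clifford"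
  assumes f: "left_monogenic_on f U" and U: "open U" and V: "bounded V" "closure V \<subseteq> U"
  obtains \<delta> M B where "\<delta> > 0" "\<And>x v. x \<in> V \<Longrightarrow> norm v < \<delta> \<Longrightarrow> norm (f (x + v) - f x) \<le> M * norm v"
    "\<And>x v. x \<in> V \<Longrightarrow> norm v < \<delta> \<Longrightarrow> norm (f (x + v)) \<le> B"
proof -
  have cc: "compact (closure V)" using V(1) by (simp add: compact_closure)
  obtain \<delta> where \<delta>: "\<delta> > 0" "(\<Union>x\<in>closure V. cball x \<delta>) \<subseteq> U"
    using compact_subset_open_imp_cball_epsilon_subset[OF cc U V(2)] by blast
  define K where "K = {x + y |x y. x \<in> closure V \<and> y \<in> cball (0::'n Rn) \<delta>}"
  have cK: "compact K" unfolding K_def by (rule compact_sums[OF cc compact_cball])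
  have cbK: "cball x \<delta> \<subseteq> K" if x: "x \<in> closure V" for x
  proof
    fix z assume "z \<in> cball x \<delta>"
    then have "z = x + (z - x) \<and> x \<in> closure V \<and> z - x \<in> cball 0 \<delta>" using x by (simp add: dist_norm norm_minus_commute)
    then show "z \<in> K" unfolding K_def by blast
  qed
  have KU: "K \<subseteq> U"
  proof
    fix z assume "z \<in> K"
    then obtain x y where "z = x + y" "x \<in> closure V" "y \<in> cball 0 \<delta>" by (auto simp: K_def)
    then have "z \<in> cball x \<delta>" by (simp add: dist_norm)
    then show "z \<in> U" using \<delta>(2) \<open>x \<in> closure V\<close> by blast
  qed
  have df: "(f has_derivative frechet_derivative f (at x)) (at x)" if "x \<in> U" for x
    using f that by (simp add: left_monogenic_on_def frechet_derivative_works)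
  have cf: "continuous_on U f"
    using df has_derivative_continuous by (metis continuous_at_imp_continuous_on)
  have "\<exists>B. \<forall>x\<in>K. norm (partial_deriv f j x) \<le> B" for j
  proof -
    have "continuous_on K (partial_deriv f j)" using f KU continuous_on_subset unfolding left_monogenic_on_def by blast
    then have "bounded (partial_deriv f j ` K)" using cK compact_continuous_image compact_imp_bounded by blast
    then show ?thesis by (auto simp: bounded_iff)
  qed
  then obtain b where b: "\<And>j x. x \<in> K \<Longrightarrow> norm (partial_deriv f j x) \<le> b j" by metis
  define M where "M = (\<Sum>j\<in>UNIV. \<bar>b j\<bar>)"
  have on: "onorm (frechet_derivative f (at x)) \<le> M" if x: "x \<in> K" for x
  proof (rule onorm_bound)
    show "0 \<le> M" by (simp add: M_def sum_nonneg)
    have lin: "linear (frechet_derivative f (at x))"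
      using df[of x] x KU has_derivative_bounded_linear bounded_linear.linear by blast
    fix v :: "'n Rn"
    have "frechet_derivative f (at x) v = frechet_derivative f (at x) (\<Sum>j\<in>UNIV. (v $ j) *\<^sub>R axis j 1)"
      by (simp add: basis_expansion[of v, unfolded scalar_mult_eq_scaleR])
    also have "\<dots> = (\<Sum>j\<in>UNIV. (v $ j) *\<^sub>R partial_deriv f j x)"
      by (simp add: linear_sum[OF lin] linear_scale[OF lin] partial_deriv_def)
    also have "norm \<dots> \<le> (\<Sum>j\<in>UNIV. norm v * \<bar>b j\<bar>)"
    proof (rule sum_norm_le)
      fix j
      have "\<bar>v $ j\<bar> \<le> norm v" by (rule component_le_norm_cart)
      moreover have "norm (partial_deriv f j x) \<le> \<bar>b j\<bar>" using b[OF x, of j] by linarith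
      ultimately show "norm ((v $ j) *\<^sub>R partial_deriv f j x) \<le> norm v * \<bar>b j\<bar>" by (simp add: mult_mono)
    qed
    finally show "norm (frechet_derivative f (at x) v) \<le> M * norm v"
      by (simp add: M_def sum_distrib_left mult.commute)
  qed
  have "bounded (f ` K)" using cK compact_continuous_image[OF continuous_on_subset[OF cf KU]] compact_imp_bounded by blast
  then obtain B where B: "\<And>x. x \<in> K \<Longrightarrow> norm (f x) \<le> B" by (auto simp: bounded_iff)
  show thesis
  proof (rule that[OF \<delta>(1), of M B])
    fix x v assume x: "x \<in> V" and v: "norm (v :: 'n Rn) < \<delta>"
    have xc: "x \<in> closure V" using x closure_subset by blast
    have xv: "x + v \<in> cball x \<delta>" using v by (simp add: dist_norm)
    show "norm (f (x + v)) \<le> B" using B cbK[OF xc] xv by blast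
    have "norm (f (x + v) - f x) \<le> M * norm ((x + v) - x)"
    proof (rule differentiable_bound[OF convex_cball[of x \<delta>]])
      show "(f has_derivative frechet_derivative f (at z)) (at z within cball x \<delta>)" if "z \<in> cball x \<delta>" for z
        using df[of z] that cbK[OF xc] KU has_derivative_at_withinI by blast
      show "onorm (frechet_derivative f (at z)) \<le> M" if "z \<in> cball x \<delta>" for z
        using on that cbK[OF xc] by blast
    qed (use xv \<delta> in auto)
    then show "norm (f (x + v) - f x) \<le> M * norm v" by simp
  qed
qed


text \<open>The divergence theorem for \<open>P x * gen j * f x\<close> in direction
  \<open>j\<close>, summed over \<open>j\<close>. By the product rule one part is
  \<open>P x * dirac f x = 0\<close> and the other contains the right Dirac derivative of the
  truncated kernel, which is constant in the ball and 0 outside it.\<close>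

lemma cauchy_integral_mean:
  fixes f :: "'n::{finite,linorder} Rn \<Rightarrow> 'n clifford"
  assumes f: "left_monogenic_on f U" and U: "open U" and V: "open V" "bounded V" "closure V \<subseteq> U"
    and S: "strongly_lipschitz (frontier V)" and \<epsilon>: "\<epsilon> > 0" and far: "\<And>x. x \<in> frontier V \<Longrightarrow> \<epsilon> \<le> dist x w"
  defines "\<sigma> \<equiv> surface_measure (frontier V)"
  shows "integrable \<sigma> (\<lambda>x. kernel_G (w - x) * vec_cl (outward_normal V x) * f x)"
    and "(LINT x|\<sigma>. kernel_G (w - x) * vec_cl (outward_normal V x) * f x)
      = (1 / (unit_ball_vol (real CARD('n)) * \<epsilon> ^ CARD('n))) *\<^sub>R (LINT x|lborel. indicator (V \<inter> ball w \<epsilon>) x *\<^sub>R f x)"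
proof -
  let ?P = "\<lambda>x. truncated_kernel \<epsilon> (w - x)"
  define F where "F j x = ?P x * gen j * f x" for j x
  define d where "d j x = - kernel_deriv \<epsilon> (w - x) (axis j 1) * gen j * f x + ?P x * gen j * partial_deriv f j x" for j x
  define c where "c = 1 / (unit_ball_vol (real CARD('n)) * \<epsilon> ^ CARD('n))"
  have VU: "V \<subseteq> U" using V(3) closure_subset by blast
  have df: "(f has_derivative frechet_derivative f (at x)) (at x)" if "x \<in> U" for x
    using f that by (simp add: left_monogenic_on_def frechet_derivative_works)
  have cf: "continuous_on U f"
    using df has_derivative_continuous by (metis continuous_at_imp_continuous_on)
  have cpd: "continuous_on U (partial_deriv f j)" for j using f unfolding left_monogenic_on_def by blast
  have cP: "continuous_on UNIV ?P"
    by (rule continuous_on_compose2[OF truncated_kernel_continuous[OF \<epsilon>]]) (auto intro: continuous_intros)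
  have cF: "continuous_on U (F j)" for j
    unfolding F_def[abs_def] by (intro clifford_continuous_on continuous_on_subset[OF cP] cf continuous_intros) auto
  obtain K where K: "K > 0" "\<And>a b :: 'n clifford. norm (a * b) \<le> norm a * norm b * K"
    using bounded_bilinear.pos_bounded[OF bounded_bilinear_clifford] by blast
  obtain \<delta>1 M B where fl: "\<delta>1 > 0" "\<And>x v. x \<in> V \<Longrightarrow> norm v < \<delta>1 \<Longrightarrow> norm (f (x + v) - f x) \<le> M * norm v"
    "\<And>x v. x \<in> V \<Longrightarrow> norm v < \<delta>1 \<Longrightarrow> norm (f (x + v)) \<le> B"
    by (rule left_monogenic_lipschitz[OF f U V(2,3)]) blast
  obtain R0 where R0: "\<And>x. x \<in> V \<Longrightarrow> norm x \<le> R0" using V(2) by (auto simp: bounded_iff)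
  define R where "R = norm w + R0 + \<delta>1"
  obtain C where C: "\<And>u v :: 'n Rn. norm u \<le> R \<Longrightarrow> norm v \<le> R \<Longrightarrow> norm (truncated_kernel \<epsilon> u - truncated_kernel \<epsilon> v) \<le> C * norm (u - v)"
    using truncated_kernel_lipschitz[OF \<epsilon>, of R] by blast
  have PR: "norm (w - (x + v)) \<le> R" if "x \<in> V" "norm v < \<delta>1" for x v
    using norm_triangle_ineq4[of w "x + v"] norm_triangle_ineq[of x v] R0[OF that(1)] that(2) by (simp add: R_def)
  have Pl: "norm (?P (x + v) - ?P x) \<le> \<bar>C\<bar> * norm v" if "x \<in> V" "norm v < \<delta>1" for x v
  proof -
    have "norm (?P (x + v) - ?P x) \<le> C * norm ((w - (x + v)) - (w - x))"
      using PR[OF that] PR[OF that(1), of 0] fl(1) by (intro C) auto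
    also have "\<dots> \<le> \<bar>C\<bar> * norm v" by (simp add: mult_right_mono)
    finally show ?thesis .
  qed
  obtain BP where BP: "\<And>x. x \<in> V \<Longrightarrow> norm (?P x) \<le> BP"
  proof -
    have "compact (?P ` closure V)"
      by (intro compact_continuous_image continuous_on_subset[OF cP]) (use V in \<open>auto simp: compact_closure\<close>)
    then have "bounded (?P ` closure V)" by (rule compact_imp_bounded)
    then obtain B' where B': "\<And>x. x \<in> closure V \<Longrightarrow> norm (?P x) \<le> B'"
      unfolding bounded_iff by blast
    show thesis by (rule that[of B']) (use B' closure_subset in blast)
  qed
  have g1: "norm (gen j :: 'n clifford) = 1" for j
    using norm_vec_cl[of "axis j 1"] by (simp add: vec_cl_axis norm_axis_1)
  define MM where "MM = K * K * (\<bar>C\<bar> * \<bar>B\<bar>) + K * K * (\<bar>BP\<bar> * \<bar>M\<bar>)"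
  have Fl: "norm (F j (x + v) - F j x) \<le> MM * norm v" if xv: "x \<in> V" "norm v < \<delta>1" for j x v
  proof -
    have tri: "norm (a * gen j * b) \<le> K * K * (norm a * norm b)" for a b :: "'n clifford"
    proof -
      have "norm (a * gen j * b) \<le> norm (a * gen j) * norm b * K" by (rule K(2))
      also have "\<dots> \<le> (norm a * norm (gen j :: 'n clifford) * K) * norm b * K"
        using K(1) K(2)[of a "gen j"] by (intro mult_right_mono) auto
      finally show ?thesis by (simp add: g1 mult_ac)
    qed
    have "F j (x + v) - F j x = (?P (x + v) - ?P x) * gen j * f (x + v) + ?P x * gen j * (f (x + v) - f x)"
      by (simp add: F_def algebra_simps)
    then have "norm (F j (x + v) - F j x) \<le> K * K * (norm (?P (x + v) - ?P x) * norm (f (x + v))) + K * K * (norm (?P x) * norm (f (x + v) - f x))"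
      by (simp only:) (rule order_trans[OF norm_triangle_ineq add_mono[OF tri tri]])
    also have "\<dots> \<le> K * K * ((\<bar>C\<bar> * norm v) * \<bar>B\<bar>) + K * K * (\<bar>BP\<bar> * (\<bar>M\<bar> * norm v))"
    proof (intro add_mono mult_left_mono mult_mono)
      show "norm (?P (x + v) - ?P x) \<le> \<bar>C\<bar> * norm v" by (rule Pl[OF xv])
      show "norm (f (x + v)) \<le> \<bar>B\<bar>" using fl(3)[OF xv] by linarith
      show "norm (?P x) \<le> \<bar>BP\<bar>" using BP[OF xv(1)] by linarith
      have "M * norm v \<le> \<bar>M\<bar> * norm v" by (intro mult_right_mono) auto
      then show "norm (f (x + v) - f x) \<le> \<bar>M\<bar> * norm v" using fl(2)[OF xv] by linarith
    qed (use K in auto)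
    finally show ?thesis by (simp add: MM_def algebra_simps)
  qed
  \<comment> \<open>The truncated kernel has its kink on this sphere, which is a null set.\<close>
  have sph: "AE x in lborel. norm (w - x) \<noteq> \<epsilon>"
  proof -
    have "sphere w \<epsilon> \<in> null_sets lborel"
      using negligible_sphere[of w \<epsilon>] by (auto simp: negligible_iff_null_sets null_sets_completion_iff)
    from AE_not_in[OF this] show ?thesis by (simp add: dist_norm)
  qed
  have Fd: "AE x in lborel. x \<in> V \<longrightarrow> (\<exists>g'. (F j has_derivative g') (at x) \<and> g' (axis j 1) = d j x)" for j
    using sph
  proof eventually_elim
    fix x assume x: "norm (w - x) \<noteq> \<epsilon>"
    show "x \<in> V \<longrightarrow> (\<exists>g'. (F j has_derivative g') (at x) \<and> g' (axis j 1) = d j x)"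
    proof
      assume "x \<in> V"
      then have xU: "x \<in> U" using VU by blast
      have blin: "bounded_linear (kernel_deriv \<epsilon> (w - x))"
        using truncated_kernel_derivative[OF \<epsilon> x] has_derivative_bounded_linear by blast
      have "((\<lambda>x. w - x) has_derivative (\<lambda>h. - h)) (at x)" by (auto intro!: derivative_eq_intros)
      from has_derivative_compose[OF this truncated_kernel_derivative[OF \<epsilon> x]]
      have "(?P has_derivative (\<lambda>h. - kernel_deriv \<epsilon> (w - x) h)) (at x)"
        by (simp add: linear_neg[OF bounded_linear.linear[OF blin]])
      from clifford_FDERIV[OF clifford_FDERIV[OF this has_derivative_const[of "gen j"]] df[OF xU]]
      have "(F j has_derivative (\<lambda>h. ?P x * gen j * frechet_derivative f (at x) h + (?P x * 0 + - kernel_deriv \<epsilon> (w - x) h * gen j) * f x)) (at x)"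
        unfolding F_def[abs_def] .
      then show "\<exists>g'. (F j has_derivative g') (at x) \<and> g' (axis j 1) = d j x"
        by (intro exI conjI) (assumption, simp add: d_def partial_deriv_def)
    qed
  qed
  have [measurable]: "V \<in> sets borel" using V by simp
  have [measurable]: "(\<lambda>x. indicator V x *\<^sub>R f x) \<in> borel_measurable borel" "(\<lambda>x. indicator V x *\<^sub>R partial_deriv f j x) \<in> borel_measurable borel" for j
    by (intro borel_measurable_continuous_on_indicator continuous_on_subset[OF cf] continuous_on_subset[OF cpd] VU; simp)+
  have [measurable]: "?P \<in> borel_measurable borel" by (rule borel_measurable_continuous_onI[OF cP])
  have dm: "(\<lambda>x. indicator V x *\<^sub>R d j x) \<in> borel_measurable borel" for j
  proof -
    have [measurable]: "(\<lambda>x. kernel_deriv \<epsilon> (w - x) (axis j 1)) \<in> borel_measurable borel"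
      by (rule measurable_compose[OF _ kernel_deriv_measurable]) measurable
    have "(\<lambda>x. indicator V x *\<^sub>R d j x) = (\<lambda>x. - kernel_deriv \<epsilon> (w - x) (axis j 1) * gen j * (indicator V x *\<^sub>R f x) + ?P x * gen j * (indicator V x *\<^sub>R partial_deriv f j x))"
      by (rule ext) (simp add: d_def algebra_simps)
    also have "\<dots> \<in> borel_measurable borel" by measurable
    finally show ?thesis .
  qed
  note div = lipschitz_divergence_vector[OF V(1,2) S U V(3) cF fl(1) Fl Fd dm]
  \<comment> \<open>By \<open>far\<close> the truncation is not noticed on the frontier; elsewhere
    both sides vanish with the normal.\<close>
  have tm: "(\<Sum>j\<in>UNIV. (axis j 1 \<bullet> outward_normal V x) *\<^sub>R F j x) = kernel_G (w - x) * vec_cl (outward_normal V x) * f x" for x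
  proof (cases "x \<in> frontier V")
    case True
    have "?P x = kernel_G (w - x)"
      by (rule truncated_kernel_eq) (use far[OF True] in \<open>simp add: dist_norm norm_minus_commute\<close>)
    then show ?thesis
      by (simp add: F_def vec_cl_def sum_distrib_left sum_distrib_right inner_axis' mult.assoc)
  qed (simp add: nonfrontier_normal[OF V(1)] vec_cl_0)
  have "integrable \<sigma> (\<lambda>x. \<Sum>j\<in>UNIV. (axis j 1 \<bullet> outward_normal V x) *\<^sub>R F j x)"
    unfolding \<sigma>_def by (intro Bochner_Integration.integrable_sum div(3))
  then show "integrable \<sigma> (\<lambda>x. kernel_G (w - x) * vec_cl (outward_normal V x) * f x)" unfolding tm .
  have "(LINT x|\<sigma>. kernel_G (w - x) * vec_cl (outward_normal V x) * f x)
     = (\<Sum>j\<in>UNIV. LINT x|\<sigma>. (axis j 1 \<bullet> outward_normal V x) *\<^sub>R F j x)"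
    unfolding tm[symmetric] \<sigma>_def by (rule Bochner_Integration.integral_sum[OF div(3)])
  also have "\<dots> = (\<Sum>j\<in>UNIV. LINT x|lborel. indicator V x *\<^sub>R d j x)"
    unfolding \<sigma>_def using div(1) by simp
  also have "\<dots> = (LINT x|lborel. (\<Sum>j\<in>UNIV. indicator V x *\<^sub>R d j x))"
    by (rule Bochner_Integration.integral_sum[OF div(2), symmetric])
  also have "\<dots> = (LINT x|lborel. c *\<^sub>R (indicator (V \<inter> ball w \<epsilon>) x *\<^sub>R f x))"
  proof (rule Bochner_Integration.integral_cong[OF refl])
    fix x
    show "(\<Sum>j\<in>UNIV. indicator V x *\<^sub>R d j x) = c *\<^sub>R (indicator (V \<inter> ball w \<epsilon>) x *\<^sub>R f x)"
    proof (cases "x \<in> V")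
      case True
      then have "dirac f x = 0" using f VU by (auto simp: left_monogenic_on_def)
      have "(\<Sum>j\<in>UNIV. d j x) = - ((\<Sum>j\<in>UNIV. kernel_deriv \<epsilon> (w - x) (axis j 1) * gen j) * f x) + ?P x * dirac f x"
        by (simp add: d_def sum.distrib sum_subtractf sum_negf sum_distrib_left sum_distrib_right dirac_def mult.assoc)
      also have "\<dots> = (if norm (w - x) < \<epsilon> then c *\<^sub>R f x else 0)"
        unfolding kernel_deriv_sum[OF \<epsilon>] \<open>dirac f x = 0\<close> by (simp add: c_def)
      finally show ?thesis using True by (simp add: indicator_def dist_norm)
    qed simp
  qed
  finally show "(LINT x|\<sigma>. kernel_G (w - x) * vec_cl (outward_normal V x) * f x)
      = (1 / (unit_ball_vol (real CARD('n)) * \<epsilon> ^ CARD('n))) *\<^sub>R (LINT x|lborel. indicator (V \<inter> ball w \<epsilon>) x *\<^sub>R f x)"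
    unfolding c_def[symmetric] by (simp only: integral_scaleR_right)
qed

text \<open>The mean value identity holds for all small radii with the same left-hand side. If
  \<open>w\<close> is outside the closure of \<open>V\<close>, a small ball misses \<open>V\<close>;
  if \<open>w\<close> is in \<open>V\<close>, the right-hand side is the mean of \<open>f\<close>
  over a small ball, which is close to \<open>f w\<close> by continuity.\<close>

theorem cauchy_integral_formula:
  fixes f :: "'n::{finite,linorder} Rn \<Rightarrow> 'n clifford"
  assumes f: "left_monogenic_on f U" and U: "open U" and V: "open V" "bounded V" "closure V \<subseteq> U"
    and S: "strongly_lipschitz (frontier V)" and w: "w \<notin> frontier V"
  shows "integrable (surface_measure (frontier V)) (\<lambda>x. kernel_G (w - x) * vec_cl (outward_normal V x) * f x)"
    and "(LINT x|surface_measure (frontier V). kernel_G (w - x) * vec_cl (outward_normal V x) * f x) = (if w \<in> V then f w else 0)"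
proof -
  let ?I = "LINT x|surface_measure (frontier V). kernel_G (w - x) * vec_cl (outward_normal V x) * f x"
  let ?vol = "\<lambda>\<epsilon>. unit_ball_vol (real CARD('n)) * \<epsilon> ^ CARD('n)"
  have "w \<in> - frontier V" "open (- frontier V)" using w by (auto simp: open_Compl)
  then obtain \<epsilon>0 where \<epsilon>0: "\<epsilon>0 > 0" "ball w \<epsilon>0 \<subseteq> - frontier V" using open_contains_ball by blast
  have far: "\<epsilon> \<le> dist x w" if "\<epsilon> \<le> \<epsilon>0" "x \<in> frontier V" for \<epsilon> x
    using \<epsilon>0(2) that by (auto simp: subset_iff dist_commute not_less[symmetric])
  show "integrable (surface_measure (frontier V)) (\<lambda>x. kernel_G (w - x) * vec_cl (outward_normal V x) * f x)"
    by (rule cauchy_integral_mean(1)[OF f U V S \<epsilon>0(1) far]) auto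
  have mean: "?I = (1 / ?vol \<epsilon>) *\<^sub>R (LINT x|lborel. indicator (V \<inter> ball w \<epsilon>) x *\<^sub>R f x)" if "0 < \<epsilon>" "\<epsilon> \<le> \<epsilon>0" for \<epsilon>
    by (rule cauchy_integral_mean(2)[OF f U V S that(1) far[OF that(2)]])
  show "?I = (if w \<in> V then f w else 0)"
  proof (cases "w \<in> V")
    case False
    then have "w \<in> - closure V" using w V(1) by (simp add: frontier_def interior_open)
    then obtain r where r: "r > 0" "ball w r \<subseteq> - closure V" using open_contains_ball open_Compl closed_closure by blast
    define \<epsilon> where "\<epsilon> = min r \<epsilon>0"
    have "V \<inter> ball w \<epsilon> = {}" using r closure_subset unfolding \<epsilon>_def by fastforce
    then show ?thesis using mean[of \<epsilon>] r \<epsilon>0 False by (simp add: \<epsilon>_def)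
  next
    case True
    obtain r where r: "r > 0" "cball w r \<subseteq> V" using V(1) True open_contains_cball by blast
    have VU: "V \<subseteq> U" using V(3) closure_subset by blast
    have "f differentiable at x" if "x \<in> U" for x using f that by (simp add: left_monogenic_on_def)
    then have cfU: "continuous_on U f" by (metis continuous_at_imp_continuous_on differentiable_imp_continuous_within)
    then have contw: "isCont f w" using U True VU continuous_on_eq_continuous_at by blast
    have close: "norm (?I - f w) \<le> e" if e: "e > 0" for e
    proof -
      obtain s where s: "s > 0" "\<And>x. dist x w < s \<Longrightarrow> dist (f x) (f w) < e" using contw e unfolding continuous_at_eps_delta by blast
      define \<epsilon> where "\<epsilon> = min (min r s) \<epsilon>0"
      have \<epsilon>: "\<epsilon> > 0" "\<epsilon> \<le> r" "\<epsilon> \<le> s" "\<epsilon> \<le> \<epsilon>0" using r s \<epsilon>0 by (auto simp: \<epsilon>_def)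
      have bV: "ball w \<epsilon> \<subseteq> V" using r(2) \<epsilon>(2) by (auto simp: subset_iff)
      define v where "v = ?vol \<epsilon>"
      have vol: "measure lborel (ball w \<epsilon>) = v" using content_ball[of \<epsilon> w] \<epsilon>(1) by (simp add: v_def)
      have volpos: "v > 0" using \<epsilon>(1) unit_ball_vol_pos[of "real CARD('n)"] by (simp add: v_def)
      have bi: "integrable lborel (\<lambda>x. indicator (ball w \<epsilon>) x *\<^sub>R c)" for c :: "'n clifford"
        using emeasure_bounded_finite[of "ball w \<epsilon>"] by (intro integrable_scaleR_left) (auto simp: integrable_indicator_iff)
      have bi': "integrable lborel (\<lambda>x. indicator (ball w \<epsilon>) x * c)" for c :: real
        using emeasure_bounded_finite[of "ball w \<epsilon>"] by (intro Bochner_Integration.integrable_mult_left) (auto simp: integrable_indicator_iff)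
      have fm: "(\<lambda>x. indicator (ball w \<epsilon>) x *\<^sub>R (f x - f w)) \<in> borel_measurable borel"
        by (intro borel_measurable_continuous_on_indicator continuous_intros continuous_on_subset[OF cfU]) (use bV VU in auto)
      have fb: "norm (indicator (ball w \<epsilon>) x *\<^sub>R (f x - f w)) \<le> indicator (ball w \<epsilon>) x * e" for x
        using s(2)[of x] \<epsilon>(3) by (auto simp: indicator_def dist_norm norm_minus_commute)
      have fi: "integrable lborel (\<lambda>x. indicator (ball w \<epsilon>) x *\<^sub>R (f x - f w))"
        by (rule Bochner_Integration.integrable_bound[OF bi'[of e]]) (use fm fb e in \<open>auto intro!: AE_I2 intro: order_trans[OF _ abs_ge_self]\<close>)
      have "(LINT x|lborel. indicator (V \<inter> ball w \<epsilon>) x *\<^sub>R f x) = (LINT x|lborel. indicator (ball w \<epsilon>) x *\<^sub>R (f x - f w) + indicator (ball w \<epsilon>) x *\<^sub>R f w)"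
        using bV by (intro Bochner_Integration.integral_cong) (auto simp: indicator_def)
      also have "\<dots> = (LINT x|lborel. indicator (ball w \<epsilon>) x *\<^sub>R (f x - f w)) + v *\<^sub>R f w"
      proof -
        have "(LINT x|lborel. indicator (ball w \<epsilon>) x *\<^sub>R f w) = (LINT x|lborel. indicator (ball w \<epsilon>) x) *\<^sub>R f w"
          using emeasure_bounded_finite[of "ball w \<epsilon>"] by (intro integral_scaleR_left) (auto simp: integrable_indicator_iff)
        also have "(LINT x|lborel. indicator (ball w \<epsilon>) x) = v" using vol by simp
        finally show ?thesis using fi bi[of "f w"] by (subst Bochner_Integration.integral_add) auto
      qed
      finally have "?I - f w = (1 / v) *\<^sub>R (LINT x|lborel. indicator (ball w \<epsilon>) x *\<^sub>R (f x - f w))"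
        using mean[OF \<epsilon>(1,4), folded v_def] volpos by (simp add: scaleR_add_right)
      then have "norm (?I - f w) = (1 / v) * norm (LINT x|lborel. indicator (ball w \<epsilon>) x *\<^sub>R (f x - f w))"
        using volpos by simp
      also have "\<dots> \<le> (1 / v) * (LINT x|lborel. indicator (ball w \<epsilon>) x * e)"
        using volpos fb by (intro mult_left_mono order_trans[OF integral_norm_bound] integral_mono integrable_norm fi bi') auto
      also have "\<dots> = e" using vol volpos by simp
      finally show ?thesis .
    qed
    have "norm (?I - f w) \<le> 0" by (rule field_le_epsilon, unfold add_0, rule close)
    then have "?I = f w" by (simp only: norm_le_zero_iff right_minus_eq)
    then show ?thesis using True by (simp only: if_True)
  qed
qed

section \<open>The kernel series\<close>

lemma versor_norm_mult_right: "a \<in> versor \<Longrightarrow> norm (b * a) = norm b * norm a"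
proof (induction arbitrary: b rule: versor.induct)
  case one
  then show ?case by (simp add: norm_one_clifford)
next
  case (vec a x)
  have "norm (b * (vec_cl x * a)) = norm ((b * vec_cl x) * a)" by (simp only: mult.assoc)
  also have "\<dots> = norm b * norm (vec_cl x * a)"
    unfolding vec.IH norm_mult_vec_cl norm_vec_cl_mult norm_vec_cl by (simp only: mult.assoc)
  finally show ?case .
qed

lemma norm_reversion_versor_mult:
  assumes "a \<in> versor" shows "norm (reversion a * b) = norm a * norm b"
proof -
  have "norm (reversion a * b) = norm (reversion (reversion a * b))" by (rule norm_reversion[symmetric])
  also have "\<dots> = norm (reversion b * a)" by (simp only: reversion_mult reversion_reversion)
  also have "\<dots> = norm a * norm b" unfolding versor_norm_mult_right[OF assms] norm_reversion by (rule mult.commute)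
  finally show ?thesis .
qed

lemma acts_norm:
  assumes L: "acts p L" and w: "w \<in> upper_half" and x: "x \<in> upper_half"
  shows "norm (denom L w) * norm (mob_act L w - mob_act L x) * norm (denom L x) = norm (w - x)"
proof -
  have v: "denom L w \<in> versor" "denom L x \<in> versor" using L w x by (auto simp: acts_def)
  have "reversion (denom L w) * vec_cl (mob_act L w - mob_act L x) * denom L x = vec_cl (w - x)"
    using L w x unfolding acts_def by blast
  then have "norm (reversion (denom L w) * vec_cl (mob_act L w - mob_act L x) * denom L x) = norm (w - x)"
    by (simp only: norm_vec_cl)
  then show ?thesis
    by (simp only: versor_norm_mult_right[OF v(2)] norm_reversion_versor_mult[OF v(1)] norm_vec_cl)
qed

text \<open>The weight \<open>K\<close> is \<open>\<parallel>cw + d\<parallel>\<^sup>n\<close> times the inverse of the reversion of \<open>cw + d\<close>.\<close>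

lemma kernel_transformation:
  fixes L :: "'n::{finite,linorder} cl_mat"
  assumes L: "acts p L" and w: "w \<in> upper_half"
  obtains K where "\<And>x. x \<in> upper_half \<Longrightarrow>
    reversion (factor_J L x * kernel_G (mob_act L w - mob_act L x)) = K * kernel_G (w - x)"
proof -
  define n where "n = CARD('n)"
  have vw: "denom L w \<in> versor" using L w by (auto simp: acts_def)
  obtain b where b: "denom L w * b = 1" "b * denom L w = 1" by (rule versor_inverse[OF vw])
  define Q where "Q = reversion b"
  have Q: "Q * reversion (denom L w) = 1"
    unfolding Q_def by (simp only: reversion_mult[symmetric] b reversion_one)
  have "reversion (factor_J L x * kernel_G (mob_act L w - mob_act L x)) = (norm (denom L w) ^ n *\<^sub>R Q) * kernel_G (w - x)"
    if x: "x \<in> upper_half" for x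
  proof -
    let ?u = "mob_act L w - mob_act L x" and ?d = "denom L x" and ?e = "denom L w"
    let ?c = "1 / (real CARD('n) * unit_ball_vol (real CARD('n)))"
    have vx: "?d \<in> versor" using L x by (auto simp: acts_def)
    have e: "norm ?e > 0" and d: "norm ?d > 0" using vw vx versor_norm_pos by auto
    have nn: "norm ?e * norm ?u * norm ?d = norm (w - x)" by (rule acts_norm[OF L w x])
    have id: "reversion ?e * vec_cl ?u * ?d = vec_cl (w - x)"
      using L w x unfolding acts_def by blast
    have "vec_cl ?u * ?d = Q * reversion ?e * (vec_cl ?u * ?d)" by (simp only: Q mult_1_left)
    also have "\<dots> = Q * (reversion ?e * vec_cl ?u * ?d)" by (simp only: mult.assoc)
    also have "\<dots> = Q * vec_cl (w - x)" by (simp only: id)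
    finally have vd: "vec_cl ?u * ?d = Q * vec_cl (w - x)" .
    have J: "reversion (factor_J L x) = (1 / norm ?d ^ n) *\<^sub>R ?d"
      by (simp only: factor_J_def reversion_scaleR reversion_reversion n_def)
    have G: "reversion (kernel_G ?u) = (?c / norm ?u ^ n) *\<^sub>R vec_cl ?u"
      by (simp add: kernel_G_def reversion_scaleR n_def)
    have G': "kernel_G (w - x) = (?c / norm (w - x) ^ n) *\<^sub>R vec_cl (w - x)"
      by (simp add: kernel_G_def n_def)
    have sc: "(?c / norm ?u ^ n) * (1 / norm ?d ^ n) = norm ?e ^ n * (?c / norm (w - x) ^ n)"
      unfolding nn[symmetric] power_mult_distrib using e d by (simp add: field_simps)
    have "reversion (factor_J L x * kernel_G ?u) = ((?c / norm ?u ^ n) * (1 / norm ?d ^ n)) *\<^sub>R (vec_cl ?u * ?d)"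
      by (simp only: reversion_mult J G mult_scaleR_left mult_scaleR_right scaleR_scaleR mult.commute)
    also have "\<dots> = (norm ?e ^ n * (?c / norm (w - x) ^ n)) *\<^sub>R (Q * vec_cl (w - x))"
      unfolding sc vd ..
    also have "\<dots> = (norm ?e ^ n *\<^sub>R Q) * kernel_G (w - x)"
      unfolding G' by (simp only: mult_scaleR_left mult_scaleR_right scaleR_scaleR mult.commute)
    finally show ?thesis .
  qed
  then show thesis by (rule that)
qed

lemma norm_kernel_G:
  assumes "CARD('n::{finite,linorder}) = Suc q" "u \<noteq> 0"
  shows "norm (kernel_G (u :: 'n Rn)) = 1 / (real CARD('n) * unit_ball_vol (real CARD('n))) * (1 / norm u ^ q)"
  using assms(2) unit_ball_vol_nonneg[of "real CARD('n)"] by (simp add: kernel_G_def norm_vec_cl assms(1) abs_mult)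

lemma norm_kernel_term:
  fixes L :: "'n::{finite,linorder} cl_mat"
  assumes q: "CARD('n) = Suc q" and L: "denom L x \<in> versor" and u: "u \<noteq> 0"
  shows "norm (factor_J L x * kernel_G u)
    = 1 / (real CARD('n) * unit_ball_vol (real CARD('n))) * (1 / norm (denom L x) ^ q) * (1 / norm u ^ q)"
proof -
  have "norm (factor_J L x * kernel_G u) = (1 / norm (denom L x) ^ CARD('n)) * (norm (denom L x) * norm (kernel_G u))"
    unfolding factor_J_def mult_scaleR_left norm_scaleR norm_reversion_versor_mult[OF L] by simp
  then show ?thesis using versor_norm_pos[OF L] by (simp add: norm_kernel_G[OF q u]) (simp add: q)
qed

text \<open>
  The last coordinate of \<open>M\<langle>x\<rangle>\<close> is \<open>x\<^sub>n / \<parallel>cx + d\<parallel>\<^sup>2\<close>, and the last coordinates of \<open>M\<langle>x\<rangle>\<close> and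
  \<open>M\<langle>w\<rangle>\<close> differ by at most the distance \<open>\<parallel>w - x\<parallel> / (\<parallel>cw + d\<parallel> \<parallel>cx + d\<parallel>)\<close> of these points.
\<close>

lemma denom_comparison:
  fixes M :: "'n::{finite,linorder} cl_mat"
  assumes M: "acts p M" and p: "p < CARD('n)" and w: "w \<in> upper_half" and x: "x \<in> upper_half"
  shows "norm (denom M w) \<le> max 1 ((norm (w - x) + w $ Max UNIV) / x $ Max UNIV) * norm (denom M x)"
proof -
  let ?n = "Max UNIV :: 'n"
  define a where "a = w $ ?n"
  define b where "b = x $ ?n"
  define D where "D = norm (denom M w)"
  define E where "E = norm (denom M x)"
  have ab: "a > 0" "b > 0" using w x by (auto simp: upper_half_def a_def b_def)
  have DE: "D > 0" "E > 0" using M w x versor_norm_pos by (auto simp: D_def E_def acts_def)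
  have n: "p < idx ?n" using p by (simp add: idx_Max)
  have mw: "mob_act M w $ ?n = a / D\<^sup>2" using M w n unfolding acts_def D_def a_def by blast
  have mx: "mob_act M x $ ?n = b / E\<^sup>2" using M x n unfolding acts_def E_def b_def by blast
  have "\<bar>a / D\<^sup>2 - b / E\<^sup>2\<bar> \<le> norm (mob_act M w - mob_act M x)"
    using component_le_norm_cart[of "mob_act M w - mob_act M x" ?n] by (simp add: mw mx)
  then have "D * \<bar>a / D\<^sup>2 - b / E\<^sup>2\<bar> * E \<le> norm (w - x)"
    using acts_norm[OF M w x] DE unfolding D_def[symmetric] E_def[symmetric]
    by (metis mult_left_mono mult_right_mono less_imp_le)
  moreover have "D * \<bar>a / D\<^sup>2 - b / E\<^sup>2\<bar> * E = \<bar>D * (a / D\<^sup>2 - b / E\<^sup>2) * E\<bar>" using DE by (simp add: abs_mult)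
  moreover have "D * (a / D\<^sup>2 - b / E\<^sup>2) * E = a * (E / D) - b * (D / E)"
    using DE by (simp add: field_simps power2_eq_square)
  ultimately have "\<bar>a * (E / D) - b * (D / E)\<bar> \<le> norm (w - x)" by (simp only:)
  \<comment> \<open>The inequality for the last coordinates, multiplied by \<open>D * E\<close>,
    involves only the ratio of the denominators, and is of use when this ratio exceeds 1.\<close>
  then have le: "b * (D / E) \<le> norm (w - x) + a * (E / D)" by (simp only: abs_le_iff) linarith
  have "D / E \<le> max 1 ((norm (w - x) + a) / b)"
  proof (cases "D / E \<le> 1")
    case False
    then have "E / D \<le> 1" using DE by (simp add: field_simps)
    then have "a * (E / D) \<le> a" using ab mult_left_mono[of "E / D" 1 a] by simp
    then have "b * (D / E) \<le> norm (w - x) + a" using le by linarith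
    then have "D / E \<le> (norm (w - x) + a) / b" using ab by (simp add: pos_le_divide_eq mult.commute)
    then show ?thesis by simp
  qed simp
  then show ?thesis using DE unfolding D_def[symmetric] E_def[symmetric] a_def[symmetric] b_def[symmetric]
    by (simp add: pos_divide_le_eq)
qed

section \<open>The congruence subgroup and its translations\<close>

lemma GammaN_subset: "M \<in> GammaN p N \<Longrightarrow> M \<in> Gamma p"
  by (simp add: GammaN_def)

lemma Gamma_int: "M \<in> Gamma p \<Longrightarrow> M $ i $ k \<in> int_ring p"
  using Gamma_mon_int Gamma_imp_Gamma_mon by blast

text \<open>The two-sided ideal modulo which elements of \<open>GammaN p N\<close> are congruent to
  the identity.\<close>

definition scaled_int_ring :: "nat \<Rightarrow> nat \<Rightarrow> 'n::{finite,linorder} clifford set" where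
  "scaled_int_ring p N = (\<lambda>a. real N *\<^sub>R a) ` int_ring p"

lemma scaled_int_ring_add: "a \<in> scaled_int_ring p N \<Longrightarrow> b \<in> scaled_int_ring p N \<Longrightarrow> a + b \<in> scaled_int_ring p N"
  by (auto simp: scaled_int_ring_def scaleR_add_right[symmetric] int_ring_add)

lemma scaled_int_ring_mult:
  "a \<in> scaled_int_ring p N \<Longrightarrow> b \<in> int_ring p \<Longrightarrow> a * b \<in> scaled_int_ring p N"
  "b \<in> int_ring p \<Longrightarrow> a \<in> scaled_int_ring p N \<Longrightarrow> b * a \<in> scaled_int_ring p N"
  by (auto simp: scaled_int_ring_def int_ring_mult)

lemma GammaN_iff: "M \<in> GammaN p N \<longleftrightarrow> M \<in> Gamma p \<and> M $ 1 $ 1 - 1 \<in> scaled_int_ring p N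
    \<and> M $ 1 $ 2 \<in> scaled_int_ring p N \<and> M $ 2 $ 1 \<in> scaled_int_ring p N \<and> M $ 2 $ 2 - 1 \<in> scaled_int_ring p N"
  by (simp add: GammaN_def scaled_int_ring_def)

lemma GammaN_mult:
  assumes A: "A \<in> GammaN p N" and B: "B \<in> GammaN p N" shows "A ** B \<in> GammaN p N"
proof -
  have iA: "A $ i $ k \<in> int_ring p" and iB: "B $ i $ k \<in> int_ring p" for i k using Gamma_int GammaN_subset A B by blast+
  have 1: "(A ** B) $ 1 $ 1 - 1 = (A $ 1 $ 1 - 1) * B $ 1 $ 1 + ((B $ 1 $ 1 - 1) + A $ 1 $ 2 * B $ 2 $ 1)"
    and 2: "(A ** B) $ 2 $ 2 - 1 = A $ 2 $ 1 * B $ 1 $ 2 + ((A $ 2 $ 2 - 1) * B $ 2 $ 2 + (B $ 2 $ 2 - 1))"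
    by (simp_all add: mult_entries algebra_simps)
  show ?thesis unfolding GammaN_iff 1 2
    using A B iA iB by (auto simp: GammaN_iff mult_entries intro!: Gamma.mult scaled_int_ring_add intro: scaled_int_ring_mult)
qed

lemma GammaN_one: "mat 1 \<in> GammaN p N"
  using imageI[OF int_ring_0[of p], of "\<lambda>a. real N *\<^sub>R a"] Gamma.one[of p] by (simp add: GammaN_def mat_1_mat2)

text \<open>The scalar coefficient of \<open>-1 - 1\<close> is -2, which is no integer multiple of a
  number \<open>N \<ge> 3\<close>.\<close>

lemma GammaN_not_uminus_one:
  assumes "3 \<le> N" shows "- mat 1 \<notin> (GammaN p N :: 'n::{finite,linorder} cl_mat set)"
proof
  assume "- mat 1 \<in> (GammaN p N :: 'n cl_mat set)"
  then have "(- mat 1 :: 'n cl_mat) $ 1 $ 1 - 1 \<in> scaled_int_ring p N" by (simp only: GammaN_iff)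
  then obtain a where a: "a \<in> int_ring p" "- 1 - 1 = real N *\<^sub>R (a :: 'n clifford)"
    by (auto simp: mat_1_mat2 scaled_int_ring_def)
  have "cl_coeff (- 1 - 1 :: 'n clifford) {} = - 2" by (simp add: one_clifford_def coeff_blade)
  then have eq: "real N * cl_coeff a {} = - 2" unfolding a(2) by simp
  then have "cl_coeff a {} \<noteq> 0" by auto
  then have "real N * 1 \<le> real N * \<bar>cl_coeff a {}\<bar>" by (intro mult_left_mono int_ring_coeff_ge_1[OF a(1)]) auto
  also have "\<dots> = \<bar>real N * cl_coeff a {}\<bar>" by (simp add: abs_mult)
  finally show False using eq assms by simp
qed

definition translation_lattice :: "nat \<Rightarrow> nat \<Rightarrow> 'n::{finite,linorder} Rn set" where
  "translation_lattice p N = {m. (\<forall>j. \<exists>k::int. m $ j = real N * of_int k) \<and> (\<forall>j. p < idx j \<longrightarrow> m $ j = 0)}"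

lemma translation_group_lattice: "translation_group p N = (\<lambda>m. mat2 1 (vec_cl m) 0 1) ` translation_lattice p N"
  by (auto simp: translation_group_def translation_lattice_def)

lemma translation_lattice_minus: "m \<in> translation_lattice p N \<Longrightarrow> - m \<in> translation_lattice p N"
  unfolding translation_lattice_def
  by (auto simp: neg_equal_iff_equal) (metis mult_minus_right of_int_minus)

lemma translation_mult: "mat2 1 (vec_cl m) 0 1 ** mat2 1 (vec_cl m') 0 1 = mat2 1 (vec_cl (m + m')) 0 1"
  by (simp add: mat2_mult vec_cl_add add.commute)

lemma translation_in_Gamma:
  fixes m :: "'n::{finite,linorder} Rn"
  assumes m: "\<And>j. m $ j \<in> \<int>" "\<And>j. p < idx j \<Longrightarrow> m $ j = 0"
  shows "mat2 1 (vec_cl m) 0 1 \<in> Gamma p"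
proof -
  define P where "P v \<longleftrightarrow> mat2 1 (vec_cl v) 0 1 \<in> Gamma p" for v :: "'n Rn"
  have P0: "P 0" using Gamma.one[of p] by (simp add: P_def vec_cl_0 mat_1_mat2)
  have Padd: "P (u + v)" if "P u" "P v" for u v
    using Gamma.mult[OF that[unfolded P_def]] unfolding P_def translation_mult .
  have Pneg: "P (- v)" if "P v" for v
  proof -
    have "mat2 1 (vec_cl v) 0 1 ** mat2 1 (vec_cl (- v)) 0 1 = mat 1" "mat2 1 (vec_cl (- v)) 0 1 ** mat2 1 (vec_cl v) 0 1 = mat 1"
      unfolding translation_mult by (simp_all add: vec_cl_0 mat_1_mat2)
    then show ?thesis using Gamma.inverse that unfolding P_def by blast
  qed
  have Pnat: "P (real k *\<^sub>R axis j 1)" if "idx j \<le> p" for j k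
  proof (induction k)
    case 0 then show ?case using P0 by simp
  next
    case (Suc k)
    have "P (axis j 1)" using Gamma.translation[OF that] by (simp add: P_def vec_cl_axis)
    from Padd[OF this Suc] show ?case by (simp add: algebra_simps)
  qed
  have Pj: "P (m $ j *\<^sub>R axis j 1)" for j
  proof (cases "idx j \<le> p")
    case True
    obtain k where k: "m $ j = of_int k" using m(1)[of j] by (auto elim: Ints_cases)
    show ?thesis
    proof (cases "k \<ge> 0")
      case True then show ?thesis using Pnat[OF \<open>idx j \<le> p\<close>, of "nat k"] by (simp add: k)
    next
      case False then show ?thesis using Pneg[OF Pnat[OF \<open>idx j \<le> p\<close>, of "nat (- k)"]] by (simp add: k)
    qed
  next
    case False then show ?thesis using m(2)[of j] P0 by simp
  qed
  have "P (\<Sum>j\<in>J. m $ j *\<^sub>R axis j 1)" for J :: "'n set"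
    by (induction J rule: infinite_finite_induct) (simp_all add: P0 Padd Pj)
  from this[of UNIV] have "P (\<Sum>j\<in>UNIV. m $ j *\<^sub>R axis j 1)" .
  moreover have "(\<Sum>j\<in>UNIV. m $ j *\<^sub>R axis j 1) = m"
    using basis_expansion[of m] by (simp add: scalar_mult_eq_scaleR)
  ultimately show ?thesis by (simp add: P_def)
qed

lemma translation_in_GammaN:
  fixes m :: "'n::{finite,linorder} Rn"
  assumes m: "m \<in> translation_lattice p N"
  shows "mat2 1 (vec_cl m) 0 1 \<in> GammaN p N"
proof -
  have "\<exists>k::int. m $ j = real N * of_int k" for j using m by (simp add: translation_lattice_def)
  then obtain k :: "'n \<Rightarrow> int" where k: "\<And>j. m $ j = real N * of_int (k j)" by metis
  have m0: "m $ j = 0" if "p < idx j" for j using m that by (simp add: translation_lattice_def)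
  define k' where "k' = (\<lambda>j. if idx j \<le> p then real_of_int (k j) else 0)"
  have mk: "m $ j = real N * k' j" for j using k[of j] m0[of j] by (auto simp: k'_def)
  have "vec_cl m = real N *\<^sub>R (\<Sum>j\<in>UNIV. k' j *\<^sub>R gen j)"
    by (simp add: vec_cl_def mk scaleR_sum_right)
  moreover have "(\<Sum>j\<in>J. k' j *\<^sub>R gen j) \<in> int_ring p" for J :: "'n set"
  proof -
    have "k' j *\<^sub>R gen j \<in> int_ring p" for j
      by (auto simp: int_ring_def gen_def coeff_blade k'_def)
    then show ?thesis
      by (induction J rule: infinite_finite_induct) (simp_all add: int_ring_0 int_ring_add)
  qed
  ultimately have "vec_cl m \<in> scaled_int_ring p N" by (auto simp: scaled_int_ring_def)
  moreover have "0 \<in> scaled_int_ring p N" using int_ring_0[of p] unfolding scaled_int_ring_def by (metis image_eqI scaleR_zero_right)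
  moreover have "mat2 1 (vec_cl m) 0 1 \<in> Gamma p"
    by (rule translation_in_Gamma) (use m0 k in auto)
  ultimately show ?thesis by (simp add: GammaN_iff)
qed

section \<open>Summability and exchange with the integral\<close>

lemma summable_on_powr_int:
  assumes s: "s > 1" shows "(\<lambda>k::int. (1 + \<bar>real_of_int k\<bar>) powr - s) summable_on UNIV"
proof -
  have "summable (\<lambda>n. real (Suc n) powr - s)"
    unfolding summable_Suc_iff[of "\<lambda>n. real n powr - s"] summable_real_powr_iff using s by simp
  then have nat: "(\<lambda>n. (1 + real n) powr - s) summable_on UNIV"
    by (intro norm_summable_imp_summable_on) (simp add: add.commute)
  have 1: "(\<lambda>k::int. (1 + \<bar>real_of_int k\<bar>) powr - s) summable_on (int ` UNIV)"
    using nat by (subst summable_on_reindex) (auto simp: o_def inj_on_def)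
  have 2: "(\<lambda>k::int. (1 + \<bar>real_of_int k\<bar>) powr - s) summable_on ((\<lambda>n. - int n) ` {0<..})"
    using summable_on_subset_banach[OF nat, of "{0<..}"] by (subst summable_on_reindex) (auto simp: o_def inj_on_def)
  have "(\<lambda>k::int. (1 + \<bar>real_of_int k\<bar>) powr - s) summable_on (int ` UNIV \<union> (\<lambda>n. - int n) ` {0<..})"
    by (rule summable_on_Un_disjoint[OF 1 2]) auto
  moreover have "int ` UNIV \<union> (\<lambda>n. - int n) ` {0<..} = UNIV"
  proof -
    have "k \<in> int ` UNIV \<union> (\<lambda>n. - int n) ` {0<..}" for k
    proof (cases "k \<ge> 0")
      case True then show ?thesis by (metis UNIV_I UnI1 image_eqI int_nat_eq)
    next
      case False
      then have "k = - int (nat (- k))" "nat (- k) \<in> {0<..}" by auto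
      then show ?thesis by blast
    qed
    then show ?thesis by blast
  qed
  ultimately show ?thesis by simp
qed

text \<open>Every finite set of families lies in a finite box, and over a box the sum of products is
  a product of sums.\<close>

lemma summable_on_prod_PiE:
  fixes a :: "'b \<Rightarrow> real"
  assumes J: "finite J" and a: "a summable_on UNIV" "\<And>i. a i \<ge> 0"
  shows "(\<lambda>k. \<Prod>j\<in>J. a (k j)) summable_on (PiE J (\<lambda>_. UNIV))"
proof (rule nonneg_bdd_above_summable_on)
  show "bdd_above (sum (\<lambda>k. \<Prod>j\<in>J. a (k j)) ` {P. P \<subseteq> PiE J (\<lambda>_. UNIV) \<and> finite P})"
  proof (rule bdd_aboveI2)
    fix P :: "('a \<Rightarrow> 'b) set" assume "P \<in> {P. P \<subseteq> PiE J (\<lambda>_. UNIV) \<and> finite P}"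
    then have P: "P \<subseteq> PiE J (\<lambda>_. UNIV)" "finite P" by auto
    define B where "B = (\<Union>k\<in>P. k ` J)"
    have B: "finite B" using P J by (simp add: B_def)
    have "P \<subseteq> PiE J (\<lambda>_. B)"
    proof
      fix k assume k: "k \<in> P"
      then have "k j \<in> B" if "j \<in> J" for j using that unfolding B_def by blast
      moreover have "k \<in> PiE J (\<lambda>_. UNIV)" using P(1) k by (rule subsetD)
      ultimately show "k \<in> PiE J (\<lambda>_. B)" by (simp only: PiE_iff) blast
    qed
    then have "(\<Sum>k\<in>P. \<Prod>j\<in>J. a (k j)) \<le> (\<Sum>k\<in>PiE J (\<lambda>_. B). \<Prod>j\<in>J. a (k j))"
      using B J a by (intro sum_mono2 finite_PiE prod_nonneg) auto
    also have "\<dots> = (\<Prod>j\<in>J. \<Sum>i\<in>B. a i)"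
      using prod_sum_PiE[of J "\<lambda>_. B" "\<lambda>_ i. a i"] B J by simp
    also have "\<dots> \<le> (\<Prod>j\<in>J. infsum a UNIV)"
      using B a by (intro prod_mono conjI sum_nonneg finite_sum_le_infsum) auto
    finally show "(\<Sum>k\<in>P. \<Prod>j\<in>J. a (k j)) \<le> infsum a UNIV ^ card J" by simp
  qed
qed (use a in \<open>auto intro: prod_nonneg\<close>)

lemma card_idx_le: "card {j :: 'n::{finite,linorder}. idx j \<le> p} \<le> p"
proof -
  have "inj_on idx {j :: 'n. idx j \<le> p}"
  proof (rule linorder_inj_onI)
    fix i j :: 'n assume "i < j"
    then have "{k. k \<le> i} \<subseteq> {k. k \<le> j}" "j \<in> {k. k \<le> j}" "j \<notin> {k. k \<le> i}" by auto
    then have "{k. k \<le> i} \<subset> {k. k \<le> j}" by blast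
    then have "idx i < idx j" unfolding idx_def by (intro psubset_card_mono) auto
    then show "idx i \<noteq> idx j" by simp
  qed auto
  moreover have "idx ` {j :: 'n. idx j \<le> p} \<subseteq> {1..p}"
    unfolding idx_def by (auto simp: Suc_le_eq card_gt_0_iff)
  ultimately have "card {j :: 'n. idx j \<le> p} \<le> card {1..p}" by (intro card_inj_on_le) auto
  then show ?thesis by simp
qed

text \<open>Every factor \<open>1 + |k_j|\<close> is at most \<open>1 + norm m\<close>. Raising it
  to the power \<open>s\<close> and multiplying over at most \<open>p\<close> coordinates stays
  below the power \<open>q\<close>, so the series is dominated by a product of convergent series in
  one variable.\<close>

lemma lattice_summable:
  fixes N :: nat
  assumes N: "N \<ge> 1" and q: "p < q"
  shows "(\<lambda>m :: 'n::{finite,linorder} Rn. 1 / (1 + norm m) ^ q) summable_on translation_lattice p N"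
proof -
  define J where "J = {j :: 'n. idx j \<le> p}"
  \<comment> \<open>Essentially \<open>q / p\<close>, which exceeds 1; for \<open>p = 0\<close> the
    denominator is \<open>1 / 2\<close> to avoid division by 0.\<close>
  define s where "s = real q / (real p + (if p = 0 then 1 / 2 else 0))"
  have s: "s > 1" "s * real (card J) \<le> real q"
  proof -
    show "s > 1" using q by (auto simp: s_def)
    have "real (card J) \<le> real p" using card_idx_le[where p=p and 'n='n] by (simp add: J_def)
    then have "s * real (card J) \<le> s * real p" using \<open>s > 1\<close> by (intro mult_left_mono) auto
    also have "\<dots> \<le> real q" by (auto simp: s_def)
    finally show "s * real (card J) \<le> real q" .
  qed
  define v where "v k = (\<chi> j. if j \<in> J then real N * of_int (k j) else 0)" for k :: "'n \<Rightarrow> int"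
  have fJ: "finite J" by simp
  have sm: "(\<lambda>k. \<Prod>j\<in>J. (1 + \<bar>real_of_int (k j)\<bar>) powr - s) summable_on (PiE J (\<lambda>_. UNIV))"
    by (rule summable_on_prod_PiE[OF fJ summable_on_powr_int[OF s(1)]]) simp
  have "(\<lambda>k. 1 / (1 + norm (v k)) ^ q) summable_on (PiE J (\<lambda>_. UNIV))"
  proof (rule summable_on_comparison_test[OF sm])
    fix k :: "'n \<Rightarrow> int"
    have "(\<Prod>j\<in>J. (1 + \<bar>real_of_int (k j)\<bar>) powr s) \<le> (\<Prod>j\<in>J. (1 + norm (v k)) powr s)"
    proof (intro prod_mono conjI powr_mono2)
      fix j assume j: "j \<in> J"
      have "1 * \<bar>real_of_int (k j)\<bar> \<le> real N * \<bar>real_of_int (k j)\<bar>" using N by (intro mult_right_mono) auto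
      also have "\<dots> = \<bar>v k $ j\<bar>" using j by (simp add: v_def abs_mult)
      also have "\<dots> \<le> norm (v k)" by (rule component_le_norm_cart)
      finally show "1 + \<bar>real_of_int (k j)\<bar> \<le> 1 + norm (v k)" by simp
    qed (use s in auto)
    also have "\<dots> = (1 + norm (v k)) powr (s * real (card J))"
      by (simp add: powr_power mult.commute add_nonneg_eq_0_iff)
    also have "\<dots> \<le> (1 + norm (v k)) powr real q" using s by (intro powr_mono) auto
    also have "\<dots> = (1 + norm (v k)) ^ q" by (simp add: powr_realpow add_pos_nonneg)
    finally have le: "(\<Prod>j\<in>J. (1 + \<bar>real_of_int (k j)\<bar>) powr s) \<le> (1 + norm (v k)) ^ q" .
    have pos: "(\<Prod>j\<in>J. (1 + \<bar>real_of_int (k j)\<bar>) powr s) > 0"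
      by (intro prod_pos) (auto simp: add_pos_nonneg)
    have "(\<Prod>j\<in>J. (1 + \<bar>real_of_int (k j)\<bar>) powr - s) = 1 / (\<Prod>j\<in>J. (1 + \<bar>real_of_int (k j)\<bar>) powr s)"
      by (simp add: powr_minus_divide prod_dividef)
    then show "1 / (1 + norm (v k)) ^ q \<le> (\<Prod>j\<in>J. (1 + \<bar>real_of_int (k j)\<bar>) powr - s)"
      using divide_left_mono[OF le, of 1] pos by (simp add: add_pos_nonneg)
  qed simp
  moreover have "inj_on v (PiE J (\<lambda>_. UNIV))"
  proof (rule inj_onI)
    fix k l assume kl: "k \<in> PiE J (\<lambda>_. UNIV)" "l \<in> PiE J (\<lambda>_. UNIV)" "v k = v l"
    show "k = l"
    proof (rule PiE_ext[OF kl(1,2)])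
      fix j assume "j \<in> J"
      then show "k j = l j" using arg_cong[OF kl(3), of "\<lambda>u. u $ j"] N by (simp add: v_def)
    qed
  qed
  ultimately have "(\<lambda>m. 1 / (1 + norm m) ^ q) summable_on (v ` PiE J (\<lambda>_. UNIV))"
    by (subst summable_on_reindex) (simp_all add: o_def)
  moreover have "translation_lattice p N \<subseteq> v ` PiE J (\<lambda>_. UNIV)"
  proof
    fix m :: "'n Rn" assume m: "m \<in> translation_lattice p N"
    then have "\<exists>k::int. m $ j = real N * of_int k" for j by (simp add: translation_lattice_def)
    then obtain k :: "'n \<Rightarrow> int" where k: "\<And>j. m $ j = real N * of_int (k j)" by metis
    have mv: "m = v (restrict k J)" using m k by (auto simp: vec_eq_iff v_def J_def translation_lattice_def)
    show "m \<in> v ` PiE J (\<lambda>_. UNIV)" unfolding mv by (rule imageI) (simp add: PiE_iff extensional_def)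
  qed
  ultimately show ?thesis by (rule summable_on_subset_banach)
qed

text \<open>The majorant does not depend on \<open>x\<close>, so finite sets \<open>F k\<close> can
  be chosen whose partial sums are within \<open>1 / Suc k\<close> of the total at every point. This
  reduces the family to a sequence; \<open>i0\<close> is put into every \<open>F k\<close>, so all
  partial sums have the same integral.\<close>

lemma integral_infsum_singleton:
  fixes h :: "'i \<Rightarrow> 'a \<Rightarrow> 'b::{banach,second_countable_topology}"
  assumes fin: "finite_measure M" and int: "\<And>i. i \<in> I \<Longrightarrow> integrable M (h i)"
    and bound: "\<And>i x. i \<in> I \<Longrightarrow> norm (h i x) \<le> b i" and b: "b summable_on I"
    and i0: "i0 \<in> I" and zero: "\<And>i. i \<in> I \<Longrightarrow> i \<noteq> i0 \<Longrightarrow> (LINT x|M. h i x) = 0"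
  shows "(LINT x|M. infsum (\<lambda>i. h i x) I) = (LINT x|M. h i0 x)"
proof -
  interpret finite_measure M by fact
  have hs: "(\<lambda>i. h i x) summable_on I" for x
    by (rule abs_summable_summable, rule summable_on_comparison_test[OF b]) (auto intro: bound)
  have b0: "b i \<ge> 0" if "i \<in> I" for i using order_trans[OF norm_ge_zero bound[OF that]] .
  have "\<exists>F. finite F \<and> F \<subseteq> I \<and> i0 \<in> F \<and> infsum b I - sum b F < 1 / real (Suc k)" for k
  proof -
    have "\<forall>\<^sub>F F in finite_subsets_at_top I. dist (sum b F) (infsum b I) < 1 / real (Suc k)"
      using has_sum_infsum[OF b] unfolding has_sum_def by (rule tendstoD) simp
    then obtain G where G: "finite G" "G \<subseteq> I" "\<forall>F. finite F \<and> G \<subseteq> F \<and> F \<subseteq> I \<longrightarrow> dist (sum b F) (infsum b I) < 1 / real (Suc k)"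
      unfolding eventually_finite_subsets_at_top by (elim exE conjE) (rule that)
    have sub: "finite (insert i0 G)" "G \<subseteq> insert i0 G" "insert i0 G \<subseteq> I" using G(1,2) i0 by auto
    have "dist (sum b (insert i0 G)) (infsum b I) < 1 / real (Suc k)" using G(3) sub by (simp only: simp_thms)
    then have "infsum b I - sum b (insert i0 G) < 1 / real (Suc k)" unfolding dist_real_def by linarith
    then show ?thesis using sub by (intro exI[of _ "insert i0 G"] conjI insertI1)
  qed
  then obtain F where F: "\<And>k. finite (F k)" "\<And>k. F k \<subseteq> I" "\<And>k. i0 \<in> F k" "\<And>k. infsum b I - sum b (F k) < 1 / real (Suc k)"
    by metis
  define u where "u k x = (\<Sum>i\<in>F k. h i x)" for k x
  have close: "norm (infsum (\<lambda>i. h i x) I - u k x) \<le> 1 / real (Suc k)" for k x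
  proof -
    have "infsum (\<lambda>i. h i x) (I - F k) = infsum (\<lambda>i. h i x) I - u k x"
      unfolding u_def using F hs by (subst infsum_Diff) auto
    moreover have "norm (infsum (\<lambda>i. h i x) (I - F k)) \<le> infsum b (I - F k)"
      by (rule norm_infsum_le[OF has_sum_infsum has_sum_infsum])
         (use bound b hs in \<open>auto intro: summable_on_subset_banach\<close>)
    moreover have "infsum b (I - F k) = infsum b I - sum b (F k)"
      using F b by (subst infsum_Diff) auto
    ultimately show ?thesis using F(4)[of k] by simp
  qed
  have lim: "(\<lambda>k. u k x) \<longlonglongrightarrow> infsum (\<lambda>i. h i x) I" for x
  proof (rule Lim_null[THEN iffD2], rule Lim_null_comparison)
    show "\<forall>\<^sub>F k in sequentially. norm (u k x - infsum (\<lambda>i. h i x) I) \<le> 1 / real (Suc k)"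
      using close[of x] by (simp add: norm_minus_commute)
    show "(\<lambda>k. 1 / real (Suc k)) \<longlonglongrightarrow> 0" by (rule lim_1_over_n[THEN LIMSEQ_Suc])
  qed
  have uint: "integrable M (u k)" for k
    unfolding u_def using F(2) int by (intro Bochner_Integration.integrable_sum) blast
  have um: "u k \<in> borel_measurable M" for k using uint by (rule borel_measurable_integrable)
  have ubound: "norm (u k x) \<le> infsum b I" for k x
  proof -
    have "norm (u k x) \<le> sum b (F k)" unfolding u_def using F(2) bound by (intro sum_norm_le) blast
    also have "\<dots> \<le> infsum b I" using F b b0 by (intro finite_sum_le_infsum) auto
    finally show ?thesis .
  qed
  have "(\<lambda>k. LINT x|M. u k x) \<longlonglongrightarrow> (LINT x|M. infsum (\<lambda>i. h i x) I)"
    by (rule integral_dominated_convergence[where w = "\<lambda>_. infsum b I"])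
       (use um lim ubound in \<open>auto intro: borel_measurable_LIMSEQ_metric\<close>)
  moreover have "(LINT x|M. u k x) = (LINT x|M. h i0 x)" for k
  proof -
    have "(LINT x|M. u k x) = (\<Sum>i\<in>F k. (LINT x|M. h i x))"
      unfolding u_def using F(2) int by (intro Bochner_Integration.integral_sum) blast
    also have "\<dots> = (\<Sum>i\<in>F k. if i = i0 then (LINT x|M. h i0 x) else 0)"
      using F(2)[of k] zero by (intro sum.cong) (auto dest: subsetD)
    also have "\<dots> = (LINT x|M. h i0 x)" using F by simp
    finally show ?thesis .
  qed
  ultimately have "(\<lambda>k::nat. LINT x|M. h i0 x) \<longlonglongrightarrow> (LINT x|M. infsum (\<lambda>i. h i x) I)" by (simp only:)
  then show ?thesis by (rule LIMSEQ_unique[OF _ tendsto_const])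
qed

text \<open>Unconditional convergence passes to each of the finitely many coefficients, where it is
  absolute. It turns the assumed convergence of the kernel series into bounds on norms.\<close>

lemma summable_on_clifford_norm:
  assumes "(g :: 'i \<Rightarrow> 'n::finite clifford) summable_on I"
  shows "(\<lambda>i. norm (g i)) summable_on I"
proof -
  have bl: "bounded_linear (\<lambda>a :: 'n clifford. cl_coeff a A)" for A
    by (intro linear_conv_bounded_linear[THEN iffD1] linearI) simp_all
  have coeff: "(\<lambda>i. \<bar>cl_coeff (g i) A\<bar>) summable_on I" for A
    using iffD1[OF summable_on_iff_abs_summable_on_real summable_on_bounded_linear[OF bl assms]] by (simp only: real_norm_def)
  have "(\<lambda>i. \<Sum>A\<in>B. \<bar>cl_coeff (g i) A\<bar>) summable_on I" if "finite B" for B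
    using that by (induction B rule: finite_induct) (auto intro: summable_on_add coeff)
  then have s: "(\<lambda>i. \<Sum>A\<in>UNIV. \<bar>cl_coeff (g i) A\<bar>) summable_on I" by simp
  have "norm a \<le> (\<Sum>A\<in>UNIV. \<bar>cl_coeff a A\<bar>)" for a :: "'n clifford"
    unfolding norm_clifford_coeff using L2_set_le_sum_abs[of "cl_coeff a" UNIV] by (simp add: L2_set_def)
  then show ?thesis by (intro summable_on_comparison_test[OF s]) auto
qed

section \<open>The sum over the group\<close>

locale cauchy_setting =
  fixes p N :: nat and F U V :: "'n::{finite,linorder} Rn set" and R :: "'n cl_mat set"
    and C :: "'n Rn \<Rightarrow> 'n Rn \<Rightarrow> 'n clifford" and f :: "'n Rn \<Rightarrow> 'n clifford" and y :: "'n Rn"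
  assumes N3: "3 \<le> N" and pn: "p + 2 < CARD('n)"
    and fd: "fundamental_domain p N F" and F_slab: "F \<subseteq> slab p N"
    and rep: "coset_representatives p N R" and R_slab: "\<forall>M\<in>R. mob_act M ` F \<subseteq> slab p N"
    and kernel: "is_cauchy_kernel p N R C"
    and U: "open U" and UF: "U \<subseteq> F"
    and V: "open V" "V \<noteq> {}" "bounded V" "V \<subseteq> U"
    and lipschitz: "strongly_lipschitz (frontier V)" and SU: "frontier V \<subseteq> U"
    and y: "y \<in> V" and monogenic: "left_monogenic_on f U"
begin

abbreviation S where "S \<equiv> frontier V"
abbreviation \<Lambda> where "\<Lambda> \<equiv> translation_lattice p N :: 'n Rn set"
abbreviation tr :: "'n Rn \<Rightarrow> 'n cl_mat" where "tr m \<equiv> mat2 1 (vec_cl m) 0 1"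

lemma p_less: "p < CARD('n)" using pn by simp

lemma U_interior: "U \<subseteq> interior F" using U UF by (rule interior_maximal[rotated])

lemma U_upper: "U \<subseteq> upper_half" using UF F_slab by (auto simp: slab_def)

lemma closure_V: "closure V \<subseteq> U"
  using V(4) SU closure_Un_frontier[of V] by blast

lemma S_upper: "x \<in> S \<Longrightarrow> x \<in> upper_half" using SU U_upper by blast

lemma y_upper: "y \<in> upper_half" using y V(4) U_upper by blast

lemma compact_S: "compact S" using V(3) by (rule compact_frontier_bounded)

lemma S_nonempty: "S \<noteq> {}"
  using V(2,3) by (intro frontier_not_empty) auto

lemma acts_GammaN: "M \<in> GammaN p N \<Longrightarrow> acts p (M :: 'n cl_mat)"
  by (rule Gamma_acts[OF GammaN_subset p_less])

lemma R_GammaN: "M \<in> R \<Longrightarrow> M \<in> GammaN p N"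
  using rep by (auto simp: coset_representatives_def)

lemma tr_mult_GammaN: "m \<in> \<Lambda> \<Longrightarrow> M \<in> R \<Longrightarrow> tr m ** M \<in> GammaN p N"
  by (intro GammaN_mult translation_in_GammaN R_GammaN)

lemma tr_mult:
  assumes m: "m \<in> \<Lambda>" and M: "M \<in> R" and x: "x \<in> upper_half"
  shows "denom (tr m ** M) x = denom M x" "mob_act (tr m ** M) x = mob_act M x + m"
proof -
  have m0: "m $ j = 0" if "p < idx j" for j using m that by (simp add: translation_lattice_def)
  have a: "acts p (tr m)" by (rule acts_translation(1)[OF m0 p_less])
  have b: "acts p M" by (rule acts_GammaN[OF R_GammaN[OF M]])
  show "denom (tr m ** M) x = denom M x" by (simp add: acts_mult(2)[OF a b x] denom_translation)
  show "mob_act (tr m ** M) x = mob_act M x + m"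
    by (simp only: acts_mult(3)[OF a b x] acts_translation(2)[OF m0 p_less])
qed

lemma tr_0: "tr 0 = mat 1" by (simp add: mat_1_mat2 vec_cl_0)

lemma mob_act_one: "mob_act (mat 1) x = x" for x :: "'n Rn"
  using acts_translation(2)[of p 0 x] p_less by (simp add: tr_0)

lemma interior_disjoint:
  assumes L: "L \<in> GammaN p N" and x: "x \<in> interior F" and Lx: "mob_act L x \<in> interior F"
  shows "L = mat 1"
proof -
  have "interior F \<inter> mob_act L ` interior F \<noteq> {}" using x Lx by blast
  then have "L = mat 1 \<or> L = - mat 1" using fd L unfolding fundamental_domain_def by blast
  then show ?thesis using GammaN_not_uminus_one[OF N3] L by auto
qed

text \<open>An image of a point of \<open>S\<close> in a ball around \<open>y\<close> inside
  \<open>V\<close> would be in the interior of the fundamental domain, as the point itself is. Then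
  the matrix is the identity, and the point is in \<open>S\<close> and in the open set
  \<open>V\<close> at once. The same \<open>\<epsilon>\<close> thus serves the whole group.\<close>

lemma separated:
  obtains \<epsilon> where "\<epsilon> > 0" "\<And>L x. L \<in> GammaN p N \<Longrightarrow> x \<in> S \<Longrightarrow> \<epsilon> \<le> norm (y - mob_act L x)"
proof -
  obtain \<epsilon> where e: "\<epsilon> > 0" "ball y \<epsilon> \<subseteq> V" using V(1) y open_contains_ball by blast
  have "\<epsilon> \<le> norm (y - mob_act L x)" if L: "L \<in> GammaN p N" and x: "x \<in> S" for L x
  proof (rule ccontr)
    assume "\<not> \<epsilon> \<le> norm (y - mob_act L x)"
    then have Lx: "mob_act L x \<in> V" using e(2) by (auto simp: dist_norm)
    then have "L = mat 1" using interior_disjoint[OF L] x SU U_interior V(4) by blast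
    then have "x \<in> V" using Lx by (simp add: mob_act_one)
    then show False using x V(1) by (simp add: frontier_def interior_open)
  qed
  then show thesis using that e(1) by blast
qed

lemma y_notin_orbit: "x \<in> S \<Longrightarrow> y \<notin> orbitN p N x"
proof
  assume x: "x \<in> S" "y \<in> orbitN p N x"
  then obtain L where "L \<in> GammaN p N" "y = mob_act L x" by (auto simp: orbitN_def)
  then show False using separated x(1) by (metis cancel_comm_monoid_add_class.diff_cancel norm_zero not_le)
qed

lemma preimage_notin_closure:
  assumes L: "L \<in> GammaN p N" "L \<noteq> mat 1" and w: "mob_act L w = y" shows "w \<notin> closure V"
proof
  assume "w \<in> closure V"
  then have "w \<in> interior F" using closure_V U_interior by blast
  then show False using interior_disjoint[OF L(1)] L(2) w y V(4) U_interior by blast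
qed

text \<open>The identity need not be its own representative. Its coset is represented by a
  translation \<open>tr k\<close> in \<open>R\<close>, and the pair sought is
  \<open>(- k, tr k)\<close>.\<close>

lemma identity_pair:
  obtains i where "i \<in> \<Lambda> \<times> R" "tr (fst i) ** snd i = mat 1"
    "\<And>m M. m \<in> \<Lambda> \<Longrightarrow> M \<in> R \<Longrightarrow> tr m ** M = mat 1 \<Longrightarrow> (m, M) = i"
proof -
  have "\<exists>!L. L \<in> R \<and> (\<exists>T\<in>translation_group p N. L = T ** mat 1)"
    using rep GammaN_one unfolding coset_representatives_def by blast
  then have ex1: "\<exists>!L. L \<in> R \<and> (\<exists>m\<in>\<Lambda>. L = tr m)"
    by (simp add: translation_group_lattice matrix_mul_rid image_iff)
  then obtain M0 k where M0: "M0 \<in> R" "k \<in> \<Lambda>" "M0 = tr k" by blast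
  have 1: "(- k, M0) \<in> \<Lambda> \<times> R" using M0 translation_lattice_minus by auto
  have 2: "tr (fst (- k, M0)) ** snd (- k, M0) = mat 1" by (simp add: M0(3) translation_mult tr_0)
  have 3: "(m, M) = (- k, M0)" if m: "m \<in> \<Lambda>" and M: "M \<in> R" and one: "tr m ** M = mat 1" for m M
  proof -
    have "M = (tr (- m) ** tr m) ** M" by (simp add: translation_mult tr_0 matrix_mul_lid)
    also have "\<dots> = tr (- m)" by (simp add: matrix_mul_assoc[symmetric] one matrix_mul_rid)
    finally have Mm: "M = tr (- m)" .
    then have eq: "M = M0" using ex1 M M0 translation_lattice_minus[OF m] by blast
    have "vec_cl (- m) = vec_cl k" using Mm eq M0(3) mat2_entries(2) by metis
    then have "- m = k" by (metis vec_part_vec_cl)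
    then show ?thesis using eq by auto
  qed
  show thesis by (rule that[OF 1 2 3])
qed

definition kernel_summand :: "'n Rn \<times> 'n cl_mat \<Rightarrow> 'n Rn \<Rightarrow> 'n clifford" where
  "kernel_summand i x = factor_J (tr (fst i) ** snd i) x * kernel_G (y - mob_act (tr (fst i) ** snd i) x)"

definition integrand :: "'n Rn \<times> 'n cl_mat \<Rightarrow> 'n Rn \<Rightarrow> 'n clifford" where
  "integrand i x = indicator S x *\<^sub>R (reversion (kernel_summand i x) * vec_cl (outward_normal V x) * f x)"

lemma outward_normal_off: "x \<notin> S \<Longrightarrow> outward_normal V x = 0"
  by (rule nonfrontier_normal[OF V(1)])

text \<open>With \<open>w\<close> the preimage of \<open>y\<close>, the integrand is a constant
  times the Cauchy integrand at \<open>w\<close>. Either \<open>w = y\<close>, or \<open>w\<close>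
  is outside the closure of \<open>V\<close>; in both cases \<open>w\<close> is off
  \<open>S\<close>.\<close>

lemma integrand_integral:
  assumes m: "m \<in> \<Lambda>" and M: "M \<in> R"
  shows "integrable (surface_measure S) (integrand (m, M))"
    and "(LINT x|surface_measure S. integrand (m, M) x) = (if tr m ** M = mat 1 then f y else 0)"
proof -
  let ?L = "tr m ** M"
  have L: "?L \<in> GammaN p N" by (rule tr_mult_GammaN[OF m M])
  obtain w where w: "w \<in> upper_half" "mob_act ?L w = y"
    by (rule Gamma_surjective[OF GammaN_subset[OF L] p_less y_upper])
  have wS: "w \<notin> S"
  proof (cases "?L = mat 1")
    case True
    then have "w = y" using w(2) by (simp add: mob_act_one)
    then show ?thesis using y V(1) by (simp add: frontier_def interior_open)
  next
    case False
    then show ?thesis using preimage_notin_closure[OF L False w(2)] by (auto simp: frontier_def)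
  qed
  define g where "g x = kernel_G (w - x) * vec_cl (outward_normal V x) * f x" for x
  have g: "integrable (surface_measure S) g" "(LINT x|surface_measure S. g x) = (if w \<in> V then f w else 0)"
    using cauchy_integral_formula[OF monogenic U V(1,3) closure_V lipschitz wS] unfolding g_def by auto
  obtain K where K: "\<And>x. x \<in> upper_half \<Longrightarrow> reversion (factor_J ?L x * kernel_G (y - mob_act ?L x)) = K * kernel_G (w - x)"
    using kernel_transformation[OF acts_GammaN[OF L] w(1)] unfolding w(2) by blast
  have eq: "integrand (m, M) x = K * g x" for x
  proof (cases "x \<in> S")
    case True
    then show ?thesis using K[OF S_upper[OF True]] by (simp add: integrand_def kernel_summand_def g_def mult.assoc)
  next
    case False
    then show ?thesis by (simp add: integrand_def g_def outward_normal_off vec_cl_0)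
  qed
  have bl: "bounded_linear (\<lambda>a. K * a)" by (rule bounded_bilinear.bounded_linear_right[OF bounded_bilinear_clifford])
  have ie: "integrand (m, M) = (\<lambda>x. K * g x)" using eq by blast
  show "integrable (surface_measure S) (integrand (m, M))"
    unfolding ie by (rule integrable_bounded_linear[OF bl g(1)])
  show "(LINT x|surface_measure S. integrand (m, M) x) = (if ?L = mat 1 then f y else 0)"
  proof (cases "?L = mat 1")
    case True
    have wy: "w = y" using w(2) True by (simp add: mob_act_one)
    \<comment> \<open>For the identity matrix \<open>factor_J\<close> is 1, so the weight is seen to
      be 1 without evaluating \<open>K\<close>.\<close>
    have "integrand (m, M) x = g x" for x
    proof (cases "x \<in> S")
      case True
      have "denom (mat 1) x = 1" using denom_translation[of 0 x] by (simp only: tr_0)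
      then show ?thesis using True \<open>?L = mat 1\<close>
        by (simp add: integrand_def kernel_summand_def g_def wy factor_J_def mob_act_one norm_one_clifford kernel_G_def reversion_scaleR)
    next
      case False
      then show ?thesis by (simp add: integrand_def g_def outward_normal_off vec_cl_0)
    qed
    then have "(LINT x|surface_measure S. integrand (m, M) x) = (LINT x|surface_measure S. g x)" by simp
    also have "\<dots> = f y" unfolding g(2) using y wy by simp
    finally show ?thesis using True by simp
  next
    case False
    then have "w \<notin> V" using preimage_notin_closure[OF L False w(2)] closure_subset by blast
    then have "(LINT x|surface_measure S. K * g x) = K * 0"
      using integral_bounded_linear[OF bl g(1)] g(2) by simp
    then show ?thesis using False unfolding ie by simp
  qed
qed

lemma last_coordinate_bound:
  obtains b where "b > 0" "\<And>x. x \<in> S \<Longrightarrow> b \<le> x $ Max UNIV"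
proof -
  have "\<exists>x\<in>S. \<forall>z\<in>S. x $ Max UNIV \<le> z $ Max UNIV"
    by (intro continuous_attains_inf compact_S S_nonempty continuous_intros)
  then obtain x where "x \<in> S" "\<And>z. z \<in> S \<Longrightarrow> x $ Max UNIV \<le> z $ Max UNIV" by blast
  then show thesis using that[of "x $ Max UNIV"] S_upper by (simp add: upper_half_def)
qed

text \<open>The choice of representatives bounds the first \<open>p\<close> coordinates. The others
  are \<open>x $ j\<close> divided by the squared norm of the denominator, which
  \<open>Gamma_denom_ge\<close> bounds below because the last coordinate has a positive minimum on
  \<open>S\<close>.\<close>

lemma orbit_bound:
  obtains \<rho> where "\<And>M x. M \<in> R \<Longrightarrow> x \<in> S \<Longrightarrow> norm (mob_act M x) \<le> \<rho>"
proof -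
  obtain b where b: "b > 0" "\<And>x. x \<in> S \<Longrightarrow> b \<le> x $ Max UNIV" by (rule last_coordinate_bound) blast
  obtain B where B: "\<And>x. x \<in> S \<Longrightarrow> norm x \<le> B" using compact_imp_bounded[OF compact_S] by (auto simp: bounded_iff)
  define \<delta> where "\<delta> = min 1 b"
  have d: "\<delta> > 0" using b by (simp add: \<delta>_def)
  have B0: "B \<ge> 0" using B S_nonempty by (metis ex_in_conv norm_ge_zero order_trans)
  have "norm (mob_act M x) \<le> (\<Sum>j\<in>(UNIV :: 'n set). real N / 2 + B / \<delta>\<^sup>2)" if M: "M \<in> R" and x: "x \<in> S" for M x
  proof -
    have "\<bar>mob_act M x $ j\<bar> \<le> real N / 2 + B / \<delta>\<^sup>2" for j
    proof (cases "idx j \<le> p")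
      case True
      have "mob_act M x \<in> slab p N" using R_slab M x SU UF by blast
      then have "\<bar>mob_act M x $ j\<bar> \<le> real N / 2" using True by (auto simp: slab_def abs_le_iff)
      then show ?thesis using B0 by (simp add: add_increasing2)
    next
      case False
      have "\<delta> \<le> norm (denom M x)"
        using Gamma_denom_ge[OF GammaN_subset[OF R_GammaN[OF M]] p_less S_upper[OF x]] b(2)[OF x] by (auto simp: \<delta>_def)
      then have "\<delta>\<^sup>2 \<le> (norm (denom M x))\<^sup>2" using d by (intro power_mono) auto
      moreover have "mob_act M x $ j = x $ j / (norm (denom M x))\<^sup>2"
        using acts_GammaN[OF R_GammaN[OF M]] S_upper[OF x] False unfolding acts_def by auto
      moreover have "\<bar>x $ j\<bar> \<le> B" using component_le_norm_cart[of x j] B[OF x] by linarith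
      ultimately have "\<bar>mob_act M x $ j\<bar> \<le> B / \<delta>\<^sup>2" using d by (simp add: abs_divide frac_le)
      then show ?thesis by (simp add: add_increasing)
    qed
    then show ?thesis by (intro order_trans[OF norm_le_l1_cart] sum_mono)
  qed
  then show thesis by (rule that)
qed

text \<open>\<open>denom_comparison\<close> made uniform: \<open>2 * B\<close> bounds distances
  between points of \<open>S\<close>, and \<open>b\<close> is a lower bound for their last
  coordinates.\<close>

lemma denom_bound:
  assumes x0: "x0 \<in> S"
  obtains A where "A > 0" "\<And>M x. M \<in> R \<Longrightarrow> x \<in> S \<Longrightarrow> norm (denom M x0) \<le> A * norm (denom M x)"
proof -
  obtain b where b: "b > 0" "\<And>x. x \<in> S \<Longrightarrow> b \<le> x $ Max UNIV" by (rule last_coordinate_bound) blast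
  obtain B where B: "\<And>x. x \<in> S \<Longrightarrow> norm x \<le> B" using compact_imp_bounded[OF compact_S] by (auto simp: bounded_iff)
  define A where "A = max 1 ((2 * B + x0 $ Max UNIV) / b)"
  have "norm (denom M x0) \<le> A * norm (denom M x)" if M: "M \<in> R" and x: "x \<in> S" for M x
  proof -
    have "norm (x0 - x) + x0 $ Max UNIV \<le> 2 * B + x0 $ Max UNIV"
      using norm_triangle_ineq4[of x0 x] B[OF x] B[OF x0] by linarith
    then have "(norm (x0 - x) + x0 $ Max UNIV) / x $ Max UNIV \<le> (2 * B + x0 $ Max UNIV) / b"
      using b(1) b(2)[OF x] b(2)[OF x0] order_trans[OF norm_ge_zero B[OF x0]] by (intro frac_le) auto
    then have "max 1 ((norm (x0 - x) + x0 $ Max UNIV) / x $ Max UNIV) \<le> A" unfolding A_def by linarith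
    then show ?thesis
      using denom_comparison[OF acts_GammaN[OF R_GammaN[OF M]] p_less S_upper[OF x0] S_upper[OF x]]
      by (meson mult_right_mono norm_ge_zero order_trans)
  qed
  moreover have "A > 0" by (simp add: A_def)
  ultimately show thesis using that by blast
qed

text \<open>The inner series of the kernel for the identity translation converges at
  \<open>x0\<close>, hence absolutely. The norms of its terms are the terms here times
  \<open>?c / norm ?u ^ q\<close>, and \<open>norm ?u\<close> is bounded by
  \<open>orbit_bound\<close>.\<close>

lemma denom_series_summable:
  assumes x0: "x0 \<in> S" and q: "CARD('n) = Suc q"
  shows "(\<lambda>M. 1 / norm (denom M x0) ^ q) summable_on R"
proof -
  let ?c = "1 / (real CARD('n) * unit_ball_vol (real CARD('n)))"
  have c: "?c > 0" by (simp add: unit_ball_vol_pos)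
  obtain \<epsilon> where e: "\<epsilon> > 0" "\<And>L x. L \<in> GammaN p N \<Longrightarrow> x \<in> S \<Longrightarrow> \<epsilon> \<le> norm (y - mob_act L x)" by (rule separated) blast
  obtain \<rho> where rho: "\<And>M x. M \<in> R \<Longrightarrow> x \<in> S \<Longrightarrow> norm (mob_act M x) \<le> \<rho>" by (rule orbit_bound) blast
  have "y \<in> upper_half - orbitN p N x0" using y_upper y_notin_orbit[OF x0] by simp
  then obtain h where h: "\<forall>T\<in>translation_group p N. ((\<lambda>M. factor_J (T ** M) x0 * kernel_G (y - mob_act (T ** M) x0)) has_sum h T) R"
    using kernel S_upper[OF x0] unfolding is_cauchy_kernel_def by blast
  have "0 \<in> \<Lambda>" by (auto simp: translation_lattice_def intro: exI[of _ 0])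
  then have "mat 1 \<in> (translation_group p N :: 'n cl_mat set)" unfolding translation_group_lattice tr_0[symmetric] by blast
  from bspec[OF h this] have "(\<lambda>M. factor_J M x0 * kernel_G (y - mob_act M x0)) summable_on R"
    by (simp add: matrix_mul_lid summable_on_def) blast
  then have "(\<lambda>M. norm (factor_J M x0 * kernel_G (y - mob_act M x0))) summable_on R" by (rule summable_on_clifford_norm)
  then have s: "(\<lambda>M. (norm y + \<rho>) ^ q / ?c * norm (factor_J M x0 * kernel_G (y - mob_act M x0))) summable_on R"
    by (rule summable_on_cmult_right)
  show ?thesis
  proof (rule summable_on_comparison_test[OF s])
    fix M assume M: "M \<in> R"
    let ?u = "y - mob_act M x0"
    have u: "0 < norm ?u" using e(1) e(2)[OF R_GammaN[OF M] x0] by linarith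
    have ur: "norm ?u \<le> norm y + \<rho>" using norm_triangle_ineq4[of y "mob_act M x0"] rho[OF M x0] by linarith
    have v: "denom M x0 \<in> versor" using acts_GammaN[OF R_GammaN[OF M]] S_upper[OF x0] by (auto simp: acts_def)
    have "norm (factor_J M x0 * kernel_G ?u) = ?c * (1 / norm (denom M x0) ^ q) * (1 / norm ?u ^ q)"
      by (rule norm_kernel_term[OF q v]) (use u in auto)
    then have "(norm y + \<rho>) ^ q / ?c * norm (factor_J M x0 * kernel_G ?u)
      = (1 / norm (denom M x0) ^ q) * ((norm y + \<rho>) ^ q / norm ?u ^ q)"
      using c by (simp add: field_simps)
    moreover have "(norm y + \<rho>) ^ q / norm ?u ^ q \<ge> 1"
      using u ur power_mono[OF ur, of q] by simp
    then have "(1 / norm (denom M x0) ^ q) * 1 \<le> (1 / norm (denom M x0) ^ q) * ((norm y + \<rho>) ^ q / norm ?u ^ q)"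
      by (rule mult_left_mono) simp
    ultimately show "1 / norm (denom M x0) ^ q \<le> (norm y + \<rho>) ^ q / ?c * norm (factor_J M x0 * kernel_G ?u)" by simp
  qed simp
qed

text \<open>A translation on the left leaves the denominator alone and only moves the image point,
  so the bound splits into a function of \<open>m\<close> times a function of
  \<open>M\<close>.\<close>

lemma kernel_summand_bound:
  obtains \<beta> where "\<beta> summable_on \<Lambda> \<times> R"
    "\<And>i x. i \<in> \<Lambda> \<times> R \<Longrightarrow> x \<in> S \<Longrightarrow> norm (kernel_summand i x) \<le> \<beta> i"
proof -
  obtain q where q: "CARD('n) = Suc q" using pn by (cases "CARD('n)") auto
  have pq: "p < q" using pn q by simp
  let ?c = "1 / (real CARD('n) * unit_ball_vol (real CARD('n)))"
  have c: "?c > 0" by (simp add: unit_ball_vol_pos)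
  obtain x0 where x0: "x0 \<in> S" using S_nonempty by blast
  obtain A where A: "A > 0" "\<And>M x. M \<in> R \<Longrightarrow> x \<in> S \<Longrightarrow> norm (denom M x0) \<le> A * norm (denom M x)" by (rule denom_bound[OF x0]) blast
  obtain \<epsilon> where e: "\<epsilon> > 0" "\<And>L x. L \<in> GammaN p N \<Longrightarrow> x \<in> S \<Longrightarrow> \<epsilon> \<le> norm (y - mob_act L x)" by (rule separated) blast
  obtain \<rho> where rho: "\<And>M x. M \<in> R \<Longrightarrow> x \<in> S \<Longrightarrow> norm (mob_act M x) \<le> \<rho>" by (rule orbit_bound) blast
  define a where "a M = 1 / norm (denom M x0) ^ q" for M
  define b where "b m = 1 / (1 + norm m) ^ q" for m :: "'n Rn"
  \<comment> \<open>From \<open>1 + norm m \<le> norm ?u + (1 + norm y + |\<rho>|)\<close> and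
    \<open>1 \<le> norm ?u / \<epsilon>\<close> one gets
    \<open>1 + norm m \<le> \<kappa> * norm ?u\<close>, including the small \<open>m\<close>, for
    which only \<open>\<epsilon>\<close> keeps \<open>?u\<close> away from 0.\<close>
  define \<kappa> where "\<kappa> = 1 + (1 + norm y + \<bar>\<rho>\<bar>) / \<epsilon>"
  define \<beta> where "\<beta> i = ?c * A ^ q * \<kappa> ^ q * (b (fst i) * a (snd i))" for i
  have asum: "a summable_on R" unfolding a_def by (rule denom_series_summable[OF x0 q])
  have bsum: "b summable_on \<Lambda>" unfolding b_def by (rule lattice_summable[OF _ pq]) (use N3 in simp)
  have "(\<lambda>i. b (fst i) * a (snd i)) summable_on \<Lambda> \<times> R"
  proof (rule summable_on_SigmaI)
    show "((\<lambda>M. b (fst (m, M)) * a (snd (m, M))) has_sum (b m * infsum a R)) R" for m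
      using has_sum_cmult_right[OF has_sum_infsum[OF asum], of "b m"] by simp
    show "(\<lambda>m. b m * infsum a R) summable_on \<Lambda>" by (rule summable_on_cmult_left[OF bsum])
  qed (simp add: a_def b_def)
  then have bs: "\<beta> summable_on \<Lambda> \<times> R" unfolding \<beta>_def by (rule summable_on_cmult_right)
  have "norm (kernel_summand i x) \<le> \<beta> i" if i: "i \<in> \<Lambda> \<times> R" and x: "x \<in> S" for i x
  proof -
    obtain m M where im: "i = (m, M)" "m \<in> \<Lambda>" "M \<in> R" using i by auto
    let ?L = "tr m ** M"
    let ?u = "y - mob_act ?L x"
    have L: "?L \<in> GammaN p N" by (rule tr_mult_GammaN[OF im(2,3)])
    have eu: "\<epsilon> \<le> norm ?u" by (rule e(2)[OF L x])
    have den: "denom ?L x = denom M x" and mob: "mob_act ?L x = mob_act M x + m"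
      using tr_mult[OF im(2,3) S_upper[OF x]] by auto
    have vM: "denom M x \<in> versor" "denom M x0 \<in> versor"
      using acts_GammaN[OF R_GammaN[OF im(3)]] S_upper x x0 by (auto simp: acts_def)
    have D: "norm (denom M x) > 0" "norm (denom M x0) > 0" using vM versor_norm_pos by auto
    have u: "norm ?u > 0" using eu e(1) by linarith
    have "norm (kernel_summand i x) = ?c * (1 / norm (denom ?L x) ^ q) * (1 / norm ?u ^ q)"
      unfolding kernel_summand_def im(1) fst_conv snd_conv by (rule norm_kernel_term[OF q]) (use u vM den in auto)
    also have "\<dots> = ?c * (1 / norm (denom M x) ^ q) * (1 / norm ?u ^ q)" unfolding den ..
    also have "\<dots> \<le> ?c * (A ^ q * a M) * (\<kappa> ^ q * b m)"
    proof (intro mult_mono)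
      have "norm (denom M x0) ^ q \<le> (A * norm (denom M x)) ^ q"
        by (intro power_mono A(2)[OF im(3) x]) simp
      then show "1 / norm (denom M x) ^ q \<le> A ^ q * a M"
        using D A(1) by (simp add: a_def power_mult_distrib divide_simps)
      have "norm m \<le> norm ?u + (norm y + norm (mob_act M x))"
      proof -
        have "m = (y - mob_act M x) - ?u" unfolding mob by simp
        then have "norm m \<le> norm (y - mob_act M x) + norm ?u" by (metis norm_triangle_ineq4)
        then show ?thesis using norm_triangle_ineq4[of y "mob_act M x"] by linarith
      qed
      then have "1 + norm m \<le> norm ?u + (1 + norm y + \<bar>\<rho>\<bar>)" using rho[OF im(3) x] by linarith
      also have "\<dots> \<le> norm ?u + (1 + norm y + \<bar>\<rho>\<bar>) * (norm ?u / \<epsilon>)"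
      proof -
        have "1 \<le> norm ?u / \<epsilon>" using eu e(1) by simp
        then have "(1 + norm y + \<bar>\<rho>\<bar>) * 1 \<le> (1 + norm y + \<bar>\<rho>\<bar>) * (norm ?u / \<epsilon>)" by (rule mult_left_mono) simp
        then show ?thesis by simp
      qed
      also have "\<dots> = \<kappa> * norm ?u" by (simp add: \<kappa>_def algebra_simps)
      finally have "(1 + norm m) ^ q \<le> (\<kappa> * norm ?u) ^ q" by (intro power_mono) auto
      moreover have "(1 + norm m) ^ q > 0" by (simp add: add_pos_nonneg)
      ultimately show "1 / norm ?u ^ q \<le> \<kappa> ^ q * b m"
        using u by (simp add: b_def power_mult_distrib divide_simps)
    qed (use c A(1) in \<open>auto simp: a_def\<close>)
    also have "\<dots> = \<beta> i" by (simp add: \<beta>_def im(1))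
    finally show ?thesis .
  qed
  then show thesis using that bs by blast
qed

text \<open>Absolute summability over the pairs identifies the iterated sum in the hypothesis with
  one sum over \<open>\<Lambda> \<times> R\<close>, to which the exchange with the integral
  applies.\<close>

lemma kernel_has_sum:
  assumes x: "x \<in> S" shows "((\<lambda>i. kernel_summand i x) has_sum C x y) (\<Lambda> \<times> R)"
proof -
  obtain \<beta> where b: "\<beta> summable_on \<Lambda> \<times> R"
    "\<And>i x. i \<in> \<Lambda> \<times> R \<Longrightarrow> x \<in> S \<Longrightarrow> norm (kernel_summand i x) \<le> \<beta> i" by (rule kernel_summand_bound) blast
  have "y \<in> upper_half - orbitN p N x" using y_upper y_notin_orbit[OF x] by simp
  then obtain h where h: "\<forall>T\<in>translation_group p N. ((\<lambda>M. factor_J (T ** M) x * kernel_G (y - mob_act (T ** M) x)) has_sum h T) R"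
      "(h has_sum C x y) (translation_group p N)"
    using kernel S_upper[OF x] unfolding is_cauchy_kernel_def by blast
  have inj: "inj_on tr \<Lambda>" by (rule inj_onI) (metis mat2_entries(2) vec_part_vec_cl)
  show ?thesis
  proof (rule has_sum_SigmaI)
    show "((\<lambda>M. kernel_summand (m, M) x) has_sum h (tr m)) R" if "m \<in> \<Lambda>" for m
      using bspec[OF h(1), of "tr m"] that by (simp add: kernel_summand_def translation_group_lattice)
    show "((\<lambda>m. h (tr m)) has_sum C x y) \<Lambda>"
      using h(2) unfolding translation_group_lattice has_sum_reindex[OF inj] by (simp add: o_def)
    show "(\<lambda>i. kernel_summand i x) summable_on \<Lambda> \<times> R"
      by (rule abs_summable_summable, rule summable_on_comparison_test[OF b(1)]) (auto intro: b(2)[OF _ x])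
  qed
qed

theorem cauchy_formula: "cauchy_integral C V f y = f y"
proof -
  let ?\<sigma> = "surface_measure S"
  obtain x0 where x0: "x0 \<in> S" using S_nonempty by blast
  then obtain K \<nu> \<phi> W where chart: "lipschitz_graph_chart K S \<nu> \<phi> W"
    using lipschitz unfolding strongly_lipschitz_def by blast
  note sm = surface_measure_chart[OF compact_S lipschitz chart]
  have fin: "finite_measure ?\<sigma>"
  proof
    have "space ?\<sigma> = UNIV" using sets_eq_imp_space_eq[OF sm(1)] by simp
    then show "emeasure ?\<sigma> (space ?\<sigma>) \<noteq> \<infinity>" using sm(2) by simp
  qed
  obtain \<beta> where b: "\<beta> summable_on \<Lambda> \<times> R"
    "\<And>i x. i \<in> \<Lambda> \<times> R \<Longrightarrow> x \<in> S \<Longrightarrow> norm (kernel_summand i x) \<le> \<beta> i" by (rule kernel_summand_bound) blast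
  have "f differentiable at x" if "x \<in> U" for x using monogenic that by (simp add: left_monogenic_on_def)
  then have "continuous_on S f"
    using SU by (meson continuous_at_imp_continuous_on differentiable_imp_continuous_within subsetD)
  then have "bounded (f ` S)" using compact_S by (intro compact_imp_bounded compact_continuous_image)
  then obtain B where B: "\<And>x. x \<in> S \<Longrightarrow> norm (f x) \<le> B" by (auto simp: bounded_iff)
  have B0: "B \<ge> 0" using order_trans[OF norm_ge_zero B[OF x0]] .
  obtain \<kappa> where k: "\<kappa> > 0" "\<And>a c. norm (a * c :: 'n clifford) \<le> norm a * norm c * \<kappa>"
    using bounded_bilinear.pos_bounded[OF bounded_bilinear_clifford] by blast
  obtain i where i: "i \<in> \<Lambda> \<times> R" "tr (fst i) ** snd i = mat 1"
    "\<And>m M. m \<in> \<Lambda> \<Longrightarrow> M \<in> R \<Longrightarrow> tr m ** M = mat 1 \<Longrightarrow> (m, M) = i" by (rule identity_pair) blast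
  have bnn: "\<beta> j \<ge> 0" if "j \<in> \<Lambda> \<times> R" for j using order_trans[OF norm_ge_zero b(2)[OF that x0]] .
  have bound: "norm (integrand j x) \<le> \<beta> j * B * \<kappa>" if j: "j \<in> \<Lambda> \<times> R" for j x
  proof (cases "x \<in> S")
    case True
    have "norm (integrand j x) \<le> norm (reversion (kernel_summand j x) * vec_cl (outward_normal V x)) * norm (f x) * \<kappa>"
      using k(2)[of "reversion (kernel_summand j x) * vec_cl (outward_normal V x)" "f x"] True by (simp add: integrand_def)
    also have "\<dots> \<le> (\<beta> j * 1) * B * \<kappa>"
      unfolding norm_mult_vec_cl norm_reversion using k(1) B0 bnn[OF j]
      by (intro mult_mono b(2)[OF j True] B[OF True] norm_outward_normal_le) auto
    finally show ?thesis by simp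
  next
    case False
    then show ?thesis using bnn[OF j] B0 k(1) by (simp add: integrand_def)
  qed
  have sum: "infsum (\<lambda>j. integrand j x) (\<Lambda> \<times> R) = indicator S x *\<^sub>R (reversion (C x y) * vec_cl (outward_normal V x) * f x)" for x
  proof (cases "x \<in> S")
    case True
    \<comment> \<open>For fixed \<open>x\<close> the integrand is linear in the kernel, so the
      series can be multiplied out term by term.\<close>
    have bl: "bounded_linear (\<lambda>a. reversion a * vec_cl (outward_normal V x) * f x)"
      by (intro linear_conv_bounded_linear[THEN iffD1] linearI) (simp_all add: reversion_add reversion_scaleR distrib_right)
    show ?thesis
      using infsumI[OF has_sum_bounded_linear[OF bl kernel_has_sum[OF True]]] True by (simp add: integrand_def)
  next
    case False
    then show ?thesis by (simp add: integrand_def)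
  qed
  have "cauchy_integral C V f y = (LINT x|?\<sigma>. infsum (\<lambda>j. integrand j x) (\<Lambda> \<times> R))"
    by (simp add: cauchy_integral_def set_lebesgue_integral_def sum)
  also have "\<dots> = (LINT x|?\<sigma>. integrand i x)"
  proof (rule integral_infsum_singleton[OF fin _ _ _ i(1)])
    show "integrable ?\<sigma> (integrand j)" if "j \<in> \<Lambda> \<times> R" for j
      using integrand_integral(1)[of "fst j" "snd j"] that by auto
    show "norm (integrand j x) \<le> \<beta> j * B * \<kappa>" if "j \<in> \<Lambda> \<times> R" for j x by (rule bound[OF that])
    show "(\<lambda>j. \<beta> j * B * \<kappa>) summable_on \<Lambda> \<times> R" by (intro summable_on_cmult_left b(1))
    show "(LINT x|?\<sigma>. integrand j x) = 0" if "j \<in> \<Lambda> \<times> R" "j \<noteq> i" for j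
      using integrand_integral(2)[of "fst j" "snd j"] i(3)[of "fst j" "snd j"] that by (auto simp: mem_Times_iff)
  qed
  also have "\<dots> = f y" using integrand_integral(2)[of "fst i" "snd i"] i(1,2) by (auto simp: mem_Times_iff)
  finally show ?thesis .
qed

end

theorem theorem1:
  fixes p N :: nat
    and F U V :: "'n::{finite,linorder} Rn set"
    and R :: "'n cl_mat set"
    and C :: "'n Rn \<Rightarrow> 'n Rn \<Rightarrow> 'n clifford"
    and s :: "'n Rn set \<Rightarrow> ('n Rn \<times> 'n clifford) set"
    and f :: "'n Rn \<Rightarrow> 'n clifford"
    and y :: "'n Rn"
  assumes "3 \<le> N" and "1 \<le> p" and "p + 2 < CARD('n)"
    and "fundamental_domain p N F" and "F \<subseteq> slab p N"
    and "\<forall>j. p < idx j \<longrightarrow> \<not> bounded ((\<lambda>x. x $ j) ` F)"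
    and "coset_representatives p N R" and "\<forall>M\<in>R. mob_act M ` F \<subseteq> slab p N"
    and "is_cauchy_kernel p N R C"
    and "is_domain U" and "U \<subseteq> F"
    and "is_domain V" and "bounded V" and "V \<subseteq> U"
    and "strongly_lipschitz (frontier V)" and "frontier V \<subseteq> U"
    and "y \<in> V"
    and "bundle_section p N (orbitN p N ` U) s"
    and "lift_of_section p N U s f" and "left_monogenic_on f U"
  shows "f y = cauchy_integral C V f y \<and>
    s (orbitN p N y) = bundle_point p N (y, cauchy_integral C V f y)"
proof -
  interpret cauchy_setting p N F U V R C f y
    by unfold_locales (use assms in \<open>auto simp: is_domain_def\<close>)
  have "y \<in> U" using \<open>y \<in> V\<close> \<open>V \<subseteq> U\<close> by blast
  then have "s (orbitN p N y) = bundle_point p N (y, f y)"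
    using \<open>lift_of_section p N U s f\<close> by (simp add: lift_of_section_def)
  then show ?thesis by (simp add: cauchy_formula)
qed

end
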